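(* In the setting and notation of the context, the following statements are equivalent: (i) For each $n\in\mathbb N$ and each $f^{(n)}\in\mathcal D^{(n)}$, $P(f^{(n)})\in\mathbf{CP}$. (ii) For each $f\in\mathcal D$, the operator $X(f)$ (realized in $\mathbb F$) maps $\mathcal F_{\mathrm{fin}}(\mathcal D)$ into itself. (iii) There exist continuous functions $\lambda,\eta:T\to\mathbb R$ with $\eta(t)\ge 0$ for all $t\in T$ such that $$b^{(l)}(t)=\lambda(t),\quad t\in T,\ l\in\mathbb N_0,\qquad\qquad a^{(l)}(t)=\eta(t),\quad t\in T,\ l\in\mathbb N.$$ In this case, for each $f\in\mathcal D$ and $g^{(n)}\in\mathcal D^{(n)}$, $n\in\mathbb N$, the three components of $X(f)=X^+(f)+X^0(f)+X^-(f)$ act as $$(X^+(f)g^{(n)})(t_1,\dots,t_{n+1})=f(t_1)g^{(n)}(t_2,\dots,t_{n+1}),\quad (t_1,\dots,t_{n+1})\in T^{n+1},$$ $$(X^0(f)g^{(n)})(t_1,\dots,t_n)=\lambda(t_1)f(t_1)g^{(n)}(t_1,t_2,\dots,t_n),\quad (t_1,\dots,t_n)\in T^n,$$ $$(X^-(f)g^{(n)})(t_1,\dots,t_{n-1})=\int_T\sigma(dt)\,f(t)g^{(n)}(t,t_1,\dots,t_{n-1})+\eta(t_1)f(t_1)g^{(n)}(t_1,t_1,t_2,\dots,t_{n-1}),\quad (t_1,\dots,t_{n-1})\in T^{n-1},$$ the second addend in the last formula being equal to zero for $n=1$.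
   Context: **Underlying space.** $T$ is a locally compact, second countable Hausdorff space without isolated points; $\mathcal B(T)$ is its Borel $\sigma$-algebra and $\mathcal B_0(T)$ the family of relatively compact Borel sets. $\sigma$ is a Radon non-atomic measure on $T$ with $\sigma(O)>0$ for every non-empty open $O$. $\mathcal D^{(n)}=C_0(T^n)$ is the space of real continuous compactly supported functions on $T^n$, $\mathcal D=\mathcal D^{(1)}$, $\mathcal D^{(0)}=\mathbb R$. $B_0(T^n)$ denotes real bounded measurable functions with compact support. $\mathcal F_{\mathrm{fin}}(\mathcal D)$ is the set of finite sequences $(f^{(0)},\dots,f^{(n)},0,0,\dots)$ with $f^{(i)}\in\mathcal D^{(i)}$. **The process.** For each $t\in T$, $\mu(t,\cdot)$ is a probability measure on $\mathbb R$ with compact support; $t\mapsto\mu(t,A)$ is measurable for each Borel $A$; and for each $\Delta\in\mathcal B_0(T)$ there is $R=R(\Delta)>0$ such that $\mu(t,\cdot)$ is supported in $[-R,R]$ for all $t\in\Delta$. Put $\tilde T=T\times\mathbb R$, $\tilde\sigma(dt,ds)=\sigma(dt)\mu(t,ds)$, $\mathcal H=L^2(\tilde T,\tilde\sigma)$ (real), $\mathcal F(\mathcal H)=\mathbb R\oplus\bigoplus_{n\ge1}\mathcal H^{\otimes n}$ the full Fock space with vacuum $\Omega=(1,0,0,\dots)$. For $f\in B_0(T)$, $$X(f)=a^+(f\otimes1)+a^-(f\otimes 1)+a^0(f\otimes s),$$ a bounded self-adjoint operator, where $(f\otimes s^l)(t,s)=f(t)s^l$, $a^+(h)g^{(n)}=h\otimes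 g^{(n)}$; $a^-(h)g_1\otimes\dots\otimes g_n=(h,g_1)_{\mathcal H}\,g_2\otimes\dots\otimes g_n$; $a^0(h)g_1\otimes\dots\otimes g_n=(hg_1)\otimes g_2\otimes\dots\otimes g_n$; $a^-(h)\Omega=a^0(h)\Omega=0$. **Monomials.** For $f^{(n)}\in B_0(T^n)$ the monomial $\langle f^{(n)},\omega^{\otimes n}\rangle$ is the bounded operator on $\mathcal F(\mathcal H)$ extending $\langle f_1\otimes\dots\otimes f_n,\omega^{\otimes n}\rangle=X(f_1)\cdots X(f_n)$, defined as follows. Write $z=(t,s)\in\tilde T$, and view $f^{(n)}$ as a function on $\tilde T^n$ not depending on the $s$-variables. For a function $h(z_1,\dots,z_k;y_1,\dots,y_m)$ ($k\ge1$) put $(Ch)(z_1,\dots,z_{k-1};y_1,\dots,y_{m+1})=h(z_1,\dots,z_{k-1},y_1;y_2,\dots,y_{m+1})$, $(Ah)(z_1,\dots,z_{k-1};y_1,\dots,y_{m-1})=\int_{\tilde T}\tilde\sigma(dz)h(z_1,\dots,z_{k-1},z;z,y_1,\dots,y_{m-1})$, $(Nh)(z_1,\dots,z_{k-1};y_1,\dots,y_m)=s(y_1)h(z_1,\dots,z_{k-1},y_1;y_1,\dots,y_m)$, where $s(y_1)$ is the $\mathbb R$-coordinate of $y_1$, and $Ah=Nh=0$ if $m=0$. Then $\langle f^{(n)},\omega^{\otimes n}\rangle g^{(m)}=(C+A+N)^n(f^{(n)}\otimes g^{(m)})$, where $(f^{(n)}\otimes g^{(m)})(z;y)=f^{(n)}(z)g^{(m)}(y)$.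 Constants are monomials of order $0$. $\mathbf{CP}$ is the set of finite sums of monomials with kernels $f^{(n)}\in\mathcal D^{(n)}$, $n\in\mathbb N_0$ (continuous polynomials), and $\mathbf{CP}^{(n)}$ those of order $\le n$. **The space $L^2(\tau)$.** $L^2(\tau)$ is the real Hilbert space obtained as the closure of $\mathbf{CP}$ in the norm $\|P\|_{L^2(\tau)}=\|P\Omega\|_{\mathcal F(\mathcal H)}$; the map $I:P\mapsto P\Omega$ extends to a unitary operator $I:L^2(\tau)\to\mathcal F(\mathcal H)$. $\mathbf{MP}^{(n)}$ is the closure of $\mathbf{CP}^{(n)}$ in $L^2(\tau)$, $\mathbf{OP}^{(n)}=\mathbf{MP}^{(n)}\ominus\mathbf{MP}^{(n-1)}$ for $n\ge 1$, $\mathbf{OP}^{(0)}=\mathbb R$. For $f^{(n)}\in\mathcal D^{(n)}$, $P(f^{(n)})$ is the orthogonal projection of $\langle f^{(n)},\omega^{\otimes n}\rangle$ onto $\mathbf{OP}^{(n)}$. **Jacobi coefficients.** For each $t\in T$, $(p^{(n)}(t,\cdot))_{n\ge0}$ are the monic orthogonal polynomials of $\mu(t,\cdot)$, with $$sp^{(n)}(t,s)=p^{(n+1)}(t,s)+b^{(n)}(t)p^{(n)}(t,s)+a^{(n)}(t)p^{(n-1)}(t,s),\quad n\in\mathbb N_0,\ p^{(-1)}:=0.$$ If $\mu(t,\cdot)$ is supported on exactly $N$ points, then one sets $p^{(n)}(t,\cdot):=0$ and $a^{(n)}(t):=0$ for $n\ge N$, the $b^{(n)}(t)$, $n\ge N$,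 being arbitrary, so that the recursion always holds. **Free extended Fock space.** Put $w_l(t)=\int_{\mathbb R}\mu(t,ds)|p^{(l)}(t,s)|^2$, $\sigma^{(l)}(dt)=w_l(t)\sigma(dt)$. For each $(l_1,\dots,l_i)\in\mathbb N_0^i$, $i\ge1$, with $l_1+\dots+l_i+i=n$, let $\gamma^{(l_1,\dots,l_i)}$ be the measure on $T^n$ that is the image of $\sigma^{(l_1)}\otimes\dots\otimes\sigma^{(l_i)}$ under $(t_1,\dots,t_i)\mapsto(t_1,\dots,t_1,t_2,\dots,t_2,\dots,t_i,\dots,t_i)$ ($t_j$ repeated $l_j+1$ times), and $\gamma_n$ the sum of all these measures. $\mathbb F=\mathbb R\oplus\bigoplus_{n\ge1}\mathbb F^{(n)}$ with $\mathbb F^{(n)}=L^2(T^n,\gamma_n)$ and $\mathbb F^{(0)}=\mathbb R$; $\mathcal F_{\mathrm{fin}}(\mathcal D)$ is regarded as a dense subset of $\mathbb F$. The map $(f^{(n)})_n\mapsto\sum_nP(f^{(n)})$ on $\mathcal F_{\mathrm{fin}}(\mathcal D)$ extends to a unitary $J:\mathbb F\to L^2(\tau)$. The realization of $X(f)$ in $\mathbb F$, again written $X(f)$, is $(IJ)^{-1}X(f)(IJ)$. **Action of $X(f)$ in $\mathbb F$ (general case).** For $f\in\mathcal D$, $X(f)=X^+(f)+X^0(f)+X^-(f)$ with $X^+(f):\mathbb F^{(n)}\to\mathbb F^{(n+1)}$, $X^0(f):\mathbb F^{(n)}\to\mathbb F^{(n)}$, $X^-(f):\mathbb F^{(n)}\to\mathbb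 F^{(n-1)}$, and $X^+(f)\Omega=f$, $X^0(f)\Omega=X^-(f)\Omega=0$. Let $T^{(l_1,\dots,l_i)}\subset T^n$ ($l_1+\dots+l_i+i=n$) be the set of points of the form $(u_1,\dots,u_1,u_2,\dots,u_2,\dots,u_i,\dots,u_i)$ with $u_j$ repeated $l_j+1$ times and $u_j\ne u_{j+1}$ for $j=1,\dots,i-1$; these sets partition $T^n$. For $g^{(n)}\in\mathcal D^{(n)}$, $n\in\mathbb N$: $(X^+(f)g^{(n)})(t_1,\dots,t_{n+1})=f(t_1)g^{(n)}(t_2,\dots,t_{n+1})$ on $T^{n+1}$; $(X^0(f)g^{(n)})(t_1,\dots,t_n)=b^{(l_1)}(t_1)f(t_1)g^{(n)}(t_1,\dots,t_n)$ for $(t_1,\dots,t_n)\in T^{(l_1,\dots,l_i)}\subset T^n$; and $(X^-(f)g^{(n)})(t_1,\dots,t_{n-1})=\int_T\sigma(dt)f(t)g^{(n)}(t,t_1,\dots,t_{n-1})+a^{(l_1+1)}(t_1)f(t_1)g^{(n)}(t_1,t_1,t_2,\dots,t_{n-1})$ for $(t_1,\dots,t_{n-1})\in T^{(l_1,\dots,l_i)}\subset T^{n-1}$ (second addend zero for $n=1$).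
   Formalization: In (iii) the equalities for b^(l)(t) and a^(l)(t) are required for σ-almost every t, not every t (changing μ(t,·) on a σ-null set leaves (i), (ii) intact), and for some admissible choice of the arbitrary b^(n)(t), n ≥ N. *)

theory Defs
  imports "HOL-Probability.Probability" "HOL-Computational_Algebra.Polynomial"
begin

text \<open>
  Conventions. The space \<open>T\<close> is a type \<open>'a\<close>; \<open>T\<^sup>n\<close> is the set of extensional functions
  \<open>{..<n} \<rightarrow>\<^sub>E UNIV\<close>, so the coordinates \<open>t\<^sub>1, \<dots>, t\<^sub>n\<close> are \<open>t 0, \<dots>, t (n - 1)\<close>.
  For \<open>t\<close> in \<open>T\<^sup>n\<close>, prepending a coordinate \<open>u\<close> is \<open>case_nat u t\<close>, and dropping the first one
  is \<open>t \<circ> Suc\<close>; both are again extensional. \<open>T\<^sup>0\<close> is a single point, so functions on it are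
  real constants.

  As the library has no quotient \<open>L\<^sup>2\<close> spaces, elements of \<open>L\<^sup>2\<close> are represented by
  square-integrable functions, and equality in \<open>L\<^sup>2\<close> is equality almost everywhere. Vectors
  specified only as elements of such a space are picked by \<open>SOME\<close>; they are determined up to
  equality almost everywhere, and are only ever compared in that sense.
\<close>

abbreviation cart :: "nat \<Rightarrow> (nat \<Rightarrow> 'x) set"
  where "cart n \<equiv> {..<n} \<rightarrow>\<^sub>E UNIV"


section \<open>The measures \<open>\<sigma>\<close> and \<open>\<mu>(t, \<cdot>)\<close>\<close>

definition radon_measure :: "'a::topological_space measure \<Rightarrow> bool"
  where "radon_measure M \<longleftrightarrow>
    sets M = sets borel \<and>
    (\<forall>K. compact K \<longrightarrow> emeasure M K < \<infinity>) \<and>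
    (\<forall>A\<in>sets borel. emeasure M A = (SUP K\<in>{K. compact K \<and> K \<subseteq> A}. emeasure M K))"

definition non_atomic :: "'a measure \<Rightarrow> bool"
  where "non_atomic M \<longleftrightarrow>
    (\<forall>A\<in>sets M. 0 < emeasure M A \<longrightarrow>
      (\<exists>B\<in>sets M. B \<subseteq> A \<and> 0 < emeasure M B \<and> emeasure M B < emeasure M A))"

definition measure_support :: "'a::topological_space measure \<Rightarrow> 'a set"
  where "measure_support M = {x. \<forall>U. open U \<longrightarrow> x \<in> U \<longrightarrow> 0 < emeasure M U}"

text \<open>\<open>\<sigma>(dt) \<mu>(t, ds)\<close> on \<open>T \<times> \<real>\<close>: its value at \<open>A\<close> is \<open>\<integral> \<mu>(t, {s. (t, s) \<in> A}) \<sigma>(dt)\<close>.\<close>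
definition sigma_tilde :: "'a::topological_space measure \<Rightarrow> ('a \<Rightarrow> real measure) \<Rightarrow> ('a \<times> real) measure"
  where "sigma_tilde \<sigma> \<mu> = \<sigma> \<bind> (\<lambda>t. distr (\<mu> t) borel (Pair t))"


section \<open>Test functions\<close>

definition test1 :: "('a::topological_space \<Rightarrow> real) set"
  where "test1 = {f. continuous_on UNIV f \<and> compact (closure {t. f t \<noteq> 0})}"

abbreviation cart_top :: "nat \<Rightarrow> (nat \<Rightarrow> 'a::topological_space) topology"
  where "cart_top n \<equiv> product_topology (\<lambda>_. euclidean) {..<n}"

text \<open>\<open>\<D>\<^sup>(\<^sup>n\<^sup>) = C\<^sub>0(T\<^sup>n)\<close>; values outside \<open>T\<^sup>n\<close> are irrelevant.\<close>
definition test :: "nat \<Rightarrow> ((nat \<Rightarrow> 'a::topological_space) \<Rightarrow> real) set"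
  where "test n = {f. continuous_map (cart_top n) euclideanreal f \<and>
    compactin (cart_top n) (cart_top n closure_of {t \<in> cart n. f t \<noteq> 0})}"

definition finite_test :: "(nat \<Rightarrow> (nat \<Rightarrow> 'a::topological_space) \<Rightarrow> real) set"
  where "finite_test = {\<phi>. (\<forall>n. \<phi> n \<in> test n) \<and> (\<exists>N. \<forall>n>N. \<forall>t\<in>cart n. \<phi> n t = 0)}"

definition single :: "nat \<Rightarrow> ('x \<Rightarrow> real) \<Rightarrow> nat \<Rightarrow> 'x \<Rightarrow> real"
  where "single n g = (\<lambda>m. if m = n then g else (\<lambda>_. 0))"


section \<open>Orthogonal direct sums of \<open>L\<^sup>2\<close> spaces\<close>

text \<open>The Hilbert space \<open>\<Oplus>\<^sub>n L\<^sup>2(M\<^sub>n)\<close>.\<close>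
definition gl2 :: "(nat \<Rightarrow> 'x measure) \<Rightarrow> (nat \<Rightarrow> 'x \<Rightarrow> real) set"
  where "gl2 M = {F. (\<forall>n. F n \<in> borel_measurable (M n) \<and> integrable (M n) (\<lambda>x. (F n x)\<^sup>2)) \<and>
    summable (\<lambda>n. \<integral>x. (F n x)\<^sup>2 \<partial>M n)}"

definition gl2_inner :: "(nat \<Rightarrow> 'x measure) \<Rightarrow> (nat \<Rightarrow> 'x \<Rightarrow> real) \<Rightarrow> (nat \<Rightarrow> 'x \<Rightarrow> real) \<Rightarrow> real"
  where "gl2_inner M F G = (\<Sum>n. \<integral>x. F n x * G n x \<partial>M n)"

definition gl2_norm :: "(nat \<Rightarrow> 'x measure) \<Rightarrow> (nat \<Rightarrow> 'x \<Rightarrow> real) \<Rightarrow> real"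
  where "gl2_norm M F = sqrt (gl2_inner M F F)"

definition gl2_eq :: "(nat \<Rightarrow> 'x measure) \<Rightarrow> (nat \<Rightarrow> 'x \<Rightarrow> real) \<Rightarrow> (nat \<Rightarrow> 'x \<Rightarrow> real) \<Rightarrow> bool"
  where "gl2_eq M F G \<longleftrightarrow> (\<forall>n. AE x in M n. F n x = G n x)"

definition gl2_closure :: "(nat \<Rightarrow> 'x measure) \<Rightarrow> (nat \<Rightarrow> 'x \<Rightarrow> real) set \<Rightarrow> (nat \<Rightarrow> 'x \<Rightarrow> real) set"
  where "gl2_closure M S = {v \<in> gl2 M. \<forall>e>0. \<exists>u\<in>S. gl2_norm M (\<lambda>n x. v n x - u n x) < e}"

text \<open>Orthogonal projection of \<open>v\<close> onto a closed subspace \<open>S\<close>.\<close>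
definition orth_proj ::
    "(nat \<Rightarrow> 'x measure) \<Rightarrow> (nat \<Rightarrow> 'x \<Rightarrow> real) set \<Rightarrow> (nat \<Rightarrow> 'x \<Rightarrow> real) \<Rightarrow> (nat \<Rightarrow> 'x \<Rightarrow> real)"
  where "orth_proj M S v =
    (SOME p. p \<in> S \<and> (\<forall>w\<in>S. gl2_inner M (\<lambda>n x. v n x - p n x) w = 0))"


section \<open>The full Fock space and the process\<close>

type_synonym 'a fock_vec = "nat \<Rightarrow> (nat \<Rightarrow> 'a \<times> real) \<Rightarrow> real"

text \<open>
  With \<open>\<H> = L\<^sup>2(T \<times> \<real>)\<close>, the tensor power \<open>\<H>\<^sup>\<otimes>\<^sup>n\<close> is \<open>L\<^sup>2\<close> of the \<open>n\<close>-fold product measure, and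
  \<open>g\<^sub>1 \<otimes> \<dots> \<otimes> g\<^sub>n\<close> is the function \<open>y \<mapsto> g\<^sub>1(y 0) \<dots> g\<^sub>n(y (n - 1))\<close>. The full Fock space is
  \<open>gl2 (fock \<sigma> \<mu>)\<close>.
\<close>
definition fock :: "'a::topological_space measure \<Rightarrow> ('a \<Rightarrow> real measure) \<Rightarrow> nat \<Rightarrow> (nat \<Rightarrow> 'a \<times> real) measure"
  where "fock \<sigma> \<mu> n = (\<Pi>\<^sub>M i\<in>{..<n}. sigma_tilde \<sigma> \<mu>)"

definition vacuum :: "'a fock_vec"
  where "vacuum = single 0 (\<lambda>_. 1)"

definition creation :: "('a \<times> real \<Rightarrow> real) \<Rightarrow> 'a fock_vec \<Rightarrow> 'a fock_vec"
  where "creation h G = (\<lambda>m y. case m of 0 \<Rightarrow> 0 | Suc k \<Rightarrow> h (y 0) * G k (y \<circ> Suc))"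

definition annihilation :: "'a::topological_space measure \<Rightarrow> ('a \<Rightarrow> real measure) \<Rightarrow>
    ('a \<times> real \<Rightarrow> real) \<Rightarrow> 'a fock_vec \<Rightarrow> 'a fock_vec"
  where "annihilation \<sigma> \<mu> h G = (\<lambda>m y. \<integral>z. h z * G (Suc m) (case_nat z y) \<partial>sigma_tilde \<sigma> \<mu>)"

definition neutral :: "('a \<times> real \<Rightarrow> real) \<Rightarrow> 'a fock_vec \<Rightarrow> 'a fock_vec"
  where "neutral h G = (\<lambda>m y. if m = 0 then 0 else h (y 0) * G m y)"

definition X_op :: "'a::topological_space measure \<Rightarrow> ('a \<Rightarrow> real measure) \<Rightarrow> ('a \<Rightarrow> real) \<Rightarrow>
    'a fock_vec \<Rightarrow> 'a fock_vec"
  where "X_op \<sigma> \<mu> f G = (\<lambda>m y.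
      creation (\<lambda>(t, s). f t) G m y
    + annihilation \<sigma> \<mu> (\<lambda>(t, s). f t) G m y
    + neutral (\<lambda>(t, s). f t * s) G m y)"


section \<open>Monomials and continuous polynomials\<close>

text \<open>
  \<open>H m z y\<close> is the component, with \<open>m\<close> variables \<open>y\<close>, of a family of functions
  \<open>h(z\<^sub>1, \<dots>, z\<^sub>k; y\<^sub>1, \<dots>, y\<^sub>m)\<close>. The operators below turn \<open>k + 1\<close> variables \<open>z\<close> into \<open>k\<close> by
  consuming the last of them, which is \<open>z k\<close>. In \<open>op_C\<close>, \<open>op_A\<close>, \<open>op_N\<close> the index \<open>m\<close> is the
  number of variables \<open>y\<close> of the result.
\<close>
type_synonym 'a two_kernel = "nat \<Rightarrow> (nat \<Rightarrow> 'a \<times> real) \<Rightarrow> (nat \<Rightarrow> 'a \<times> real) \<Rightarrow> real"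

definition op_C :: "nat \<Rightarrow> 'a two_kernel \<Rightarrow> 'a two_kernel"
  where "op_C k H = (\<lambda>m z y. case m of 0 \<Rightarrow> 0 | Suc j \<Rightarrow> H j (z(k := y 0)) (y \<circ> Suc))"

definition op_A :: "'a::topological_space measure \<Rightarrow> ('a \<Rightarrow> real measure) \<Rightarrow>
    nat \<Rightarrow> 'a two_kernel \<Rightarrow> 'a two_kernel"
  where "op_A \<sigma> \<mu> k H = (\<lambda>m z y. \<integral>x. H (Suc m) (z(k := x)) (case_nat x y) \<partial>sigma_tilde \<sigma> \<mu>)"

definition op_N :: "nat \<Rightarrow> 'a two_kernel \<Rightarrow> 'a two_kernel"
  where "op_N k H = (\<lambda>m z y. if m = 0 then 0 else snd (y 0) * H m (z(k := y 0)) y)"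

text \<open>\<open>(C + A + N)\<^sup>k\<close>, which eliminates the variables \<open>z (k - 1), \<dots>, z 0\<close> in this order.\<close>
primrec CAN_power :: "'a::topological_space measure \<Rightarrow> ('a \<Rightarrow> real measure) \<Rightarrow>
    nat \<Rightarrow> 'a two_kernel \<Rightarrow> 'a two_kernel"
  where
    "CAN_power \<sigma> \<mu> 0 H = H"
  | "CAN_power \<sigma> \<mu> (Suc k) H =
      CAN_power \<sigma> \<mu> k (\<lambda>m z y. op_C k H m z y + op_A \<sigma> \<mu> k H m z y + op_N k H m z y)"

text \<open>
  The operator \<open>\<langle>f\<^sup>(\<^sup>n\<^sup>), \<omega>\<^sup>\<otimes>\<^sup>n\<rangle>\<close>. After \<open>n\<close> steps no variable \<open>z\<close> is left, so the value
  \<open>undefined\<close> plugged in for \<open>z\<close> does not matter.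
\<close>
definition monomial :: "'a::topological_space measure \<Rightarrow> ('a \<Rightarrow> real measure) \<Rightarrow>
    nat \<Rightarrow> ((nat \<Rightarrow> 'a) \<Rightarrow> real) \<Rightarrow> 'a fock_vec \<Rightarrow> 'a fock_vec"
  where "monomial \<sigma> \<mu> n f G = (\<lambda>m y.
    CAN_power \<sigma> \<mu> n (\<lambda>j z y. f (\<lambda>i\<in>{..<n}. fst (z i)) * G j y) m undefined y)"

definition CP_le :: "'a::topological_space measure \<Rightarrow> ('a \<Rightarrow> real measure) \<Rightarrow>
    nat \<Rightarrow> ('a fock_vec \<Rightarrow> 'a fock_vec) set"
  where "CP_le \<sigma> \<mu> n =
    {Q. \<exists>f. (\<forall>k\<le>n. f k \<in> test k) \<and> Q = (\<lambda>G m y. \<Sum>k\<le>n. monomial \<sigma> \<mu> k (f k) G m y)}"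

definition CP :: "'a::topological_space measure \<Rightarrow> ('a \<Rightarrow> real measure) \<Rightarrow>
    ('a fock_vec \<Rightarrow> 'a fock_vec) set"
  where "CP \<sigma> \<mu> = (\<Union>n. CP_le \<sigma> \<mu> n)"


section \<open>Orthogonal polynomials of the process\<close>

text \<open>
  \<open>L\<^sup>2(\<tau>)\<close>, the completion of \<open>CP\<close> in the norm \<open>\<parallel>Q \<Omega>\<parallel>\<close>, is realized through the isometry
  \<open>I : Q \<mapsto> Q \<Omega>\<close> as the closure of \<open>{Q \<Omega> | Q \<in> CP}\<close> in the full Fock space. Thus \<open>I\<close> becomes
  an inclusion, and an element \<open>v\<close> of \<open>L\<^sup>2(\<tau>)\<close> belongs to \<open>CP\<close> iff \<open>v = Q \<Omega>\<close> for some \<open>Q \<in> CP\<close>.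
\<close>
definition MP :: "'a::topological_space measure \<Rightarrow> ('a \<Rightarrow> real measure) \<Rightarrow> nat \<Rightarrow> 'a fock_vec set"
  where "MP \<sigma> \<mu> n = gl2_closure (fock \<sigma> \<mu>) ((\<lambda>Q. Q vacuum) ` CP_le \<sigma> \<mu> n)"

definition OP :: "'a::topological_space measure \<Rightarrow> ('a \<Rightarrow> real measure) \<Rightarrow> nat \<Rightarrow> 'a fock_vec set"
  where "OP \<sigma> \<mu> n =
    (if n = 0 then {v \<in> gl2 (fock \<sigma> \<mu>). \<exists>c. gl2_eq (fock \<sigma> \<mu>) v (\<lambda>m y. c * vacuum m y)}
     else {v \<in> MP \<sigma> \<mu> n. \<forall>w\<in>MP \<sigma> \<mu> (n - 1). gl2_inner (fock \<sigma> \<mu>) v w = 0})"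

text \<open>\<open>P(f\<^sup>(\<^sup>n\<^sup>))\<close>\<close>
definition P_proj :: "'a::topological_space measure \<Rightarrow> ('a \<Rightarrow> real measure) \<Rightarrow>
    nat \<Rightarrow> ((nat \<Rightarrow> 'a) \<Rightarrow> real) \<Rightarrow> 'a fock_vec"
  where "P_proj \<sigma> \<mu> n f = orth_proj (fock \<sigma> \<mu>) (OP \<sigma> \<mu> n) (monomial \<sigma> \<mu> n f vacuum)"


section \<open>Jacobi coefficients\<close>

definition supp_card_le :: "real measure \<Rightarrow> nat \<Rightarrow> bool"
  where "supp_card_le M n \<longleftrightarrow> finite (measure_support M) \<and> card (measure_support M) \<le> n"

text \<open>Monic orthogonal polynomials, with \<open>p\<^sup>(\<^sup>n\<^sup>) = 0\<close> for \<open>n \<ge> N\<close> if the support has \<open>N\<close> points.\<close>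
definition monic_op :: "real measure \<Rightarrow> nat \<Rightarrow> real poly"
  where "monic_op M n = (if supp_card_le M n then 0 else
    (THE p. degree p = n \<and> lead_coeff p = 1 \<and>
      (\<forall>q. degree q < n \<longrightarrow> (\<integral>s. poly p s * poly q s \<partial>M) = 0)))"

text \<open>
  If the support of \<open>\<mu>(t, \<cdot>)\<close> has \<open>N\<close> points, the recursion for \<open>n = N - 1\<close> holds on the support
  only, hence it is required almost everywhere. The predicate leaves \<open>b\<^sup>(\<^sup>n\<^sup>)(t)\<close> unconstrained
  for \<open>n \<ge> N\<close>, and likewise \<open>a\<^sup>(\<^sup>0\<^sup>)(t)\<close>, whose factor is \<open>p\<^sup>(\<^sup>-\<^sup>1\<^sup>) = 0\<close>.
\<close>
definition jacobi_coefficients ::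
    "('a \<Rightarrow> real measure) \<Rightarrow> (nat \<Rightarrow> 'a \<Rightarrow> real) \<Rightarrow> (nat \<Rightarrow> 'a \<Rightarrow> real) \<Rightarrow> bool"
  where "jacobi_coefficients \<mu> a b \<longleftrightarrow>
    (\<forall>t n. AE s in \<mu> t. s * poly (monic_op (\<mu> t) n) s =
        poly (monic_op (\<mu> t) (Suc n)) s
      + b n t * poly (monic_op (\<mu> t) n) s
      + a n t * (if n = 0 then 0 else poly (monic_op (\<mu> t) (n - 1)) s)) \<and>
    (\<forall>t n. 0 < n \<longrightarrow> supp_card_le (\<mu> t) n \<longrightarrow> a n t = 0)"

text \<open>
  Statement (iii) for given \<open>\<lambda>\<close> and \<open>\<eta>\<close>. Since \<open>b\<^sup>(\<^sup>n\<^sup>)(t)\<close> may be chosen freely when the support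
  of \<open>\<mu>(t, \<cdot>)\<close> has at most \<open>n\<close> points, the equalities are asked for one admissible choice.
  They are asked for \<open>\<sigma>\<close>-almost every \<open>t\<close>: changing \<open>\<mu>(t, \<cdot>)\<close> for \<open>t\<close> in a \<open>\<sigma>\<close>-null set alters
  neither \<open>\<sigma>(dt) \<mu>(t, ds)\<close> nor anything built from it, so that nothing can be inferred for
  individual \<open>t\<close>.
\<close>
definition constant_jacobi :: "'a::topological_space measure \<Rightarrow> ('a \<Rightarrow> real measure) \<Rightarrow>
    ('a \<Rightarrow> real) \<Rightarrow> ('a \<Rightarrow> real) \<Rightarrow> bool"
  where "constant_jacobi \<sigma> \<mu> lam eta \<longleftrightarrow>
    continuous_on UNIV lam \<and> continuous_on UNIV eta \<and> (\<forall>t. 0 \<le> eta t) \<and>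
    (\<exists>a b. jacobi_coefficients \<mu> a b \<and>
      (AE t in \<sigma>. (\<forall>l. b l t = lam t) \<and> (\<forall>l\<ge>1. a l t = eta t)))"


section \<open>The free extended Fock space\<close>

definition sigma_l :: "'a measure \<Rightarrow> ('a \<Rightarrow> real measure) \<Rightarrow> nat \<Rightarrow> 'a measure"
  where "sigma_l \<sigma> \<mu> l = density \<sigma> (\<lambda>t. ennreal (\<integral>s. (poly (monic_op (\<mu> t) l) s)\<^sup>2 \<partial>\<mu> t))"

text \<open>\<open>(t\<^sub>1, \<dots>, t\<^sub>i) \<mapsto> (t\<^sub>1, \<dots>, t\<^sub>1, \<dots>, t\<^sub>i, \<dots>, t\<^sub>i)\<close> with \<open>t\<^sub>j\<close> repeated \<open>l\<^sub>j + 1\<close> times\<close>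
definition spread :: "nat list \<Rightarrow> (nat \<Rightarrow> 'a) \<Rightarrow> (nat \<Rightarrow> 'a)"
  where "spread ls t = (\<lambda>k\<in>{..<length ls + sum_list ls}.
    concat (map (\<lambda>j. replicate (ls ! j + 1) (t j)) [0..<length ls]) ! k)"

definition gamma_ls :: "'a::topological_space measure \<Rightarrow> ('a \<Rightarrow> real measure) \<Rightarrow>
    nat list \<Rightarrow> (nat \<Rightarrow> 'a) measure"
  where "gamma_ls \<sigma> \<mu> ls =
    distr (\<Pi>\<^sub>M j\<in>{..<length ls}. sigma_l \<sigma> \<mu> (ls ! j))
      (\<Pi>\<^sub>M k\<in>{..<length ls + sum_list ls}. borel) (spread ls)"

text \<open>
  The measure \<open>\<gamma>\<^sub>n\<close>. For \<open>n = 0\<close> only the empty list contributes and \<open>\<gamma>\<^sub>0\<close> is the unit mass on the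
  point \<open>T\<^sup>0\<close>, so that \<open>\<bbbF> = gl2 (ext_fock \<sigma> \<mu>)\<close> with \<open>\<bbbF>\<^sup>(\<^sup>0\<^sup>) = \<real>\<close>.
\<close>
definition ext_fock :: "'a::topological_space measure \<Rightarrow> ('a \<Rightarrow> real measure) \<Rightarrow>
    nat \<Rightarrow> (nat \<Rightarrow> 'a) measure"
  where "ext_fock \<sigma> \<mu> n =
    measure_of (cart n) (sets (\<Pi>\<^sub>M k\<in>{..<n}. borel))
      (\<lambda>A. \<Sum>ls | length ls + sum_list ls = n. emeasure (gamma_ls \<sigma> \<mu> ls) A)"

text \<open>The map \<open>(f\<^sup>(\<^sup>n\<^sup>))\<^sub>n \<mapsto> \<Sum>\<^sub>n P(f\<^sup>(\<^sup>n\<^sup>))\<close> on finite sequences, and its continuous extension \<open>J\<close>.\<close>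
definition J_fin :: "'a::topological_space measure \<Rightarrow> ('a \<Rightarrow> real measure) \<Rightarrow>
    (nat \<Rightarrow> (nat \<Rightarrow> 'a) \<Rightarrow> real) \<Rightarrow> 'a fock_vec"
  where "J_fin \<sigma> \<mu> \<phi> = (\<lambda>m y. \<Sum>n | \<exists>t\<in>cart n. \<phi> n t \<noteq> 0. P_proj \<sigma> \<mu> n (\<phi> n) m y)"

definition J_ext :: "'a::topological_space measure \<Rightarrow> ('a \<Rightarrow> real measure) \<Rightarrow>
    (nat \<Rightarrow> (nat \<Rightarrow> 'a) \<Rightarrow> real) \<Rightarrow> 'a fock_vec"
  where "J_ext \<sigma> \<mu> F = (SOME v. v \<in> gl2 (fock \<sigma> \<mu>) \<and>
    (\<forall>e>0. \<exists>\<phi>\<in>finite_test.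
      gl2_norm (ext_fock \<sigma> \<mu>) (\<lambda>n t. F n t - \<phi> n t) < e \<and>
      gl2_norm (fock \<sigma> \<mu>) (\<lambda>m y. v m y - J_fin \<sigma> \<mu> \<phi> m y) < e))"

text \<open>The realization \<open>(I J)\<^sup>-\<^sup>1 X(f) (I J)\<close> of \<open>X(f)\<close> in \<open>\<bbbF>\<close>, with \<open>I\<close> an inclusion as above.\<close>
definition X_ext :: "'a::topological_space measure \<Rightarrow> ('a \<Rightarrow> real measure) \<Rightarrow> ('a \<Rightarrow> real) \<Rightarrow>
    (nat \<Rightarrow> (nat \<Rightarrow> 'a) \<Rightarrow> real) \<Rightarrow> (nat \<Rightarrow> (nat \<Rightarrow> 'a) \<Rightarrow> real)"
  where "X_ext \<sigma> \<mu> f F =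
    (SOME G. G \<in> gl2 (ext_fock \<sigma> \<mu>) \<and> gl2_eq (fock \<sigma> \<mu>) (J_ext \<sigma> \<mu> G) (X_op \<sigma> \<mu> f (J_ext \<sigma> \<mu> F)))"

text \<open>
  The components of \<open>X(f)\<close> that map \<open>\<bbbF>\<^sup>(\<^sup>n\<^sup>)\<close> to \<open>\<bbbF>\<^sup>(\<^sup>n\<^sup>+\<^sup>1\<^sup>)\<close>, \<open>\<bbbF>\<^sup>(\<^sup>n\<^sup>)\<close> and \<open>\<bbbF>\<^sup>(\<^sup>n\<^sup>-\<^sup>1\<^sup>)\<close>; the last one is only
  meaningful for \<open>n \<ge> 1\<close>.
\<close>
definition X_plus :: "'a::topological_space measure \<Rightarrow> ('a \<Rightarrow> real measure) \<Rightarrow> ('a \<Rightarrow> real) \<Rightarrow>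
    nat \<Rightarrow> ((nat \<Rightarrow> 'a) \<Rightarrow> real) \<Rightarrow> ((nat \<Rightarrow> 'a) \<Rightarrow> real)"
  where "X_plus \<sigma> \<mu> f n g = X_ext \<sigma> \<mu> f (single n g) (n + 1)"

definition X_zero :: "'a::topological_space measure \<Rightarrow> ('a \<Rightarrow> real measure) \<Rightarrow> ('a \<Rightarrow> real) \<Rightarrow>
    nat \<Rightarrow> ((nat \<Rightarrow> 'a) \<Rightarrow> real) \<Rightarrow> ((nat \<Rightarrow> 'a) \<Rightarrow> real)"
  where "X_zero \<sigma> \<mu> f n g = X_ext \<sigma> \<mu> f (single n g) n"

definition X_minus :: "'a::topological_space measure \<Rightarrow> ('a \<Rightarrow> real measure) \<Rightarrow> ('a \<Rightarrow> real) \<Rightarrow>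
    nat \<Rightarrow> ((nat \<Rightarrow> 'a) \<Rightarrow> real) \<Rightarrow> ((nat \<Rightarrow> 'a) \<Rightarrow> real)"
  where "X_minus \<sigma> \<mu> f n g = X_ext \<sigma> \<mu> f (single n g) (n - 1)"

text \<open>The element \<open>u\<close> of \<open>\<bbbF>\<^sup>(\<^sup>n\<^sup>)\<close> is (the class of) the function \<open>h\<close> in \<open>\<D>\<^sup>(\<^sup>n\<^sup>)\<close>.\<close>
definition is_test_fun :: "'a::topological_space measure \<Rightarrow> ('a \<Rightarrow> real measure) \<Rightarrow>
    nat \<Rightarrow> ((nat \<Rightarrow> 'a) \<Rightarrow> real) \<Rightarrow> ((nat \<Rightarrow> 'a) \<Rightarrow> real) \<Rightarrow> bool"
  where "is_test_fun \<sigma> \<mu> n u h \<longleftrightarrow> h \<in> test n \<and> (AE t in ext_fock \<sigma> \<mu> n. u t = h t)"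

end

theory Submission
  imports Defs
begin

text \<open>
  In the full Fock space the products \<open>h(t\<^sub>1, \<dots>, t\<^sub>i) p\<^sup>(\<^sup>l\<^sup>\<^sub>1\<^sup>)(t\<^sub>1, s\<^sub>1) \<dots> p\<^sup>(\<^sup>l\<^sup>\<^sub>i\<^sup>)(t\<^sub>i, s\<^sub>i)\<close> with different
  \<open>(l\<^sub>1, \<dots>, l\<^sub>i)\<close> are orthogonal, and the three-term recursion makes \<open>C + A + N\<close> act on the coefficients \<open>h\<close>
  alone. Hence a monomial of order \<open>n\<close> applied to the vacuum is the sum over \<open>l\<^sub>1 + \<dots> + l\<^sub>i + i = n\<close> of the
  products whose coefficients are the restrictions of its kernel \<open>f\<close> to the sets \<open>T\<^sup>(\<^sup>l\<^sup>\<^sub>1\<^sup>,\<^sup>\<dots>\<^sup>,\<^sup>l\<^sup>\<^sub>i\<^sup>)\<close>, plus products of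
  lower degree. The latter belong to \<open>MP\<^sup>(\<^sup>n\<^sup>-\<^sup>1\<^sup>)\<close>, so the former sum is \<open>P(f)\<close>, which makes \<open>J\<close> explicit.

  (iii) implies (i): if the Jacobi coefficients are continuous and independent of \<open>l\<close>, the lower terms are
  again of the form \<open>P(g)\<close> with continuous \<open>g\<close>, and one concludes by induction on \<open>n\<close>.
  (i) implies (ii): \<open>X(f)\<close> maps continuous polynomials to continuous polynomials, and these are sums of
  elements \<open>P(g)\<close> with continuous \<open>g\<close>, because \<open>\<sigma>\<close> has full support and therefore a continuous leading kernel
  that does not contribute vanishes.
  (ii) implies (iii): the coefficients of \<open>X(f) g\<close> in degrees \<open>n\<close> and \<open>n - 1\<close> are restrictions of continuous
  functions; off the diagonals they involve \<open>b\<^sup>(\<^sup>0\<^sup>)\<close> and \<open>a\<^sup>(\<^sup>1\<^sup>)\<close>, on the full diagonal \<open>b\<^sup>(\<^sup>l\<^sup>)\<close> and \<open>a\<^sup>(\<^sup>l\<^sup>+\<^sup>1\<^sup>)\<close>.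
\<close>

section \<open>The Hilbert spaces \<open>gl2\<close>\<close>

text \<open>Exceptional sets shape the proof. The recursion with \<open>lam\<close> and
  \<open>eta\<close> holds only for \<open>\<sigma>\<close>-almost every \<open>t\<close>, whereas
  \<open>C\<close> and \<open>N\<close> copy variables \<open>y\<close> into the slots
  \<open>z\<close>. Identities between kernels are therefore required at every point whose entries
  are \<open>good\<close>, and only when no \<open>z\<close> remains do they become equalities
  almost everywhere. The coefficients met in the expansions are in general merely bounded and
  measurable. That products of degree at most \<open>n\<close> still lie in \<open>MP n\<close>
  rests on the density of continuous kernels in L2 of \<gamma>_n, and on the possibility of gluing
  independent coefficients into one kernel: \<open>\<sigma>\<close> has no atoms, so each
  \<open>gamma_ls\<close> is carried by its own stratum. In the step from (ii) to (iii), level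
  \<open>l\<close> is visible only where the weight \<open>w l t\<close> is not zero. Elsewhere the
  coefficient b is free and can be set to \<open>lam\<close>, but a has to be 0 there. This is
  consistent: at the first vanishing weight w_k the quotient a_k = w_k / w_(k-1) is 0 while level k
  - 1 is still visible, which forces \<open>eta t = 0\<close>.\<close>

lemma gl2D:
  assumes "F \<in> gl2 M"
  shows "F n \<in> borel_measurable (M n)" "integrable (M n) (\<lambda>x. (F n x)\<^sup>2)"
    "summable (\<lambda>n. \<integral>x. (F n x)\<^sup>2 \<partial>M n)"
  using assms by (auto simp: gl2_def)

lemma abs_prod_le_squares: "\<bar>a * b\<bar> \<le> a\<^sup>2 + (b::real)\<^sup>2"
proof -
  have "2 * \<bar>a * b\<bar> \<le> a\<^sup>2 + b\<^sup>2"
    using sum_squares_bound[of "\<bar>a\<bar>" "\<bar>b\<bar>"] by (simp add: mult.assoc abs_mult)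
  then show ?thesis using abs_ge_zero[of "a * b"] by linarith
qed

lemma gl2_integrable_prod:
  assumes "F \<in> gl2 M" "G \<in> gl2 M"
  shows "integrable (M n) (\<lambda>x. F n x * G n x)"
proof (rule Bochner_Integration.integrable_bound)
  show "integrable (M n) (\<lambda>x. (F n x)\<^sup>2 + (G n x)\<^sup>2)"
    using gl2D[OF assms(1)] gl2D[OF assms(2)] by simp
  show "(\<lambda>x. F n x * G n x) \<in> borel_measurable (M n)"
    using gl2D(1)[OF assms(1), of n] gl2D(1)[OF assms(2), of n] by measurable
  show "AE x in M n. norm (F n x * G n x) \<le> norm ((F n x)\<^sup>2 + (G n x)\<^sup>2)"
    using abs_prod_le_squares by (auto simp: abs_mult)
qed

lemma gl2_summable_prod:
  assumes "F \<in> gl2 M" "G \<in> gl2 M"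
  shows "summable (\<lambda>n. \<integral>x. F n x * G n x \<partial>M n)"
proof (rule summable_comparison_test')
  show "summable (\<lambda>n. (\<integral>x. (F n x)\<^sup>2 \<partial>M n) + (\<integral>x. (G n x)\<^sup>2 \<partial>M n))"
    using gl2D(3)[OF assms(1)] gl2D(3)[OF assms(2)] by (rule summable_add)
  fix n :: nat
  have "norm (\<integral>x. F n x * G n x \<partial>M n) \<le> (\<integral>x. norm (F n x * G n x) \<partial>M n)" by simp
  also have "\<dots> \<le> (\<integral>x. (F n x)\<^sup>2 + (G n x)\<^sup>2 \<partial>M n)"
    using gl2_integrable_prod[OF assms, of n] gl2D(2)[OF assms(1), of n] gl2D(2)[OF assms(2), of n]
    by (intro integral_mono) (auto simp: abs_prod_le_squares[unfolded real_norm_def])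
  also have "\<dots> = (\<integral>x. (F n x)\<^sup>2 \<partial>M n) + (\<integral>x. (G n x)\<^sup>2 \<partial>M n)"
    using gl2D(2)[OF assms(1), of n] gl2D(2)[OF assms(2), of n] by simp
  finally show "norm (\<integral>x. F n x * G n x \<partial>M n)
      \<le> (\<integral>x. (F n x)\<^sup>2 \<partial>M n) + (\<integral>x. (G n x)\<^sup>2 \<partial>M n)" .
qed

lemma gl2_scale: assumes "F \<in> gl2 M" shows "(\<lambda>n x. c * F n x) \<in> gl2 M"
  using gl2D[OF assms] by (auto simp: gl2_def power_mult_distrib)

lemma gl2_add: assumes "F \<in> gl2 M" "G \<in> gl2 M" shows "(\<lambda>n x. F n x + G n x) \<in> gl2 M"
proof -
  have i: "integrable (M n) (\<lambda>x. (F n x + G n x)\<^sup>2)" for n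
    using gl2D(2)[OF assms(1), of n] gl2D(2)[OF assms(2), of n] gl2_integrable_prod[OF assms, of n]
    by (simp add: power2_sum mult.assoc)
  have e: "(\<integral>x. (F n x + G n x)\<^sup>2 \<partial>M n)
      = (\<integral>x. (F n x)\<^sup>2 \<partial>M n) + (\<integral>x. (G n x)\<^sup>2 \<partial>M n) + 2 * (\<integral>x. F n x * G n x \<partial>M n)" for n
    using gl2D(2)[OF assms(1), of n] gl2D(2)[OF assms(2), of n] gl2_integrable_prod[OF assms, of n]
    by (simp add: power2_sum mult.assoc)
  have "summable (\<lambda>n. \<integral>x. (F n x + G n x)\<^sup>2 \<partial>M n)"
    unfolding e using gl2D(3)[OF assms(1)] gl2D(3)[OF assms(2)] gl2_summable_prod[OF assms]
    by (intro summable_add summable_mult)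
  with i show ?thesis
    using gl2D(1)[OF assms(1)] gl2D(1)[OF assms(2)] by (auto simp: gl2_def)
qed

lemma gl2_diff: assumes "F \<in> gl2 M" "G \<in> gl2 M" shows "(\<lambda>n x. F n x - G n x) \<in> gl2 M"
  using gl2_add[OF assms(1) gl2_scale[OF assms(2), of "-1"]] by simp

lemma gl2_zero: "(\<lambda>n x. 0) \<in> gl2 M"
  by (auto simp: gl2_def)

lemma gl2_sum:
  assumes "\<And>i. i \<in> I \<Longrightarrow> F i \<in> gl2 M" shows "(\<lambda>n x. \<Sum>i\<in>I. F i n x) \<in> gl2 M"
  using assms
  by (induction I rule: infinite_finite_induct) (auto simp: gl2_zero gl2_add)

lemma gl2_inner_sym: "gl2_inner M F G = gl2_inner M G F"
  by (simp add: gl2_inner_def mult.commute)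

lemma gl2_inner_add:
  assumes "F \<in> gl2 M" "G \<in> gl2 M" "H \<in> gl2 M"
  shows "gl2_inner M (\<lambda>n x. F n x + G n x) H = gl2_inner M F H + gl2_inner M G H"
proof -
  have "(\<integral>x. (F n x + G n x) * H n x \<partial>M n) = (\<integral>x. F n x * H n x \<partial>M n) + (\<integral>x. G n x * H n x \<partial>M n)" for n
    using gl2_integrable_prod[OF assms(1,3), of n] gl2_integrable_prod[OF assms(2,3), of n]
    by (simp add: distrib_right)
  then show ?thesis
    using suminf_add[OF gl2_summable_prod[OF assms(1,3)] gl2_summable_prod[OF assms(2,3)]]
    by (simp add: gl2_inner_def)
qed

lemma gl2_inner_scale:
  assumes "F \<in> gl2 M" "H \<in> gl2 M"
  shows "gl2_inner M (\<lambda>n x. c * F n x) H = c * gl2_inner M F H"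
  using suminf_mult[OF gl2_summable_prod[OF assms], of c]
  by (simp add: gl2_inner_def mult.assoc)

lemma gl2_inner_diff:
  assumes "F \<in> gl2 M" "G \<in> gl2 M" "H \<in> gl2 M"
  shows "gl2_inner M (\<lambda>n x. F n x - G n x) H = gl2_inner M F H - gl2_inner M G H"
  using gl2_inner_add[OF assms(1) gl2_scale[OF assms(2), of "-1"] assms(3)]
    gl2_inner_scale[OF assms(2,3), of "-1"] by simp

lemma gl2_inner_add2:
  assumes "F \<in> gl2 M" "G \<in> gl2 M" "H \<in> gl2 M"
  shows "gl2_inner M H (\<lambda>n x. F n x + G n x) = gl2_inner M H F + gl2_inner M H G"
  using gl2_inner_add[OF assms] by (simp add: gl2_inner_sym)

lemma gl2_inner_scale2:
  assumes "F \<in> gl2 M" "H \<in> gl2 M"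
  shows "gl2_inner M H (\<lambda>n x. c * F n x) = c * gl2_inner M H F"
  using gl2_inner_scale[OF assms] by (simp add: gl2_inner_sym)

lemma gl2_inner_diff2:
  assumes "F \<in> gl2 M" "G \<in> gl2 M" "H \<in> gl2 M"
  shows "gl2_inner M H (\<lambda>n x. F n x - G n x) = gl2_inner M H F - gl2_inner M H G"
  using gl2_inner_diff[OF assms] by (simp add: gl2_inner_sym)

lemma gl2_inner_zero: "gl2_inner M (\<lambda>n x. 0) H = 0"
  by (simp add: gl2_inner_def)

lemma gl2_inner_sum:
  assumes "\<And>i. i \<in> I \<Longrightarrow> F i \<in> gl2 M" "H \<in> gl2 M"
  shows "gl2_inner M (\<lambda>n x. \<Sum>i\<in>I. F i n x) H = (\<Sum>i\<in>I. gl2_inner M (F i) H)"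
  using assms(1)
proof (induction I rule: infinite_finite_induct)
  case (insert i I)
  then show ?case
    using gl2_inner_add[of "F i" M "\<lambda>n x. \<Sum>i\<in>I. F i n x" H] assms(2) by (simp add: gl2_sum)
qed (auto simp: gl2_inner_zero)

lemma gl2_inner_cong:
  assumes "gl2_eq M F F'" "gl2_eq M G G'"
    and "\<And>n. F n \<in> borel_measurable (M n)" "\<And>n. F' n \<in> borel_measurable (M n)"
    and "\<And>n. G n \<in> borel_measurable (M n)" "\<And>n. G' n \<in> borel_measurable (M n)"
  shows "gl2_inner M F G = gl2_inner M F' G'"
proof -
  have "(\<integral>x. F n x * G n x \<partial>M n) = (\<integral>x. F' n x * G' n x \<partial>M n)" for n
  proof (rule integral_cong_AE)
    show "AE x in M n. F n x * G n x = F' n x * G' n x"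
      using assms(1)[unfolded gl2_eq_def, rule_format, of n] assms(2)[unfolded gl2_eq_def, rule_format, of n]
      by eventually_elim simp
  qed (use assms in measurable)
  then show ?thesis by (simp add: gl2_inner_def)
qed

lemma gl2_eq_refl [simp]: "gl2_eq M F F"
  by (simp add: gl2_eq_def)

lemma gl2_eq_sym: "gl2_eq M F G \<Longrightarrow> gl2_eq M G F"
  by (simp add: gl2_eq_def eq_commute)

lemma gl2_eq_trans:
  assumes "gl2_eq M F G" "gl2_eq M G H" shows "gl2_eq M F H"
  unfolding gl2_eq_def
proof
  fix n show "AE x in M n. F n x = H n x"
    using assms(1)[unfolded gl2_eq_def, rule_format, of n] assms(2)[unfolded gl2_eq_def, rule_format, of n]
    by eventually_elim simp
qed

lemma gl2_eq_add:
  assumes "gl2_eq M F F'" "gl2_eq M G G'"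
  shows "gl2_eq M (\<lambda>n x. F n x + G n x) (\<lambda>n x. F' n x + G' n x)"
  unfolding gl2_eq_def
proof
  fix n show "AE x in M n. F n x + G n x = F' n x + G' n x"
    using assms(1)[unfolded gl2_eq_def, rule_format, of n] assms(2)[unfolded gl2_eq_def, rule_format, of n]
    by eventually_elim simp
qed

lemma gl2_eq_diff:
  assumes "gl2_eq M F F'" "gl2_eq M G G'"
  shows "gl2_eq M (\<lambda>n x. F n x - G n x) (\<lambda>n x. F' n x - G' n x)"
  unfolding gl2_eq_def
proof
  fix n show "AE x in M n. F n x - G n x = F' n x - G' n x"
    using assms(1)[unfolded gl2_eq_def, rule_format, of n] assms(2)[unfolded gl2_eq_def, rule_format, of n]
    by eventually_elim simp
qed

lemma gl2_eq_scale:
  assumes "gl2_eq M F F'"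
  shows "gl2_eq M (\<lambda>n x. c * F n x) (\<lambda>n x. c * F' n x)"
  unfolding gl2_eq_def
proof
  fix n show "AE x in M n. c * F n x = c * F' n x"
    using assms(1)[unfolded gl2_eq_def, rule_format, of n] by eventually_elim simp
qed

lemma gl2_eq_sum:
  assumes "\<And>i. i \<in> I \<Longrightarrow> gl2_eq M (F i) (F' i)"
  shows "gl2_eq M (\<lambda>n x. \<Sum>i\<in>I. F i n x) (\<lambda>n x. \<Sum>i\<in>I. F' i n x)"
  using assms by (induction I rule: infinite_finite_induct) (auto intro: gl2_eq_add)

lemma gl2_norm_cong:
  assumes "gl2_eq M F F'" "\<And>n. F n \<in> borel_measurable (M n)" "\<And>n. F' n \<in> borel_measurable (M n)"
  shows "gl2_norm M F = gl2_norm M F'"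
  unfolding gl2_norm_def using gl2_inner_cong[OF assms(1,1)] assms by simp

lemma gl2_inner_self_nonneg: "F \<in> gl2 M \<Longrightarrow> 0 \<le> gl2_inner M F F"
  unfolding gl2_inner_def
  by (intro suminf_nonneg gl2_summable_prod) (auto intro!: integral_nonneg)

lemma gl2_norm_square: "F \<in> gl2 M \<Longrightarrow> (gl2_norm M F)\<^sup>2 = gl2_inner M F F"
  by (simp add: gl2_norm_def gl2_inner_self_nonneg)

lemma gl2_norm_nonneg: "F \<in> gl2 M \<Longrightarrow> 0 \<le> gl2_norm M F"
  by (simp add: gl2_norm_def gl2_inner_self_nonneg)

lemma gl2_eq_zero_iff:
  assumes "F \<in> gl2 M"
  shows "gl2_inner M F F = 0 \<longleftrightarrow> gl2_eq M F (\<lambda>n x. 0)"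
proof -
  have "gl2_inner M F F = 0 \<longleftrightarrow> (\<forall>n. (\<integral>x. (F n x)\<^sup>2 \<partial>M n) = 0)"
    unfolding gl2_inner_def power2_eq_square[symmetric]
    by (rule suminf_eq_zero_iff[OF gl2D(3)[OF assms]]) (auto intro!: integral_nonneg)
  also have "\<dots> \<longleftrightarrow> gl2_eq M F (\<lambda>n x. 0)"
    using integral_nonneg_eq_0_iff_AE[OF gl2D(2)[OF assms]] by (simp add: gl2_eq_def)
  finally show ?thesis .
qed

lemma gl2_eq_iff_norm:
  assumes "F \<in> gl2 M" "G \<in> gl2 M"
  shows "gl2_eq M F G \<longleftrightarrow> gl2_norm M (\<lambda>n x. F n x - G n x) = 0"
  using gl2_eq_zero_iff[OF gl2_diff[OF assms]] by (simp add: gl2_norm_def gl2_eq_def)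

lemma gl2_Cauchy_Schwarz:
  assumes "F \<in> gl2 M" "G \<in> gl2 M"
  shows "\<bar>gl2_inner M F G\<bar> \<le> gl2_norm M F * gl2_norm M G"
proof (cases "gl2_inner M G G = 0")
  case True
  then have "gl2_eq M G (\<lambda>n x. 0)" using gl2_eq_zero_iff[OF assms(2)] by simp
  then have "gl2_inner M F G = gl2_inner M F (\<lambda>n x. 0)"
    using gl2D(1)[OF assms(1)] gl2D(1)[OF assms(2)] by (intro gl2_inner_cong) auto
  then show ?thesis using assms by (simp add: gl2_inner_zero gl2_inner_sym[of M F] gl2_norm_nonneg)
next
  case False
  define b where "b = gl2_inner M G G"
  have b: "b > 0" using False gl2_inner_self_nonneg[OF assms(2)] by (simp add: b_def)
  define c where "c = gl2_inner M F G"
  note cG = gl2_scale[OF assms(2), of "c / b"]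
  have "0 \<le> gl2_inner M (\<lambda>n x. F n x - c / b * G n x) (\<lambda>n x. F n x - c / b * G n x)"
    by (rule gl2_inner_self_nonneg[OF gl2_diff[OF assms(1) cG]])
  also have "\<dots> = gl2_inner M F F - 2 * (c / b * c) + c / b * (c / b * b)"
    using gl2_inner_diff[OF assms(1) cG gl2_diff[OF assms(1) cG]] gl2_inner_diff2[OF assms(1) cG assms(1)]
      gl2_inner_diff2[OF assms(1) cG cG] gl2_inner_scale[OF assms(2,1), of "c / b"]
      gl2_inner_scale[OF assms(2) cG, of "c / b"] gl2_inner_scale2[OF assms(2,1), of "c / b"]
      gl2_inner_scale2[OF assms(2,2), of "c / b"] gl2_inner_sym[of M G F]
    by (simp add: b_def[symmetric] c_def[symmetric])
  also have "\<dots> = gl2_inner M F F - c\<^sup>2 / b"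
    using b by (simp add: power2_eq_square)
  finally have "c\<^sup>2 \<le> gl2_inner M F F * b"
    using b by (simp add: field_simps)
  then have "sqrt (c\<^sup>2) \<le> sqrt (gl2_inner M F F * b)"
    by (rule real_sqrt_le_mono)
  then show ?thesis by (simp add: c_def b_def gl2_norm_def real_sqrt_mult)
qed

lemma gl2_triangle:
  assumes "F \<in> gl2 M" "G \<in> gl2 M"
  shows "gl2_norm M (\<lambda>n x. F n x + G n x) \<le> gl2_norm M F + gl2_norm M G"
proof (rule power2_le_imp_le)
  have "(gl2_norm M (\<lambda>n x. F n x + G n x))\<^sup>2
      = gl2_inner M F F + 2 * gl2_inner M F G + gl2_inner M G G"
    using assms gl2_add[OF assms]
    by (simp add: gl2_norm_square gl2_inner_add gl2_inner_add2 gl2_inner_sym[of M G F])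
  also have "\<dots> \<le> (gl2_norm M F + gl2_norm M G)\<^sup>2"
    using gl2_Cauchy_Schwarz[OF assms] assms by (simp add: power2_sum gl2_norm_square)
  finally show "(gl2_norm M (\<lambda>n x. F n x + G n x))\<^sup>2 \<le> (gl2_norm M F + gl2_norm M G)\<^sup>2" .
qed (simp add: assms gl2_norm_nonneg)

lemma gl2_norm_scale:
  assumes "F \<in> gl2 M"
  shows "gl2_norm M (\<lambda>n x. c * F n x) = \<bar>c\<bar> * gl2_norm M F"
proof -
  have "gl2_inner M (\<lambda>n x. c * F n x) (\<lambda>n x. c * F n x) = c\<^sup>2 * gl2_inner M F F"
    using gl2_inner_scale[OF assms gl2_scale[OF assms, of c], of c] gl2_inner_scale2[OF assms assms, of c]
    by (simp add: power2_eq_square)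
  then show ?thesis by (simp add: gl2_norm_def real_sqrt_mult)
qed

lemma gl2_norm_diff_sym: "gl2_norm M (\<lambda>n x. F n x - G n x) = gl2_norm M (\<lambda>n x. G n x - F n x)"
proof -
  have "(F n x - G n x) * (F n x - G n x) = (G n x - F n x) * (G n x - F n x)" for n x
    by (simp add: algebra_simps)
  then show ?thesis by (simp add: gl2_norm_def gl2_inner_def)
qed

lemma gl2_triangle_diff:
  assumes "F \<in> gl2 M" "G \<in> gl2 M" "H \<in> gl2 M"
  shows "gl2_norm M (\<lambda>n x. F n x - H n x)
    \<le> gl2_norm M (\<lambda>n x. F n x - G n x) + gl2_norm M (\<lambda>n x. G n x - H n x)"
  using gl2_triangle[OF gl2_diff[OF assms(1,2)] gl2_diff[OF assms(2,3)]] by simp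

section \<open>Completeness, extension of isometries, orthogonal projections\<close>

definition gl2_energy :: "(nat \<Rightarrow> 'x measure) \<Rightarrow> (nat \<Rightarrow> 'x \<Rightarrow> real) \<Rightarrow> ennreal"
  where "gl2_energy M F = (\<Sum>n. \<integral>\<^sup>+x. ennreal ((F n x)\<^sup>2) \<partial>M n)"

lemma gl2_energy_eq:
  assumes "F \<in> gl2 M" shows "gl2_energy M F = ennreal ((gl2_norm M F)\<^sup>2)"
proof -
  have "(\<integral>\<^sup>+x. ennreal ((F n x)\<^sup>2) \<partial>M n) = ennreal (\<integral>x. (F n x)\<^sup>2 \<partial>M n)" for n
    by (rule nn_integral_eq_integral[OF gl2D(2)[OF assms]]) simp
  then have "gl2_energy M F = (\<Sum>n. ennreal (\<integral>x. (F n x)\<^sup>2 \<partial>M n))"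
    unfolding gl2_energy_def by presburger
  also have "\<dots> = ennreal (\<Sum>n. \<integral>x. (F n x)\<^sup>2 \<partial>M n)"
    by (intro suminf_ennreal2 gl2D(3)[OF assms] integral_nonneg) simp
  finally show ?thesis
    unfolding gl2_norm_square[OF assms] unfolding gl2_inner_def power2_eq_square .
qed

text \<open>The extended-valued square of the norm makes sense before square integrability is known,
  so a limit can first be bounded by Fatou and then be recognized as an element of
  \<open>gl2\<close>.\<close>

lemma gl2_energy_finiteI:
  assumes meas: "\<And>n. F n \<in> borel_measurable (M n)" and fin: "gl2_energy M F < \<infinity>"
  shows "F \<in> gl2 M"
proof -
  have "(\<Sum>n. \<integral>\<^sup>+x. ennreal ((F n x)\<^sup>2) \<partial>M n) \<noteq> \<infinity>" using fin by (simp add: gl2_energy_def)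
  then have f: "(\<integral>\<^sup>+x. ennreal ((F n x)\<^sup>2) \<partial>M n) < \<infinity>" for n
    using ennreal_suminf_lessD[of "\<lambda>n. \<integral>\<^sup>+x. ennreal ((F n x)\<^sup>2) \<partial>M n" \<top> n] by (simp add: less_top)
  have i: "integrable (M n) (\<lambda>x. (F n x)\<^sup>2)" for n
    using meas[of n] f[of n] by (intro integrableI_bounded) auto
  have e: "(\<integral>\<^sup>+x. ennreal ((F n x)\<^sup>2) \<partial>M n) = ennreal (\<integral>x. (F n x)\<^sup>2 \<partial>M n)" for n
    by (rule nn_integral_eq_integral[OF i]) simp
  have "(\<Sum>n. ennreal (\<integral>x. (F n x)\<^sup>2 \<partial>M n)) \<noteq> \<infinity>"
    using fin by (simp add: gl2_energy_def e)
  then have "summable (\<lambda>n. \<integral>x. (F n x)\<^sup>2 \<partial>M n)"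
    by (intro summable_suminf_not_top) (auto intro!: integral_nonneg)
  with i meas show ?thesis by (auto simp: gl2_def)
qed

text \<open>The increments have squared norm at most 8^(-k), so the series of their squares weighted
  by 2^k has integral at most the sum of 4^(-k) and is finite almost everywhere. At such a point its
  terms are bounded by some B, hence the increments by sqrt B times 2^(-k/2), which is
  summable.\<close>

lemma fast_L2_Cauchy_AE_convergent:
  fixes u :: "nat \<Rightarrow> 'x \<Rightarrow> real"
  assumes meas: "\<And>k. u k \<in> borel_measurable N"
    and fast: "\<And>k. (\<integral>\<^sup>+x. ennreal ((u (Suc k) x - u k x)\<^sup>2) \<partial>N) \<le> ennreal ((1/8)^k)"
  shows "AE x in N. convergent (\<lambda>k. u k x)"
proof -
  define d where "d k x = u (Suc k) x - u k x" for k x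
  have md: "d k \<in> borel_measurable N" for k unfolding d_def using meas by measurable
  define g where "g x = (\<Sum>k. ennreal (2^k * (d k x)\<^sup>2))" for x
  have mg: "g \<in> borel_measurable N" unfolding g_def using md by measurable
  have "(\<integral>\<^sup>+x. g x \<partial>N) = (\<Sum>k. \<integral>\<^sup>+x. ennreal (2^k * (d k x)\<^sup>2) \<partial>N)"
    unfolding g_def using md by (intro nn_integral_suminf) measurable
  also have "\<dots> = (\<Sum>k. ennreal (2^k) * (\<integral>\<^sup>+x. ennreal ((d k x)\<^sup>2) \<partial>N))"
    using md by (simp add: ennreal_mult nn_integral_cmult)
  also have "\<dots> \<le> (\<Sum>k. ennreal (2^k) * ennreal ((1/8)^k))"
    using fast by (intro suminf_le mult_left_mono) (auto simp: d_def)
  also have "\<dots> = (\<Sum>k. ennreal ((1/4)^k))"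
    by (simp flip: ennreal_mult power_mult_distrib)
  also have "\<dots> = ennreal (\<Sum>k. (1/4)^k)"
    by (intro suminf_ennreal2) (auto intro: summable_geometric)
  also have "\<dots> < \<infinity>" by simp
  finally have "AE x in N. g x \<noteq> \<infinity>"
    using nn_integral_PInf_AE[OF mg] by simp
  then show ?thesis
  proof eventually_elim
    case (elim x)
    then have "summable (\<lambda>k. 2^k * (d k x)\<^sup>2)"
      unfolding g_def by (intro summable_suminf_not_top) auto
    then obtain B where B: "norm (2^k * (d k x)\<^sup>2) \<le> B" for k
      using summable_imp_bounded[of "\<lambda>k. 2^k * (d k x)\<^sup>2"] unfolding bounded_iff by auto
    have bd: "norm (d k x) \<le> sqrt B * (sqrt (1/2))^k" for k
    proof -
      have "(d k x)\<^sup>2 \<le> B * (1/2)^k"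
        using B[of k] by (simp add: power_one_over field_simps)
      then have "sqrt ((d k x)\<^sup>2) \<le> sqrt (B * (1/2)^k)" by (rule real_sqrt_le_mono)
      then show ?thesis unfolding real_sqrt_mult real_sqrt_power[of "1/2"] real_sqrt_abs real_norm_def .
    qed
    have "sqrt (1/2) < (1::real)" by simp
    then have "norm (sqrt (1/2)) < (1::real)" by simp
    then have "summable (\<lambda>k. sqrt B * (sqrt (1/2))^k)"
      by (intro summable_mult summable_geometric)
    then have "summable (\<lambda>k. d k x)"
      by (rule summable_comparison_test'[where N = 0]) (rule bd)
    then have "convergent (\<lambda>k. \<Sum>i<k. d i x)" by (simp add: summable_iff_convergent)
    then have "convergent (\<lambda>k. u 0 x + (\<Sum>i<k. d i x))" by (intro convergent_add convergent_const)
    moreover have "u 0 x + (\<Sum>i<k. d i x) = u k x" for k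
      using sum_lessThan_telescope[of "\<lambda>i. u i x" k] by (simp add: d_def)
    ultimately show "convergent (\<lambda>k. u k x)" by simp
  qed
qed

text \<open>Fatou is used twice: in each component for the integral, and over the counting measure
  for the sum of the components.\<close>

lemma gl2_energy_Fatou:
  assumes meas: "\<And>j n. u j n \<in> borel_measurable (M n)" "\<And>n. v n \<in> borel_measurable (M n)"
    and lim: "\<And>n. AE x in M n. (\<lambda>j. u j n x) \<longlonglongrightarrow> v n x"
  shows "gl2_energy M v \<le> liminf (\<lambda>j. gl2_energy M (u j))"
proof -
  have "(\<integral>\<^sup>+x. ennreal ((v n x)\<^sup>2) \<partial>M n) \<le> liminf (\<lambda>j. \<integral>\<^sup>+x. ennreal ((u j n x)\<^sup>2) \<partial>M n)" for n
  proof -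
    have "(\<integral>\<^sup>+x. ennreal ((v n x)\<^sup>2) \<partial>M n) = (\<integral>\<^sup>+x. liminf (\<lambda>j. ennreal ((u j n x)\<^sup>2)) \<partial>M n)"
    proof (rule nn_integral_cong_AE, use lim[of n] in eventually_elim)
      case (elim x)
      then have "(\<lambda>j. ennreal ((u j n x)\<^sup>2)) \<longlonglongrightarrow> ennreal ((v n x)\<^sup>2)"
        by (intro tendsto_intros)
      from lim_imp_Liminf[OF _ this] show ?case by simp
    qed
    also have "\<dots> \<le> liminf (\<lambda>j. \<integral>\<^sup>+x. ennreal ((u j n x)\<^sup>2) \<partial>M n)"
      using meas by (intro nn_integral_liminf) auto
    finally show ?thesis .
  qed
  then have "gl2_energy M v \<le> (\<Sum>n. liminf (\<lambda>j. \<integral>\<^sup>+x. ennreal ((u j n x)\<^sup>2) \<partial>M n))"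
    unfolding gl2_energy_def by (intro suminf_le) auto
  also have "\<dots> = (\<integral>\<^sup>+n. liminf (\<lambda>j. \<integral>\<^sup>+x. ennreal ((u j n x)\<^sup>2) \<partial>M n) \<partial>count_space UNIV)"
    by (simp add: nn_integral_count_space_nat)
  also have "\<dots> \<le> liminf (\<lambda>j. \<integral>\<^sup>+n. (\<integral>\<^sup>+x. ennreal ((u j n x)\<^sup>2) \<partial>M n) \<partial>count_space UNIV)"
    by (intro nn_integral_liminf) auto
  also have "\<dots> = liminf (\<lambda>j. gl2_energy M (u j))"
    by (simp add: nn_integral_count_space_nat gl2_energy_def)
  finally show ?thesis .
qed

text \<open>The pointwise limit exists by the fast rate. Letting \<open>j\<close> tend to infinity
  in the Cauchy estimate, Fatou yields the same rate for the limit.\<close>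

lemma gl2_fast_complete:
  assumes u: "\<And>k. u k \<in> gl2 M"
    and fast: "\<And>k j. k \<le> j \<Longrightarrow> (gl2_norm M (\<lambda>n x. u j n x - u k n x))\<^sup>2 \<le> (1/8)^k"
  obtains v where "v \<in> gl2 M" "\<And>k. (gl2_norm M (\<lambda>n x. v n x - u k n x))\<^sup>2 \<le> (1/8)^k"
proof -
  define v where "v n x = lim (\<lambda>k. u k n x)" for n x
  have mu: "u k n \<in> borel_measurable (M n)" for k n using gl2D(1)[OF u] .
  have mv: "v n \<in> borel_measurable (M n)" for n
    unfolding v_def using mu by (intro borel_measurable_lim_metric) auto
  have en: "gl2_energy M (\<lambda>n x. u j n x - u k n x) \<le> ennreal ((1/8)^k)" if "k \<le> j" for k j
    using fast[OF that] by (simp add: gl2_energy_eq[OF gl2_diff[OF u u]] ennreal_leI)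
  have "(\<integral>\<^sup>+x. ennreal ((u (Suc k) n x - u k n x)\<^sup>2) \<partial>M n) \<le> ennreal ((1/8)^k)" for k n
  proof -
    have "(\<integral>\<^sup>+x. ennreal ((u (Suc k) n x - u k n x)\<^sup>2) \<partial>M n)
        = (\<Sum>i\<in>{n}. \<integral>\<^sup>+x. ennreal ((u (Suc k) i x - u k i x)\<^sup>2) \<partial>M i)" by simp
    also have "\<dots> \<le> gl2_energy M (\<lambda>n x. u (Suc k) n x - u k n x)"
      unfolding gl2_energy_def by (intro sum_le_suminf) auto
    finally show ?thesis using en[of k "Suc k"] by simp
  qed
  then have conv: "AE x in M n. convergent (\<lambda>k. u k n x)" for n
    using mu by (intro fast_L2_Cauchy_AE_convergent) auto
  then have lim: "AE x in M n. (\<lambda>k. u k n x) \<longlonglongrightarrow> v n x" for n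
    by (rule AE_mp) (auto simp: v_def convergent_LIMSEQ_iff)
  have E: "gl2_energy M (\<lambda>n x. v n x - u k n x) \<le> ennreal ((1/8)^k)" for k
  proof -
    have "gl2_energy M (\<lambda>n x. v n x - u k n x) \<le> liminf (\<lambda>j. gl2_energy M (\<lambda>n x. u j n x - u k n x))"
    proof (rule gl2_energy_Fatou)
      fix n show "AE x in M n. (\<lambda>j. u j n x - u k n x) \<longlonglongrightarrow> v n x - u k n x"
        using lim[of n] by eventually_elim (intro tendsto_intros)
    qed (use mu mv in auto)
    also have "\<dots> \<le> liminf (\<lambda>j. ennreal ((1/8)^k))"
      by (intro Liminf_mono) (use en in \<open>auto simp: eventually_sequentially\<close>)
    finally show ?thesis by (simp add: Liminf_const)
  qed
  have d: "(\<lambda>n x. v n x - u k n x) \<in> gl2 M" for k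
    using E[of k] mu mv by (intro gl2_energy_finiteI) (auto simp: le_less_trans[OF E])
  have "v \<in> gl2 M"
    using gl2_add[OF d[of 0] u[of 0]] by simp
  moreover have "(gl2_norm M (\<lambda>n x. v n x - u k n x))\<^sup>2 \<le> (1/8)^k" for k
    using E[of k] by (simp add: gl2_energy_eq[OF d] ennreal_le_iff)
  ultimately show ?thesis by (rule that)
qed

text \<open>The closure of the graph of \<open>Jf\<close> over \<open>A\<close>. For
  \<open>A = finite_test\<close> and \<open>Jf = J_fin\<close> it is the condition by which
  \<open>J_ext\<close> selects its value, so the next two lemmas make that choice
  legitimate.\<close>

definition ext_graph where
  "ext_graph M1 M2 A Jf F v \<longleftrightarrow> v \<in> gl2 M2 \<and> (\<forall>e>0. \<exists>\<phi>\<in>A.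
      gl2_norm M1 (\<lambda>n t. F n t - \<phi> n t) < e \<and> gl2_norm M2 (\<lambda>m y. v m y - Jf \<phi> m y) < e)"

text \<open>Approximants of \<open>F\<close> with errors 8^(-k/2) / 2 have images that are Cauchy at
  the rate required by \<open>gl2_fast_complete\<close>, since \<open>Jf\<close> preserves
  distances.\<close>

lemma ext_graph_exists:
  assumes A: "A \<subseteq> gl2 M1" and Jf: "\<And>\<phi>. \<phi> \<in> A \<Longrightarrow> Jf \<phi> \<in> gl2 M2"
    and iso: "\<And>\<phi> \<psi>. \<phi> \<in> A \<Longrightarrow> \<psi> \<in> A \<Longrightarrow>
      gl2_norm M2 (\<lambda>m y. Jf \<phi> m y - Jf \<psi> m y) = gl2_norm M1 (\<lambda>n t. \<phi> n t - \<psi> n t)"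
    and F: "F \<in> gl2 M1" and dense: "\<And>e. e > 0 \<Longrightarrow> \<exists>\<phi>\<in>A. gl2_norm M1 (\<lambda>n t. F n t - \<phi> n t) < e"
  shows "\<exists>v. ext_graph M1 M2 A Jf F v"
proof -
  have "\<exists>\<phi>. \<phi> \<in> A \<and> gl2_norm M1 (\<lambda>n t. F n t - \<phi> n t) < sqrt ((1/8)^k) / 2" for k :: nat
    using dense[of "sqrt ((1/8)^k) / 2"] by auto
  then obtain \<phi> where \<phi>: "\<And>k. \<phi> k \<in> A"
      "\<And>k. gl2_norm M1 (\<lambda>n t. F n t - \<phi> k n t) < sqrt ((1/8)^k) / 2" by metis
  have \<phi>g: "\<phi> k \<in> gl2 M1" for k using \<phi>(1) A by auto
  have "(gl2_norm M2 (\<lambda>n x. Jf (\<phi> j) n x - Jf (\<phi> k) n x))\<^sup>2 \<le> (1/8)^k" if "k \<le> j" for k j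
  proof -
    have "gl2_norm M2 (\<lambda>n x. Jf (\<phi> j) n x - Jf (\<phi> k) n x) = gl2_norm M1 (\<lambda>n t. \<phi> j n t - \<phi> k n t)"
      by (rule iso[OF \<phi>(1) \<phi>(1)])
    also have "\<dots> \<le> gl2_norm M1 (\<lambda>n t. \<phi> j n t - F n t) + gl2_norm M1 (\<lambda>n t. F n t - \<phi> k n t)"
      by (rule gl2_triangle_diff[OF \<phi>g F \<phi>g])
    also have "\<dots> \<le> sqrt ((1/8)^j) / 2 + sqrt ((1/8)^k) / 2"
      using \<phi>(2)[of j] \<phi>(2)[of k] by (simp add: gl2_norm_diff_sym[of M1 "\<phi> j"])
    also have "\<dots> \<le> sqrt ((1/8)^k)"
    proof -
      have "(1/8::real)^j \<le> (1/8)^k" using that by (intro power_decreasing) auto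
      then have "sqrt ((1/8::real)^j) \<le> sqrt ((1/8)^k)" by (rule real_sqrt_le_mono)
      then show ?thesis by linarith
    qed
    finally have "gl2_norm M2 (\<lambda>n x. Jf (\<phi> j) n x - Jf (\<phi> k) n x) \<le> sqrt ((1/8)^k)" .
    then have "(gl2_norm M2 (\<lambda>n x. Jf (\<phi> j) n x - Jf (\<phi> k) n x))\<^sup>2 \<le> (sqrt ((1/8)^k))\<^sup>2"
      by (intro power_mono) (auto intro!: gl2_norm_nonneg gl2_diff Jf \<phi>)
    then show ?thesis by simp
  qed
  note fast = this
  obtain v where v: "v \<in> gl2 M2" "\<And>k. (gl2_norm M2 (\<lambda>n x. v n x - Jf (\<phi> k) n x))\<^sup>2 \<le> (1/8)^k"
    by (rule gl2_fast_complete[of "\<lambda>k. Jf (\<phi> k)" M2, OF Jf[OF \<phi>(1)]]) (use fast in auto)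
  have "\<exists>\<psi>\<in>A. gl2_norm M1 (\<lambda>n t. F n t - \<psi> n t) < e \<and> gl2_norm M2 (\<lambda>m y. v m y - Jf \<psi> m y) < e"
    if "e > 0" for e
  proof -
    obtain k where k: "(1/8)^k < e\<^sup>2"
      using real_arch_pow_inv[of "e\<^sup>2" "1/8"] \<open>e > 0\<close> by auto
    then have "sqrt ((1/8)^k) < e" using that real_sqrt_less_mono[OF k] by simp
    moreover have "0 \<le> sqrt ((1/8)^k)" by simp
    ultimately have 1: "gl2_norm M1 (\<lambda>n t. F n t - \<phi> k n t) < e" using \<phi>(2)[of k] by linarith
    have "(gl2_norm M2 (\<lambda>n x. v n x - Jf (\<phi> k) n x))\<^sup>2 < e\<^sup>2" using v(2)[of k] k by linarith
    then have "gl2_norm M2 (\<lambda>n x. v n x - Jf (\<phi> k) n x) < e"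
      using that power2_less_imp_less[of _ e] by simp
    with 1 show ?thesis using \<phi>(1) by auto
  qed
  with v(1) show ?thesis unfolding ext_graph_def by auto
qed

text \<open>Both distances are compared with those of approximants, at the cost of 4 e. In
  particular the value over \<open>F\<close> is unique modulo null sets, and values equal in this
  sense have arguments equal in this sense.\<close>

lemma ext_graph_isometry:
  assumes A: "A \<subseteq> gl2 M1" and Jf: "\<And>\<phi>. \<phi> \<in> A \<Longrightarrow> Jf \<phi> \<in> gl2 M2"
    and iso: "\<And>\<phi> \<psi>. \<phi> \<in> A \<Longrightarrow> \<psi> \<in> A \<Longrightarrow>
      gl2_norm M2 (\<lambda>m y. Jf \<phi> m y - Jf \<psi> m y) = gl2_norm M1 (\<lambda>n t. \<phi> n t - \<psi> n t)"
    and F: "F \<in> gl2 M1" "F' \<in> gl2 M1"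
    and v: "ext_graph M1 M2 A Jf F v" "ext_graph M1 M2 A Jf F' v'"
  shows "gl2_norm M2 (\<lambda>m y. v m y - v' m y) = gl2_norm M1 (\<lambda>n t. F n t - F' n t)"
proof -
  have vg: "v \<in> gl2 M2" "v' \<in> gl2 M2" using v by (auto simp: ext_graph_def)
  have *: "\<bar>gl2_norm M2 (\<lambda>m y. v m y - v' m y) - gl2_norm M1 (\<lambda>n t. F n t - F' n t)\<bar> \<le> 4 * e" if "e > 0" for e
  proof -
    obtain \<phi> where p: "\<phi> \<in> A" "gl2_norm M1 (\<lambda>n t. F n t - \<phi> n t) < e" "gl2_norm M2 (\<lambda>m y. v m y - Jf \<phi> m y) < e"
      using v(1) \<open>e > 0\<close> unfolding ext_graph_def by blast
    obtain \<psi> where q: "\<psi> \<in> A" "gl2_norm M1 (\<lambda>n t. F' n t - \<psi> n t) < e" "gl2_norm M2 (\<lambda>m y. v' m y - Jf \<psi> m y) < e"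
      using v(2) \<open>e > 0\<close> unfolding ext_graph_def by blast
    have g: "\<phi> \<in> gl2 M1" "\<psi> \<in> gl2 M1" "Jf \<phi> \<in> gl2 M2" "Jf \<psi> \<in> gl2 M2" using p q A Jf by auto
    have "\<bar>gl2_norm M2 (\<lambda>m y. v m y - v' m y) - gl2_norm M2 (\<lambda>m y. Jf \<phi> m y - Jf \<psi> m y)\<bar> \<le> 2 * e"
      using gl2_triangle_diff[OF vg(1) g(3) vg(2)] gl2_triangle_diff[OF g(3,4) vg(2)]
        gl2_triangle_diff[OF g(3) vg(1) g(4)] gl2_triangle_diff[OF vg g(4)]
        p q gl2_norm_diff_sym[of M2 v "Jf \<phi>"] gl2_norm_diff_sym[of M2 v' "Jf \<psi>"] by linarith
    moreover have "\<bar>gl2_norm M1 (\<lambda>m y. F m y - F' m y) - gl2_norm M1 (\<lambda>m y. \<phi> m y - \<psi> m y)\<bar> \<le> 2 * e"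
      using gl2_triangle_diff[OF F(1) g(1) F(2)] gl2_triangle_diff[OF g(1,2) F(2)]
        gl2_triangle_diff[OF g(1) F(1) g(2)] gl2_triangle_diff[OF F g(2)]
        p q gl2_norm_diff_sym[of M1 F "\<phi>"] gl2_norm_diff_sym[of M1 F' "\<psi>"] by linarith
    ultimately show ?thesis using iso[OF p(1) q(1)] by linarith
  qed
  have "\<bar>gl2_norm M2 (\<lambda>m y. v m y - v' m y) - gl2_norm M1 (\<lambda>n t. F n t - F' n t)\<bar> \<le> 0 + e" if "e > 0" for e
    using *[of "e / 4"] that by simp
  then have "\<bar>gl2_norm M2 (\<lambda>m y. v m y - v' m y) - gl2_norm M1 (\<lambda>n t. F n t - F' n t)\<bar> \<le> 0"
    by (rule field_le_epsilon)
  then show ?thesis by simp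
qed

text \<open>The residuals of \<open>v\<close> at \<open>p\<close> and at the selected point
  \<open>q\<close> are both orthogonal to \<open>p\<close> and to \<open>q\<close>; the four
  resulting equations give \<open>q - p\<close> norm zero.\<close>

lemma orth_proj_eq:
  assumes v: "v \<in> gl2 M" and S: "S \<subseteq> gl2 M" and p: "p \<in> S"
    and orth: "\<And>w. w \<in> S \<Longrightarrow> gl2_inner M (\<lambda>n x. v n x - p n x) w = 0"
  shows "gl2_eq M (orth_proj M S v) p" "orth_proj M S v \<in> S"
proof -
  define q where "q = orth_proj M S v"
  have q: "q \<in> S \<and> (\<forall>w\<in>S. gl2_inner M (\<lambda>n x. v n x - q n x) w = 0)"
    unfolding q_def orth_proj_def by (rule someI[of _ p]) (use p orth in auto)
  have g: "p \<in> gl2 M" "q \<in> gl2 M" using p q S by auto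
  have "gl2_inner M v p - gl2_inner M p p = 0" "gl2_inner M v q - gl2_inner M p q = 0"
    "gl2_inner M v p - gl2_inner M q p = 0" "gl2_inner M v q - gl2_inner M q q = 0"
    using orth[OF p] orth[of q] q p g v by (auto simp: gl2_inner_diff)
  then have "gl2_inner M (\<lambda>n x. q n x - p n x) (\<lambda>n x. q n x - p n x) = 0"
    using g gl2_diff[OF g(2,1)] by (simp add: gl2_inner_diff gl2_inner_diff2 gl2_inner_sym[of M q p])
  then show "gl2_eq M (orth_proj M S v) p"
    using gl2_eq_iff_norm[OF g(2,1)] by (simp add: gl2_norm_def q_def)
  show "orth_proj M S v \<in> S" using q q_def by simp
qed

section \<open>Orthogonal polynomials of a compactly supported measure\<close>

text \<open>By second countability the complement of the support is covered by countably many basic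
  open null sets.\<close>

lemma measure_support_AE:
  fixes M :: "'b::second_countable_topology measure"
  assumes sets: "sets M = sets borel"
  shows "AE s in M. s \<in> measure_support M"
proof -
  obtain B :: "'b set set" where B: "countable B" "topological_basis B"
    using ex_countable_basis by auto
  define N where "N = \<Union>{U\<in>B. emeasure M U = 0}"
  have "N \<in> null_sets M"
  proof -
    have "(\<Union>U\<in>{U\<in>B. emeasure M U = 0}. U) \<in> null_sets M"
    proof (rule null_sets_UN')
      show "countable {U\<in>B. emeasure M U = 0}" by (rule countable_subset[OF _ B(1)]) auto
      fix U assume "U \<in> {U\<in>B. emeasure M U = 0}"
      then show "U \<in> null_sets M"
        using topological_basis_open[OF B(2), of U] sets null_setsI[of M U] borel_open[of U] by simp
    qed
    then show ?thesis by (simp add: N_def)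
  qed
  moreover have "{s\<in>space M. s \<notin> measure_support M} \<subseteq> N"
  proof
    fix s assume "s \<in> {s\<in>space M. s \<notin> measure_support M}"
    then obtain U where U: "open U" "s \<in> U" "emeasure M U = 0"
      by (auto simp: measure_support_def zero_less_iff_neq_zero)
    then obtain V where V: "V \<in> B" "s \<in> V" "V \<subseteq> U"
      using topological_basisE[OF B(2)] by metis
    have "emeasure M V \<le> emeasure M U"
      using V U sets by (intro emeasure_mono) auto
    then show "s \<in> N" using U V by (auto simp: N_def)
  qed
  ultimately show ?thesis by (rule AE_I')
qed

definition poly_int :: "real measure \<Rightarrow> real poly \<Rightarrow> real"
  where "poly_int M q = (\<integral>s. poly q s \<partial>M)"

text \<open>The classical quotients (s p, p) / (p, p) and, in \<open>jac_a\<close>, (p, p) / (q, q).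
  A vanishing denominator gives 0, because \<open>x / 0 = 0\<close>.\<close>

definition jac_b :: "real measure \<Rightarrow> real poly \<Rightarrow> real"
  where "jac_b M p = poly_int M ([:0, 1:] * (p * p)) / poly_int M (p * p)"

definition jac_a :: "real measure \<Rightarrow> real poly \<Rightarrow> real poly \<Rightarrow> real"
  where "jac_a M p q = poly_int M (p * p) / poly_int M (q * q)"

definition raw_next :: "real measure \<Rightarrow> real poly \<Rightarrow> real poly \<Rightarrow> real poly"
  where "raw_next M p q = [:0, 1:] * p - smult (jac_b M p) p - smult (jac_a M p q) q"

text \<open>The pair \<open>(p\<^sup>(\<^sup>n\<^sup>), p\<^sup>(\<^sup>n\<^sup>-\<^sup>1\<^sup>))\<close>, computed by the recursion; because of \<open>x / 0 = 0\<close> it stays zero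
  from the first vanishing polynomial on.\<close>
primrec op_pair :: "real measure \<Rightarrow> nat \<Rightarrow> real poly \<times> real poly" where
  "op_pair M 0 = (1, 0)"
| "op_pair M (Suc n) =
    (let r = raw_next M (fst (op_pair M n)) (snd (op_pair M n))
     in (if poly_int M (r * r) = 0 then 0 else r, fst (op_pair M n)))"

text \<open>Compact support is used in the form of an almost sure bound; later one \<open>R\<close>
  serves all \<open>t\<close> in a compact set.\<close>

locale bounded_prob = prob_space M for M :: "real measure" +
  fixes R :: real
  assumes sets_M: "sets M = sets borel" and R_bound: "AE s in M. \<bar>s\<bar> \<le> R"
begin

lemma integrable_poly: "integrable M (poly q)"
proof -
  have "compact (poly q ` {-R..R})"
    by (intro compact_continuous_image) (auto intro: continuous_intros)
  then obtain C where C: "\<And>s. s \<in> {-R..R} \<Longrightarrow> norm (poly q s) \<le> C"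
    by (metis bounded_iff compact_imp_bounded imageI)
  show ?thesis
  proof (rule integrable_const_bound[where B = C])
    show "AE s in M. norm (poly q s) \<le> C"
      using R_bound by eventually_elim (intro C, auto)
    show "poly q \<in> borel_measurable M"
      unfolding measurable_cong_sets[OF sets_M refl]
      by (intro borel_measurable_continuous_onI continuous_intros)
  qed
qed

lemma poly_int_add: "poly_int M (p + q) = poly_int M p + poly_int M q"
  and poly_int_diff: "poly_int M (p - q) = poly_int M p - poly_int M q"
  and poly_int_smult: "poly_int M (smult c p) = c * poly_int M p"
  and poly_int_0: "poly_int M 0 = 0"
  and poly_int_1: "poly_int M 1 = 1"
  using integrable_poly[of p] integrable_poly[of q] by (auto simp: poly_int_def prob_space)

lemma poly_int_square_nonneg: "0 \<le> poly_int M (q * q)"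
  unfolding poly_int_def by (intro integral_nonneg_AE) auto

lemma poly_int_square_eq_0: "poly_int M (q * q) = 0 \<longleftrightarrow> (AE s in M. poly q s = 0)"
  unfolding poly_int_def
  by (subst integral_nonneg_eq_0_iff_AE[OF integrable_poly]) auto

lemma poly_int_null:
  assumes "poly_int M (q * q) = 0" shows "poly_int M (q * r) = 0"
proof -
  have "poly_int M (q * r) = (\<integral>s. 0 \<partial>M)"
    unfolding poly_int_def
  proof (rule integral_cong_AE)
    show "AE s in M. poly (q * r) s = 0"
      using assms[unfolded poly_int_square_eq_0] by eventually_elim simp
  qed (use integrable_poly in auto)
  then show ?thesis by simp
qed

text \<open>Forward: the product of the linear factors at the support points vanishes almost
  everywhere. Backward: the nonzero set of \<open>q\<close> is open and null, so it misses the
  support, which therefore consists of roots of \<open>q\<close>. This turns the number of support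
  points into a question about polynomials of norm zero.\<close>

lemma supp_card_le_iff:
  "supp_card_le M n \<longleftrightarrow> (\<exists>q. q \<noteq> 0 \<and> degree q \<le> n \<and> poly_int M (q * q) = 0)"
proof
  assume s: "supp_card_le M n"
  let ?q = "\<Prod>x\<in>measure_support M. [:-x, 1:]"
  have f: "finite (measure_support M)" using s by (simp add: supp_card_le_def)
  have "degree ?q = card (measure_support M)"
    by (subst degree_prod_eq_sum_degree) auto
  moreover have "AE s in M. poly ?q s = 0"
    using measure_support_AE[OF sets_M]
    by eventually_elim (use f in \<open>auto simp: poly_prod\<close>)
  moreover have "?q \<noteq> 0" using f by auto
  ultimately show "\<exists>q. q \<noteq> 0 \<and> degree q \<le> n \<and> poly_int M (q * q) = 0"
    using s unfolding supp_card_le_def poly_int_square_eq_0 by metis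
next
  assume "\<exists>q. q \<noteq> 0 \<and> degree q \<le> n \<and> poly_int M (q * q) = 0"
  then obtain q where q: "q \<noteq> 0" "degree q \<le> n" "AE s in M. poly q s = 0"
    by (auto simp: poly_int_square_eq_0)
  have "measure_support M \<subseteq> {x. poly q x = 0}"
  proof (rule ccontr)
    assume "\<not> ?thesis"
    then obtain x where x: "x \<in> measure_support M" "poly q x \<noteq> 0" by auto
    let ?U = "{s. poly q s \<noteq> 0}"
    have U: "open ?U" by (intro open_Collect_neq continuous_intros)
    then have "emeasure M ?U > 0" using x by (auto simp: measure_support_def)
    moreover have "emeasure M ?U = 0"
      using q(3) U sets_M sets_eq_imp_space_eq[OF sets_M]
      by (subst (asm) AE_iff_measurable[of ?U]) auto
    ultimately show False by simp
  qed
  then show "supp_card_le M n"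
    using poly_roots_finite[OF q(1)] card_mono[of "{x. poly q x = 0}" "measure_support M"]
      card_poly_roots_bound[OF q(1)] q(2) finite_subset
    unfolding supp_card_le_def by fastforce
qed

lemma not_supp_card_le_0: "\<not> supp_card_le M 0"
proof
  assume "supp_card_le M 0"
  then obtain q where q: "q \<noteq> 0" "degree q = 0" "poly_int M (q * q) = 0"
    by (auto simp: supp_card_le_iff)
  then obtain c where "q = [:c:]" by (meson degree_eq_zeroE)
  with q show False by (simp add: poly_int_def prob_space)
qed

lemma supp_card_le_mono: "supp_card_le M n \<Longrightarrow> n \<le> m \<Longrightarrow> supp_card_le M m"
  by (auto simp: supp_card_le_def)

definition "is_monic_orth n p \<longleftrightarrow> degree p = n \<and> lead_coeff p = 1 \<and>
  (\<forall>q. degree q < n \<longrightarrow> poly_int M (p * q) = 0)"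

lemma monic_diff_degree:
  fixes p q :: "real poly"
  assumes "degree p = Suc n" "degree q = Suc n" "lead_coeff p = 1" "lead_coeff q = 1"
  shows "degree (p - q) \<le> n"
proof (rule degree_le, intro allI impI)
  fix i assume "n < i"
  then show "coeff (p - q) i = 0"
    using assms by (cases "i = Suc n") (auto simp: coeff_eq_0)
qed

lemma is_monic_orth_pos:
  assumes "\<not> supp_card_le M n" "is_monic_orth n p" shows "poly_int M (p * p) > 0"
proof -
  have "p \<noteq> 0" using assms(2) by (auto simp: is_monic_orth_def)
  then have "poly_int M (p * p) \<noteq> 0"
    using assms by (auto simp: supp_card_le_iff is_monic_orth_def)
  then show ?thesis using poly_int_square_nonneg[of p] by simp
qed

text \<open>A test polynomial of degree at most \<open>n\<close> is split as \<open>k p + g'\<close>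
  with \<open>g'\<close> of degree below \<open>n\<close>. Against \<open>p\<close> the choice of
  \<open>jac_b\<close> gives zero. Against \<open>g'\<close> only its coefficient \<open>k'\<close>
  of degree \<open>n - 1\<close> matters: it contributes \<open>k'\<close> (p, p) through
  multiplication by s and \<open>k'\<close> (q, q) through \<open>q\<close>, and
  \<open>jac_a\<close> is the ratio of the two norms.\<close>

lemma is_monic_orth_step:
  assumes n: "\<not> supp_card_le M n" and p: "is_monic_orth n p"
    and q: "if n = 0 then q = 0 else is_monic_orth (n - 1) q"
  shows "is_monic_orth (Suc n) (raw_next M p q)"
proof -
  let ?r = "raw_next M p q"
  have pos: "poly_int M (p * p) > 0" by (rule is_monic_orth_pos[OF n p])
  have dp: "degree p = n" "coeff p n = 1" using p by (auto simp: is_monic_orth_def)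
  have dq: "coeff q i = 0" if "n \<le> i" for i
    using q that by (cases "n = 0") (auto simp: is_monic_orth_def intro: coeff_eq_0)
  have c: "coeff ?r i = (if i = 0 then 0 else coeff p (i - 1)) - jac_b M p * coeff p i - jac_a M p q * coeff q i" for i
    by (simp add: raw_next_def coeff_pCons split: nat.split)
  have top: "coeff ?r (Suc n) = 1" using dp dq by (simp add: c coeff_eq_0)
  have "degree ?r \<le> Suc n"
    by (rule degree_le) (use dp dq in \<open>auto simp: c coeff_eq_0\<close>)
  then have deg: "degree ?r = Suc n" using le_degree[of ?r "Suc n"] top by simp
  have orth: "poly_int M (?r * g) = 0" if g: "degree g < Suc n" for g
  proof -
    have expand: "poly_int M (?r * g)
      = poly_int M (p * ([:0, 1:] * g)) - jac_b M p * poly_int M (p * g) - jac_a M p q * poly_int M (q * g)" for g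
    proof -
      have "?r * g = p * ([:0, 1:] * g) - smult (jac_b M p) (p * g) - smult (jac_a M p q) (q * g)"
        by (simp add: raw_next_def algebra_simps)
      then show ?thesis by (simp only: poly_int_diff poly_int_smult)
    qed
    define k where "k = coeff g n"
    define g' where "g' = g - smult k p"
    have g'0: "coeff g' i = 0" if "n \<le> i" for i
      using that g dp by (cases "i = n") (auto simp: g'_def k_def coeff_eq_0)
    have qp0: "poly_int M (q * p) = 0"
    proof (cases "n = 0")
      case False
      then have "degree q < n" using q by (simp add: is_monic_orth_def)
      then show ?thesis using p by (simp add: is_monic_orth_def mult.commute[of q])
    qed (use q in \<open>simp add: poly_int_0\<close>)
    have "p * ([:0, 1:] * p) = [:0, 1:] * (p * p)" by (simp add: mult.left_commute)
    then have 1: "poly_int M (?r * p) = 0"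
      unfolding expand qp0 using pos by (simp add: jac_b_def)
    have 2: "poly_int M (?r * g') = 0"
    proof (cases "n = 0")
      case True
      then have "g' = 0" using g'0 by (auto intro: poly_eqI)
      then show ?thesis by (simp add: poly_int_0)
    next
      case False
      have deg': "degree g' < n" using False g'0 by (intro degree_lessI) auto
      have pg': "poly_int M (p * g') = 0" using p deg' by (auto simp: is_monic_orth_def)
      have qo: "is_monic_orth (n - 1) q" using q False by simp
      have qd: "degree q = n - 1" "coeff q (n - 1) = 1" using qo by (auto simp: is_monic_orth_def)
      have nq: "\<not> supp_card_le M (n - 1)" using n supp_card_le_mono[of "n - 1" n] by auto
      have posq: "poly_int M (q * q) > 0" by (rule is_monic_orth_pos[OF nq qo])
      define k' where "k' = coeff g' (n - 1)"
      have A: "poly_int M (q * g') = k' * poly_int M (q * q)"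
      \<comment> \<open>In general \<open>g' - k' q\<close> has degree below \<open>n - 1\<close>.
        For \<open>n = 1\<close> no degree is that small, although the difference is zero; both
        polynomials are then constants.\<close>
      proof (cases "n = 1")
        case True
        then obtain u v where uv: "g' = [:u:]" "q = [:v:]"
          using deg' qd by (metis One_nat_def degree_eq_zeroE diff_self_eq_0 less_Suc0)
        then show ?thesis using True qd by (simp add: k'_def poly_int_def prob_space)
      next
        case n1: False
        have "degree (g' - smult k' q) < n - 1"
        proof (rule degree_lessI)
          show "\<forall>k\<ge>n - 1. coeff (g' - smult k' q) k = 0"
          proof (intro allI impI)
            fix i assume "n - 1 \<le> i"
            then show "coeff (g' - smult k' q) i = 0"
              using g'0[of i] qd by (cases "i = n - 1") (auto simp: k'_def coeff_eq_0)
          qed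
        qed (use n1 False in auto)
        then have "poly_int M (q * (g' - smult k' q)) = 0" using qo by (auto simp: is_monic_orth_def)
        then show ?thesis by (simp add: right_diff_distrib poly_int_diff poly_int_smult)
      qed
      have "degree ([:0, 1:] * g' - smult k' p) < n"
      proof (rule degree_lessI)
        show "\<forall>k\<ge>n. coeff ([:0, 1:] * g' - smult k' p) k = 0"
        proof (intro allI impI)
          fix i assume i: "n \<le> i"
          then obtain j where j: "i = Suc j" using False by (cases i) auto
          show "coeff ([:0, 1:] * g' - smult k' p) i = 0"
            using i j g'0[of j] dp by (cases "i = n") (auto simp: k'_def coeff_eq_0)
        qed
      qed (use False in auto)
      then have "poly_int M (p * ([:0, 1:] * g' - smult k' p)) = 0" using p by (auto simp: is_monic_orth_def)
      then have B: "poly_int M (p * ([:0, 1:] * g')) = k' * poly_int M (p * p)"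
        by (simp only: right_diff_distrib poly_int_diff mult_smult_right poly_int_smult)
      show ?thesis unfolding expand pg' A B using posq by (simp add: jac_a_def)
    qed
    have "?r * g = ?r * g' + smult k (?r * p)" by (simp add: g'_def algebra_simps)
    then show ?thesis using 1 2 by (simp only: poly_int_add poly_int_smult)
  qed
  show ?thesis using deg top orth by (auto simp: is_monic_orth_def)
qed

text \<open>The difference of two candidates has smaller degree, so it is orthogonal to both and
  hence to itself; a polynomial of norm zero and degree at most \<open>n\<close> vanishes unless the
  support is small.\<close>

lemma is_monic_orth_unique:
  assumes n: "\<not> supp_card_le M n" and p: "is_monic_orth n p" "is_monic_orth n p'"
  shows "p = p'"
proof (cases n)
  case 0
  then obtain u v where "p = [:u:]" "p' = [:v:]"
    using p by (auto simp: is_monic_orth_def elim!: degree_eq_zeroE)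
  then show ?thesis using p 0 by (simp add: is_monic_orth_def)
next
  case (Suc m)
  have d: "degree (p - p') \<le> m"
    using p Suc by (intro monic_diff_degree) (auto simp: is_monic_orth_def)
  then have "poly_int M (p * (p - p')) = 0" "poly_int M (p' * (p - p')) = 0"
    using p Suc by (auto simp: is_monic_orth_def)
  then have "poly_int M ((p - p') * (p - p')) = 0"
    by (simp add: left_diff_distrib poly_int_diff)
  then show ?thesis
    using d n Suc supp_card_le_iff[of n] by (metis eq_iff_diff_eq_0 le_SucI)
qed

lemma op_pair_snd: "snd (op_pair M n) = (if n = 0 then 0 else fst (op_pair M (n - 1)))"
  by (cases n) (auto simp: Let_def)

text \<open>The test for norm zero in \<open>op_pair\<close> stops the recursion exactly when the
  support is exhausted: the recursion yields a monic \<open>r\<close> of degree \<open>n\<close>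
  orthogonal to all lower degrees, and \<open>r\<close> has norm zero iff some nonzero polynomial of
  degree at most \<open>n\<close> has.\<close>

lemma op_pair_main:
  "if supp_card_le M n then fst (op_pair M n) = 0 else is_monic_orth n (fst (op_pair M n))"
proof (induction n rule: less_induct)
  case (less n)
  show ?case
  proof (cases n)
    case 0
    then show ?thesis using not_supp_card_le_0 by (auto simp: is_monic_orth_def)
  next
    case (Suc m)
    define p q where "p = fst (op_pair M m)" and "q = snd (op_pair M m)"
    define r where "r = raw_next M p q"
    have step: "fst (op_pair M n) = (if poly_int M (r * r) = 0 then 0 else r)"
      by (simp add: Suc Let_def r_def p_def q_def)
    show ?thesis
    proof (cases "supp_card_le M m")
      case True
      then have "p = 0" using less[of m] Suc by (auto simp: p_def)
      then have "r = 0" by (simp add: r_def raw_next_def jac_a_def poly_int_0)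
      then show ?thesis using supp_card_le_mono[OF True, of n] Suc step by simp
    next
      case False
      have p: "is_monic_orth m p" using less[of m] Suc False by (auto simp: p_def)
      have "if m = 0 then q = 0 else is_monic_orth (m - 1) q"
      proof (cases "m = 0")
        case m: False
        have "\<not> supp_card_le M (m - 1)" using False supp_card_le_mono[of "m - 1" m] by auto
        then show ?thesis using less[of "m - 1"] Suc m by (simp add: q_def op_pair_snd)
      qed (simp add: q_def)
      then have r: "is_monic_orth n r"
        using is_monic_orth_step[OF False p] Suc by (simp add: r_def)
      have "supp_card_le M n \<longleftrightarrow> poly_int M (r * r) = 0"
      proof
        assume "poly_int M (r * r) = 0"
        moreover have "r \<noteq> 0" "degree r = n" using r by (auto simp: is_monic_orth_def)
        ultimately show "supp_card_le M n" by (auto simp: supp_card_le_iff)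
      next
        assume "supp_card_le M n"
        then obtain g where g: "g \<noteq> 0" "degree g \<le> n" "poly_int M (g * g) = 0"
          by (auto simp: supp_card_le_iff)
        have dg: "degree g = n"
          using g False Suc by (auto simp: supp_card_le_iff le_Suc_eq)
        \<comment> \<open>Normalized to be monic, the polynomial \<open>g\<close> of norm zero
          differs from \<open>r\<close> by a polynomial of lower degree, to which \<open>r\<close>
          is orthogonal.\<close>
        define h where "h = smult (1 / lead_coeff g) g"
        have h: "degree h = n" "lead_coeff h = 1" using g dg by (auto simp: h_def)
        have h0: "poly_int M (h * h) = 0" by (simp add: h_def poly_int_smult g)
        have "degree (r - h) \<le> m"
          using r h Suc by (intro monic_diff_degree) (auto simp: is_monic_orth_def)
        then have "poly_int M (r * (r - h)) = 0" using r Suc by (auto simp: is_monic_orth_def)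
        moreover have "poly_int M (r * h) = 0" using poly_int_null[OF h0, of r] by (simp add: mult.commute)
        ultimately show "poly_int M (r * r) = 0" by (simp add: right_diff_distrib poly_int_diff)
      qed
      then show ?thesis using r step by auto
    qed
  qed
qed

text \<open>Replaces the definite description by a recursion in finitely many integrals, which is
  what makes the dependence on the parameter \<open>t\<close> measurable.\<close>

lemma monic_op_eq: "monic_op M n = fst (op_pair M n)"
proof (cases "supp_card_le M n")
  case True
  then show ?thesis using op_pair_main[of n] by (simp add: monic_op_def)
next
  case False
  then have o: "is_monic_orth n (fst (op_pair M n))" using op_pair_main[of n] by simp
  have "monic_op M n = (THE p. is_monic_orth n p)"
    using False by (simp add: monic_op_def is_monic_orth_def poly_int_def)
  also have "\<dots> = fst (op_pair M n)"
    using o is_monic_orth_unique[OF False] by (intro the_equality) auto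
  finally show ?thesis .
qed

lemma monic_op_0: "monic_op M 0 = 1"
  by (simp add: monic_op_eq)

lemma monic_op_Suc:
  defines "r n \<equiv> raw_next M (monic_op M n) (if n = 0 then 0 else monic_op M (n - 1))"
  shows "monic_op M (Suc n) = (if poly_int M (r n * r n) = 0 then 0 else r n)"
proof -
  have "r n = raw_next M (fst (op_pair M n)) (snd (op_pair M n))"
    by (simp add: r_def monic_op_eq op_pair_snd)
  then show ?thesis by (simp add: monic_op_eq Let_def)
qed

lemma monic_op_orth:
  assumes "l \<noteq> k" shows "poly_int M (monic_op M l * monic_op M k) = 0"
proof -
  have *: "poly_int M (monic_op M l * monic_op M k) = 0" if "l < k" for l k
  proof (cases "supp_card_le M k")
    case True
    then show ?thesis by (simp add: monic_op_def poly_int_0)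
  next
    case False
    then have k: "is_monic_orth k (monic_op M k)" using op_pair_main[of k] by (simp add: monic_op_eq)
    have l: "is_monic_orth l (monic_op M l)"
    proof -
      have "\<not> supp_card_le M l" using False supp_card_le_mono[of l k] that by auto
      then show ?thesis using op_pair_main[of l] by (simp add: monic_op_eq)
    qed
    have "degree (monic_op M l) < k" using l that by (simp add: is_monic_orth_def)
    then show ?thesis using k by (auto simp: is_monic_orth_def mult.commute)
  qed
  show ?thesis using *[of l k] *[of k l] assms by (cases "l < k") (auto simp: mult.commute)
qed

lemma monic_op_norm_eq_0_iff: "poly_int M (monic_op M n * monic_op M n) = 0 \<longleftrightarrow> supp_card_le M n"
  using is_monic_orth_pos[of n "monic_op M n"] op_pair_main[of n]
  by (auto simp: monic_op_eq[symmetric] poly_int_0 split: if_splits)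

text \<open>The recursion is an identity of polynomials except when the next one has norm zero and
  is replaced by 0; in that case it survives almost everywhere.\<close>

lemma monic_op_recursion:
  "AE s in M. s * poly (monic_op M n) s = poly (monic_op M (Suc n)) s
     + jac_b M (monic_op M n) * poly (monic_op M n) s
     + jac_a M (monic_op M n) (if n = 0 then 0 else monic_op M (n - 1))
         * poly (if n = 0 then 0 else monic_op M (n - 1)) s"
proof -
  define q where "q = (if n = 0 then 0 else monic_op M (n - 1))"
  define r where "r = raw_next M (monic_op M n) q"
  have S: "monic_op M (Suc n) = (if poly_int M (r * r) = 0 then 0 else r)"
    using monic_op_Suc[of n] by (simp add: r_def q_def)
  have "AE s in M. poly (monic_op M (Suc n)) s = poly r s"
  proof (cases "poly_int M (r * r) = 0")
    case True
    then have "AE s in M. poly r s = 0" by (simp add: poly_int_square_eq_0)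
    then show ?thesis using True S by simp
  qed (use S in simp)
  then show ?thesis
    unfolding q_def[symmetric]
    by eventually_elim (simp add: r_def raw_next_def algebra_simps)
qed

section \<open>Bounds in terms of the radius of the support\<close>

lemma jac_b_bound: assumes "R > 0" shows "\<bar>jac_b M p\<bar> \<le> R"
proof (cases "poly_int M (p * p) = 0")
  case False
  then have pos: "poly_int M (p * p) > 0" using poly_int_square_nonneg[of p] by simp
  have "\<bar>poly_int M ([:0, 1:] * (p * p))\<bar> \<le> (\<integral>s. \<bar>poly ([:0, 1:] * (p * p)) s\<bar> \<partial>M)"
    unfolding poly_int_def by (rule integral_abs_bound)
  also have "\<dots> \<le> (\<integral>s. poly (smult R (p * p)) s \<partial>M)"
  proof (rule integral_mono_AE)
    show "AE s in M. \<bar>poly ([:0, 1:] * (p * p)) s\<bar> \<le> poly (smult R (p * p)) s"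
      using R_bound by eventually_elim (auto simp: abs_mult intro!: mult_right_mono)
  qed (intro integrable_abs integrable_poly)+
  also have "\<dots> = R * poly_int M (p * p)" using poly_int_smult[of R "p * p"] by (simp add: poly_int_def)
  finally show ?thesis using pos by (simp add: jac_b_def abs_mult divide_le_eq)
qed (use assms in \<open>simp add: jac_b_def\<close>)

text \<open>The next polynomial \<open>r\<close> is orthogonal to \<open>p\<close> and
  \<open>q\<close>, so (r, r) = (r, s p), and 2 r s p is at most R^2 p^2 + r^2 where |s| is at most
  R.\<close>

lemma monic_op_norm_step:
  assumes "R > 0"
  shows "poly_int M (monic_op M (Suc n) * monic_op M (Suc n)) \<le> R\<^sup>2 * poly_int M (monic_op M n * monic_op M n)"
proof (cases "supp_card_le M (Suc n)")
  case True
  then show ?thesis using poly_int_square_nonneg by (simp add: monic_op_def poly_int_0)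
next
  case False
  define p r q where "p = monic_op M n" and "r = monic_op M (Suc n)"
    and "q = (if n = 0 then 0 else monic_op M (n - 1))"
  have req: "r = raw_next M p q"
    using monic_op_Suc[of n] False monic_op_norm_eq_0_iff[of "Suc n"] by (auto simp: r_def p_def q_def poly_int_0 split: if_splits)
  have rp: "poly_int M (r * p) = 0" using monic_op_orth[of "Suc n" n] by (simp add: r_def p_def)
  have rq: "poly_int M (r * q) = 0" using monic_op_orth[of "Suc n" "n - 1"] by (simp add: r_def q_def poly_int_0)
  have "r * r = r * ([:0, 1:] * p) - smult (jac_b M p) (r * p) - smult (jac_a M p q) (r * q)"
    by (subst (2) req) (simp add: raw_next_def algebra_simps)
  then have e: "poly_int M (r * r) = poly_int M (r * ([:0, 1:] * p))"
    by (simp only: poly_int_diff poly_int_smult rp rq)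
  have "poly_int M (r * ([:0, 1:] * p)) \<le> poly_int M (smult (R\<^sup>2 / 2) (p * p) + smult (1/2) (r * r))"
    unfolding poly_int_def
  proof (rule integral_mono_AE)
    show "AE s in M. poly (r * ([:0, 1:] * p)) s \<le> poly (smult (R\<^sup>2 / 2) (p * p) + smult (1/2) (r * r)) s"
      using R_bound
    proof eventually_elim
      case (elim s)
      have "0 \<le> (s * poly p s - poly r s)\<^sup>2" by simp
      then have "2 * (poly r s * (s * poly p s)) \<le> s\<^sup>2 * (poly p s)\<^sup>2 + (poly r s)\<^sup>2"
        by (simp add: power2_diff power_mult_distrib algebra_simps)
      moreover have "s\<^sup>2 \<le> R\<^sup>2" using elim assms by (simp add: abs_le_square_iff[symmetric])
      then have "s\<^sup>2 * (poly p s)\<^sup>2 \<le> R\<^sup>2 * (poly p s)\<^sup>2" by (intro mult_right_mono) auto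
      ultimately have "2 * (poly r s * (s * poly p s)) \<le> R\<^sup>2 * (poly p s)\<^sup>2 + (poly r s)\<^sup>2" by linarith
      then show ?case by (simp add: power2_eq_square algebra_simps)
    qed
  qed (use integrable_poly in auto)
  also have "\<dots> = R\<^sup>2 / 2 * poly_int M (p * p) + 1/2 * poly_int M (r * r)"
    by (simp only: poly_int_add poly_int_smult)
  finally have "poly_int M (r * r) \<le> R\<^sup>2 * poly_int M (p * p)" using e by simp
  then show ?thesis by (simp add: r_def p_def)
qed

lemma monic_op_norm_bound:
  assumes "R > 0" shows "poly_int M (monic_op M n * monic_op M n) \<le> (R\<^sup>2) ^ n"
proof (induction n)
  case 0
  then show ?case by (simp add: monic_op_0 poly_int_1)
next
  case (Suc n)
  have "R\<^sup>2 * poly_int M (monic_op M n * monic_op M n) \<le> R\<^sup>2 * (R\<^sup>2)^n"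
    using Suc by (intro mult_left_mono) auto
  then show ?case using monic_op_norm_step[OF assms, of n] by simp
qed

lemma jac_a_bound:
  assumes "R > 0"
  shows "\<bar>jac_a M (monic_op M n) (if n = 0 then 0 else monic_op M (n - 1))\<bar> \<le> R\<^sup>2"
proof (cases n)
  case (Suc m)
  show ?thesis
  proof (cases "poly_int M (monic_op M m * monic_op M m) = 0")
    case False
    then have "poly_int M (monic_op M m * monic_op M m) > 0"
      using poly_int_square_nonneg[of "monic_op M m"] by simp
    then show ?thesis
      using monic_op_norm_step[OF assms, of m] poly_int_square_nonneg[of "monic_op M n"] Suc
      by (simp add: jac_a_def divide_le_eq)
  qed (use Suc in \<open>simp add: jac_a_def\<close>)
qed (simp add: jac_a_def poly_int_0)

end

section \<open>The measure \<open>\<sigma>(dt) \<mu>(t, ds)\<close>\<close>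

locale jac_process =
  fixes \<sigma> :: "'a::{t2_space, second_countable_topology} measure"
    and \<mu> :: "'a \<Rightarrow> real measure"
  assumes loc_compact: "locally_compact_space (euclidean :: 'a topology)"
    and radon: "radon_measure \<sigma>"
    and nonatomic: "non_atomic \<sigma>"
    and full_support: "\<And>U. open U \<Longrightarrow> U \<noteq> {} \<Longrightarrow> emeasure \<sigma> U > 0"
    and kernel: "\<mu> \<in> borel \<rightarrow>\<^sub>M prob_algebra borel"
    and local_bound: "\<And>\<Delta>. \<Delta> \<in> sets borel \<Longrightarrow> compact (closure \<Delta>) \<Longrightarrow>
           \<exists>R>0. \<forall>t\<in>\<Delta>. measure_support (\<mu> t) \<subseteq> {-R..R}"
begin

lemma sets_sigma [simp, measurable_cong]: "sets \<sigma> = sets borel"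
  using radon by (simp add: radon_measure_def)

lemma space_sigma [simp]: "space \<sigma> = UNIV"
  using sets_eq_imp_space_eq[OF sets_sigma] by simp

lemma emeasure_compact: "compact K \<Longrightarrow> emeasure \<sigma> K < \<infinity>"
  using radon by (simp add: radon_measure_def)

lemma compact_nhd: obtains U K where "open U" "compact K" "(x::'a) \<in> U" "U \<subseteq> K"
proof -
  have "\<exists>U K. open U \<and> compact K \<and> x \<in> U \<and> U \<subseteq> K"
    using loc_compact unfolding locally_compact_space_def by auto
  then show ?thesis using that by blast
qed

text \<open>The members of a countable base with compact closure still cover, by local compactness;
  finite unions of them increase to the whole space.\<close>

lemma compact_exhaustion:
  obtains B :: "nat \<Rightarrow> 'a set" where "\<And>n. open (B n)" "\<And>n. compact (closure (B n))" "incseq B" "(\<Union>n. B n) = UNIV"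
proof -
  obtain \<B> :: "'a set set" where B: "countable \<B>" "topological_basis \<B>"
    using ex_countable_basis by auto
  define \<C> where "\<C> = insert {} {U\<in>\<B>. compact (closure U)}"
  have cC: "countable \<C>" "\<C> \<noteq> {}" using B(1) by (auto simp: \<C>_def)
  define b where "b = from_nat_into \<C>"
  have b: "range b = \<C>" unfolding b_def by (rule range_from_nat_into[OF cC(2,1)])
  have bo: "open (b i)" "compact (closure (b i))" for i
  proof -
    have "b i \<in> \<C>" using b by auto
    then show "open (b i)" "compact (closure (b i))"
      using topological_basis_open[OF B(2)] by (auto simp: \<C>_def)
  qed
  define D where "D n = (\<Union>i\<le>n. b i)" for n
  have "(\<Union>n. D n) = UNIV"
  proof (rule equalityI[OF subset_UNIV subsetI])
    fix x :: 'a
    obtain U K where U: "open U" "compact K" "x \<in> U" "U \<subseteq> K" by (rule compact_nhd)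
    obtain V where V: "V \<in> \<B>" "x \<in> V" "V \<subseteq> U" using topological_basisE[OF B(2) U(1,3)] by metis
    have "closure V \<subseteq> K" using V U compact_imp_closed by (intro closure_minimal) auto
    then have "compact (closure V)" using U(2) compact_Int_closed[of K "closure V"] by (simp add: Int_absorb1)
    then have "V \<in> range b" using V b by (auto simp: \<C>_def)
    then show "x \<in> (\<Union>n. D n)" using V by (auto simp: D_def)
  qed
  moreover have "open (D n)" for n using bo by (auto simp: D_def)
  moreover have "compact (closure (D n))" for n
  proof -
    have "closure (\<Union>i\<in>I. b i) = (\<Union>i\<in>I. closure (b i))" if "finite I" for I
      using that by (induction I rule: finite_induct) (auto simp: closure_Un)
    then have "closure (D n) = (\<Union>i\<le>n. closure (b i))"
      unfolding D_def by simp
    then show ?thesis using bo by auto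
  qed
  moreover have "incseq D" by (fastforce simp: D_def incseq_def)
  ultimately show ?thesis by (intro that)
qed

lemma compact_sets_borel [measurable]: "compact (K::'a set) \<Longrightarrow> K \<in> sets borel"
  by (simp add: borel_closed compact_imp_closed)

lemma sigma_finite_of_locally_finite:
  fixes N :: "'a measure"
  assumes s: "sets N = sets borel" and f: "\<And>K. compact K \<Longrightarrow> emeasure N K < \<infinity>"
  shows "sigma_finite_measure N"
proof -
  obtain B :: "nat \<Rightarrow> 'a set" where B: "\<And>n. open (B n)" "\<And>n. compact (closure (B n))" "incseq B" "(\<Union>n. B n) = UNIV"
    by (rule compact_exhaustion) blast
  have sp: "space N = UNIV" using sets_eq_imp_space_eq[OF s] by simp
  show ?thesis
  proof
    show "\<exists>A. countable A \<and> A \<subseteq> sets N \<and> \<Union> A = space N \<and> (\<forall>a\<in>A. emeasure N a \<noteq> \<infinity>)"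
    proof (intro exI conjI)
      show "countable (range B)" by simp
      show "range B \<subseteq> sets N" using B(1) s by auto
      show "\<Union> (range B) = space N" using B(4) sp by simp
      show "\<forall>a\<in>range B. emeasure N a \<noteq> \<infinity>"
      proof clarsimp
        fix n assume "emeasure N (B n) = \<top>"
        moreover have "emeasure N (B n) \<le> emeasure N (closure (B n))"
          using closure_subset s compact_sets_borel[OF B(2)] by (intro emeasure_mono) auto
        ultimately show False using f[OF B(2)[of n]] by (simp add: top_unique)
      qed
    qed
  qed
qed

sublocale S: sigma_finite_measure \<sigma>
  by (rule sigma_finite_of_locally_finite) (use emeasure_compact in auto)

lemma prob_mu: "prob_space (\<mu> t)" and sets_mu [simp, measurable_cong]: "sets (\<mu> t) = sets borel"
  using measurable_space[OF kernel, of t] by (auto simp: space_prob_algebra)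

lemma space_mu [simp]: "space (\<mu> t) = UNIV"
  using sets_eq_imp_space_eq[OF sets_mu] by simp

lemma kernel_subprob [measurable]: "\<mu> \<in> borel \<rightarrow>\<^sub>M subprob_algebra borel"
  using kernel by (rule measurable_prob_algebraD)

lemma local_bounded_prob:
  assumes "compact K"
  obtains R where "R > 0" "\<And>t. t \<in> K \<Longrightarrow> bounded_prob (\<mu> t) R"
proof -
  have "closure K = K" by (rule closure_closed[OF compact_imp_closed[OF assms]])
  then obtain R where R: "R > 0" "\<And>t. t \<in> K \<Longrightarrow> measure_support (\<mu> t) \<subseteq> {-R..R}"
    using local_bound[OF compact_sets_borel[OF assms]] assms by auto
  have "bounded_prob (\<mu> t) R" if "t \<in> K" for t
  proof -
    interpret prob_space "\<mu> t" by (rule prob_mu)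
    have "AE s in \<mu> t. \<bar>s\<bar> \<le> R"
      using measure_support_AE[OF sets_mu, of t] by eventually_elim (use R(2)[OF that] in force)
    then show ?thesis by unfold_locales auto
  qed
  then show ?thesis using R that by metis
qed

lemma bounded_prob_mu: obtains R where "bounded_prob (\<mu> t) R"
  using local_bounded_prob[of "{t}"] by auto

section \<open>The orthogonal polynomials as functions of \<open>t\<close>\<close>

definition p :: "nat \<Rightarrow> 'a \<times> real \<Rightarrow> real"
  where "p l z = poly (monic_op (\<mu> (fst z)) l) (snd z)"

definition w :: "nat \<Rightarrow> 'a \<Rightarrow> real"
  where "w l t = (\<integral>s. (poly (monic_op (\<mu> t) l) s)\<^sup>2 \<partial>\<mu> t)"

text \<open>The particular coefficients given by quotients of inner products. Where
  \<open>w l t = 0\<close> the value of \<open>jb\<close> is 0, which need not be the value chosen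
  in statement (iii).\<close>

definition jb :: "nat \<Rightarrow> 'a \<Rightarrow> real"
  where "jb l t = jac_b (\<mu> t) (monic_op (\<mu> t) l)"

definition ja :: "nat \<Rightarrow> 'a \<Rightarrow> real"
  where "ja l t = jac_a (\<mu> t) (monic_op (\<mu> t) l) (if l = 0 then 0 else monic_op (\<mu> t) (l - 1))"

lemma integrable_p: "integrable (\<mu> t) (\<lambda>s. p l (t, s) * p k (t, s))"
  "integrable (\<mu> t) (\<lambda>s. (p l (t, s))\<^sup>2)" "integrable (\<mu> t) (\<lambda>s. s * (p l (t, s))\<^sup>2)"
  "integrable (\<mu> t) (\<lambda>s. p l (t, s))"
proof -
  obtain R where "bounded_prob (\<mu> t) R" by (rule bounded_prob_mu)
  then have i: "integrable (\<mu> t) (\<lambda>s. poly q s)" for q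
    using bounded_prob.integrable_poly by blast
  show "integrable (\<mu> t) (\<lambda>s. p l (t, s) * p k (t, s))"
    using i[of "monic_op (\<mu> t) l * monic_op (\<mu> t) k"] unfolding p_def poly_mult by simp
  show "integrable (\<mu> t) (\<lambda>s. (p l (t, s))\<^sup>2)"
    using i[of "monic_op (\<mu> t) l * monic_op (\<mu> t) l"] unfolding p_def power2_eq_square poly_mult by simp
  show "integrable (\<mu> t) (\<lambda>s. s * (p l (t, s))\<^sup>2)"
    using i[of "[:0, 1:] * (monic_op (\<mu> t) l * monic_op (\<mu> t) l)"]
    unfolding p_def power2_eq_square poly_mult by simp
  show "integrable (\<mu> t) (\<lambda>s. p l (t, s))"
    using i[of "monic_op (\<mu> t) l"] by (simp add: p_def)
qed

lemma p_0 [simp]: "p 0 z = 1"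
proof -
  obtain R where "bounded_prob (\<mu> (fst z)) R" by (rule bounded_prob_mu)
  then show ?thesis by (simp add: p_def bounded_prob.monic_op_0)
qed

lemma w_nonneg: "0 \<le> w l t"
  unfolding w_def by (intro integral_nonneg_AE) auto

lemma w_0 [simp]: "w 0 t = 1"
  using p_0[of "(t, _)"] prob_space.prob_space[OF prob_mu] by (simp add: w_def p_def)

lemma w_eq: "w l t = (\<integral>s. (p l (t, s))\<^sup>2 \<partial>\<mu> t)"
  by (simp add: w_def p_def)

lemma p_orth: "l \<noteq> k \<Longrightarrow> (\<integral>s. p l (t, s) * p k (t, s) \<partial>\<mu> t) = 0"
proof -
  assume *: "l \<noteq> k"
  obtain R where "bounded_prob (\<mu> t) R" by (rule bounded_prob_mu)
  from bounded_prob.monic_op_orth[OF this *] show ?thesis by (simp add: p_def poly_int_def)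
qed

lemma w_poly_int: "w l t = poly_int (\<mu> t) (monic_op (\<mu> t) l * monic_op (\<mu> t) l)"
  by (simp add: w_def poly_int_def power2_eq_square)

lemma w_eq_0_iff: "w l t = 0 \<longleftrightarrow> supp_card_le (\<mu> t) l"
proof -
  obtain R where "bounded_prob (\<mu> t) R" by (rule bounded_prob_mu)
  from bounded_prob.monic_op_norm_eq_0_iff[OF this, of l] show ?thesis by (simp add: w_poly_int)
qed

lemma jb_eq: "jb l t = (\<integral>s. s * (p l (t, s))\<^sup>2 \<partial>\<mu> t) / w l t"
  by (simp add: jb_def jac_b_def w_poly_int poly_int_def p_def power2_eq_square)

lemma ja_eq: "ja l t = (if l = 0 then 0 else w l t / w (l - 1) t)"
  by (simp add: ja_def jac_a_def w_poly_int) (simp add: poly_int_def)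

lemma p_recursion:
  "AE s in \<mu> t. s * p l (t, s) = p (Suc l) (t, s) + jb l t * p l (t, s) + ja l t * (if l = 0 then 0 else p (l - 1) (t, s))"
proof -
  obtain R where "bounded_prob (\<mu> t) R" by (rule bounded_prob_mu)
  from bounded_prob.monic_op_recursion[OF this, of l]
  show ?thesis by (rule AE_mp) (auto simp: p_def jb_def ja_def)
qed

lemma kernel_integral_measurable:
  fixes f :: "'a \<times> real \<Rightarrow> real"
  assumes f: "f \<in> borel_measurable borel" and i: "\<And>t. integrable (\<mu> t) (\<lambda>s. f (t, s))"
  shows "(\<lambda>t. \<integral>s. f (t, s) \<partial>\<mu> t) \<in> borel_measurable borel"
proof -
  have f': "f \<in> borel_measurable (borel \<Otimes>\<^sub>M borel)" using f by (simp add: borel_prod)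
  have m1: "(\<lambda>t. \<integral>\<^sup>+s. ennreal (f (t, s)) \<partial>\<mu> t) \<in> borel_measurable borel"
    by (rule nn_integral_measurable_subprob_algebra2[where N = borel]) (use f' kernel_subprob in measurable)
  have m2: "(\<lambda>t. \<integral>\<^sup>+s. ennreal (- f (t, s)) \<partial>\<mu> t) \<in> borel_measurable borel"
    by (rule nn_integral_measurable_subprob_algebra2[where N = borel]) (use f' kernel_subprob in measurable)
  have "(\<integral>s. f (t, s) \<partial>\<mu> t) = enn2real (\<integral>\<^sup>+s. ennreal (f (t, s)) \<partial>\<mu> t) - enn2real (\<integral>\<^sup>+s. ennreal (- f (t, s)) \<partial>\<mu> t)" for t
    by (rule real_lebesgue_integral_def[OF i])
  then show ?thesis using m1 m2 by simp
qed

text \<open>Induction along the recursion: the coefficients are quotients of integrals of the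
  preceding polynomials, and the replacement by 0 is decided by the measurable condition that such
  an integral vanishes. Two consecutive polynomials are carried because the recursion has three
  terms.\<close>

lemma p_measurable [measurable]: "p l \<in> borel_measurable borel"
proof -
  have "p l \<in> borel_measurable borel \<and> (l > 0 \<longrightarrow> p (l - 1) \<in> borel_measurable borel)"
  proof (induction l)
    case 0
    have "p 0 = (\<lambda>_. 1)" by auto
    then show ?case by simp
  next
    case (Suc l)
    then have m: "p l \<in> borel_measurable borel" by simp
    define q where "q = (if l = 0 then (\<lambda>_. 0) else p (l - 1))"
    have q: "q \<in> borel_measurable borel" using Suc by (auto simp: q_def)
    have w: "w l \<in> borel_measurable borel" if "p l \<in> borel_measurable borel" for l
      unfolding w_eq[abs_def] by (rule kernel_integral_measurable) (use that integrable_p in auto)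
    have jb: "jb l \<in> borel_measurable borel"
    proof -
      have "(\<lambda>z. snd z * (p l z)\<^sup>2) \<in> borel_measurable borel"
        using m by (simp add: borel_prod[symmetric])
      from kernel_integral_measurable[OF this] show ?thesis
        unfolding jb_eq[abs_def] using w[OF m] integrable_p by auto
    qed
    have ja: "ja l \<in> borel_measurable borel"
      unfolding ja_eq[abs_def] using w[OF m] w[of "l - 1"] Suc by (cases "l = 0") auto
    define r where "r z = snd z * p l z - jb l (fst z) * p l z - ja l (fst z) * q z" for z
    have r_poly: "r (t, s) = poly (raw_next (\<mu> t) (monic_op (\<mu> t) l) (if l = 0 then 0 else monic_op (\<mu> t) (l - 1))) s" for t s
      by (simp add: r_def raw_next_def p_def jb_def ja_def q_def)
    have r: "r \<in> borel_measurable borel"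
    proof -
      have [measurable]: "fst \<in> (borel :: ('a \<times> real) measure) \<rightarrow>\<^sub>M borel" "snd \<in> (borel :: ('a \<times> real) measure) \<rightarrow>\<^sub>M borel"
        by (simp_all add: borel_prod[symmetric])
      show ?thesis unfolding r_def[abs_def] using m q jb ja by measurable
    qed
    have ri: "integrable (\<mu> t) (\<lambda>s. (r (t, s))\<^sup>2)" for t
    proof -
      obtain R where "bounded_prob (\<mu> t) R" by (rule bounded_prob_mu)
      then have "integrable (\<mu> t) (\<lambda>s. poly (q * q) s)" for q
        using bounded_prob.integrable_poly by blast
      then show ?thesis unfolding r_poly power2_eq_square poly_mult .
    qed
    have v: "(\<lambda>t. \<integral>s. (r (t, s))\<^sup>2 \<partial>\<mu> t) \<in> borel_measurable borel"
      by (rule kernel_integral_measurable) (use r ri in auto)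
    have "p (Suc l) z = (if (\<integral>s. (r (fst z, s))\<^sup>2 \<partial>\<mu> (fst z)) = 0 then 0 else r z)" for z
    proof -
      obtain t s where z: "z = (t, s)" by (cases z)
      obtain R where "bounded_prob (\<mu> t) R" by (rule bounded_prob_mu)
      from bounded_prob.monic_op_Suc[OF this, of l] show ?thesis
        by (simp add: z p_def poly_int_def r_poly power2_eq_square)
    qed
    moreover have "(\<lambda>z. if (\<integral>s. (r (fst z, s))\<^sup>2 \<partial>\<mu> (fst z)) = 0 then 0 else r z) \<in> borel_measurable borel"
    proof -
      have "(\<lambda>z::'a \<times> real. \<integral>s. (r (fst z, s))\<^sup>2 \<partial>\<mu> (fst z)) \<in> borel_measurable borel"
        unfolding borel_prod[symmetric] using v by measurable
      then show ?thesis using r by measurable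
    qed
    ultimately have "p (Suc l) \<in> borel_measurable borel" by (simp cong: measurable_cong)
    then show ?case using m by simp
  qed
  then show ?thesis by simp
qed

lemma w_measurable [measurable]: "w l \<in> borel_measurable borel"
  unfolding w_eq[abs_def] by (rule kernel_integral_measurable) (use integrable_p in auto)

lemma jb_measurable [measurable]: "jb l \<in> borel_measurable borel"
proof -
  have "(\<lambda>z. snd z * (p l z)\<^sup>2) \<in> borel_measurable borel"
    using p_measurable[of l] by (simp add: borel_prod[symmetric])
  from kernel_integral_measurable[OF this] show ?thesis
    unfolding jb_eq[abs_def] using integrable_p by auto
qed

lemma ja_measurable [measurable]: "ja l \<in> borel_measurable borel"
  unfolding ja_eq[abs_def] by (cases "l = 0") auto

lemma w_local_bound:
  assumes "compact K" obtains C where "\<And>t. t \<in> K \<Longrightarrow> w l t \<le> C"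
proof -
  obtain R where "R > 0" "\<And>t. t \<in> K \<Longrightarrow> bounded_prob (\<mu> t) R"
    using local_bounded_prob[OF assms] by blast
  then show ?thesis
    using bounded_prob.monic_op_norm_bound by (intro that[of "(R\<^sup>2)^l"]) (auto simp: w_poly_int)
qed

lemma jb_local_bound:
  assumes "compact K" shows "\<exists>C. \<forall>t\<in>K. \<bar>jb l t\<bar> \<le> C"
proof -
  obtain R where "R > 0" "\<And>t. t \<in> K \<Longrightarrow> bounded_prob (\<mu> t) R"
    using local_bounded_prob[OF assms] by blast
  then show ?thesis
    using bounded_prob.jac_b_bound by (intro exI[of _ R]) (auto simp: jb_def)
qed

lemma ja_local_bound:
  assumes "compact K" shows "\<exists>C. \<forall>t\<in>K. \<bar>ja l t\<bar> \<le> C"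
proof -
  obtain R where "R > 0" "\<And>t. t \<in> K \<Longrightarrow> bounded_prob (\<mu> t) R"
    using local_bounded_prob[OF assms] by blast
  then show ?thesis
    using bounded_prob.jac_a_bound by (intro exI[of _ "R\<^sup>2"]) (auto simp: ja_def)
qed

section \<open>Integration over \<open>T \<times> \<real>\<close> fibre by fibre\<close>

abbreviation "st \<equiv> sigma_tilde \<sigma> \<mu>"

lemma kernel_distr [measurable]: "(\<lambda>t. distr (\<mu> t) borel (Pair t)) \<in> \<sigma> \<rightarrow>\<^sub>M subprob_algebra borel"
proof (rule measurable_distr2[where M = borel])
  show "(\<lambda>(x, y). (x, y)) \<in> \<sigma> \<Otimes>\<^sub>M borel \<rightarrow>\<^sub>M (borel :: ('a \<times> real) measure)"
    by (simp add: borel_prod[symmetric])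
  show "\<mu> \<in> \<sigma> \<rightarrow>\<^sub>M subprob_algebra borel"
    using kernel_subprob by (simp add: measurable_cong_sets[OF sets_sigma refl])
qed

lemma Pair_measurable [measurable]: "Pair t \<in> \<mu> t \<rightarrow>\<^sub>M (borel :: ('a \<times> real) measure)"
  by (simp add: borel_prod[symmetric])

lemma sets_st [simp, measurable_cong]: "sets st = sets borel"
  unfolding sigma_tilde_def by (rule sets_bind) auto

lemma space_st [simp]: "space st = UNIV"
  using sets_eq_imp_space_eq[OF sets_st] by simp

lemma nn_integral_st:
  assumes F: "F \<in> borel_measurable borel"
  shows "(\<integral>\<^sup>+z. F z \<partial>st) = (\<integral>\<^sup>+t. \<integral>\<^sup>+s. F (t, s) \<partial>\<mu> t \<partial>\<sigma>)"
  unfolding sigma_tilde_def using F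
  by (subst nn_integral_bind[OF _ kernel_distr]) (auto simp: nn_integral_distr)

lemma AE_st:
  assumes P: "Measurable.pred borel P"
  shows "(AE z in st. P z) \<longleftrightarrow> (AE t in \<sigma>. AE s in \<mu> t. P (t, s))"
  unfolding sigma_tilde_def using P
  by (subst AE_bind[OF kernel_distr]) (auto simp: AE_distr_iff pred_def)

lemma emeasure_st_cylinder:
  assumes "A \<in> sets borel" shows "emeasure st (A \<times> UNIV) = emeasure \<sigma> A"
proof -
  have "A \<times> (UNIV :: real set) \<in> sets borel"
    unfolding borel_prod[symmetric] using assms by auto
  then have "emeasure st (A \<times> UNIV) = (\<integral>\<^sup>+t. \<integral>\<^sup>+s. indicator (A \<times> UNIV) (t, s) \<partial>\<mu> t \<partial>\<sigma>)"
    by (simp add: nn_integral_st flip: nn_integral_indicator)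
  also have "\<dots> = (\<integral>\<^sup>+t. indicator A t \<partial>\<sigma>)"
  proof -
    have "(\<integral>\<^sup>+s. indicator (A \<times> UNIV) (t, s) \<partial>\<mu> t) = indicator A t" for t
      using prob_space.emeasure_space_1[OF prob_mu[of t]] by (cases "t \<in> A") (auto simp: indicator_def)
    then show ?thesis by simp
  qed
  finally show ?thesis using assms by simp
qed

sublocale ST: sigma_finite_measure st
proof
  obtain A :: "nat \<Rightarrow> 'a set" where A: "range A \<subseteq> sets \<sigma>" "(\<Union>i. A i) = space \<sigma>" "\<And>i. emeasure \<sigma> (A i) \<noteq> \<infinity>"
    by (rule S.sigma_finite) blast
  show "\<exists>A. countable A \<and> A \<subseteq> sets st \<and> \<Union> A = space st \<and> (\<forall>a\<in>A. emeasure st a \<noteq> \<infinity>)"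
  proof (intro exI[of _ "range (\<lambda>i. A i \<times> UNIV)"] conjI)
    show "range (\<lambda>i. A i \<times> UNIV) \<subseteq> sets st"
      using A by (auto simp: borel_prod[symmetric] image_subset_iff)
    show "\<Union> (range (\<lambda>i. A i \<times> UNIV)) = space st" using A(2) by auto
    show "\<forall>a\<in>range (\<lambda>i. A i \<times> UNIV). emeasure st a \<noteq> \<infinity>"
      using A by (auto simp: emeasure_st_cylinder image_subset_iff)
  qed simp
qed

text \<open>Integrability is assumed on every fibre, so the fibre integrals split into positive and
  negative parts for each \<open>t\<close>, and each part reduces to the formula for nonnegative
  functions.\<close>

lemma integral_st:
  fixes F :: "'a \<times> real \<Rightarrow> real"
  assumes F: "integrable st F" and Ft: "\<And>t. integrable (\<mu> t) (\<lambda>s. F (t, s))"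
  shows "(\<integral>z. F z \<partial>st) = (\<integral>t. \<integral>s. F (t, s) \<partial>\<mu> t \<partial>\<sigma>)"
proof -
  have m: "F \<in> borel_measurable borel" using borel_measurable_integrable[OF F] by simp
  have part: "integrable \<sigma> (\<lambda>t. enn2real (\<integral>\<^sup>+s. ennreal (G (t, s)) \<partial>\<mu> t)) \<and>
      (\<integral>t. enn2real (\<integral>\<^sup>+s. ennreal (G (t, s)) \<partial>\<mu> t) \<partial>\<sigma>) = enn2real (\<integral>\<^sup>+z. ennreal (G z) \<partial>st)"
    if G: "G \<in> borel_measurable borel" "(\<integral>\<^sup>+z. ennreal (G z) \<partial>st) < \<infinity>" "\<And>t. (\<integral>\<^sup>+s. ennreal (G (t, s)) \<partial>\<mu> t) < \<infinity>" for G :: "'a \<times> real \<Rightarrow> real"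
  proof -
    have G': "G \<in> borel_measurable (borel \<Otimes>\<^sub>M borel)" using G by (simp add: borel_prod)
    have mm: "(\<lambda>t. \<integral>\<^sup>+s. ennreal (G (t, s)) \<partial>\<mu> t) \<in> borel_measurable borel"
      by (rule nn_integral_measurable_subprob_algebra2[where N = borel]) (use G' kernel_subprob in measurable)
    have e: "(\<integral>\<^sup>+t. ennreal (enn2real (\<integral>\<^sup>+s. ennreal (G (t, s)) \<partial>\<mu> t)) \<partial>\<sigma>) = (\<integral>\<^sup>+z. ennreal (G z) \<partial>st)"
      using G by (simp add: nn_integral_st)
    have "integrable \<sigma> (\<lambda>t. enn2real (\<integral>\<^sup>+s. ennreal (G (t, s)) \<partial>\<mu> t))"
      using mm e G(2) by (intro integrableI_nonneg) auto
    then show ?thesis using e mm by (simp add: integral_eq_nn_integral)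
  qed
  have fin: "(\<integral>\<^sup>+z. ennreal (F z) \<partial>st) < \<infinity>" "(\<integral>\<^sup>+z. ennreal (- F z) \<partial>st) < \<infinity>"
    using F by (auto simp: real_integrable_def less_top)
  have fint: "(\<integral>\<^sup>+s. ennreal (F (t, s)) \<partial>\<mu> t) < \<infinity>" "(\<integral>\<^sup>+s. ennreal (- F (t, s)) \<partial>\<mu> t) < \<infinity>" for t
    using Ft[of t] by (auto simp: real_integrable_def less_top)
  have "(\<integral>z. F z \<partial>st) = enn2real (\<integral>\<^sup>+z. ennreal (F z) \<partial>st) - enn2real (\<integral>\<^sup>+z. ennreal (- F z) \<partial>st)"
    by (rule real_lebesgue_integral_def[OF F])
  also have "\<dots> = (\<integral>t. enn2real (\<integral>\<^sup>+s. ennreal (F (t, s)) \<partial>\<mu> t) - enn2real (\<integral>\<^sup>+s. ennreal (- F (t, s)) \<partial>\<mu> t) \<partial>\<sigma>)"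
    using part[of F, OF m fin(1) fint(1)] part[of "\<lambda>z. - F z", OF _ fin(2) fint(2)] m by simp
  also have "\<dots> = (\<integral>t. \<integral>s. F (t, s) \<partial>\<mu> t \<partial>\<sigma>)"
    by (simp add: real_lebesgue_integral_def[OF Ft])
  finally show ?thesis .
qed

text \<open>The product of two polynomials is dominated by the sum of their squares, whose fibre
  integrals \<open>w l\<close> and \<open>w k\<close> are bounded on the compact set
  \<open>K\<close>.\<close>

lemma integrable_st_p:
  fixes h :: "'a \<Rightarrow> real"
  assumes h: "h \<in> borel_measurable borel" and K: "compact K"
    and bd: "\<And>t. \<bar>h t\<bar> \<le> C" and supp: "\<And>t. h t \<noteq> 0 \<Longrightarrow> t \<in> K"
  shows "integrable st (\<lambda>z. h (fst z) * (p l z * p k z))"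
proof (rule integrableI_bounded)
  have [measurable]: "fst \<in> (borel :: ('a \<times> real) measure) \<rightarrow>\<^sub>M borel" by (simp add: borel_prod[symmetric])
  note h[measurable]
  show "(\<lambda>z. h (fst z) * (p l z * p k z)) \<in> borel_measurable st"
    unfolding measurable_cong_sets[OF sets_st refl] by measurable
  obtain C1 where C1: "\<And>t. t \<in> K \<Longrightarrow> w l t \<le> C1" using w_local_bound[OF K] by blast
  obtain C2 where C2: "\<And>t. t \<in> K \<Longrightarrow> w k t \<le> C2" using w_local_bound[OF K] by blast
  have "(\<integral>\<^sup>+z. ennreal (norm (h (fst z) * (p l z * p k z))) \<partial>st)
      = (\<integral>\<^sup>+t. \<integral>\<^sup>+s. ennreal (norm (h t * (p l (t, s) * p k (t, s)))) \<partial>\<mu> t \<partial>\<sigma>)"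
    by (subst nn_integral_st) auto
  also have "\<dots> \<le> (\<integral>\<^sup>+t. ennreal (\<bar>C\<bar> * (\<bar>C1\<bar> + \<bar>C2\<bar>)) * indicator K t \<partial>\<sigma>)"
  proof (rule nn_integral_mono)
    fix t
    show "(\<integral>\<^sup>+s. ennreal (norm (h t * (p l (t, s) * p k (t, s)))) \<partial>\<mu> t)
      \<le> ennreal (\<bar>C\<bar> * (\<bar>C1\<bar> + \<bar>C2\<bar>)) * indicator K t"
    proof (cases "t \<in> K")
      case False
      then have "h t = 0" using supp by auto
      then show ?thesis by simp
    next
      case True
      have "(\<integral>\<^sup>+s. ennreal (norm (h t * (p l (t, s) * p k (t, s)))) \<partial>\<mu> t)
          \<le> (\<integral>\<^sup>+s. ennreal (\<bar>C\<bar> * ((p l (t, s))\<^sup>2 + (p k (t, s))\<^sup>2)) \<partial>\<mu> t)"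
        using bd[of t] abs_prod_le_squares
        by (intro nn_integral_mono ennreal_leI) (auto simp: abs_mult[of "h t"] intro!: mult_mono)
      also have "\<dots> = ennreal (\<integral>s. \<bar>C\<bar> * ((p l (t, s))\<^sup>2 + (p k (t, s))\<^sup>2) \<partial>\<mu> t)"
        using integrable_p[of t] by (intro nn_integral_eq_integral) auto
      also have "(\<integral>s. \<bar>C\<bar> * ((p l (t, s))\<^sup>2 + (p k (t, s))\<^sup>2) \<partial>\<mu> t) = \<bar>C\<bar> * (w l t + w k t)"
        using integrable_p[of t] by (simp add: w_eq)
      also have "\<dots> \<le> \<bar>C\<bar> * (\<bar>C1\<bar> + \<bar>C2\<bar>)"
        using C1[OF True] C2[OF True] by (intro mult_left_mono) auto
      finally show ?thesis using True by (simp add: ennreal_leI)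
    qed
  qed
  also have "\<dots> = ennreal (\<bar>C\<bar> * (\<bar>C1\<bar> + \<bar>C2\<bar>)) * emeasure \<sigma> K"
    using K by (intro nn_integral_cmult_indicator) auto
  also have "\<dots> < \<infinity>" using emeasure_compact[OF K] by (simp add: ennreal_mult_less_top)
  finally show "(\<integral>\<^sup>+z. ennreal (norm (h (fst z) * (p l z * p k z))) \<partial>st) < \<infinity>" .
qed

lemma integral_st_p:
  fixes h :: "'a \<Rightarrow> real"
  assumes h: "h \<in> borel_measurable borel" and K: "compact K"
    and bd: "\<And>t. \<bar>h t\<bar> \<le> C" and supp: "\<And>t. h t \<noteq> 0 \<Longrightarrow> t \<in> K"
  shows "(\<integral>z. h (fst z) * (p l z * p k z) \<partial>st) = (if l = k then \<integral>t. h t * w l t \<partial>\<sigma> else 0)"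
proof -
  have "(\<integral>z. h (fst z) * (p l z * p k z) \<partial>st) = (\<integral>t. \<integral>s. h t * (p l (t, s) * p k (t, s)) \<partial>\<mu> t \<partial>\<sigma>)"
    using integral_st[OF integrable_st_p[OF assms, of l k]] integrable_p(1) by simp
  also have "\<dots> = (\<integral>t. h t * (\<integral>s. p l (t, s) * p k (t, s) \<partial>\<mu> t) \<partial>\<sigma>)" by simp
  also have "\<dots> = (if l = k then \<integral>t. h t * w l t \<partial>\<sigma> else 0)"
    by (auto simp: p_orth w_eq power2_eq_square)
  finally show ?thesis .
qed

section \<open>The weighted measures \<open>sigma_l\<close>\<close>

abbreviation "\<S> \<equiv> sigma_l \<sigma> \<mu>"

lemma sets_sigma_l [simp, measurable_cong]: "sets (\<S> l) = sets borel"
  by (simp add: sigma_l_def)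

lemma space_sigma_l [simp]: "space (\<S> l) = UNIV"
  by (simp add: sigma_l_def)

lemma nn_integral_sigma_l:
  assumes "f \<in> borel_measurable borel"
  shows "(\<integral>\<^sup>+t. f t \<partial>\<S> l) = (\<integral>\<^sup>+t. ennreal (w l t) * f t \<partial>\<sigma>)"
  unfolding sigma_l_def w_def[symmetric] using assms by (intro nn_integral_density) auto

lemma sigma_l_0: "\<S> 0 = \<sigma>"
  unfolding sigma_l_def w_def[symmetric] by (simp add: density_1)

lemma AE_sigma_l:
  "(AE t in \<S> l. P t) \<longleftrightarrow> (AE t in \<sigma>. w l t \<noteq> 0 \<longrightarrow> P t)"
proof -
  have "0 < ennreal (w l t) \<longleftrightarrow> w l t \<noteq> 0" for t
    using w_nonneg[of l t] by auto
  then show ?thesis unfolding sigma_l_def w_def[symmetric] by (subst AE_density) auto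
qed

lemma emeasure_sigma_l_compact:
  assumes K: "compact K" shows "emeasure (\<S> l) K < \<infinity>"
proof -
  obtain C where C: "\<And>t. t \<in> K \<Longrightarrow> w l t \<le> C" using w_local_bound[OF K] by blast
  have "emeasure (\<S> l) K = (\<integral>\<^sup>+t. ennreal (w l t) * indicator K t \<partial>\<sigma>)"
    using K by (simp add: nn_integral_sigma_l flip: nn_integral_indicator)
  also have "\<dots> \<le> (\<integral>\<^sup>+t. ennreal C * indicator K t \<partial>\<sigma>)"
    by (intro nn_integral_mono) (auto simp: indicator_def intro!: ennreal_leI C)
  also have "\<dots> < \<infinity>"
    using emeasure_compact[OF K] K by (simp add: nn_integral_cmult_indicator ennreal_mult_less_top)
  finally show ?thesis .
qed

lemma sigma_finite_sigma_l: "sigma_finite_measure (\<S> l)"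
  by (rule sigma_finite_of_locally_finite) (use emeasure_sigma_l_compact in auto)

text \<open>Non-atomicity enters through this fact, which separates the strata in
  \<open>adjacent_distinct_AE\<close>.\<close>

lemma emeasure_singleton: "emeasure \<sigma> {t} = 0"
proof (rule ccontr)
  assume "emeasure \<sigma> {t} \<noteq> 0"
  then have "0 < emeasure \<sigma> {t}" by (simp add: zero_less_iff_neq_zero)
  then obtain B where B: "B \<in> sets \<sigma>" "B \<subseteq> {t}" "0 < emeasure \<sigma> B" "emeasure \<sigma> B < emeasure \<sigma> {t}"
    using nonatomic[unfolded non_atomic_def, rule_format, of "{t}"] by auto
  then have "B = {} \<or> B = {t}" by auto
  with B show False by auto
qed

end

section \<open>Product measures and sequence spaces\<close>

lemma measurable_fst_borel [measurable (raw)]: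
  fixes f :: "'x \<Rightarrow> 'b::second_countable_topology \<times> 'c::second_countable_topology"
  assumes "f \<in> borel_measurable M" shows "(\<lambda>x. fst (f x)) \<in> borel_measurable M"
  using assms by (simp add: borel_prod[symmetric])

lemma measurable_snd_borel [measurable (raw)]:
  fixes f :: "'x \<Rightarrow> 'b::second_countable_topology \<times> 'c::second_countable_topology"
  assumes "f \<in> borel_measurable M" shows "(\<lambda>x. snd (f x)) \<in> borel_measurable M"
  using assms by (simp add: borel_prod[symmetric])

lemma measurable_app_borel:
  fixes f :: "'x \<Rightarrow> nat \<Rightarrow> 'b::second_countable_topology"
  assumes "f \<in> borel_measurable M" shows "(\<lambda>x. f x i) \<in> borel_measurable M"
  using measurable_compose[OF assms measurable_product_coordinates] .

lemma measurable_case_nat_borel [measurable (raw)]: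
  fixes f :: "'x \<Rightarrow> 'b::second_countable_topology"
  assumes "f \<in> borel_measurable M" "g \<in> borel_measurable M"
  shows "(\<lambda>x. case_nat (f x) (g x)) \<in> borel_measurable M"
proof (rule measurable_coordinatewise_then_product)
  fix i show "(\<lambda>x. case_nat (f x) (g x) i) \<in> borel_measurable M"
    using assms(1) measurable_app_borel[OF assms(2)] by (cases i) auto
qed

lemma measurable_case_nat_const:
  "case_nat (x::'b::second_countable_topology) \<in> borel_measurable borel"
  using measurable_case_nat_borel[of "\<lambda>_. x" borel "\<lambda>t. t"] by simp

lemma measurable_shift_borel [measurable (raw)]:
  fixes g :: "'x \<Rightarrow> nat \<Rightarrow> 'b::second_countable_topology"
  assumes "g \<in> borel_measurable M"
  shows "(\<lambda>x. g x \<circ> Suc) \<in> borel_measurable M"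
  by (rule measurable_coordinatewise_then_product) (simp add: measurable_app_borel[OF assms])

lemma measurable_fst_comp_borel [measurable (raw)]:
  fixes g :: "'x \<Rightarrow> nat \<Rightarrow> 'b::second_countable_topology \<times> 'c::second_countable_topology"
  assumes "g \<in> borel_measurable M"
  shows "(\<lambda>x. fst \<circ> g x) \<in> borel_measurable M"
  by (rule measurable_coordinatewise_then_product)
    (simp add: measurable_fst_borel[OF measurable_app_borel[OF assms]])

lemma measurable_PiM_borel:
  fixes N :: "nat \<Rightarrow> 'b::second_countable_topology measure"
  assumes "\<And>i. i \<in> I \<Longrightarrow> sets (N i) = sets borel"
  shows "(\<lambda>x. x) \<in> borel_measurable (PiM I N)"
proof (rule measurable_coordinatewise_then_product)
  fix i
  show "(\<lambda>x. x i) \<in> borel_measurable (PiM I N)"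
  proof (cases "i \<in> I")
    case True
    then show ?thesis
      using measurable_component_singleton[OF True, of N] measurable_cong_sets[OF refl assms[OF True], of "PiM I N"]
      by blast
  next
    case False
    have "(\<lambda>x. x i) \<in> borel_measurable (PiM I N) \<longleftrightarrow> (\<lambda>x. undefined :: 'b) \<in> borel_measurable (PiM I N)"
      by (intro measurable_cong) (use False in \<open>auto simp: space_PiM PiE_def extensional_def\<close>)
    then show ?thesis by simp
  qed
qed

lemma case_nat_in_PiE:
  "case_nat x y \<in> PiE {..<Suc m} A \<longleftrightarrow> x \<in> A 0 \<and> y \<in> PiE {..<m} (\<lambda>i. A (Suc i))"
proof
  assume a: "case_nat x y \<in> PiE {..<Suc m} A"
  then have "case_nat x y 0 \<in> A 0" by (rule PiE_mem) simp
  moreover have "y i \<in> A (Suc i)" if "i < m" for i using PiE_mem[OF a, of "Suc i"] that by simp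
  moreover have "y i = undefined" if "\<not> i < m" for i using PiE_arb[OF a, of "Suc i"] that by simp
  ultimately show "x \<in> A 0 \<and> y \<in> PiE {..<m} (\<lambda>i. A (Suc i))" by (auto simp: PiE_iff extensional_def)
next
  assume a: "x \<in> A 0 \<and> y \<in> PiE {..<m} (\<lambda>i. A (Suc i))"
  show "case_nat x y \<in> PiE {..<Suc m} A"
  proof (rule PiE_I)
    fix i assume "i \<in> {..<Suc m}"
    then show "case_nat x y i \<in> A i" using a by (cases i) (auto intro: PiE_mem)
  next
    fix i assume "i \<notin> {..<Suc m}"
    then obtain k where "i = Suc k" "k \<notin> {..<m}" by (cases i) auto
    then show "case_nat x y i = undefined" using a PiE_arb[of y] by auto
  qed
qed

lemma measurable_case_nat_PiM:
  fixes M :: "nat \<Rightarrow> 'b measure"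
  shows "(\<lambda>(x, y). case_nat x y) \<in> M 0 \<Otimes>\<^sub>M PiM {..<m} (\<lambda>i. M (Suc i)) \<rightarrow>\<^sub>M PiM {..<Suc m} M"
proof -
  let ?Q = "M 0 \<Otimes>\<^sub>M PiM {..<m} (\<lambda>i. M (Suc i))"
  have "(\<lambda>w i. (case w of (x, y) \<Rightarrow> case_nat x y) i) \<in> ?Q \<rightarrow>\<^sub>M PiM {..<Suc m} M"
  proof (rule measurable_PiM_single')
    fix i assume i: "i \<in> {..<Suc m}"
    show "(\<lambda>w. (case w of (x, y) \<Rightarrow> case_nat x y) i) \<in> ?Q \<rightarrow>\<^sub>M M i"
    proof (cases i)
      case 0
      have "(\<lambda>w. fst w) \<in> ?Q \<rightarrow>\<^sub>M M 0" by (rule measurable_fst)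
      then show ?thesis using 0 by (simp only: case_prod_unfold nat.case)
    next
      case (Suc k)
      then have "k \<in> {..<m}" using i by auto
      then have "(\<lambda>w. snd w k) \<in> ?Q \<rightarrow>\<^sub>M M (Suc k)"
        by (rule measurable_compose[OF measurable_snd measurable_component_singleton])
      then show ?thesis using Suc by (simp only: case_prod_unfold nat.case)
    qed
  next
    show "(\<lambda>w i. (case w of (x, y) \<Rightarrow> case_nat x y) i)
        \<in> space ?Q \<rightarrow> PiE {..<Suc m} (\<lambda>i. space (M i))"
    proof (rule Pi_I)
      fix v assume v: "v \<in> space ?Q"
      obtain x y where "v = (x, y)" by (cases v)
      then show "(\<lambda>i. (case v of (x, y) \<Rightarrow> case_nat x y) i) \<in> PiE {..<Suc m} (\<lambda>i. space (M i))"
        using v by (simp add: space_pair_measure space_PiM case_nat_in_PiE del: PiE_iff)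
    qed
  qed
  then show ?thesis .
qed

text \<open>Coordinate 0 is split off and the others are shifted down, because \<open>PP\<close>,
  \<open>op_C\<close>, \<open>op_A\<close> and \<open>op_N\<close> all work on the first of the
  variables \<open>y\<close>.\<close>

lemma PiM_Suc_eq_distr:
  fixes M :: "nat \<Rightarrow> 'b measure"
  assumes "\<And>i. sigma_finite_measure (M i)"
  shows "PiM {..<Suc m} M = distr (M 0 \<Otimes>\<^sub>M PiM {..<m} (\<lambda>i. M (Suc i))) (PiM {..<Suc m} M) (\<lambda>(x, y). case_nat x y)"
proof -
  let ?Q = "M 0 \<Otimes>\<^sub>M PiM {..<m} (\<lambda>i. M (Suc i))" and ?c = "\<lambda>(x, y). case_nat x y"
  interpret product_sigma_finite M using assms by (simp add: product_sigma_finite_def)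
  interpret S: product_sigma_finite "\<lambda>i. M (Suc i)" using assms by (simp add: product_sigma_finite_def)
  interpret F: finite_product_sigma_finite "\<lambda>i. M (Suc i)" "{..<m}" by standard simp
  show ?thesis
  proof (rule PiM_eqI[symmetric])
    fix A assume A: "\<And>i. i \<in> {..<Suc m} \<Longrightarrow> A i \<in> sets (M i)"
    have *: "?c -` (PiE {..<Suc m} A) \<inter> space ?Q
        = A 0 \<times> PiE {..<m} (\<lambda>i. A (Suc i))"
    proof (rule set_eqI)
      fix z :: "'b \<times> (nat \<Rightarrow> 'b)"
      obtain x y where z: "z = (x, y)" by (cases z)
      have s: "A i \<subseteq> space (M i)" if "i < Suc m" for i using A[of i] sets.sets_into_space that by auto
      have "x \<in> A 0 \<and> y \<in> PiE {..<m} (\<lambda>i. A (Suc i)) \<Longrightarrow> x \<in> space (M 0) \<and> y \<in> PiE {..<m} (\<lambda>i. space (M (Suc i)))"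
        using s PiE_mono[of "{..<m}" "\<lambda>i. A (Suc i)" "\<lambda>i. space (M (Suc i))"] by blast
      then show "z \<in> ?c -` (PiE {..<Suc m} A) \<inter> space ?Q
         \<longleftrightarrow> z \<in> A 0 \<times> PiE {..<m} (\<lambda>i. A (Suc i))"
        unfolding z vimage_def space_pair_measure space_PiM Int_iff mem_Collect_eq prod.case case_nat_in_PiE mem_Sigma_iff
        by blast
    qed
    have "emeasure (distr ?Q (PiM {..<Suc m} M) ?c) (PiE {..<Suc m} A)
       = emeasure ?Q (A 0 \<times> PiE {..<m} (\<lambda>i. A (Suc i)))"
      using A by (subst emeasure_distr[OF measurable_case_nat_PiM]) (auto simp: * intro!: sets_PiM_I_finite)
    also have "\<dots> = emeasure (M 0) (A 0) * (\<Prod>i<m. emeasure (M (Suc i)) (A (Suc i)))"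
    proof -
      have "emeasure (PiM {..<m} (\<lambda>i. M (Suc i))) (PiE {..<m} (\<lambda>i. A (Suc i))) = (\<Prod>i<m. emeasure (M (Suc i)) (A (Suc i)))"
        using A by (intro S.emeasure_PiM) auto
      then show ?thesis
        using A by (subst F.emeasure_pair_measure_Times) (auto intro!: sets_PiM_I_finite)
    qed
    also have "\<dots> = (\<Prod>i\<in>{..<Suc m}. emeasure (M i) (A i))"
      by (simp only: prod.lessThan_Suc_shift)
    finally show "emeasure (distr ?Q (PiM {..<Suc m} M) ?c) (PiE {..<Suc m} A)
       = (\<Prod>i\<in>{..<Suc m}. emeasure (M i) (A i))" .
  qed auto
qed

lemma sigma_finite_PiM:
  assumes "\<And>i. sigma_finite_measure (M i)" "finite I"
  shows "sigma_finite_measure (PiM I M)"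
proof -
  interpret product_sigma_finite M using assms by (simp add: product_sigma_finite_def)
  interpret finite_product_sigma_finite M I by standard fact
  show ?thesis by unfold_locales
qed

lemma nn_integral_PiM_Suc:
  fixes M :: "nat \<Rightarrow> 'b measure"
  assumes M: "\<And>i. sigma_finite_measure (M i)" and f: "f \<in> borel_measurable (PiM {..<Suc m} M)"
  shows "(\<integral>\<^sup>+y. f y \<partial>PiM {..<Suc m} M) = (\<integral>\<^sup>+x. \<integral>\<^sup>+y. f (case_nat x y) \<partial>PiM {..<m} (\<lambda>i. M (Suc i)) \<partial>M 0)"
proof -
  interpret sigma_finite_measure "PiM {..<m} (\<lambda>i. M (Suc i))" using M by (intro sigma_finite_PiM) auto
  have f': "(\<lambda>z. f (case z of (x, y) \<Rightarrow> case_nat x y)) \<in> borel_measurable (M 0 \<Otimes>\<^sub>M PiM {..<m} (\<lambda>i. M (Suc i)))"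
    by (rule measurable_compose[OF measurable_case_nat_PiM f])
  show ?thesis
    using nn_integral_distr[OF measurable_case_nat_PiM[of M m], of f] f nn_integral_fst[OF f']
      arg_cong[OF PiM_Suc_eq_distr[of M m, OF M], of "\<lambda>N. integral\<^sup>N N f"]
    by simp
qed

lemma integral_PiM_Suc:
  fixes M :: "nat \<Rightarrow> 'b measure" and f :: "_ \<Rightarrow> real"
  assumes M: "\<And>i. sigma_finite_measure (M i)" and f: "integrable (PiM {..<Suc m} M) f"
  shows "(\<integral>y. f y \<partial>PiM {..<Suc m} M) = (\<integral>x. \<integral>y. f (case_nat x y) \<partial>PiM {..<m} (\<lambda>i. M (Suc i)) \<partial>M 0)" (is "_ = ?r1")
    "(\<integral>y. f y \<partial>PiM {..<Suc m} M) = (\<integral>y. \<integral>x. f (case_nat x y) \<partial>M 0 \<partial>PiM {..<m} (\<lambda>i. M (Suc i)))" (is "_ = ?r2")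
proof -
  interpret P: sigma_finite_measure "PiM {..<m} (\<lambda>i. M (Suc i))" using M by (intro sigma_finite_PiM) auto
  interpret M0: sigma_finite_measure "M 0" by (rule M)
  interpret pair_sigma_finite "M 0" "PiM {..<m} (\<lambda>i. M (Suc i))" ..
  let ?c = "\<lambda>(x, y). case_nat x y"
  note mc = measurable_case_nat_PiM[of M m]
  have fm: "f \<in> borel_measurable (PiM {..<Suc m} M)" using f by (rule borel_measurable_integrable)
  have i: "integrable (M 0 \<Otimes>\<^sub>M PiM {..<m} (\<lambda>i. M (Suc i))) (\<lambda>z. f (?c z))"
    using f by (subst (asm) PiM_Suc_eq_distr[OF M]) (simp add: integrable_distr_eq[OF mc fm])
  have e: "(\<integral>y. f y \<partial>PiM {..<Suc m} M) = (\<integral>z. f (?c z) \<partial>(M 0 \<Otimes>\<^sub>M PiM {..<m} (\<lambda>i. M (Suc i))))"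
    by (subst PiM_Suc_eq_distr[OF M]) (rule integral_distr[OF mc fm])
  show "(\<integral>y. f y \<partial>PiM {..<Suc m} M) = ?r1" using integral_fst'[OF i] e by simp
  show "(\<integral>y. f y \<partial>PiM {..<Suc m} M) = ?r2"
    using integral_snd[of "\<lambda>x y. f (case_nat x y)"] i e by (simp add: case_prod_unfold)
qed

lemma AE_PiM_Suc:
  fixes M :: "nat \<Rightarrow> 'b measure"
  assumes M: "\<And>i. sigma_finite_measure (M i)" and ae: "AE y in PiM {..<Suc m} M. P y"
  shows "AE x in M 0. AE y in PiM {..<m} (\<lambda>i. M (Suc i)). P (case_nat x y)"
proof -
  interpret P: sigma_finite_measure "PiM {..<m} (\<lambda>i. M (Suc i))" using M by (intro sigma_finite_PiM) auto
  interpret M0: sigma_finite_measure "M 0" by (rule M)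
  interpret pair_sigma_finite "M 0" "PiM {..<m} (\<lambda>i. M (Suc i))" ..
  let ?c = "\<lambda>(x, y). case_nat x y"
  note mc = measurable_case_nat_PiM[of M m]
  have "AE y in distr (M 0 \<Otimes>\<^sub>M PiM {..<m} (\<lambda>i. M (Suc i))) (PiM {..<Suc m} M) ?c. P y"
    using ae by (subst (asm) PiM_Suc_eq_distr[OF M])
  then have "AE z in M 0 \<Otimes>\<^sub>M PiM {..<m} (\<lambda>i. M (Suc i)). P (?c z)"
    by (rule AE_distrD[OF mc])
  from AE_pair[OF this] show ?thesis by simp
qed

lemma AE_PiM_Suc_I:
  fixes M :: "nat \<Rightarrow> 'b measure"
  assumes M: "\<And>i. sigma_finite_measure (M i)" and P: "Measurable.pred (PiM {..<Suc m} M) P"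
    and ae: "AE x in M 0. AE y in PiM {..<m} (\<lambda>i. M (Suc i)). P (case_nat x y)"
  shows "AE y in PiM {..<Suc m} M. P y"
proof -
  interpret P: sigma_finite_measure "PiM {..<m} (\<lambda>i. M (Suc i))" using M by (intro sigma_finite_PiM) auto
  interpret M0: sigma_finite_measure "M 0" by (rule M)
  interpret pair_sigma_finite "M 0" "PiM {..<m} (\<lambda>i. M (Suc i))" ..
  let ?c = "\<lambda>(x, y). case_nat x y"
  note mc = measurable_case_nat_PiM[of M m]
  have "Measurable.pred (M 0 \<Otimes>\<^sub>M PiM {..<m} (\<lambda>i. M (Suc i))) (\<lambda>z. P (?c z))"
    by (rule measurable_compose[OF mc P])
  then have "AE z in M 0 \<Otimes>\<^sub>M PiM {..<m} (\<lambda>i. M (Suc i)). P (?c z)"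
    by (intro AE_pair_measure) (use ae in \<open>auto simp: pred_def\<close>)
  then show ?thesis
    by (subst PiM_Suc_eq_distr[OF M], subst AE_distr_iff[OF mc]) (use P in \<open>auto simp: pred_def\<close>)
qed

lemma AE_PiM_coordinates:
  fixes M :: "nat \<Rightarrow> 'b measure"
  assumes M: "\<And>i. sigma_finite_measure (M i)" and ae: "\<And>i. i < m \<Longrightarrow> AE x in M i. P i x"
  shows "AE y in PiM {..<m} M. \<forall>i<m. P i (y i)"
proof -
  interpret product_sigma_finite M using M by (simp add: product_sigma_finite_def)
  have "AE y in PiM {..<m} M. P i (y i)" if "i < m" for i
  proof -
    from ae[OF that] obtain N where N: "{x\<in>space (M i). \<not> P i x} \<subseteq> N" "emeasure (M i) N = 0" "N \<in> sets (M i)"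
      by (auto elim: AE_E)
    let ?N = "PiE {..<m} (\<lambda>k. if k = i then N else space (M k))"
    have "emeasure (PiM {..<m} M) ?N = (\<Prod>k<m. emeasure (M k) (if k = i then N else space (M k)))"
      using N(3) by (intro emeasure_PiM) auto
    also have "\<dots> = 0" using that N(2) by (intro prod_zero) auto
    finally have "?N \<in> null_sets (PiM {..<m} M)"
      using N(3) by (intro null_setsI) (auto intro!: sets_PiM_I_finite)
    then show ?thesis
    proof (rule AE_I', intro subsetI)
      fix y assume y: "y \<in> {y \<in> space (PiM {..<m} M). \<not> P i (y i)}"
      then have "y i \<in> space (M i)" using that by (auto simp: space_PiM)
      then have "y i \<in> N" using y N(1) by auto
      then show "y \<in> ?N" using y by (auto simp: space_PiM PiE_iff)
    qed
  qed
  then have "AE y in PiM {..<m} M. \<forall>i\<in>{..<m}. P i (y i)"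
    by (subst AE_ball_countable) auto
  then show ?thesis by (simp add: Ball_def)
qed

section \<open>Bounded kernels with compact support\<close>

definition dep :: "nat \<Rightarrow> ((nat \<Rightarrow> 'b) \<Rightarrow> 'c) \<Rightarrow> bool"
  where "dep N h \<longleftrightarrow> (\<forall>t t'. (\<forall>i<N. t i = t' i) \<longrightarrow> h t = h t')"

lemma depD: "dep N h \<Longrightarrow> (\<And>i. i < N \<Longrightarrow> t i = t' i) \<Longrightarrow> h t = h t'"
  by (auto simp: dep_def)

text \<open>Functions of \<open>t 0, \<dots>, t (N - 1)\<close> are encoded as functions on the full sequence space, so that
  composing them with maps between different \<open>T\<^sup>n\<close> needs no extensionality bookkeeping.\<close>
definition B0 :: "nat \<Rightarrow> ((nat \<Rightarrow> 'b::topological_space) \<Rightarrow> real) \<Rightarrow> bool"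
  where "B0 N h \<longleftrightarrow> h \<in> borel_measurable borel \<and> dep N h \<and>
    (\<exists>C K. compact K \<and> (\<forall>t. \<bar>h t\<bar> \<le> C \<and> (h t \<noteq> 0 \<longrightarrow> (\<forall>i<N. t i \<in> K))))"

definition C0 :: "nat \<Rightarrow> ((nat \<Rightarrow> 'b::topological_space) \<Rightarrow> real) \<Rightarrow> bool"
  where "C0 N h \<longleftrightarrow> continuous_on UNIV h \<and> dep N h \<and>
    (\<exists>K. compact K \<and> (\<forall>t. h t \<noteq> 0 \<longrightarrow> (\<forall>i<N. t i \<in> K)))"

lemma B0D:
  assumes "B0 N h"
  shows "h \<in> borel_measurable borel" "dep N h"
    "\<exists>C K. C \<ge> 0 \<and> compact K \<and> (\<forall>t. \<bar>h t\<bar> \<le> C) \<and> (\<forall>t i. h t \<noteq> 0 \<longrightarrow> i < N \<longrightarrow> t i \<in> K)"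
proof -
  show "h \<in> borel_measurable borel" "dep N h" using assms by (auto simp: B0_def)
  from assms obtain C K where "compact K" "\<forall>t. \<bar>h t\<bar> \<le> C \<and> (h t \<noteq> 0 \<longrightarrow> (\<forall>i<N. t i \<in> K))"
    by (auto simp: B0_def)
  then show "\<exists>C K. C \<ge> 0 \<and> compact K \<and> (\<forall>t. \<bar>h t\<bar> \<le> C) \<and> (\<forall>t i. h t \<noteq> 0 \<longrightarrow> i < N \<longrightarrow> t i \<in> K)"
    by (intro exI[of _ C] exI[of _ K]) (auto intro: order.trans[OF abs_ge_zero])
qed

lemma B0I:
  assumes "h \<in> borel_measurable borel" "dep N h" "compact K" "\<And>t. \<bar>h t\<bar> \<le> C"
    "\<And>t i. h t \<noteq> 0 \<Longrightarrow> i < N \<Longrightarrow> t i \<in> K"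
  shows "B0 N h"
  using assms unfolding B0_def by blast

lemma B0_zero: "B0 N (\<lambda>_. 0)"
  by (rule B0I[where K = "{}" and C = 0]) (auto simp: dep_def)

text \<open>The factor \<open>g\<close> need only be bounded on compact boxes, as Jacobi
  coefficients and continuous functions are.\<close>

lemma B0_mult:
  assumes h: "B0 N h" and g: "g \<in> borel_measurable borel" "dep N g"
    and b: "\<And>K. compact K \<Longrightarrow> \<exists>C. \<forall>t. (\<forall>i<N. t i \<in> K) \<longrightarrow> \<bar>g t\<bar> \<le> C"
  shows "B0 N (\<lambda>t. g t * h t)"
proof -
  from B0D(3)[OF h] obtain C K where C: "C \<ge> 0" "compact K" "\<And>t. \<bar>h t\<bar> \<le> C" "\<And>t i. h t \<noteq> 0 \<Longrightarrow> i < N \<Longrightarrow> t i \<in> K"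
    by auto
  obtain D where D: "\<And>t. (\<forall>i<N. t i \<in> K) \<Longrightarrow> \<bar>g t\<bar> \<le> D" using b[OF C(2)] by auto
  show ?thesis
  proof (rule B0I[OF _ _ C(2), of _ _ "\<bar>D\<bar> * C"])
    show "(\<lambda>t. g t * h t) \<in> borel_measurable borel" using g B0D(1)[OF h] by measurable
    show "dep N (\<lambda>t. g t * h t)"
      using g(2) B0D(2)[OF h] unfolding dep_def by metis
    fix t
    show "\<bar>g t * h t\<bar> \<le> \<bar>D\<bar> * C"
    proof (cases "h t = 0")
      case False
      then have "\<bar>g t\<bar> \<le> \<bar>D\<bar>" using C(4)[of t] D[of t] by fastforce
      then show ?thesis using C(1,3) by (auto simp: abs_mult intro!: mult_mono)
    qed (use C in auto)
    fix i assume "g t * h t \<noteq> 0" "i < N"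
    then show "t i \<in> K" using C(4) by auto
  qed
qed

lemma B0_add: 
  assumes h: "B0 N h" and g: "B0 N g" shows "B0 N (\<lambda>t. h t + g t)"
proof -
  from B0D(3)[OF h] obtain C K where C: "C \<ge> 0" "compact K" "\<And>t. \<bar>h t\<bar> \<le> C" "\<And>t i. h t \<noteq> 0 \<Longrightarrow> i < N \<Longrightarrow> t i \<in> K"
    by auto
  from B0D(3)[OF g] obtain C' K' where C': "C' \<ge> 0" "compact K'" "\<And>t. \<bar>g t\<bar> \<le> C'" "\<And>t i. g t \<noteq> 0 \<Longrightarrow> i < N \<Longrightarrow> t i \<in> K'"
    by auto
  show ?thesis
  proof (rule B0I[of _ _ "K \<union> K'" "C + C'"])
    show "(\<lambda>t. h t + g t) \<in> borel_measurable borel" using B0D(1)[OF g] B0D(1)[OF h] by measurable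
    show "dep N (\<lambda>t. h t + g t)"
      using B0D(2)[OF g] B0D(2)[OF h] unfolding dep_def by metis
    show "\<bar>h t + g t\<bar> \<le> C + C'" for t using C(3)[of t] C'(3)[of t] by linarith
    fix t i assume "h t + g t \<noteq> 0" "i < N"
    then have "h t \<noteq> 0 \<or> g t \<noteq> 0" by auto
    then show "t i \<in> K \<union> K'" using C(4) C'(4) \<open>i < N\<close> by auto
  qed (use C C' in auto)
qed

lemma B0_cmult: "B0 N h \<Longrightarrow> B0 N (\<lambda>t. c * h t)"
  by (rule B0_mult) (auto simp: dep_def)

lemma B0_diff: "B0 N h \<Longrightarrow> B0 N g \<Longrightarrow> B0 N (\<lambda>t. h t - g t)"
  using B0_add[of N h "\<lambda>t. (-1) * g t"] B0_cmult[of N g "-1"] by simp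

lemma B0_prod: assumes "B0 N h" "B0 N g" shows "B0 N (\<lambda>t. g t * h t)"
proof -
  from B0D(3)[OF assms(2)] obtain C where "\<And>t. \<bar>g t\<bar> \<le> C" by auto
  then show ?thesis using B0D(1,2)[OF assms(2)] by (intro B0_mult[OF assms(1)]) auto
qed

lemma B0_sum: "(\<And>i. i \<in> I \<Longrightarrow> B0 N (h i)) \<Longrightarrow> B0 N (\<lambda>t. \<Sum>i\<in>I. h i t)"
  by (induction I rule: infinite_finite_induct) (auto simp: B0_zero B0_add)

lemma B0_case_nat:
  fixes h :: "(nat \<Rightarrow> 'b::second_countable_topology) \<Rightarrow> real"
  assumes "B0 (Suc N) h" shows "B0 N (\<lambda>t. h (case_nat x t))"
proof -
  from B0D(3)[OF assms] obtain C K where C: "C \<ge> 0" "compact K" "\<And>t. \<bar>h t\<bar> \<le> C" "\<And>t i. h t \<noteq> 0 \<Longrightarrow> i < Suc N \<Longrightarrow> t i \<in> K"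
    by auto
  show ?thesis
  proof (rule B0I[OF _ _ C(2), of _ _ C])
    show "(\<lambda>t. h (case_nat x t)) \<in> borel_measurable borel"
      by (rule measurable_compose[OF measurable_case_nat_const B0D(1)[OF assms]])
    show "dep N (\<lambda>t. h (case_nat x t))"
      unfolding dep_def by (auto intro!: depD[OF B0D(2)[OF assms]] split: nat.split)
    show "t i \<in> K" if "h (case_nat x t) \<noteq> 0" "i < N" for t i
      using C(4)[OF that(1), of "Suc i"] that(2) by simp
  qed (use C in auto)
qed

section \<open>Orthogonality of products of orthogonal polynomials\<close>

lemma dep_comp: "dep N h \<Longrightarrow> dep N (\<lambda>t. g (h t))"
  unfolding dep_def by metis

lemma fst_comp_case_nat: "fst \<circ> case_nat z y = case_nat (fst z) (fst \<circ> y)"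
  by (auto split: nat.split)

lemma case_nat_comp_Suc [simp]: "case_nat z y \<circ> Suc = y"
  by (simp add: o_def)

context jac_process
begin

abbreviation "\<F> \<equiv> fock \<sigma> \<mu>"
abbreviation "\<M> \<equiv> MP \<sigma> \<mu>"
abbreviation "\<X> \<equiv> X_op \<sigma> \<mu>"

text \<open>The measure of which \<open>gamma_ls\<close> is the image under \<open>spread\<close>;
  coefficients are compared here, before coordinates are repeated.\<close>

definition SP :: "nat list \<Rightarrow> (nat \<Rightarrow> 'a) measure"
  where "SP ls = (\<Pi>\<^sub>M j\<in>{..<length ls}. \<S> (ls ! j))"

primrec PP :: "nat list \<Rightarrow> (nat \<Rightarrow> 'a \<times> real) \<Rightarrow> real" where
  "PP [] y = 1"
| "PP (l # ls) y = p l (y 0) * PP ls (y \<circ> Suc)"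

lemma measurable_fockI: "f \<in> borel_measurable borel \<Longrightarrow> f \<in> borel_measurable (\<F> m)"
  unfolding fock_def by (rule measurable_compose[OF measurable_PiM_borel]) auto

lemma measurable_SPI: "f \<in> borel_measurable borel \<Longrightarrow> f \<in> borel_measurable (SP ls)"
  unfolding SP_def by (rule measurable_compose[OF measurable_PiM_borel]) auto

lemma space_SP: "space (SP ls) = cart (length ls)"
  by (simp add: SP_def space_PiM)

lemma SP_sigma_finite: "sigma_finite_measure (SP ls)"
  unfolding SP_def by (rule sigma_finite_PiM) (auto intro: sigma_finite_sigma_l)

lemma fock_sigma_finite: "sigma_finite_measure (\<F> m)"
  unfolding fock_def by (rule sigma_finite_PiM) (auto intro: ST.sigma_finite_measure_axioms)

lemma SP_Nil: "SP [] = PiM {} (\<lambda>j. \<S> ([] ! j))"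
  by (simp add: SP_def)

lemma fock_0: "\<F> 0 = PiM {} (\<lambda>j. st)"
  by (simp add: fock_def)

lemma nn_integral_SP_Nil: "(\<integral>\<^sup>+t. f t \<partial>SP []) = f (\<lambda>_. undefined)"
proof -
  interpret product_sigma_finite "\<lambda>j. \<S> ([] ! j)"
    by (simp add: product_sigma_finite_def sigma_finite_sigma_l)
  show ?thesis unfolding SP_Nil by (rule nn_integral_empty) simp
qed

lemma nn_integral_fock_0: "(\<integral>\<^sup>+t. f t \<partial>\<F> 0) = f (\<lambda>_. undefined)"
proof -
  interpret product_sigma_finite "\<lambda>j::nat. st"
    by (simp add: product_sigma_finite_def ST.sigma_finite_measure_axioms)
  show ?thesis unfolding fock_0 by (rule nn_integral_empty) simp
qed

lemma nn_integral_SP_Cons: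
  assumes "f \<in> borel_measurable borel"
  shows "(\<integral>\<^sup>+t. f t \<partial>SP (l # ls)) = (\<integral>\<^sup>+u. \<integral>\<^sup>+t. f (case_nat u t) \<partial>SP ls \<partial>\<S> l)"
  using nn_integral_PiM_Suc[of "\<lambda>j. \<S> ((l # ls) ! j)" f "length ls"]
    measurable_SPI[OF assms, of "l # ls"]
  by (simp add: SP_def sigma_finite_sigma_l)

lemma nn_integral_fock_Suc:
  assumes "f \<in> borel_measurable borel"
  shows "(\<integral>\<^sup>+t. f t \<partial>\<F> (Suc m)) = (\<integral>\<^sup>+z. \<integral>\<^sup>+y. f (case_nat z y) \<partial>\<F> m \<partial>st)"
  using nn_integral_PiM_Suc[of "\<lambda>j. st" f m] measurable_fockI[OF assms, of "Suc m"]
  by (simp add: fock_def ST.sigma_finite_measure_axioms)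

lemma PP_measurable [measurable]: "PP ls \<in> borel_measurable borel"
proof (induction ls)
  case (Cons l ls)
  have "(\<lambda>y. p l (y 0)) \<in> borel_measurable borel"
    by (rule measurable_compose[OF measurable_product_coordinates p_measurable])
  moreover have "(\<lambda>y. PP ls (y \<circ> Suc)) \<in> borel_measurable borel"
    by (rule measurable_compose[OF measurable_shift_borel Cons]) simp
  ultimately show ?case by simp
qed simp

lemma Pair_case_nat_measurable:
  fixes f :: "(nat \<Rightarrow> 'b::second_countable_topology) \<Rightarrow> 'c::topological_space"
  assumes f: "f \<in> borel_measurable borel" and N: "(\<lambda>x. x) \<in> borel_measurable N"
  shows "(\<lambda>(u, t). f (case_nat u t)) \<in> borel_measurable (borel \<Otimes>\<^sub>M N)"
proof -
  have "(\<lambda>w. case_nat (fst w) (snd w)) \<in> borel_measurable (borel \<Otimes>\<^sub>M N)"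
    by (rule measurable_case_nat_borel) (auto intro: measurable_compose[OF measurable_snd N])
  from measurable_compose[OF this f] show ?thesis by (simp add: case_prod_unfold)
qed

lemma id_SP: "(\<lambda>x. x) \<in> borel_measurable (SP ls)"
  unfolding SP_def by (rule measurable_PiM_borel) simp

text \<open>The second coordinates are integrated out one at a time: the fibre integral of the
  square of \<open>p l\<close> is \<open>w l\<close>, which turns \<open>\<sigma>\<close> into
  \<open>sigma_l\<close>. This is where the weights in the measures \<gamma>_n come from.\<close>

lemma nn_integral_PP:
  assumes "H \<in> borel_measurable borel" "dep (length ls) H"
  shows "(\<integral>\<^sup>+y. H (fst \<circ> y) * ennreal ((PP ls y)\<^sup>2) \<partial>\<F> (length ls)) = (\<integral>\<^sup>+t. H t \<partial>SP ls)"
  using assms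
proof (induction ls arbitrary: H)
  case Nil
  have "H (fst \<circ> (\<lambda>_. undefined)) = H (\<lambda>_. undefined)" by (rule depD[OF Nil(2)]) simp
  then show ?case by (simp add: nn_integral_SP_Nil nn_integral_fock_0)
next
  case (Cons l ls)
  let ?F = "\<F> (length ls)"
  note H = Cons.prems(1)
  interpret sigma_finite_measure "SP ls" by (rule SP_sigma_finite)
  define \<Phi> where "\<Phi> u = (\<integral>\<^sup>+t. H (case_nat u t) \<partial>SP ls)" for u
  have m\<Phi>: "\<Phi> \<in> borel_measurable borel"
    unfolding \<Phi>_def by (rule borel_measurable_nn_integral[OF Pair_case_nat_measurable[OF H id_SP]])
  have mF: "(\<lambda>y :: nat \<Rightarrow> 'a \<times> real. H (fst \<circ> y)) \<in> borel_measurable borel"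
    by (rule measurable_compose[OF measurable_fst_comp_borel H]) simp
  have Hc: "(\<lambda>t. H (case_nat u t)) \<in> borel_measurable borel" for u
    by (rule measurable_compose[OF measurable_case_nat_const H])
  have mHc: "(\<lambda>y :: nat \<Rightarrow> 'a \<times> real. H (case_nat u (fst \<circ> y))) \<in> borel_measurable borel" for u
    by (rule measurable_compose[OF measurable_fst_comp_borel Hc]) simp
  have IH: "(\<integral>\<^sup>+y. H (case_nat u (fst \<circ> y)) * ennreal ((PP ls y)\<^sup>2) \<partial>?F) = \<Phi> u" for u
    unfolding \<Phi>_def
  proof (rule Cons.IH[OF Hc])
    show "dep (length ls) (\<lambda>t. H (case_nat u t))"
      using Cons.prems(2) by (auto simp: dep_def split: nat.split)
  qed
  have "(\<integral>\<^sup>+y. H (fst \<circ> y) * ennreal ((PP (l # ls) y)\<^sup>2) \<partial>\<F> (length (l # ls)))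
      = (\<integral>\<^sup>+z. \<integral>\<^sup>+y. H (fst \<circ> case_nat z y) * ennreal ((PP (l # ls) (case_nat z y))\<^sup>2) \<partial>?F \<partial>st)"
  proof -
    have "(\<lambda>y. H (fst \<circ> y) * ennreal ((PP (l # ls) y)\<^sup>2)) \<in> borel_measurable borel"
      using mF PP_measurable[of "l # ls"] by measurable
    from nn_integral_fock_Suc[OF this] show ?thesis by simp
  qed
  also have "\<dots> = (\<integral>\<^sup>+z. ennreal ((p l z)\<^sup>2) * \<Phi> (fst z) \<partial>st)"
  proof (rule nn_integral_cong)
    fix z
    have "(\<integral>\<^sup>+y. H (fst \<circ> case_nat z y) * ennreal ((PP (l # ls) (case_nat z y))\<^sup>2) \<partial>?F)
      = (\<integral>\<^sup>+y. ennreal ((p l z)\<^sup>2) * (H (case_nat (fst z) (fst \<circ> y)) * ennreal ((PP ls y)\<^sup>2)) \<partial>?F)"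
      by (simp add: fst_comp_case_nat power_mult_distrib ennreal_mult mult_ac)
    also have "\<dots> = ennreal ((p l z)\<^sup>2) * (\<integral>\<^sup>+y. H (case_nat (fst z) (fst \<circ> y)) * ennreal ((PP ls y)\<^sup>2) \<partial>?F)"
      by (intro nn_integral_cmult measurable_fockI) (use mHc PP_measurable[of ls] in measurable)
    finally show "(\<integral>\<^sup>+y. H (fst \<circ> case_nat z y) * ennreal ((PP (l # ls) (case_nat z y))\<^sup>2) \<partial>?F)
      = ennreal ((p l z)\<^sup>2) * \<Phi> (fst z)" by (simp add: IH)
  qed
  also have "\<dots> = (\<integral>\<^sup>+t. \<integral>\<^sup>+s. ennreal ((p l (t, s))\<^sup>2) * \<Phi> t \<partial>\<mu> t \<partial>\<sigma>)"
    using m\<Phi> by (subst nn_integral_st) (auto intro!: borel_measurable_times measurable_compose[OF measurable_fst_borel m\<Phi>])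
  also have "\<dots> = (\<integral>\<^sup>+t. ennreal (w l t) * \<Phi> t \<partial>\<sigma>)"
  proof (rule nn_integral_cong)
    fix t
    have "(\<integral>\<^sup>+s. ennreal ((p l (t, s))\<^sup>2) * \<Phi> t \<partial>\<mu> t) = (\<integral>\<^sup>+s. ennreal ((p l (t, s))\<^sup>2) \<partial>\<mu> t) * \<Phi> t"
      using borel_measurable_integrable[OF integrable_p(2)[of t l]] by (intro nn_integral_multc) simp
    also have "(\<integral>\<^sup>+s. ennreal ((p l (t, s))\<^sup>2) \<partial>\<mu> t) = ennreal (w l t)"
      unfolding w_eq using integrable_p(2)[of t l] by (intro nn_integral_eq_integral) auto
    finally show "(\<integral>\<^sup>+s. ennreal ((p l (t, s))\<^sup>2) * \<Phi> t \<partial>\<mu> t) = ennreal (w l t) * \<Phi> t" .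
  qed
  also have "\<dots> = (\<integral>\<^sup>+t. \<Phi> t \<partial>\<S> l)"
    by (rule nn_integral_sigma_l[OF m\<Phi>, symmetric])
  also have "\<dots> = (\<integral>\<^sup>+t. H t \<partial>SP (l # ls))"
    using nn_integral_SP_Cons[OF H, of l ls] by (simp add: \<Phi>_def)
  finally show ?case .
qed

lemma B0_comp_fst_measurable:
  fixes h :: "(nat \<Rightarrow> 'a) \<Rightarrow> real"
  assumes "B0 N h" shows "(\<lambda>y :: nat \<Rightarrow> 'a \<times> real. h (fst \<circ> y)) \<in> borel_measurable borel"
  by (rule measurable_compose[OF measurable_fst_comp_borel B0D(1)[OF assms]]) simp

lemma SP_box_finite: 
  assumes "compact K" shows "emeasure (SP ls) (PiE {..<length ls} (\<lambda>_. K)) < \<infinity>"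
proof -
  interpret product_sigma_finite "\<lambda>j. \<S> (ls ! j)"
    by (simp add: product_sigma_finite_def sigma_finite_sigma_l)
  have "emeasure (SP ls) (PiE {..<length ls} (\<lambda>_. K)) = (\<Prod>j<length ls. emeasure (\<S> (ls ! j)) K)"
    unfolding SP_def using assms by (intro emeasure_PiM) auto
  also have "\<dots> < \<infinity>"
    using emeasure_sigma_l_compact[OF assms] by (auto simp: less_top[symmetric] ennreal_prod_eq_top less_imp_neq)
  finally show ?thesis .
qed

lemma B0_integrable_SP:
  assumes h: "B0 (length ls) h" shows "integrable (SP ls) h"
proof (rule integrableI_bounded)
  show "h \<in> borel_measurable (SP ls)" by (rule measurable_SPI[OF B0D(1)[OF h]])
  obtain C K where C: "C \<ge> 0" "compact K" "\<And>t. \<bar>h t\<bar> \<le> C" "\<And>t i. h t \<noteq> 0 \<Longrightarrow> i < length ls \<Longrightarrow> t i \<in> K"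
    using B0D(3)[OF h] by auto
  have S: "PiE {..<length ls} (\<lambda>_. K) \<in> sets (SP ls)"
    unfolding SP_def using C by (intro sets_PiM_I_finite) auto
  have "(\<integral>\<^sup>+t. ennreal (norm (h t)) \<partial>SP ls) \<le> (\<integral>\<^sup>+t. ennreal C * indicator (PiE {..<length ls} (\<lambda>_. K)) t \<partial>SP ls)"
  proof (rule nn_integral_mono)
    fix t assume t: "t \<in> space (SP ls)"
    show "ennreal (norm (h t)) \<le> ennreal C * indicator (PiE {..<length ls} (\<lambda>_. K)) t"
    proof (cases "h t = 0")
      case False
      then have "t \<in> PiE {..<length ls} (\<lambda>_. K)" using t C(4) by (auto simp: space_SP PiE_iff)
      then show ?thesis using C(3) by (simp add: ennreal_leI)
    qed simp
  qed
  also have "\<dots> = ennreal C * emeasure (SP ls) (PiE {..<length ls} (\<lambda>_. K))"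
    using S by (rule nn_integral_cmult_indicator)
  also have "\<dots> < \<infinity>" using SP_box_finite[OF C(2), of ls] by (simp add: ennreal_mult_less_top)
  finally show "(\<integral>\<^sup>+t. ennreal (norm (h t)) \<partial>SP ls) < \<infinity>" .
qed

lemma integrable_PP_square:
  assumes h: "B0 (length ls) h"
  shows "integrable (\<F> (length ls)) (\<lambda>y. h (fst \<circ> y) * (PP ls y)\<^sup>2)"
    "(\<integral>y. h (fst \<circ> y) * (PP ls y)\<^sup>2 \<partial>\<F> (length ls)) = (\<integral>t. h t \<partial>SP ls)"
proof -
  have nn: "(\<integral>\<^sup>+y. ennreal (g (fst \<circ> y) * (PP ls y)\<^sup>2) \<partial>\<F> (length ls)) = (\<integral>\<^sup>+t. ennreal (g t) \<partial>SP ls)"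
    if g: "B0 (length ls) g" for g
  proof -
    have "ennreal (g (fst \<circ> y) * (PP ls y)\<^sup>2) = ennreal (g (fst \<circ> y)) * ennreal ((PP ls y)\<^sup>2)" for y
      by (cases "g (fst \<circ> y) \<ge> 0") (auto simp: ennreal_mult ennreal_neg mult_nonpos_nonneg)
    then show ?thesis
      using nn_integral_PP[of "\<lambda>t. ennreal (g t)" ls, OF _ dep_comp[OF B0D(2)[OF g]]] B0D(1)[OF g] by simp
  qed
  have mg: "B0 (length ls) (\<lambda>t. - h t)" using B0_cmult[OF h, of "-1"] by simp
  have m: "(\<lambda>y. h (fst \<circ> y) * (PP ls y)\<^sup>2) \<in> borel_measurable (\<F> (length ls))"
    using B0_comp_fst_measurable[OF h] PP_measurable[of ls]
    by (intro measurable_fockI borel_measurable_times borel_measurable_power)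
  have fin: "(\<integral>\<^sup>+t. ennreal (h t) \<partial>SP ls) < \<infinity>" "(\<integral>\<^sup>+t. ennreal (- h t) \<partial>SP ls) < \<infinity>"
    using B0_integrable_SP[OF h] by (auto simp: real_integrable_def less_top)
  show i: "integrable (\<F> (length ls)) (\<lambda>y. h (fst \<circ> y) * (PP ls y)\<^sup>2)"
    unfolding real_integrable_def using nn[OF h] nn[OF mg] fin m by (auto simp: less_top)
  show "(\<integral>y. h (fst \<circ> y) * (PP ls y)\<^sup>2 \<partial>\<F> (length ls)) = (\<integral>t. h t \<partial>SP ls)"
    using nn[OF h] nn[OF mg] by (simp add: real_lebesgue_integral_def[OF i] real_lebesgue_integral_def[OF B0_integrable_SP[OF h]])
qed

lemma integrable_PP_prod:
  assumes h: "B0 (length ls) h" and len: "length ls' = length ls"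
  shows "integrable (\<F> (length ls)) (\<lambda>y. h (fst \<circ> y) * (PP ls y * PP ls' y))"
proof (rule Bochner_Integration.integrable_bound)
  have a: "B0 (length ls) (\<lambda>t. \<bar>h t\<bar>)"
  proof -
    obtain C K where C: "C \<ge> 0" "compact K" "\<And>t. \<bar>h t\<bar> \<le> C" "\<And>t i. h t \<noteq> 0 \<Longrightarrow> i < length ls \<Longrightarrow> t i \<in> K"
      using B0D(3)[OF h] by auto
    show ?thesis
      by (rule B0I[OF _ _ C(2), of _ _ C]) (use B0D(1)[OF h] dep_comp[OF B0D(2)[OF h]] C in auto)
  qed
  show "integrable (\<F> (length ls)) (\<lambda>y. \<bar>h (fst \<circ> y)\<bar> * (PP ls y)\<^sup>2 + \<bar>h (fst \<circ> y)\<bar> * (PP ls' y)\<^sup>2)"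
    using integrable_PP_square(1)[OF a] integrable_PP_square(1)[of ls' "\<lambda>t. \<bar>h t\<bar>"] a len by simp
  show "(\<lambda>y. h (fst \<circ> y) * (PP ls y * PP ls' y)) \<in> borel_measurable (\<F> (length ls))"
    using B0_comp_fst_measurable[OF h] PP_measurable[of ls] PP_measurable[of ls']
    by (intro measurable_fockI borel_measurable_times)
  show "AE y in \<F> (length ls). norm (h (fst \<circ> y) * (PP ls y * PP ls' y))
      \<le> norm (\<bar>h (fst \<circ> y)\<bar> * (PP ls y)\<^sup>2 + \<bar>h (fst \<circ> y)\<bar> * (PP ls' y)\<^sup>2)"
  proof (rule AE_I2)
    fix y
    have "\<bar>h (fst \<circ> y)\<bar> * \<bar>PP ls y * PP ls' y\<bar> \<le> \<bar>h (fst \<circ> y)\<bar> * ((PP ls y)\<^sup>2 + (PP ls' y)\<^sup>2)"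
      by (intro mult_left_mono abs_prod_le_squares) simp
    then show "norm (h (fst \<circ> y) * (PP ls y * PP ls' y))
      \<le> norm (\<bar>h (fst \<circ> y)\<bar> * (PP ls y)\<^sup>2 + \<bar>h (fst \<circ> y)\<bar> * (PP ls' y)\<^sup>2)"
      by (simp add: abs_mult distrib_left)
  qed
qed

text \<open>If the first indices agree, the remaining variables are integrated first and the
  induction hypothesis applies. If they differ, the first variable is integrated first and the
  orthogonality of \<open>p l\<close> and \<open>p l'\<close> on the fibres gives zero. Hence both
  orders of integration in \<open>integral_PiM_Suc\<close>.\<close>

lemma integral_PP_orth:
  assumes "B0 (length ls) h" "length ls' = length ls" "ls \<noteq> ls'"
  shows "(\<integral>y. h (fst \<circ> y) * (PP ls y * PP ls' y) \<partial>\<F> (length ls)) = 0"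
  using assms
proof (induction ls arbitrary: ls' h)
  case (Cons l ls)
  obtain l' r where ls': "ls' = l' # r" "length r = length ls" using Cons.prems(2) by (cases ls') auto
  define f where "f y = h (fst \<circ> y) * (PP (l # ls) y * PP ls' y)" for y
  have fi: "integrable (\<F> (Suc (length ls))) f"
    unfolding f_def using integrable_PP_prod[OF Cons.prems(1,2)] by (simp only: length_Cons)
  have fc: "f (case_nat z y) = (h (case_nat (fst z) (fst \<circ> y)) * (p l z * p l' z)) * (PP ls y * PP r y)" for z y
    by (simp add: f_def ls' fst_comp_case_nat)
  obtain C K where C: "C \<ge> 0" "compact K" "\<And>t. \<bar>h t\<bar> \<le> C" "\<And>t i. h t \<noteq> 0 \<Longrightarrow> i < length (l # ls) \<Longrightarrow> t i \<in> K"
    using B0D(3)[OF Cons.prems(1)] by metis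
  note I = integral_PiM_Suc[of "\<lambda>j. st" "length ls" f, folded fock_def, OF ST.sigma_finite_measure_axioms fi]
  have "(\<integral>y. f y \<partial>\<F> (Suc (length ls))) = 0"
  proof (cases "l = l'")
    case True
    then have ne: "ls \<noteq> r" using Cons.prems(3) ls' by auto
    have "(\<integral>y. f (case_nat z y) \<partial>\<F> (length ls)) = 0" for z
    proof -
      have "(\<integral>y. h (case_nat (fst z) (fst \<circ> y)) * (PP ls y * PP r y) \<partial>\<F> (length ls)) = 0"
        using Cons.IH[OF B0_case_nat[of "length ls" h "fst z"], of r] Cons.prems(1) ls' ne by simp
      moreover have "f (case_nat z y) = (p l z * p l' z) * (h (case_nat (fst z) (fst \<circ> y)) * (PP ls y * PP r y))" for y
        by (simp add: fc)
      ultimately show ?thesis by simp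
    qed
    then show ?thesis using I(1) by simp
  next
    case False
    have "(\<integral>z. f (case_nat z y) \<partial>st) = 0" for y
    proof -
      have m: "(\<lambda>u. h (case_nat u (fst \<circ> y))) \<in> borel_measurable borel"
        by (rule measurable_compose[OF measurable_case_nat_borel[OF measurable_ident_sets measurable_const] B0D(1)[OF Cons.prems(1)]]) auto
      have "(\<integral>z. h (case_nat (fst z) (fst \<circ> y)) * (p l z * p l' z) \<partial>st) = 0"
        using integral_st_p[OF m C(2,3), of l l'] C(4)[of "case_nat _ (fst \<circ> y)" 0] False by simp
      then show ?thesis by (simp add: fc)
    qed
    then show ?thesis using I(2) by simp
  qed
  then show ?case by (simp only: f_def[abs_def] length_Cons)
qed auto

definition vec :: "((nat \<Rightarrow> 'a) \<Rightarrow> real) \<Rightarrow> nat list \<Rightarrow> 'a fock_vec"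
  where "vec h ls = (\<lambda>m y. if m = length ls then h (fst \<circ> y) * PP ls y else 0)"

lemma vec_measurable: assumes "B0 (length ls) h" shows "vec h ls m \<in> borel_measurable borel"
  using B0_comp_fst_measurable[OF assms] PP_measurable[of ls] by (cases "m = length ls") (auto simp: vec_def)

lemma vec_gl2: assumes h: "B0 (length ls) h" shows "vec h ls \<in> gl2 \<F>"
proof -
  have i: "integrable (\<F> m) (\<lambda>y. (vec h ls m y)\<^sup>2)" for m
    using integrable_PP_square(1)[OF B0_prod[OF h h]]
    by (cases "m = length ls") (auto simp: vec_def power2_eq_square mult_ac)
  have "summable (\<lambda>m. \<integral>y. (vec h ls m y)\<^sup>2 \<partial>\<F> m)"
    by (rule summable_finite[of "{length ls}"]) (auto simp: vec_def)
  with i show ?thesis using vec_measurable[OF h] by (auto simp: gl2_def intro: measurable_fockI)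
qed

lemma vec_inner:
  assumes h: "B0 (length ls) h" and h': "B0 (length ls') h'"
  shows "gl2_inner \<F> (vec h ls) (vec h' ls') = (if ls = ls' then \<integral>t. h t * h' t \<partial>SP ls else 0)"
proof -
  have "gl2_inner \<F> (vec h ls) (vec h' ls')
      = (\<Sum>m\<in>{length ls}. \<integral>y. vec h ls m y * vec h' ls' m y \<partial>\<F> m)"
    unfolding gl2_inner_def by (rule suminf_finite) (auto simp: vec_def)
  also have "\<dots> = (\<integral>y. vec h ls (length ls) y * vec h' ls' (length ls) y \<partial>\<F> (length ls))" by simp
  also have "\<dots> = (if ls = ls' then \<integral>t. h t * h' t \<partial>SP ls else 0)"
  proof (cases "length ls' = length ls")
    case True
    then have hh: "B0 (length ls) (\<lambda>t. h t * h' t)" using B0_prod[of "length ls" h' h] h h' by simp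
    have e: "vec h ls (length ls) y * vec h' ls' (length ls) y = h (fst \<circ> y) * h' (fst \<circ> y) * (PP ls y * PP ls' y)" for y
      using True by (simp add: vec_def)
    show ?thesis
      unfolding e using integral_PP_orth[OF hh True] integrable_PP_square(2)[OF hh] by (auto simp: power2_eq_square)
  qed (auto simp: vec_def)
  finally show ?thesis .
qed

end

section \<open>The measures \<open>\<gamma>\<^sub>n\<close>\<close>

definition deg :: "nat list \<Rightarrow> nat" where "deg ls = length ls + sum_list ls"

lemma deg_simps [simp]: "deg [] = 0" "deg (l # ls) = Suc (l + deg ls)"
  by (simp_all add: deg_def)

text \<open>\<open>blk ls k\<close> is the index of the block of \<open>spread ls\<close> containing position \<open>k\<close>.\<close>
fun blk :: "nat list \<Rightarrow> nat \<Rightarrow> nat" where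
  "blk [] k = 0"
| "blk (l # ls) k = (if k \<le> l then 0 else Suc (blk ls (k - Suc l)))"

text \<open>The first position of block \<open>j\<close>, so that \<open>start ls\<close> is a right
  inverse of \<open>blk ls\<close> and recovers a point from its repetition.\<close>

fun start :: "nat list \<Rightarrow> nat \<Rightarrow> nat" where
  "start [] j = 0"
| "start (l # ls) 0 = 0"
| "start (l # ls) (Suc j) = Suc (l + start ls j)"

lemma blk_0 [simp]: "blk ls 0 = 0"
  by (cases ls) auto

lemma spread_nth:
  "k < deg ls \<Longrightarrow> concat (map (\<lambda>j. replicate (ls ! j + 1) (t j)) [0..<length ls]) ! k = t (blk ls k)"
proof (induction ls arbitrary: t k)
  case (Cons l ls)
  have u: "[0..<length (l # ls)] = 0 # map Suc [0..<length ls]"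
    by (simp add: upt_conv_Cons map_Suc_upt del: upt_Suc)
  have "concat (map (\<lambda>j. replicate ((l # ls) ! j + 1) (t j)) [0..<length (l # ls)])
    = replicate (l + 1) (t 0) @ concat (map (\<lambda>j. replicate (ls ! j + 1) (t (Suc j))) [0..<length ls])"
    unfolding u by (simp add: o_def)
  moreover have "k - Suc l < deg ls" if "\<not> k \<le> l" using Cons.prems that by auto
  ultimately show ?case using Cons.IH[of "k - Suc l" "\<lambda>j. t (Suc j)"] by (auto simp: nth_append less_Suc_eq_le nth_Cons split: nat.split)
qed simp

lemma spread_eq: "spread ls t = (\<lambda>k\<in>{..<deg ls}. t (blk ls k))"
  unfolding spread_def using spread_nth[of _ ls t]
  by (auto simp: deg_def[symmetric] restrict_def fun_eq_iff)

lemma blk_less: "k < deg ls \<Longrightarrow> blk ls k < length ls"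
  by (induction ls k rule: blk.induct) auto

lemma start_less: "j < length ls \<Longrightarrow> start ls j < deg ls"
  by (induction ls j rule: start.induct) auto

lemma blk_start [simp]: "j < length ls \<Longrightarrow> blk ls (start ls j) = j"
  by (induction ls j rule: start.induct) auto

lemma blk_Suc: "Suc k < deg ls \<Longrightarrow> blk ls (Suc k) = blk ls k \<or> blk ls (Suc k) = Suc (blk ls k)"
proof (induction ls k rule: blk.induct)
  case (2 l ls k)
  show ?case
  proof (cases "Suc k \<le> l")
    case False
    show ?thesis
    proof (cases "k \<le> l")
      case True
      then have "k = l" using False by simp
      then show ?thesis by simp
    next
      case kl: False
      then have "Suc (k - Suc l) = Suc k - Suc l" by simp
      then show ?thesis using 2(1)[OF kl] 2(2) kl by auto
    qed
  qed simp
qed simp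

text \<open>Were the first blocks of different lengths, the position just after the shorter one
  would lie in block 1 for one list and in block 0 for the other.\<close>

lemma blk_inj:
  assumes "deg ls = deg ls'" "\<And>k. k < deg ls \<Longrightarrow> blk ls k = blk ls' k"
  shows "ls = ls'"
  using assms
proof (induction ls arbitrary: ls')
  case Nil
  then show ?case by (cases ls') auto
next
  case (Cons l ls)
  then obtain l' r where ls': "ls' = l' # r" by (cases ls') auto
  have "\<not> l < l'"
  proof
    assume a: "l < l'"
    then have "Suc l < deg (l # ls)" using Cons.prems(1) ls' by auto
    from Cons.prems(2)[OF this] show False using ls' a by simp
  qed
  moreover have "\<not> l' < l"
  proof
    assume a: "l' < l"
    then have "Suc l' < deg (l # ls)" by auto
    from Cons.prems(2)[OF this] show False using ls' a by simp
  qed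
  ultimately have l: "l = l'" by simp
  have "ls = r"
  proof (rule Cons.IH)
    show "deg ls = deg r" using Cons.prems(1) ls' l by simp
    fix k assume "k < deg ls"
    then show "blk ls k = blk r k" using Cons.prems(2)[of "Suc l + k"] ls' l by simp
  qed
  then show ?case using ls' l by simp
qed

definition Sn :: "nat \<Rightarrow> nat list set" where "Sn n = {ls. deg ls = n}"

lemma finite_Sn [simp]: "finite (Sn n)"
proof (rule finite_subset)
  show "Sn n \<subseteq> {ls. set ls \<subseteq> {..n} \<and> length ls \<le> n}"
    by (auto simp: Sn_def deg_def dest: member_le_sum_list)
  show "finite {ls. set ls \<subseteq> {..n} \<and> length ls \<le> n}"
    by (rule finite_lists_length_le) simp
qed

lemma Sn_0 [simp]: "Sn 0 = {[]}"
  by (auto simp: Sn_def deg_def)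

lemma deg_Sn: "ls \<in> Sn n \<Longrightarrow> deg ls = n"
  by (simp add: Sn_def)

text \<open>The set of the paper's \<open>T\<^sup>(\<^sup>l\<^sup>\<^sub>1\<^sup>,\<^sup>\<dots>\<^sup>,\<^sup>l\<^sup>\<^sub>i\<^sup>)\<close>.\<close>
definition diag_set :: "nat list \<Rightarrow> (nat \<Rightarrow> 'b) set"
  where "diag_set ls = {u. (\<forall>k<deg ls. u k = u (start ls (blk ls k))) \<and>
    (\<forall>j. Suc j < length ls \<longrightarrow> u (start ls j) \<noteq> u (start ls (Suc j)))}"

text \<open>Values may recur in distant blocks but not in neighbouring ones, so the blocks are
  visible in the equalities between neighbouring coordinates.\<close>

lemma diag_set_adjacent:
  assumes "u \<in> diag_set ls" "Suc k < deg ls"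
  shows "u k = u (Suc k) \<longleftrightarrow> blk ls k = blk ls (Suc k)"
proof -
  have e: "u k = u (start ls (blk ls k))" "u (Suc k) = u (start ls (blk ls (Suc k)))"
    using assms by (auto simp: diag_set_def)
  show ?thesis
  proof (cases "blk ls k = blk ls (Suc k)")
    case False
    then have b: "blk ls (Suc k) = Suc (blk ls k)" using blk_Suc[OF assms(2)] by auto
    then have "Suc (blk ls k) < length ls" using blk_less[OF assms(2)] by simp
    then have "u (start ls (blk ls k)) \<noteq> u (start ls (Suc (blk ls k)))"
      using assms(1) by (auto simp: diag_set_def)
    then show ?thesis using e b by auto
  qed (use e in auto)
qed

text \<open>Position 0 lies in block 0, and the equalities between neighbours tell at each further
  position whether a new block begins.\<close>

lemma diag_set_disjoint:
  assumes "u \<in> diag_set ls" "u \<in> diag_set ls'" "deg ls = deg ls'"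
  shows "ls = ls'"
proof (rule blk_inj[OF assms(3)])
  fix k assume "k < deg ls"
  then show "blk ls k = blk ls' k"
  proof (induction k)
    case (Suc k)
    have "blk ls k = blk ls (Suc k) \<longleftrightarrow> blk ls' k = blk ls' (Suc k)"
      using diag_set_adjacent[OF assms(1)] diag_set_adjacent[OF assms(2)] Suc.prems assms(3) by auto
    moreover have "blk ls k = blk ls' k" using Suc by auto
    ultimately show ?case using Suc.prems blk_Suc[of k ls] blk_Suc[of k ls'] assms(3) by metis
  qed simp
qed

lemma diag_set_measurable:
  "diag_set ls \<in> sets (borel :: (nat \<Rightarrow> 'b::{t2_space, second_countable_topology}) measure)"
proof -
  have c: "{u :: nat \<Rightarrow> 'b. u i = u j} \<in> sets borel" for i j
    by (intro borel_closed closed_Collect_eq continuous_on_product_coordinates)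
  have "diag_set ls = (\<Inter>k\<in>{..<deg ls}. {u :: nat \<Rightarrow> 'b. u k = u (start ls (blk ls k))})
     \<inter> (\<Inter>j\<in>{j. Suc j < length ls}. - {u. u (start ls j) = u (start ls (Suc j))})"
    by (auto simp: diag_set_def)
  also have "\<dots> \<in> sets borel"
  proof (cases "ls = []")
    case True
    then show ?thesis by simp
  next
    case False
    have "(\<Inter>k\<in>{..<deg ls}. {u :: nat \<Rightarrow> 'b. u k = u (start ls (blk ls k))}) \<in> sets borel"
      using False c by (intro sets.finite_INT) (auto simp: deg_def)
    moreover have "(\<Inter>j\<in>{j. Suc j < length ls}. - {u :: nat \<Rightarrow> 'b. u (start ls j) = u (start ls (Suc j))}) \<in> sets borel"
    proof (cases "{j. Suc j < length ls} = {}")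
      case ne: False
      have "finite {j. Suc j < length ls}" by (rule finite_subset[of _ "{..<length ls}"]) auto
      then show ?thesis using ne c by (intro sets.finite_INT) (auto simp: borel_comp)
    next
      case True
      show ?thesis unfolding True by simp
    qed
    ultimately show ?thesis by (rule sets.Int)
  qed
  finally show ?thesis .
qed

lemma measurable_reindex_borel:
  fixes f :: "nat \<Rightarrow> nat"
  shows "(\<lambda>u i. u (f i)) \<in> borel_measurable (borel :: (nat \<Rightarrow> 'b::second_countable_topology) measure)"
  by (rule measurable_coordinatewise_then_product) (rule measurable_product_coordinates)

lemma spread_measurable:
  assumes "\<And>j. j \<in> I \<Longrightarrow> sets (N j) = sets (borel :: 'b::second_countable_topology measure)" "I = {..<length ls}"
  shows "spread ls \<in> PiM I N \<rightarrow>\<^sub>M (\<Pi>\<^sub>M k\<in>{..<deg ls}. (borel :: 'b measure))"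
proof -
  have "(\<lambda>t. \<lambda>k\<in>{..<deg ls}. t (blk ls k)) \<in> PiM I N \<rightarrow>\<^sub>M (\<Pi>\<^sub>M k\<in>{..<deg ls}. (borel :: 'b measure))"
  proof (rule measurable_restrict)
    fix k assume "k \<in> {..<deg ls}"
    then have b: "blk ls k \<in> I" using blk_less assms(2) by auto
    then show "(\<lambda>t. t (blk ls k)) \<in> borel_measurable (PiM I N)"
      using measurable_component_singleton[OF b, of N] measurable_cong_sets[OF refl assms(1)[OF b], of "PiM I N"]
      by blast
  qed
  then show ?thesis by (simp add: spread_eq[abs_def])
qed

lemma nn_integral_sum_measure:
  assumes sets: "\<And>i. i \<in> I \<Longrightarrow> sets (N i) = sets M"
    and em: "\<And>A. A \<in> sets M \<Longrightarrow> emeasure M A = (\<Sum>i\<in>I. emeasure (N i) A)"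
    and f: "f \<in> borel_measurable M"
  shows "(\<integral>\<^sup>+x. f x \<partial>M) = (\<Sum>i\<in>I. \<integral>\<^sup>+x. f x \<partial>N i)"
  using f
proof (induction rule: borel_measurable_induct)
  case (cong f g)
  have "(\<integral>\<^sup>+x. f x \<partial>M) = (\<integral>\<^sup>+x. g x \<partial>M)" using cong by (intro nn_integral_cong) auto
  moreover have "(\<integral>\<^sup>+x. f x \<partial>N i) = (\<integral>\<^sup>+x. g x \<partial>N i)" if "i \<in> I" for i
    using cong sets_eq_imp_space_eq[OF sets[OF that]] by (intro nn_integral_cong) auto
  ultimately show ?case using cong by simp
next
  case (set A)
  then show ?case using sets em by simp
next
  case (mult u c)
  have "u \<in> borel_measurable (N i)" if "i \<in> I" for i using mult(2) measurable_cong_sets[OF sets[OF that] refl] by blast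
  then show ?case using mult by (simp add: nn_integral_cmult sum_distrib_left)
next
  case (add u v)
  have "u \<in> borel_measurable (N i)" "v \<in> borel_measurable (N i)" if "i \<in> I" for i
    using add measurable_cong_sets[OF sets[OF that] refl] by blast+
  then show ?case using add by (simp add: nn_integral_add sum.distrib)
next
  case (seq U)
  have m: "U j \<in> borel_measurable (N i)" if "i \<in> I" for i j
    using seq measurable_cong_sets[OF sets[OF that] refl] by blast
  have inc: "incseq (\<lambda>j. \<integral>\<^sup>+x. U j x \<partial>N i)" for i
    using seq(3) by (auto simp: incseq_def le_fun_def intro!: nn_integral_mono)
  have "(\<integral>\<^sup>+x. (SUP j. U j x) \<partial>M) = (SUP j. \<integral>\<^sup>+x. U j x \<partial>M)"
    using seq by (intro nn_integral_monotone_convergence_SUP) auto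
  also have "\<dots> = (SUP j. \<Sum>i\<in>I. \<integral>\<^sup>+x. U j x \<partial>N i)" using seq by simp
  also have "\<dots> = (\<Sum>i\<in>I. SUP j. \<integral>\<^sup>+x. U j x \<partial>N i)"
    using inc by (intro ennreal_SUP_sum) auto
  also have "\<dots> = (\<Sum>i\<in>I. \<integral>\<^sup>+x. (SUP j. U j x) \<partial>N i)"
    using seq m by (intro sum.cong refl nn_integral_monotone_convergence_SUP[symmetric]) auto
  finally show ?case by (simp add: image_comp)
qed

context jac_process
begin

section \<open>Integration against \<gamma>_n and gluing over strata\<close>

abbreviation "ext \<equiv> ext_fock \<sigma> \<mu>"

lemma gamma_ls_eq: "gamma_ls \<sigma> \<mu> ls = distr (SP ls) (\<Pi>\<^sub>M k\<in>{..<deg ls}. borel) (spread ls)"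
  by (simp add: gamma_ls_def SP_def deg_def)

lemma spread_measurable_SP [measurable]: "spread ls \<in> SP ls \<rightarrow>\<^sub>M (\<Pi>\<^sub>M k\<in>{..<deg ls}. borel)"
  unfolding SP_def by (rule spread_measurable) auto

lemma sets_ext: "sets (ext n) = sets (\<Pi>\<^sub>M k\<in>{..<n}. borel)"
proof -
  have "sets (\<Pi>\<^sub>M k\<in>{..<n}. (borel :: 'a measure)) \<subseteq> Pow (cart n)"
    using sets.space_closed[of "\<Pi>\<^sub>M k\<in>{..<n}. (borel :: 'a measure)"] by (simp add: space_PiM)
  moreover have "sigma_sets (cart n) (sets (\<Pi>\<^sub>M k\<in>{..<n}. (borel :: 'a measure))) = sets (\<Pi>\<^sub>M k\<in>{..<n}. borel)"
    using sets.sigma_sets_eq[of "\<Pi>\<^sub>M k\<in>{..<n}. (borel :: 'a measure)"] by (simp add: space_PiM)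
  ultimately show ?thesis by (simp add: ext_fock_def)
qed

lemma space_ext: "space (ext n) = cart n"
  using sets_eq_imp_space_eq[OF sets_ext[of n]] by (simp add: space_PiM)

lemma emeasure_ext:
  assumes A: "A \<in> sets (ext n)" shows "emeasure (ext n) A = (\<Sum>ls\<in>Sn n. emeasure (gamma_ls \<sigma> \<mu> ls) A)"
proof -
  let ?S = "sets (\<Pi>\<^sub>M k\<in>{..<n}. (borel :: 'a measure))"
  let ?m = "\<lambda>A. \<Sum>ls\<in>Sn n. emeasure (gamma_ls \<sigma> \<mu> ls) A"
  have e: "ext n = measure_of (cart n) ?S ?m"
    by (simp add: ext_fock_def Sn_def deg_def)
  have S: "?S \<subseteq> Pow (cart n)"
    using sets.space_closed[of "\<Pi>\<^sub>M k\<in>{..<n}. (borel :: 'a measure)"] by (simp add: space_PiM)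
  have ss: "sets (ext n) = ?S" by (rule sets_ext)
  show ?thesis
  proof (rule emeasure_measure_of[OF e S])
    show "positive (sets (ext n)) ?m" by (simp add: positive_def)
    show "countably_additive (sets (ext n)) ?m"
    proof (rule countably_additiveI)
      fix B :: "nat \<Rightarrow> (nat \<Rightarrow> 'a) set"
      assume B: "range B \<subseteq> sets (ext n)" "disjoint_family B" "(\<Union>i. B i) \<in> sets (ext n)"
      have "(\<Sum>i. ?m (B i)) = (\<Sum>ls\<in>Sn n. \<Sum>i. emeasure (gamma_ls \<sigma> \<mu> ls) (B i))"
        by (rule suminf_sum) simp
      also have "\<dots> = ?m (\<Union>i. B i)"
      proof (rule sum.cong[OF refl])
        fix ls assume "ls \<in> Sn n"
        then have "sets (gamma_ls \<sigma> \<mu> ls) = sets (ext n)" by (simp add: gamma_ls_eq ss Sn_def)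
        then show "(\<Sum>i. emeasure (gamma_ls \<sigma> \<mu> ls) (B i)) = emeasure (gamma_ls \<sigma> \<mu> ls) (\<Union>i. B i)"
          using B by (intro suminf_emeasure) auto
      qed
      finally show "(\<Sum>i. ?m (B i)) = ?m (\<Union>i. B i)" .
    qed
  qed (rule A)
qed

lemma sets_gamma: "ls \<in> Sn n \<Longrightarrow> sets (gamma_ls \<sigma> \<mu> ls) = sets (ext n)"
  by (simp add: gamma_ls_eq sets_ext Sn_def)

lemma nn_integral_ext:
  assumes f: "f \<in> borel_measurable (ext n)"
  shows "(\<integral>\<^sup>+u. f u \<partial>ext n) = (\<Sum>ls\<in>Sn n. \<integral>\<^sup>+t. f (spread ls t) \<partial>SP ls)"
proof -
  have "(\<integral>\<^sup>+u. f u \<partial>ext n) = (\<Sum>ls\<in>Sn n. \<integral>\<^sup>+u. f u \<partial>gamma_ls \<sigma> \<mu> ls)"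
    using nn_integral_sum_measure[OF sets_gamma emeasure_ext f] by blast
  also have "\<dots> = (\<Sum>ls\<in>Sn n. \<integral>\<^sup>+t. f (spread ls t) \<partial>SP ls)"
  proof (rule sum.cong[OF refl])
    fix ls assume ls: "ls \<in> Sn n"
    then have "f \<in> borel_measurable (gamma_ls \<sigma> \<mu> ls)"
      using f measurable_cong_sets[OF sets_gamma[OF ls] refl] by blast
    then show "(\<integral>\<^sup>+u. f u \<partial>gamma_ls \<sigma> \<mu> ls) = (\<integral>\<^sup>+t. f (spread ls t) \<partial>SP ls)"
      unfolding gamma_ls_eq by (intro nn_integral_distr) auto
  qed
  finally show ?thesis .
qed

lemma B0_spread:
  assumes "dep n h" "deg ls = n" shows "h (spread ls t) = h (\<lambda>k. t (blk ls k))"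
  by (rule depD[OF assms(1)]) (use assms(2) in \<open>simp add: spread_eq\<close>)

text \<open>Points have measure zero for \<open>\<sigma>\<close>, hence for every
  \<open>sigma_l\<close>, so for a fixed first coordinate the next one avoids it almost
  everywhere.\<close>

lemma adjacent_distinct_AE: "AE t in SP ls. \<forall>j. Suc j < length ls \<longrightarrow> t j \<noteq> t (Suc j)"
proof (induction ls)
  case (Cons l ls)
  let ?P = "\<lambda>t. \<forall>j. Suc j < length (l # ls) \<longrightarrow> t j \<noteq> t (Suc j)"
  have SPC: "SP (l # ls) = PiM {..<Suc (length ls)} (\<lambda>j. \<S> ((l # ls) ! j))"
    by (simp add: SP_def)
  have "AE t in PiM {..<Suc (length ls)} (\<lambda>j. \<S> ((l # ls) ! j)). ?P t"
  proof (rule AE_PiM_Suc_I)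
    show "sigma_finite_measure (\<S> ((l # ls) ! i))" for i by (rule sigma_finite_sigma_l)
    have c: "Measurable.pred (borel :: (nat \<Rightarrow> 'a) measure) (\<lambda>u. u i \<noteq> u j)" for i j
    proof -
      have "{u :: nat \<Rightarrow> 'a. u i = u j} \<in> sets borel"
        by (intro borel_closed closed_Collect_eq continuous_on_product_coordinates)
      then have "Measurable.pred (borel :: (nat \<Rightarrow> 'a) measure) (\<lambda>u. u i = u j)" by (simp add: pred_def)
      then show ?thesis by (rule pred_intros_logic)
    qed
    have "Measurable.pred (borel :: (nat \<Rightarrow> 'a) measure) ?P"
      by (intro pred_intros_countable pred_intros_logic c) simp
    then show "Measurable.pred (PiM {..<Suc (length ls)} (\<lambda>j. \<S> ((l # ls) ! j))) ?P"
      using measurable_compose[OF id_SP[of "l # ls", unfolded SPC], of ?P] by blast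
    have *: "AE t in SP ls. 0 < length ls \<longrightarrow> t 0 \<noteq> u" for u
    proof -
      have "AE t in SP ls. \<forall>i<length ls. t i \<noteq> u"
        unfolding SP_def
      proof (rule AE_PiM_coordinates)
        fix i
        have "AE x in \<sigma>. x \<noteq> u" using emeasure_singleton[of u]
          by (intro AE_I[of _ _ "{u}"]) auto
        then show "AE x in \<S> (ls ! i). x \<noteq> u" unfolding AE_sigma_l by eventually_elim simp
      qed (rule sigma_finite_sigma_l)
      then show ?thesis by eventually_elim auto
    qed
    have **: "AE t in SP ls. ?P (case_nat u t)" for u
      using *[of u] Cons
    proof eventually_elim
      case (elim t)
      show ?case
      proof (intro allI impI)
        fix j assume "Suc j < length (l # ls)"
        then show "case_nat u t j \<noteq> case_nat u t (Suc j)" using elim by (cases j) auto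
      qed
    qed
    show "AE u in \<S> ((l # ls) ! 0). AE t in PiM {..<length ls} (\<lambda>i. \<S> ((l # ls) ! Suc i)). ?P (case_nat u t)"
      by (rule AE_I2) (rule **[unfolded SP_def, folded nth_Cons_Suc[of l ls]])
  qed
  then show ?case unfolding SPC .
qed simp

text \<open>The measures \<open>\<gamma>\<^sup>(\<^sup>l\<^sup>s\<^sup>)\<close> live on disjoint sets, so their densities can be prescribed independently.\<close>
definition glue :: "nat \<Rightarrow> (nat list \<Rightarrow> (nat \<Rightarrow> 'a) \<Rightarrow> real) \<Rightarrow> (nat \<Rightarrow> 'a) \<Rightarrow> real"
  where "glue n h u = (\<Sum>ls\<in>Sn n. indicator (diag_set ls) u * h ls (\<lambda>j. u (start ls j)))"

text \<open>The repeated point lies almost everywhere in the stratum of \<open>ls\<close> and in no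
  other, so a single summand survives; \<open>blk_start\<close> undoes the repetition.\<close>

lemma glue_AE:
  assumes dep: "\<And>ls. ls \<in> Sn n \<Longrightarrow> dep (length ls) (h ls)" and ls: "ls \<in> Sn n"
  shows "AE t in SP ls. glue n h (\<lambda>k. t (blk ls k)) = h ls t"
  using adjacent_distinct_AE[of ls]
proof eventually_elim
  case (elim t)
  let ?u = "\<lambda>k. t (blk ls k)"
  have u: "?u \<in> diag_set ls"
    using elim blk_less[of _ ls] by (auto simp: diag_set_def)
  have "glue n h ?u = (\<Sum>ls'\<in>Sn n. if ls' = ls then h ls (\<lambda>j. ?u (start ls j)) else 0)"
    unfolding glue_def
  proof (intro sum.cong refl)
    fix ls' assume "ls' \<in> Sn n"
    then show "indicator (diag_set ls') ?u * h ls' (\<lambda>j. ?u (start ls' j))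
        = (if ls' = ls then h ls (\<lambda>j. ?u (start ls j)) else 0)"
      using diag_set_disjoint[OF u, of ls'] u ls by (auto simp: Sn_def indicator_def)
  qed
  also have "\<dots> = h ls (\<lambda>j. ?u (start ls j))" using ls by (simp add: sum.delta')
  also have "\<dots> = h ls t" by (rule depD[OF dep[OF ls]]) simp
  finally show ?case .
qed

lemma glue_B0:
  assumes h: "\<And>ls. ls \<in> Sn n \<Longrightarrow> B0 (length ls) (h ls)"
  shows "B0 n (glue n h)"
  unfolding glue_def[abs_def]
proof (rule B0_sum)
  fix ls assume ls: "ls \<in> Sn n"
  have n: "deg ls = n" using ls by (simp add: Sn_def)
  obtain C K where C: "C \<ge> 0" "compact K" "\<And>t. \<bar>h ls t\<bar> \<le> C" "\<And>t i. h ls t \<noteq> 0 \<Longrightarrow> i < length ls \<Longrightarrow> t i \<in> K"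
    using B0D(3)[OF h[OF ls]] by auto
  show "B0 n (\<lambda>u. indicator (diag_set ls) u * h ls (\<lambda>j. u (start ls j)))"
  proof (rule B0I[OF _ _ C(2), of _ _ C])
    have "(\<lambda>u. h ls (\<lambda>j. u (start ls j))) \<in> borel_measurable borel"
      by (rule measurable_compose[OF measurable_reindex_borel B0D(1)[OF h[OF ls]]])
    then show "(\<lambda>u. indicator (diag_set ls) u * h ls (\<lambda>j. u (start ls j))) \<in> borel_measurable borel"
      using diag_set_measurable[of ls] by (intro borel_measurable_times borel_measurable_indicator)
    show "dep n (\<lambda>u. indicator (diag_set ls) u * h ls (\<lambda>j. u (start ls j)))"
      unfolding dep_def
    proof (intro allI impI)
      fix t t' :: "nat \<Rightarrow> 'a" assume e: "\<forall>i<n. t i = t' i"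
      have s: "t (start ls j) = t' (start ls j)" if "j < length ls" for j
        using e start_less[OF that] n by auto
      have "t \<in> diag_set ls \<longleftrightarrow> t' \<in> diag_set ls"
        using s e blk_less[of _ ls] n by (auto simp: diag_set_def)
      moreover have "h ls (\<lambda>j. t (start ls j)) = h ls (\<lambda>j. t' (start ls j))"
        by (rule depD[OF B0D(2)[OF h[OF ls]]]) (rule s)
      ultimately show "indicator (diag_set ls) t * h ls (\<lambda>j. t (start ls j)) = indicator (diag_set ls) t' * h ls (\<lambda>j. t' (start ls j))"
        by (simp add: indicator_def)
    qed
    show "\<bar>indicator (diag_set ls) u * h ls (\<lambda>j. u (start ls j))\<bar> \<le> C" for u
      using C by (simp add: indicator_def)
    fix u i assume a: "indicator (diag_set ls) u * h ls (\<lambda>j. u (start ls j)) \<noteq> 0" "i < n"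
    then have "u \<in> diag_set ls" "h ls (\<lambda>j. u (start ls j)) \<noteq> 0" by (auto simp: indicator_def split: if_splits)
    then show "u i \<in> K" using C(4)[of "\<lambda>j. u (start ls j)" "blk ls i"] a(2) blk_less[of i ls] n by (auto simp: diag_set_def)
  qed
qed

end

section \<open>Test functions and density\<close>

lemma C0D:
  assumes "C0 N h"
  shows "continuous_on UNIV h" "dep N h" "\<exists>K. compact K \<and> (\<forall>t i. h t \<noteq> 0 \<longrightarrow> i < N \<longrightarrow> t i \<in> K)"
  using assms by (auto simp: C0_def)

lemma C0I:
  assumes "continuous_on UNIV h" "dep N h" "compact K" "\<And>t i. h t \<noteq> 0 \<Longrightarrow> i < N \<Longrightarrow> t i \<in> K"
  shows "C0 N h"
  using assms unfolding C0_def by blast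

lemma compact_box:
  fixes K :: "'b::topological_space set"
  assumes "compact K" shows "compact {t :: nat \<Rightarrow> 'b. \<forall>i. if i < N then t i \<in> K else t i = c}"
proof -
  have "compactin (product_topology (\<lambda>_. euclidean) UNIV) (PiE UNIV (\<lambda>i. if i < N then K else {c}))"
    by (subst compactin_PiE) (use assms in auto)
  moreover have "PiE UNIV (\<lambda>i. if i < N then K else {c}) = {t. \<forall>i. if i < N then t i \<in> K else t i = c}"
    by (auto simp: PiE_UNIV_domain split: if_splits)
  ultimately show ?thesis by (simp add: euclidean_product_topology)
qed

lemma C0_imp_B0:
  fixes h :: "(nat \<Rightarrow> 'b::second_countable_topology) \<Rightarrow> real"
  assumes "C0 N h" shows "B0 N h"
proof -
  obtain K where K: "compact K" "\<And>t i. h t \<noteq> 0 \<Longrightarrow> i < N \<Longrightarrow> t i \<in> K" using C0D(3)[OF assms] by auto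
  \<comment> \<open>An arbitrary point that fills the coordinates on which \<open>h\<close> does not
    depend; the box \<open>?B\<close> is then compact in the whole sequence space.\<close>
  obtain c :: 'b where True by simp
  let ?B = "{t :: nat \<Rightarrow> 'b. \<forall>i. if i < N then t i \<in> K else t i = c}"
  have "compact (h ` ?B)"
    using compact_continuous_image[OF continuous_on_subset[OF C0D(1)[OF assms]] compact_box[OF K(1)]] by auto
  then have "bounded (h ` ?B)" by (rule compact_imp_bounded)
  then obtain C where C: "\<And>t. t \<in> ?B \<Longrightarrow> \<bar>h t\<bar> \<le> C" by (auto simp: bounded_iff)
  show ?thesis
  proof (rule B0I[OF _ C0D(2)[OF assms] K(1), of "\<bar>C\<bar>"])
    show "h \<in> borel_measurable borel" by (rule borel_measurable_continuous_onI[OF C0D(1)[OF assms]])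
    fix t
    show "\<bar>h t\<bar> \<le> \<bar>C\<bar>"
    proof (cases "h t = 0")
      case False
      let ?t = "\<lambda>i. if i < N then t i else c"
      have "h t = h ?t" by (rule depD[OF C0D(2)[OF assms]]) simp
      moreover have "\<forall>i. if i < N then ?t i \<in> K else ?t i = c" using K(2)[OF False] by simp
      then have "?t \<in> ?B" by simp
      ultimately show ?thesis using C[of ?t] abs_ge_self[of C] by linarith
    qed simp
  qed (use K in auto)
qed

lemma C0_zero: "C0 N (\<lambda>_. 0)"
  by (rule C0I[of _ _ "{}"]) (auto simp: dep_def)

lemma C0_mult:
  assumes h: "C0 N h" and g: "continuous_on UNIV g" "dep N g" shows "C0 N (\<lambda>t. g t * h t)"
proof -
  obtain K where K: "compact K" "\<And>t i. h t \<noteq> 0 \<Longrightarrow> i < N \<Longrightarrow> t i \<in> K" using C0D(3)[OF h] by auto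
  show ?thesis
  proof (rule C0I[OF _ _ K(1)])
    show "continuous_on UNIV (\<lambda>t. g t * h t)" by (intro continuous_on_mult g C0D(1)[OF h])
    show "dep N (\<lambda>t. g t * h t)" using g(2) C0D(2)[OF h] unfolding dep_def by metis
  qed (use K in auto)
qed

lemma C0_cmult: "C0 N h \<Longrightarrow> C0 N (\<lambda>t. c * h t)"
  by (rule C0_mult) (auto simp: dep_def)

lemma C0_iff: "C0 N h \<longleftrightarrow> continuous_on UNIV h \<and> B0 N h"
  for h :: "(nat \<Rightarrow> 'b::second_countable_topology) \<Rightarrow> real"
  using C0D(1) C0_imp_B0 B0D(2,3) C0I by metis

lemma C0_add: "C0 N h \<Longrightarrow> C0 N g \<Longrightarrow> C0 N (\<lambda>t. h t + g t)"
  for h :: "(nat \<Rightarrow> 'b::second_countable_topology) \<Rightarrow> real"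
  by (simp add: C0_iff B0_add continuous_on_add)

lemma C0_diff: "C0 N (h :: (nat \<Rightarrow> 'b::second_countable_topology) \<Rightarrow> real) \<Longrightarrow> C0 N g \<Longrightarrow> C0 N (\<lambda>t. h t - g t)"
  using C0_add[of N h "\<lambda>t. (-1) * g t"] C0_cmult[of N g "-1"] by simp

lemma continuous_map_inclusion_cart:
  "continuous_map (cart_top n) euclidean (\<lambda>t. t :: nat \<Rightarrow> 'b::topological_space)"
proof -
  have "continuous_map (cart_top n) (product_topology (\<lambda>_. euclidean) UNIV) (\<lambda>t. t :: nat \<Rightarrow> 'b)"
    unfolding continuous_map_componentwise_UNIV
  proof
    fix k
    show "continuous_map (cart_top n) euclidean (\<lambda>t. t k :: 'b)"
    proof (cases "k < n")
      case True
      then show ?thesis by (intro continuous_map_product_projection) simp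
    next
      case False
      have "continuous_map (cart_top n) euclidean (\<lambda>t :: nat \<Rightarrow> 'b. undefined :: 'b)" by simp
      then show ?thesis
        by (rule continuous_map_eq) (use False in \<open>auto simp: PiE_def extensional_def\<close>)
    qed
  qed
  then show ?thesis by (simp add: euclidean_product_topology)
qed

lemma Hausdorff_space_euclidean_t2: "Hausdorff_space (euclidean :: 'b::t2_space topology)"
  unfolding Hausdorff_space_def by (metis hausdorff disjnt_def open_openin)

lemma C0_imp_test:
  fixes h :: "(nat \<Rightarrow> 'b::t2_space) \<Rightarrow> real"
  assumes h: "C0 n h" shows "h \<in> test n"
proof -
  obtain K where K: "compact K" "\<And>t i. h t \<noteq> 0 \<Longrightarrow> i < n \<Longrightarrow> t i \<in> K" using C0D(3)[OF h] by auto
  have "continuous_map (cart_top n) euclideanreal (h \<circ> (\<lambda>t. t))"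
    by (rule continuous_map_compose[OF continuous_map_inclusion_cart]) (use C0D(1)[OF h] in simp)
  then have c: "continuous_map (cart_top n) euclideanreal h" by (simp add: o_def)
  let ?B = "PiE {..<n} (\<lambda>_. K)"
  have B: "compactin (cart_top n) ?B" by (subst compactin_PiE) (use K in auto)
  have "Hausdorff_space (cart_top n :: (nat \<Rightarrow> 'b) topology)"
    by (simp add: Hausdorff_space_product_topology Hausdorff_space_euclidean_t2)
  then have cl: "closedin (cart_top n) ?B" using B compactin_imp_closedin by blast
  have "{t \<in> cart n. h t \<noteq> 0} \<subseteq> ?B"
  proof
    fix t assume t: "t \<in> {t \<in> cart n. h t \<noteq> 0}"
    show "t \<in> ?B"
    proof (rule PiE_I)
      fix i assume "i \<in> {..<n}" then show "t i \<in> K" using K(2) t by auto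
    next
      fix i assume "i \<notin> {..<n}" then show "t i = undefined" using PiE_arb[of t "{..<n}" "\<lambda>_. UNIV" i] t by auto
    qed
  qed
  then have "cart_top n closure_of {t \<in> cart n. h t \<noteq> 0} \<subseteq> ?B" by (rule closure_of_minimal[OF _ cl])
  then have "compactin (cart_top n) (cart_top n closure_of {t \<in> cart n. h t \<noteq> 0})"
    by (rule closed_compactin[OF B]) simp
  with c show ?thesis by (simp add: test_def)
qed

text \<open>Transfers functions on T^n, whose values elsewhere are arbitrary, to the encoding on the
  sequence space.\<close>

definition ext_seq :: "nat \<Rightarrow> ((nat \<Rightarrow> 'b) \<Rightarrow> 'c) \<Rightarrow> (nat \<Rightarrow> 'b) \<Rightarrow> 'c"
  where "ext_seq n f t = f (restrict t {..<n})"

lemma dep_ext_seq: "dep n (ext_seq n f)"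
  unfolding dep_def ext_seq_def
  by (intro allI impI arg_cong[where f = f]) (auto simp: restrict_def fun_eq_iff)

lemma ext_seq_cart: "t \<in> cart n \<Longrightarrow> ext_seq n f t = f t"
  by (simp add: ext_seq_def PiE_def extensional_restrict)

text \<open>The union of the coordinate projections of the compact support serves as the set
  \<open>K\<close> in the box condition.\<close>

lemma test_imp_C0:
  fixes f :: "(nat \<Rightarrow> 'b::topological_space) \<Rightarrow> real"
  assumes f: "f \<in> test n" shows "C0 n (ext_seq n f)"
proof -
  let ?S = "cart_top n closure_of {t \<in> cart n. f t \<noteq> 0}"
  have S: "compactin (cart_top n) ?S" and c: "continuous_map (cart_top n) euclideanreal f"
    using f by (auto simp: test_def)
  have r: "continuous_map euclidean (cart_top n) (\<lambda>t :: nat \<Rightarrow> 'b. restrict t {..<n})"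
  proof -
    have "continuous_map euclidean euclidean (\<lambda>t :: nat \<Rightarrow> 'b. t k)" for k
      by (simp add: continuous_on_product_coordinates)
    then show ?thesis by (auto simp: continuous_map_componentwise)
  qed
  define K where "K = (\<Union>i<n. (\<lambda>t. t i) ` ?S)"
  have "compactin euclidean ((\<lambda>t. t i) ` ?S)" if "i < n" for i
    using that by (intro image_compactin[OF S] continuous_map_product_projection) simp
  then have K: "compact K" unfolding K_def by (intro compact_UN) auto
  show ?thesis
  proof (rule C0I[OF _ dep_ext_seq K])
    have "continuous_map euclidean euclideanreal (f \<circ> (\<lambda>t. restrict t {..<n}))"
      by (rule continuous_map_compose[OF r c])
    then show "continuous_on UNIV (ext_seq n f)" by (simp add: ext_seq_def o_def)
    fix t i assume a: "ext_seq n f t \<noteq> 0" "i < n"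
    then have "restrict t {..<n} \<in> {t \<in> cart n. f t \<noteq> 0}" by (auto simp: ext_seq_def)
    moreover have "{t \<in> cart n. f t \<noteq> 0} \<subseteq> ?S" by (rule closure_of_subset) auto
    ultimately have "restrict t {..<n} \<in> ?S" by blast
    then have "restrict t {..<n} i \<in> K" using a(2) unfolding K_def by blast
    then show "t i \<in> K" using a(2) by simp
  qed
qed

context jac_process
begin

text \<open>Complete regularity gives a bump at each point of \<open>W\<close>, and by the Lindelof
  property countably many bumps suffice for the sets where they exceed 1/2 to cover
  \<open>W\<close>.\<close>

lemma cutoff_functions:
  assumes W: "open (W :: 'a set)"
  obtains f :: "nat \<Rightarrow> 'a \<Rightarrow> real" where "\<And>k. continuous_on UNIV (f k)" "\<And>k t. 0 \<le> f k t" "\<And>k t. f k t \<le> 1"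
    "\<And>k t. t \<notin> W \<Longrightarrow> f k t = 0" "\<And>t. t \<in> W \<Longrightarrow> (\<lambda>k. f k t) \<longlonglongrightarrow> 1"
proof -
  have cr: "completely_regular_space (euclidean :: 'a topology)"
    by (intro locally_compact_regular_imp_completely_regular_space loc_compact disjI1 Hausdorff_space_euclidean_t2)
  have "\<exists>g :: 'a \<Rightarrow> real. continuous_on UNIV g \<and> (\<forall>t. 0 \<le> g t) \<and> g x = 1 \<and> (\<forall>t. t \<notin> W \<longrightarrow> g t = 0)" if x: "x \<in> W" for x
  proof -
    obtain f where f: "continuous_map euclidean (top_of_set {0..1}) f" "f ` (- W) \<subseteq> {0::real}" "f ` {x} \<subseteq> {1}"
      by (rule Urysohn_completely_regular_compact_closed[OF zero_le_one cr, of "{x}" "- W"])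
        (use W x in \<open>auto simp: disjnt_def\<close>)
    have "continuous_on UNIV f" "f t \<in> {0..1}" for t
      using f(1) by (auto simp: continuous_map_in_subtopology)
    then show ?thesis
      using f(2,3) by (intro exI[of _ f]) auto
  qed
  then obtain g :: "'a \<Rightarrow> 'a \<Rightarrow> real" where g: "\<And>x. x \<in> W \<Longrightarrow> continuous_on UNIV (g x)" "\<And>x t. x \<in> W \<Longrightarrow> 0 \<le> g x t"
     "\<And>x. x \<in> W \<Longrightarrow> g x x = 1" "\<And>x t. x \<in> W \<Longrightarrow> t \<notin> W \<Longrightarrow> g x t = 0" by metis
  define F where "F = (\<lambda>x. {t. g x t > 1/2}) ` W"
  have Fo: "open S" if "S \<in> F" for S
    using that g(1) by (auto simp: F_def intro!: open_Collect_less continuous_intros)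
  have FO: "\<Union>F = W"
  proof (rule equalityI)
    show "\<Union>F \<subseteq> W"
    proof
      fix t assume "t \<in> \<Union>F"
      then obtain x where "x \<in> W" "g x t > 1/2" by (auto simp: F_def)
      then show "t \<in> W" using g(4)[of x t] by (cases "t \<in> W") auto
    qed
    show "W \<subseteq> \<Union>F" using g(3) by (auto simp: F_def)
  qed
  obtain F' where F': "F' \<subseteq> F" "countable F'" "\<Union>F' = \<Union>F" using Lindelof[OF Fo] by metis
  obtain X where X: "X \<subseteq> W" "countable X" "F' = (\<lambda>x. {t. g x t > 1/2}) ` X"
    using F'(1,2) countable_subset_image[of F' "\<lambda>x. {t. g x t > 1/2}" W] unfolding F_def by blast
  show ?thesis
  proof (cases "X = {}")
    case True
    then have "W = {}" using X F' FO by auto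
    then show ?thesis by (intro that[of "\<lambda>_ _. 0"]) auto
  next
    case False
    define x where "x = from_nat_into X"
    have x: "range x = X" unfolding x_def using False X(2) by (rule range_from_nat_into)
    have xO: "x i \<in> W" for i using x X(1) by auto
    \<comment> \<open>The factor \<open>k\<close> drives the sum beyond 1: once \<open>k\<close> is
      at least \<open>i + 2\<close>, the bump at \<open>x i\<close> with value above 1/2 is among
      the summands and is multiplied by at least 2.\<close>
    define f where "f k t = min 1 (real k * (\<Sum>i<k. g (x i) t))" for k t
    have s0: "0 \<le> (\<Sum>i<k. g (x i) t)" for k t using g(2) xO by (intro sum_nonneg) auto
    show ?thesis
    proof (rule that[of f])
      show "continuous_on UNIV (f k)" for k
        unfolding f_def using g(1)[OF xO] by (intro continuous_intros) auto
      show "0 \<le> f k t" "f k t \<le> 1" for k t using s0[of t k] by (auto simp: f_def)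
      show "f k t = 0" if "t \<notin> W" for k t using g(4)[OF xO that] by (simp add: f_def)
      fix t assume "t \<in> W"
      then have "t \<in> \<Union>F'" using F' FO by simp
      then obtain y where "y \<in> X" "g y t > 1/2" using X(3) by auto
      then obtain i where i: "g (x i) t > 1/2" using x by auto
      have "f k t = 1" if "k \<ge> i + 2" for k
      proof -
        have "1/2 < g (x i) t" by (rule i)
        also have "g (x i) t \<le> (\<Sum>i<k. g (x i) t)"
          using that g(2)[OF xO] by (intro member_le_sum) auto
        finally have "real 2 * (1/2) \<le> real k * (\<Sum>i<k. g (x i) t)"
          using that s0[of t k] by (intro mult_mono) auto
        then show ?thesis by (simp add: f_def)
      qed
      then have "eventually (\<lambda>k. f k t = 1) sequentially" by (auto simp: eventually_sequentially)
      then show "(\<lambda>k. f k t) \<longlonglongrightarrow> 1" by (rule tendsto_eventually)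
    qed
  qed
qed

section \<open>Density of continuous kernels in L2 of \<gamma>_n\<close>

lemma measurable_extI: "f \<in> borel_measurable borel \<Longrightarrow> f \<in> borel_measurable (ext n)"
proof -
  assume f: "f \<in> borel_measurable borel"
  have "(\<lambda>x. x) \<in> borel_measurable (\<Pi>\<^sub>M k\<in>{..<n}. (borel :: 'a measure))" by (rule measurable_PiM_borel) simp
  from measurable_compose[OF this f] show ?thesis by (simp add: measurable_cong_sets[OF sets_ext refl])
qed

lemma C0_borel: "C0 n (f :: (nat \<Rightarrow> 'a) \<Rightarrow> real) \<Longrightarrow> f \<in> borel_measurable borel"
  using borel_measurable_continuous_onI C0D(1) by blast

lemma box_ext_sets: "A \<in> sets borel \<Longrightarrow> PiE {..<n} (\<lambda>_. A) \<in> sets (ext n)"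
  unfolding sets_ext by (intro sets_PiM_I_finite) auto

text \<open>\<open>spread\<close> repeats coordinates without losing any, so a repeated point lies
  in the box only if the original one does.\<close>

lemma box_ext_finite:
  assumes K: "compact K" shows "emeasure (ext n) (PiE {..<n} (\<lambda>_. K)) < \<infinity>"
proof -
  have "emeasure (ext n) (PiE {..<n} (\<lambda>_. K)) = (\<integral>\<^sup>+u. indicator (PiE {..<n} (\<lambda>_. K)) u \<partial>ext n)"
    using box_ext_sets[OF compact_sets_borel[OF K]] by simp
  also have "\<dots> = (\<Sum>ls\<in>Sn n. \<integral>\<^sup>+t. indicator (PiE {..<n} (\<lambda>_. K)) (spread ls t) \<partial>SP ls)"
    using box_ext_sets[OF compact_sets_borel[OF K]] by (intro nn_integral_ext) auto
  also have "\<dots> \<le> (\<Sum>ls\<in>Sn n. \<integral>\<^sup>+t. indicator (PiE {..<length ls} (\<lambda>_. K)) t \<partial>SP ls)"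
  proof (intro sum_mono nn_integral_mono)
    fix ls t assume ls: "ls \<in> Sn n" and t: "t \<in> space (SP ls)"
    show "indicator (PiE {..<n} (\<lambda>_. K)) (spread ls t) \<le> (indicator (PiE {..<length ls} (\<lambda>_. K)) t :: ennreal)"
    proof (cases "spread ls t \<in> PiE {..<n} (\<lambda>_. K)")
      case True
      have "t j \<in> K" if "j < length ls" for j
      proof -
        have s: "start ls j < n" using start_less[OF that] ls by (simp add: Sn_def)
        then have "spread ls t (start ls j) \<in> K" using True by (auto simp: PiE_iff)
        then show ?thesis using s that ls by (simp add: spread_eq Sn_def)
      qed
      then have "t \<in> PiE {..<length ls} (\<lambda>_. K)" using t by (auto simp: space_SP PiE_iff)
      then show ?thesis by (simp add: indicator_def)
    qed simp
  qed
  also have "\<dots> = (\<Sum>ls\<in>Sn n. emeasure (SP ls) (PiE {..<length ls} (\<lambda>_. K)))"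
    using K by (intro sum.cong refl nn_integral_indicator) (auto simp: SP_def intro!: sets_PiM_I_finite)
  also have "\<dots> < \<infinity>" using SP_box_finite[OF K] by (simp add: less_top[symmetric] less_imp_neq)
  finally show ?thesis .
qed

text \<open>Membership in the L2 closure of the continuous kernels, stated with nonnegative
  integrals so that no integrability of \<open>f\<close> is presupposed.\<close>

definition approx :: "nat \<Rightarrow> ((nat \<Rightarrow> 'a) \<Rightarrow> real) \<Rightarrow> bool"
  where "approx n f \<longleftrightarrow> f \<in> borel_measurable (ext n) \<and>
    (\<forall>e>0. \<exists>\<phi>. C0 n \<phi> \<and> (\<integral>\<^sup>+u. ennreal ((f u - \<phi> u)\<^sup>2) \<partial>ext n) < ennreal e)"

lemma sq_add_le: "ennreal ((a + b)\<^sup>2) \<le> 2 * ennreal (a\<^sup>2) + 2 * ennreal ((b::real)\<^sup>2)"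
proof -
  have "(a + b)\<^sup>2 \<le> 2 * a\<^sup>2 + 2 * b\<^sup>2" using sum_squares_bound[of a b] by (simp add: power2_sum)
  then have "ennreal ((a + b)\<^sup>2) \<le> ennreal (2 * a\<^sup>2 + 2 * b\<^sup>2)" by (rule ennreal_leI)
  also have "\<dots> = 2 * ennreal (a\<^sup>2) + 2 * ennreal (b\<^sup>2)" by (simp add: ennreal_mult)
  finally show ?thesis .
qed

lemma nn_integral_sq_add_le:
  assumes "f \<in> borel_measurable M" "g \<in> borel_measurable M"
  shows "(\<integral>\<^sup>+u. ennreal ((f u + g u)\<^sup>2) \<partial>M) \<le> 2 * (\<integral>\<^sup>+u. ennreal ((f u)\<^sup>2) \<partial>M) + 2 * (\<integral>\<^sup>+u. ennreal ((g u :: real)\<^sup>2) \<partial>M)"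
proof -
  have "(\<integral>\<^sup>+u. ennreal ((f u + g u)\<^sup>2) \<partial>M) \<le> (\<integral>\<^sup>+u. 2 * ennreal ((f u)\<^sup>2) + 2 * ennreal ((g u)\<^sup>2) \<partial>M)"
    by (intro nn_integral_mono sq_add_le)
  also have "\<dots> = 2 * (\<integral>\<^sup>+u. ennreal ((f u)\<^sup>2) \<partial>M) + 2 * (\<integral>\<^sup>+u. ennreal ((g u)\<^sup>2) \<partial>M)"
    using assms by (simp add: nn_integral_add nn_integral_cmult)
  finally show ?thesis .
qed

lemma approx_limit:
  assumes f: "f \<in> borel_measurable (ext n)" and g: "\<And>k. approx n (g k)"
    and lim: "(\<lambda>k. \<integral>\<^sup>+u. ennreal ((f u - g k u)\<^sup>2) \<partial>ext n) \<longlonglongrightarrow> 0"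
  shows "approx n f"
  unfolding approx_def
proof (intro conjI f allI impI)
  fix e :: real assume e: "e > 0"
  have "eventually (\<lambda>k. (\<integral>\<^sup>+u. ennreal ((f u - g k u)\<^sup>2) \<partial>ext n) < ennreal (e/4)) sequentially"
    using e by (intro order_tendstoD(2)[OF lim]) simp
  then obtain k where k: "(\<integral>\<^sup>+u. ennreal ((f u - g k u)\<^sup>2) \<partial>ext n) < ennreal (e/4)"
    by (auto simp: eventually_sequentially)
  obtain \<phi> where p: "C0 n \<phi>" "(\<integral>\<^sup>+u. ennreal ((g k u - \<phi> u)\<^sup>2) \<partial>ext n) < ennreal (e/4)"
    using g[of k] e unfolding approx_def by (metis zero_less_divide_iff zero_less_numeral)
  have m: "g k \<in> borel_measurable (ext n)" "\<phi> \<in> borel_measurable (ext n)"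
    using g[of k] C0_borel[OF p(1)] by (auto simp: approx_def intro: measurable_extI)
  have "(\<integral>\<^sup>+u. ennreal ((f u - \<phi> u)\<^sup>2) \<partial>ext n) = (\<integral>\<^sup>+u. ennreal (((f u - g k u) + (g k u - \<phi> u))\<^sup>2) \<partial>ext n)" by simp
  also have "\<dots> \<le> 2 * (\<integral>\<^sup>+u. ennreal ((f u - g k u)\<^sup>2) \<partial>ext n) + 2 * (\<integral>\<^sup>+u. ennreal ((g k u - \<phi> u)\<^sup>2) \<partial>ext n)"
    using f m by (intro nn_integral_sq_add_le) auto
  also have "\<dots> < 2 * ennreal (e/4) + 2 * ennreal (e/4)"
    using k p(2) by (intro add_strict_mono ennreal_mult_strict_left_mono) auto
  also have "\<dots> = ennreal e" using e by (simp flip: ennreal_plus ennreal_numeral ennreal_mult)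
  finally show "\<exists>\<phi>. C0 n \<phi> \<and> (\<integral>\<^sup>+u. ennreal ((f u - \<phi> u)\<^sup>2) \<partial>ext n) < ennreal e" using p(1) by blast
qed

lemma approx_C0: "C0 n f \<Longrightarrow> approx n f"
proof -
  assume f: "C0 n f"
  have "(\<integral>\<^sup>+u. ennreal ((f u - f u)\<^sup>2) \<partial>ext n) < ennreal e" if "e > 0" for e using that by simp
  then show ?thesis unfolding approx_def using measurable_extI[OF C0_borel[OF f]] f by blast
qed

lemma approx_add:
  assumes f: "approx n f" and g: "approx n g" shows "approx n (\<lambda>u. f u + g u)"
  unfolding approx_def
proof (intro conjI allI impI)
  have mf: "f \<in> borel_measurable (ext n)" "g \<in> borel_measurable (ext n)" using f g by (auto simp: approx_def)
  then show "(\<lambda>u. f u + g u) \<in> borel_measurable (ext n)" by simp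
  fix e :: real assume e: "e > 0"
  then have e4: "e / 4 > 0" by simp
  obtain \<phi> where p: "C0 n \<phi>" "(\<integral>\<^sup>+u. ennreal ((f u - \<phi> u)\<^sup>2) \<partial>ext n) < ennreal (e/4)"
    using f e4 unfolding approx_def by blast
  obtain \<psi> where q: "C0 n \<psi>" "(\<integral>\<^sup>+u. ennreal ((g u - \<psi> u)\<^sup>2) \<partial>ext n) < ennreal (e/4)"
    using g e4 unfolding approx_def by blast
  have m: "\<psi> \<in> borel_measurable (ext n)" "\<phi> \<in> borel_measurable (ext n)"
    using C0_borel[OF p(1)] C0_borel[OF q(1)] by (auto intro: measurable_extI)
  have "(\<integral>\<^sup>+u. ennreal ((f u + g u - (\<phi> u + \<psi> u))\<^sup>2) \<partial>ext n) = (\<integral>\<^sup>+u. ennreal (((f u - \<phi> u) + (g u - \<psi> u))\<^sup>2) \<partial>ext n)"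
    by (simp add: algebra_simps)
  also have "\<dots> \<le> 2 * (\<integral>\<^sup>+u. ennreal ((f u - \<phi> u)\<^sup>2) \<partial>ext n) + 2 * (\<integral>\<^sup>+u. ennreal ((g u - \<psi> u)\<^sup>2) \<partial>ext n)"
    using mf m by (intro nn_integral_sq_add_le) auto
  also have "\<dots> < 2 * ennreal (e/4) + 2 * ennreal (e/4)"
    using q(2) p(2) by (intro add_strict_mono ennreal_mult_strict_left_mono) auto
  also have "\<dots> = ennreal e" using e by (simp flip: ennreal_plus ennreal_numeral ennreal_mult)
  finally show "\<exists>\<phi>. C0 n \<phi> \<and> (\<integral>\<^sup>+u. ennreal ((f u + g u - \<phi> u)\<^sup>2) \<partial>ext n) < ennreal e"
    using C0_add[OF p(1) q(1)] by blast
qed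

lemma approx_cmult:
  assumes f: "approx n f" shows "approx n (\<lambda>u. c * f u)"
  unfolding approx_def
proof (intro conjI allI impI)
  have mf: "f \<in> borel_measurable (ext n)" using f by (auto simp: approx_def)
  then show "(\<lambda>u. c * f u) \<in> borel_measurable (ext n)" by simp
  fix e :: real assume e: "e > 0"
  have c: "c\<^sup>2 + 1 > 0" by (simp add: add_nonneg_pos)
  then have "e / (c\<^sup>2 + 1) > 0" using e by simp
  then obtain \<phi> where p: "C0 n \<phi>" "(\<integral>\<^sup>+u. ennreal ((f u - \<phi> u)\<^sup>2) \<partial>ext n) < ennreal (e/(c\<^sup>2 + 1))"
    using f unfolding approx_def by blast
  have m: "\<phi> \<in> borel_measurable (ext n)" using C0_borel[OF p(1)] by (auto intro: measurable_extI)
  have "(\<integral>\<^sup>+u. ennreal ((c * f u - c * \<phi> u)\<^sup>2) \<partial>ext n) = (\<integral>\<^sup>+u. ennreal (c\<^sup>2) * ennreal ((f u - \<phi> u)\<^sup>2) \<partial>ext n)"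
    by (simp add: power_mult_distrib ennreal_mult flip: right_diff_distrib)
  also have "\<dots> = ennreal (c\<^sup>2) * (\<integral>\<^sup>+u. ennreal ((f u - \<phi> u)\<^sup>2) \<partial>ext n)"
    using mf m by (intro nn_integral_cmult) auto
  also have "\<dots> \<le> ennreal (c\<^sup>2) * ennreal (e/(c\<^sup>2 + 1))"
    using p(2) by (intro mult_left_mono) auto
  also have "\<dots> = ennreal (c\<^sup>2 * (e/(c\<^sup>2 + 1)))" using e c by (intro ennreal_mult[symmetric]) auto
  also have "\<dots> < ennreal e"
    using e c by (intro ennreal_lessI) (auto simp: field_simps)
  finally show "\<exists>\<phi>. C0 n \<phi> \<and> (\<integral>\<^sup>+u. ennreal ((c * f u - \<phi> u)\<^sup>2) \<partial>ext n) < ennreal e"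
    using C0_cmult[OF p(1)] by blast
qed

lemma approx_dominated:
  assumes f: "f \<in> borel_measurable (ext n)" and g: "\<And>k. approx n (g k)"
    and D: "D \<in> borel_measurable (ext n)" "(\<integral>\<^sup>+u. D u \<partial>ext n) < \<infinity>"
    and bd: "\<And>k u. u \<in> space (ext n) \<Longrightarrow> ennreal ((f u - g k u)\<^sup>2) \<le> D u"
    and lim: "\<And>u. u \<in> space (ext n) \<Longrightarrow> (\<lambda>k. g k u) \<longlonglongrightarrow> f u"
  shows "approx n f"
proof (rule approx_limit[OF f g])
  have m: "g k \<in> borel_measurable (ext n)" for k using g[of k] by (simp add: approx_def)
  have "(\<lambda>k. \<integral>\<^sup>+u. ennreal ((f u - g k u)\<^sup>2) \<partial>ext n) \<longlonglongrightarrow> (\<integral>\<^sup>+u. 0 \<partial>ext n)"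
  proof (rule nn_integral_dominated_convergence[where w = D])
    show "AE u in ext n. (\<lambda>k. ennreal ((f u - g k u)\<^sup>2)) \<longlonglongrightarrow> 0"
    proof (rule AE_I2)
      fix u assume "u \<in> space (ext n)"
      then have "(\<lambda>k. ennreal ((f u - g k u)\<^sup>2)) \<longlonglongrightarrow> ennreal ((f u - f u)\<^sup>2)"
        by (intro tendsto_intros lim)
      then show "(\<lambda>k. ennreal ((f u - g k u)\<^sup>2)) \<longlonglongrightarrow> 0" by simp
    qed
  qed (use f m D bd in auto)
  then show "(\<lambda>k. \<integral>\<^sup>+u. ennreal ((f u - g k u)\<^sup>2) \<partial>ext n) \<longlonglongrightarrow> 0" by simp
qed

abbreviation "pbox n A \<equiv> PiE {..<n} (\<lambda>_. A)"

text \<open>Products of cutoff functions for the sets \<open>U i \<inter> W\<close> converge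
  pointwise and vanish outside the box over the compact closure of \<open>W\<close>, whose indicator
  dominates the squared errors.\<close>

lemma approx_open_box:
  assumes W: "open W" "compact (closure W)" and U: "\<And>i. i < n \<Longrightarrow> open (U i)"
  shows "approx n (indicator (PiE {..<n} U \<inter> pbox n W))"
proof -
  define cut where "cut A f \<longleftrightarrow> (\<forall>k. continuous_on UNIV (f k)) \<and> (\<forall>k t. 0 \<le> f k t \<and> f k t \<le> 1) \<and>
    (\<forall>k t. t \<notin> A \<longrightarrow> f k t = 0) \<and> (\<forall>t. t \<in> A \<longrightarrow> (\<lambda>k. f k t) \<longlonglongrightarrow> 1)"
    for A :: "'a set" and f :: "nat \<Rightarrow> 'a \<Rightarrow> real"
  have "\<exists>f. cut (U i \<inter> W) f" if "i < n" for i
  proof -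
    have "open (U i \<inter> W)" using U[OF that] W(1) by (rule open_Int)
    then show ?thesis by (rule cutoff_functions) (unfold cut_def, blast)
  qed
  then obtain f where "\<And>i. i < n \<Longrightarrow> cut (U i \<inter> W) (f i)" by metis
  then have f: "\<And>i k. i < n \<Longrightarrow> continuous_on UNIV (f i k)"
    "\<And>i k t. i < n \<Longrightarrow> 0 \<le> f i k t" "\<And>i k t. i < n \<Longrightarrow> f i k t \<le> 1"
    "\<And>i k t. i < n \<Longrightarrow> t \<notin> U i \<inter> W \<Longrightarrow> f i k t = 0" "\<And>i t. i < n \<Longrightarrow> t \<in> U i \<inter> W \<Longrightarrow> (\<lambda>k. f i k t) \<longlonglongrightarrow> 1"
    unfolding cut_def by blast+
  define g where "g k u = (\<Prod>i<n. f i k (u i))" for k and u :: "nat \<Rightarrow> 'a"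
  let ?A = "PiE {..<n} U \<inter> pbox n W"
  have gC: "C0 n (g k)" for k
  proof (rule C0I[OF _ _ W(2)])
    show "continuous_on UNIV (g k)" unfolding g_def
    proof (intro continuous_on_prod)
      fix i assume "i \<in> {..<n}"
      then show "continuous_on UNIV (\<lambda>u :: nat \<Rightarrow> 'a. f i k (u i))"
        using continuous_on_compose2[OF f(1)[of i k] continuous_on_product_coordinates] by auto
    qed
    show "dep n (g k)" unfolding dep_def g_def by (auto intro!: prod.cong)
    fix t i assume "g k t \<noteq> 0" "i < n"
    then have "f i k (t i) \<noteq> 0" by (auto simp: g_def)
    then have "t i \<in> W" using f(4)[OF \<open>i < n\<close>, of "t i" k] by auto
    then show "t i \<in> closure W" using closure_subset by blast
  qed
  have As: "?A \<in> sets (ext n)" unfolding sets_ext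
    using U W by (intro sets.Int sets_PiM_I_finite) auto
  have g1: "0 \<le> g k u" "g k u \<le> 1" for k u
    unfolding g_def using f by (auto intro!: prod_nonneg prod_le_1)
  have g0: "g k u = 0" if "u \<in> cart n" "u \<notin> ?A" for k u
  proof -
    have "\<exists>i<n. u i \<notin> U i \<inter> W"
    proof (rule ccontr)
      assume "\<not> ?thesis"
      then have "u \<in> ?A" using that(1) by (auto simp: PiE_iff)
      then show False using that(2) by simp
    qed
    then obtain i where i: "i < n" "u i \<notin> U i \<inter> W" by blast
    then have "f i k (u i) = 0" using f(4) by blast
    then show ?thesis using i unfolding g_def by (intro prod_zero) auto
  qed
  show ?thesis
  proof (rule approx_dominated[where g = g and D = "indicator (pbox n (closure W))"])
    show "indicator ?A \<in> borel_measurable (ext n)" using As by simp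
    show "approx n (g k)" for k by (rule approx_C0[OF gC])
    show "indicator (pbox n (closure W)) \<in> borel_measurable (ext n)"
      using box_ext_sets[of "closure W" n] by simp
    show "(\<integral>\<^sup>+u. indicator (pbox n (closure W)) u \<partial>ext n) < \<infinity>"
      using box_ext_sets[of "closure W" n] box_ext_finite[OF W(2), of n] by simp
    fix u assume u: "u \<in> space (ext n)"
    have A: "u \<in> pbox n (closure W)" if "u \<in> ?A" using that closure_subset[of W] by (auto simp: PiE_iff)
    show "ennreal ((indicator ?A u - g k u)\<^sup>2) \<le> indicator (pbox n (closure W)) u" for k
    proof (cases "u \<in> ?A")
      case True
      have "(1 - g k u)\<^sup>2 \<le> 1" using g1[of k u] by (intro power_le_one) auto
      then show ?thesis using True A[OF True] by (simp add: ennreal_le_1)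
    next
      case False
      then show ?thesis using g0[of u k] u by (simp add: space_ext)
    qed
    show "(\<lambda>k. g k u) \<longlonglongrightarrow> indicator ?A u"
    proof (cases "u \<in> ?A")
      case True
      have "(\<lambda>k. g k u) \<longlonglongrightarrow> (\<Prod>i<n. 1)"
        unfolding g_def using True by (intro tendsto_prod f(5)) (auto simp: PiE_iff)
      then show ?thesis using True by simp
    next
      case False
      then have "g k u = 0" for k using g0 u by (simp add: space_ext)
      then show ?thesis using False by simp
    qed
  qed
qed

lemma sets_ext_open_boxes:
  "sets (ext n) = sigma_sets (cart n) {PiE {..<n} U |U. \<forall>i<n. open (U i :: 'a set)}" (is "_ = sigma_sets _ ?G")
proof (rule equalityI)
  have G: "?G \<subseteq> Pow (cart n)" by auto
  let ?N = "sigma (cart n) ?G"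
  have "sets (\<Pi>\<^sub>M k\<in>{..<n}. (borel :: 'a measure)) \<subseteq> sets ?N"
  proof (rule sets_PiM_in_sets)
    show "space ?N = (\<Pi>\<^sub>E k\<in>{..<n}. space borel)" by (simp add: space_measure_of[OF G])
    fix i and A :: "'a set" assume i: "i \<in> {..<n}" and A: "A \<in> sets borel"
    have "(\<lambda>x. x i) \<in> borel_measurable ?N"
    proof (rule borel_measurableI)
      fix S :: "'a set" assume S: "open S"
      have "(\<lambda>x. x i) -` S \<inter> space ?N = PiE {..<n} (\<lambda>k. if k = i then S else UNIV)"
      proof (rule set_eqI)
        fix x :: "nat \<Rightarrow> 'a"
        have "x \<in> PiE {..<n} (\<lambda>k. if k = i then S else UNIV) \<longleftrightarrow> x \<in> cart n \<and> x i \<in> S"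
          using i by (auto simp: PiE_iff)
        then show "x \<in> (\<lambda>x. x i) -` S \<inter> space ?N \<longleftrightarrow> x \<in> PiE {..<n} (\<lambda>k. if k = i then S else UNIV)"
          unfolding space_measure_of[OF G] by blast
      qed
      also have "\<dots> \<in> ?G" using S by (auto intro!: exI[of _ "\<lambda>k. if k = i then S else UNIV"])
      finally show "(\<lambda>x. x i) -` S \<inter> space ?N \<in> sets ?N" by (simp add: sets_measure_of[OF G] sigma_sets.Basic)
    qed
    from measurable_sets[OF this A] show "{x \<in> space ?N. x i \<in> A} \<in> sets ?N" by (simp add: vimage_def Int_def conj_commute)
  qed
  then show "sets (ext n) \<subseteq> sigma_sets (cart n) ?G" by (simp add: sets_ext sets_measure_of[OF G])
  have "?G \<subseteq> sets (ext n)" unfolding sets_ext by (auto intro!: sets_PiM_I_finite)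
  then show "sigma_sets (cart n) ?G \<subseteq> sets (ext n)"
    using sets.sigma_sets_subset[of ?G "ext n"] by (simp add: space_ext)
qed

text \<open>Open boxes form an intersection-stable generator. Cutting with the box over
  \<open>W\<close> keeps the measure finite, which provides the dominating function for disjoint
  unions.\<close>

lemma approx_set:
  assumes W: "open W" "compact (closure W)" and A: "A \<in> sets (ext n)"
  shows "approx n (indicator (A \<inter> pbox n W))"
proof -
  let ?G = "{PiE {..<n} U |U. \<forall>i<n. open (U i :: 'a set)}"
  have bW: "pbox n W \<in> sets (ext n)" using W by (intro box_ext_sets) auto
  have "emeasure (ext n) (pbox n W) \<le> emeasure (ext n) (pbox n (closure W))"
    using closure_subset[of W] by (intro emeasure_mono box_ext_sets PiE_mono) auto
  then have fin: "emeasure (ext n) (pbox n W) < \<infinity>" using box_ext_finite[OF W(2), of n] by simp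
  have st: "Int_stable ?G"
  proof (rule Int_stableI)
    fix a b assume "a \<in> ?G" "b \<in> ?G"
    then obtain U V where "a = PiE {..<n} U" "\<forall>i<n. open (U i)" "b = PiE {..<n} V" "\<forall>i<n. open (V i)" by auto
    then show "a \<inter> b \<in> ?G" by (auto simp: PiE_Int intro!: exI[of _ "\<lambda>i. U i \<inter> V i"])
  qed
  have G: "?G \<subseteq> Pow (cart n)" by auto
  have s: "B \<in> sets (ext n)" if "B \<in> sigma_sets (cart n) ?G" for B using that sets_ext_open_boxes by blast
  have A': "A \<in> sigma_sets (cart n) ?G" using A sets_ext_open_boxes by blast
  show ?thesis
    using st G A'
  proof (induction rule: sigma_sets_induct_disjoint)
    case (basic A)
    then show ?case using approx_open_box[OF W] by auto
  next
    case empty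
    show ?case using approx_C0[OF C0_zero, of n] by (simp add: indicator_def)
  next
    case (compl A)
    have "approx n (indicator (PiE {..<n} (\<lambda>_. UNIV) \<inter> pbox n W))" by (rule approx_open_box[OF W]) simp
    from approx_add[OF this approx_cmult[OF compl(2), of "-1"]]
    have "approx n (\<lambda>u. indicator (cart n \<inter> pbox n W) u + (-1) * indicator (A \<inter> pbox n W) u)" .
    moreover have "A \<subseteq> cart n" using sets.sets_into_space[OF s[OF compl(1)]] by (simp add: space_ext)
    then have "(\<lambda>u. indicator (cart n \<inter> pbox n W) u + (-1) * indicator (A \<inter> pbox n W) u) = (indicator ((cart n - A) \<inter> pbox n W) :: _ \<Rightarrow> real)"
      by (auto simp: indicator_def fun_eq_iff)
    ultimately show ?case by simp
  next
    case (union A)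
    have m: "A i \<in> sets (ext n)" for i using union(2) s by auto
    let ?g = "\<lambda>k u. \<Sum>i<k. indicator (A i \<inter> pbox n W) u :: real"
    have ap: "approx n (?g k)" for k
    proof (induction k)
      case 0
      then show ?case using approx_C0[OF C0_zero, of n] by simp
    next
      case (Suc k)
      then show ?case using approx_add[OF Suc union(3)[of k]] by simp
    qed
    have ge: "?g k u = indicator ((\<Union>i<k. A i) \<inter> pbox n W) u" for k u
    proof -
      have "disjoint_family_on A {..<k}" using union(1) by (auto simp: disjoint_family_on_def)
      then have "(\<Sum>i<k. indicator (A i) u) = (indicator (\<Union>i<k. A i) u :: real)"
        by (intro indicator_UN_disjoint[symmetric]) auto
      then show ?thesis by (simp add: indicator_inter_arith flip: sum_distrib_right)
    qed
    show ?case
    proof (rule approx_dominated[where g = ?g and D = "indicator (pbox n W)", OF _ ap])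
      show "indicator ((\<Union>i. A i) \<inter> pbox n W) \<in> borel_measurable (ext n)" using m bW by (intro borel_measurable_indicator) auto
      show "(\<integral>\<^sup>+u. indicator (pbox n W) u \<partial>ext n) < \<infinity>" using fin bW by simp
      show "ennreal ((indicator ((\<Union>i. A i) \<inter> pbox n W) u - ?g k u)\<^sup>2) \<le> indicator (pbox n W) u" for k u
        unfolding ge by (auto simp: indicator_def)
      fix u assume "u \<in> space (ext n)"
      show "(\<lambda>k. ?g k u) \<longlonglongrightarrow> indicator ((\<Union>i. A i) \<inter> pbox n W) u"
      proof (cases "u \<in> (\<Union>i. A i)")
        case True
        then obtain i where i: "u \<in> A i" by auto
        have "eventually (\<lambda>k. ?g k u = indicator ((\<Union>i. A i) \<inter> pbox n W) u) sequentially"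
          unfolding eventually_sequentially ge using i
          by (intro exI[of _ "Suc i"]) (auto simp: indicator_def)
        then show ?thesis by (rule tendsto_eventually)
      next
        case False
        then have "?g k u = indicator ((\<Union>i. A i) \<inter> pbox n W) u" for k by (simp add: indicator_def)
        then show ?thesis by simp
      qed
    qed (use bW in auto)
  qed
qed

text \<open>The induction over nonnegative functions carries finiteness of the L2 norm as a premise:
  it passes from a multiple by a nonzero constant to the function itself, from a sum to its
  nonnegative summands, and from a limit to its increasing approximants.\<close>

lemma approx_nonneg_box:
  assumes W: "open W" "compact (closure W)"
    and f: "f \<in> borel_measurable (ext n)" "\<And>u. 0 \<le> f u" "(\<integral>\<^sup>+u. ennreal ((f u)\<^sup>2) \<partial>ext n) < \<infinity>"
  shows "approx n (\<lambda>u. f u * indicator (pbox n W) u)"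
  using f
proof (induction rule: borel_measurable_induct_real)
  case (set A)
  then show ?case using approx_set[OF W set(1)] by (simp add: indicator_inter_arith[symmetric])
next
  case (mult u c)
  show ?case
  proof (cases "c = 0")
    case True
    then show ?thesis using approx_C0[OF C0_zero, of n] by simp
  next
    case False
    have "ennreal ((u x)\<^sup>2) = ennreal (1 / c\<^sup>2) * ennreal ((c * u x)\<^sup>2)" for x
      using False by (simp add: ennreal_mult[symmetric] power_mult_distrib)
    then have "(\<integral>\<^sup>+x. ennreal ((u x)\<^sup>2) \<partial>ext n) = ennreal (1 / c\<^sup>2) * (\<integral>\<^sup>+x. ennreal ((c * u x)\<^sup>2) \<partial>ext n)"
      using mult(2) by (simp add: nn_integral_cmult)
    then have "(\<integral>\<^sup>+x. ennreal ((u x)\<^sup>2) \<partial>ext n) < \<infinity>" using mult.prems by (simp add: ennreal_mult_less_top)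
    from approx_cmult[OF mult.IH[OF this], of c] show ?thesis by (simp add: mult.assoc)
  qed
next
  case (add u v)
  have "(\<integral>\<^sup>+x. ennreal ((u x)\<^sup>2) \<partial>ext n) \<le> (\<integral>\<^sup>+x. ennreal ((v x + u x)\<^sup>2) \<partial>ext n)"
    using add by (intro nn_integral_mono ennreal_leI power_mono) auto
  moreover have "(\<integral>\<^sup>+x. ennreal ((v x)\<^sup>2) \<partial>ext n) \<le> (\<integral>\<^sup>+x. ennreal ((v x + u x)\<^sup>2) \<partial>ext n)"
    using add by (intro nn_integral_mono ennreal_leI power_mono) auto
  ultimately show ?case
    using approx_add[OF add.IH(2) add.IH(1)] add.prems by (simp add: distrib_right le_less_trans)
next
  case (seq U)
  have fm: "f \<in> borel_measurable (ext n)"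
    using seq.hyps(4) seq.hyps(1) by (rule borel_measurable_LIMSEQ_real)
  have le: "U k x \<le> f x" if "x \<in> space (ext n)" for k x
    using seq.hyps(3) seq.hyps(4)[OF that] by (intro incseq_le[of "\<lambda>k. U k x"]) (auto simp: incseq_def le_fun_def)
  have bW: "pbox n W \<in> sets (ext n)" using W by (intro box_ext_sets) auto
  show ?case
  proof (rule approx_dominated[where g = "\<lambda>k u. U k u * indicator (pbox n W) u" and D = "\<lambda>u. ennreal ((f u)\<^sup>2)"])
    fix k
    have "(\<integral>\<^sup>+x. ennreal ((U k x)\<^sup>2) \<partial>ext n) \<le> (\<integral>\<^sup>+x. ennreal ((f x)\<^sup>2) \<partial>ext n)"
      using le seq.hyps(2) by (intro nn_integral_mono ennreal_leI power_mono) auto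
    then show "approx n (\<lambda>u. U k u * indicator (pbox n W) u)" using seq.IH[of k] seq.prems by simp
    fix u assume u: "u \<in> space (ext n)"
    have "(f u * indicator (pbox n W) u - U k u * indicator (pbox n W) u)\<^sup>2 \<le> (f u)\<^sup>2"
      using le[OF u, of k] seq.hyps(2)[of k u] by (auto simp: indicator_def intro!: power_mono)
    then show "ennreal ((f u * indicator (pbox n W) u - U k u * indicator (pbox n W) u)\<^sup>2) \<le> ennreal ((f u)\<^sup>2)"
      by (rule ennreal_leI)
  qed (use seq.hyps fm seq.prems bW in \<open>auto intro!: tendsto_intros\<close>)
qed

lemma approx_L2:
  assumes f: "f \<in> borel_measurable (ext n)" "(\<integral>\<^sup>+u. ennreal ((f u)\<^sup>2) \<partial>ext n) < \<infinity>"
  shows "approx n f"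
proof -
  obtain B :: "nat \<Rightarrow> 'a set" where B: "\<And>k. open (B k)" "\<And>k. compact (closure (B k))" "incseq B" "(\<Union>k. B k) = UNIV"
    by (rule compact_exhaustion) blast
  have "approx n (\<lambda>u. f u * indicator (pbox n (B k)) u)" for k
  proof -
    have "(\<integral>\<^sup>+u. ennreal ((max 0 (s * f u))\<^sup>2) \<partial>ext n) < \<infinity>" if "s\<^sup>2 = 1" for s
    proof -
      have "(max 0 (s * f u))\<^sup>2 \<le> (f u)\<^sup>2" for u
        using that by (simp add: max_def power_mult_distrib)
      then have "(\<integral>\<^sup>+u. ennreal ((max 0 (s * f u))\<^sup>2) \<partial>ext n) \<le> (\<integral>\<^sup>+u. ennreal ((f u)\<^sup>2) \<partial>ext n)"
        by (intro nn_integral_mono ennreal_leI)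
      then show ?thesis using f(2) by simp
    qed
    \<comment> \<open>\<open>s\<close> stands for 1 and -1, so the positive and the negative part of
      \<open>f\<close> are treated at once.\<close>
    then have *: "approx n (\<lambda>u. max 0 (s * f u) * indicator (pbox n (B k)) u)" if "s\<^sup>2 = 1" for s
      using f(1) that by (intro approx_nonneg_box B) auto
    have "approx n (\<lambda>u. max 0 (1 * f u) * indicator (pbox n (B k)) u + (-1) * (max 0 ((-1) * f u) * indicator (pbox n (B k)) u))"
      by (intro approx_add approx_cmult *) auto
    moreover have "max 0 (1 * f u) * indicator (pbox n (B k)) u + (-1) * (max 0 ((-1) * f u) * indicator (pbox n (B k)) u)
      = f u * indicator (pbox n (B k)) u" for u by (auto simp: indicator_def max_def)
    ultimately show ?thesis by simp
  qed
  then show ?thesis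
  proof (rule approx_dominated[OF f(1), where D = "\<lambda>u. ennreal ((f u)\<^sup>2)"])
    show "ennreal ((f u - f u * indicator (pbox n (B k)) u)\<^sup>2) \<le> ennreal ((f u)\<^sup>2)" for u k
      by (auto simp: indicator_def)
    fix u assume u: "u \<in> space (ext n)"
    have "\<exists>m. \<forall>i<n. u i \<in> B m"
    proof -
      have "\<forall>i. \<exists>m. u i \<in> B m" using B(4) by auto
      then obtain m where m: "\<And>i. u i \<in> B (m i)" by metis
      have "u i \<in> B (\<Sum>i<n. m i)" if "i < n" for i
      proof -
        have "m i \<le> (\<Sum>i<n. m i)" using that by (intro member_le_sum) auto
        then show ?thesis using m[of i] incseqD[OF B(3)] by blast
      qed
      then show ?thesis by blast
    qed
    then obtain m where m: "\<And>i. i < n \<Longrightarrow> u i \<in> B m" by blast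
    have "u \<in> pbox n (B k)" if "k \<ge> m" for k
      using m incseqD[OF B(3) that] u by (auto simp: PiE_iff space_ext)
    then have "eventually (\<lambda>k. f u * indicator (pbox n (B k)) u = f u) sequentially"
      unfolding eventually_sequentially by (intro exI[of _ m]) auto
    then show "(\<lambda>k. f u * indicator (pbox n (B k)) u) \<longlonglongrightarrow> f u" by (rule tendsto_eventually)
  qed (use f in auto)
qed

end

section \<open>Expansion of monomials\<close>

definition join :: "nat \<Rightarrow> (nat \<Rightarrow> 'b) \<Rightarrow> (nat \<Rightarrow> 'b) \<Rightarrow> nat \<Rightarrow> 'b"
  where "join j z t i = (if i < j then z i else t (i - j))"

text \<open>The effect of \<open>N\<close> on the concatenation \<open>join\<close> of the remaining
  \<open>z\<close> with the first coordinates of \<open>y\<close>: entries \<open>j\<close> and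
  \<open>j + 1\<close> coincide, as the consumed \<open>z\<close> is set to the first
  \<open>y\<close>. Under \<open>C\<close> the concatenation does not change, by
  \<open>join_C\<close>.\<close>

definition dmap :: "nat \<Rightarrow> (nat \<Rightarrow> 'b) \<Rightarrow> nat \<Rightarrow> 'b"
  where "dmap j v i = (if i \<le> j then v i else v (i - 1))"

text \<open>The effect of \<open>A\<close>: the integration variable occupies positions
  \<open>j\<close> and \<open>j + 1\<close>, once as the consumed \<open>z\<close> and once as the
  consumed \<open>y\<close>.\<close>

definition emap :: "nat \<Rightarrow> 'b \<Rightarrow> (nat \<Rightarrow> 'b) \<Rightarrow> nat \<Rightarrow> 'b"
  where "emap j x v i = (if i < j then v i else if i \<le> Suc j then x else v (i - 2))"

text \<open>Repetition according to the blocks of \<open>ls\<close>, behind \<open>j\<close>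
  variables that are still to be consumed; the counterpart of \<open>spread\<close> on the full
  sequence space.\<close>

definition spr :: "nat \<Rightarrow> nat list \<Rightarrow> (nat \<Rightarrow> 'b) \<Rightarrow> nat \<Rightarrow> 'b"
  where "spr j ls v i = (if i < j then v i else v (j + blk ls (i - j)))"

lemma join_0 [simp]: "join 0 z t = t"
  by (simp add: join_def fun_eq_iff)

lemma join_nth [simp]: "join j z t j = t 0"
  by (simp add: join_def)

lemma join_C: "join (Suc j) (fst \<circ> z(j := y 0)) (fst \<circ> (y \<circ> Suc)) = join j (fst \<circ> z) (fst \<circ> y)"
proof
  fix i
  show "join (Suc j) (fst \<circ> z(j := y 0)) (fst \<circ> (y \<circ> Suc)) i = join j (fst \<circ> z) (fst \<circ> y) i"
    by (cases "i < j"; cases "i = j") (auto simp: join_def Suc_diff_Suc)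
qed

lemma join_N: "join (Suc j) (fst \<circ> z(j := y 0)) (fst \<circ> y) = dmap j (join j (fst \<circ> z) (fst \<circ> y))"
  by (auto simp: join_def dmap_def fun_eq_iff)

lemma join_A: "join (Suc j) (fst \<circ> z(j := x)) (fst \<circ> case_nat x y) = emap j (fst x) (join j (fst \<circ> z) (fst \<circ> y))"
proof
  fix i
  show "join (Suc j) (fst \<circ> z(j := x)) (fst \<circ> case_nat x y) i = emap j (fst x) (join j (fst \<circ> z) (fst \<circ> y)) i"
  proof (cases "i < j \<or> i = j \<or> i = Suc j")
    case False
    then have "i - Suc j = Suc (i - 2 - j)" "\<not> i - 2 < j" by auto
    then show ?thesis using False by (auto simp: join_def emap_def)
  qed (auto simp: join_def emap_def)
qed

lemma spr_0: "spr j (0 # ls) = spr (Suc j) ls"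
proof (intro ext)
  fix v :: "nat \<Rightarrow> 'b" and i
  show "spr j (0 # ls) v i = spr (Suc j) ls v i"
    by (cases "i = j") (auto simp: spr_def)
qed

lemma spr_dmap: "spr (Suc j) (l # ls) (dmap j v) = spr j (Suc l # ls) v"
proof
  fix i
  show "spr (Suc j) (l # ls) (dmap j v) i = spr j (Suc l # ls) v i"
  proof (cases "i \<le> j")
    case True
    then show ?thesis by (cases "i = j") (auto simp: spr_def dmap_def)
  next
    case False
    then show ?thesis by (auto simp: spr_def dmap_def Suc_diff_Suc[symmetric] le_diff_conv)
  qed
qed

lemma dmap_spr: "dmap j (spr j (l # ls) v) = spr (Suc j) (l # ls) (dmap j v)"
proof
  fix i
  show "dmap j (spr j (l # ls) v) i = spr (Suc j) (l # ls) (dmap j v) i"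
  proof (cases "i \<le> j")
    case True
    then show ?thesis by (cases "i = j") (auto simp: spr_def dmap_def)
  next
    case False
    then have "i - 1 - j = i - Suc j" by simp
    then show ?thesis using False by (auto simp: spr_def dmap_def)
  qed
qed

lemma emap_spr: "spr (Suc j) (0 # ls) (emap j x v) = emap j x (spr j ls v)"
proof
  fix i
  show "spr (Suc j) (0 # ls) (emap j x v) i = emap j x (spr j ls v) i"
  proof (cases "i \<le> Suc j")
    case True
    then show ?thesis by (auto simp: spr_def emap_def)
  next
    case False
    then have "i - 2 - j = i - Suc (Suc j)" "\<not> i - 2 < j" "\<not> i - Suc j \<le> 0" by auto
    then show ?thesis using False by (auto simp: spr_def emap_def)
  qed
qed

text \<open>A stratum of order \<open>k + 1\<close> arises by putting a block of length one in front
  or by lengthening the first block. These are the ways in which \<open>C\<close> and the leading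
  term of \<open>N\<close> raise the degree.\<close>

lemma Sn_Suc: "Sn (Suc k) = (\<lambda>ls. 0 # ls) ` Sn k \<union> (\<lambda>ls. Suc (hd ls) # tl ls) ` (Sn k - {[]})"
proof (rule equalityI; rule subsetI)
  fix ls assume "ls \<in> Sn (Suc k)"
  then have d: "deg ls = Suc k" by (simp add: Sn_def)
  then obtain l r where lr: "ls = l # r" by (cases ls) auto
  show "ls \<in> (\<lambda>ls. 0 # ls) ` Sn k \<union> (\<lambda>ls. Suc (hd ls) # tl ls) ` (Sn k - {[]})"
  proof (cases l)
    case 0
    then show ?thesis using d lr by (auto simp: Sn_def)
  next
    case (Suc l')
    then have "l' # r \<in> Sn k - {[]}" using d lr by (auto simp: Sn_def)
    then show ?thesis using lr Suc by (intro UnI2 image_eqI[of _ _ "l' # r"]) auto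
  qed
next
  fix ls assume "ls \<in> (\<lambda>ls. 0 # ls) ` Sn k \<union> (\<lambda>ls. Suc (hd ls) # tl ls) ` (Sn k - {[]})"
  then show "ls \<in> Sn (Suc k)"
  proof
    assume "ls \<in> (\<lambda>ls. Suc (hd ls) # tl ls) ` (Sn k - {[]})"
    then obtain r where "r \<in> Sn k" "r \<noteq> []" "ls = Suc (hd r) # tl r" by auto
    then show ?thesis by (cases r) (auto simp: Sn_def)
  qed (auto simp: Sn_def)
qed

lemma sum_Sn_Suc:
  fixes \<phi> :: "nat list \<Rightarrow> 'c::comm_monoid_add"
  shows "(\<Sum>ls\<in>Sn (Suc k). \<phi> ls) = (\<Sum>ls\<in>Sn k. \<phi> (0 # ls)) + (\<Sum>ls\<in>Sn k. case ls of [] \<Rightarrow> 0 | l # r \<Rightarrow> \<phi> (Suc l # r))"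
proof -
  have "(\<Sum>ls\<in>Sn (Suc k). \<phi> ls) = (\<Sum>ls\<in>(\<lambda>ls. 0 # ls) ` Sn k. \<phi> ls) + (\<Sum>ls\<in>(\<lambda>ls. Suc (hd ls) # tl ls) ` (Sn k - {[]}). \<phi> ls)"
    unfolding Sn_Suc by (rule sum.union_disjoint) auto
  also have "(\<Sum>ls\<in>(\<lambda>ls. 0 # ls) ` Sn k. \<phi> ls) = (\<Sum>ls\<in>Sn k. \<phi> (0 # ls))"
    by (subst sum.reindex) (auto simp: inj_on_def)
  also have "(\<Sum>ls\<in>(\<lambda>ls. Suc (hd ls) # tl ls) ` (Sn k - {[]}). \<phi> ls) = (\<Sum>ls\<in>Sn k - {[]}. \<phi> (Suc (hd ls) # tl ls))"
    by (subst sum.reindex) (auto simp: inj_on_def intro: list.expand)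
  also have "\<dots> = (\<Sum>ls\<in>Sn k. case ls of [] \<Rightarrow> 0 | l # r \<Rightarrow> \<phi> (Suc l # r))"
    by (rule sum.mono_neutral_cong_left) (auto split: list.split)
  finally show ?thesis .
qed

lemma emap_measurable:
  "(\<lambda>w. emap j (snd w) (fst w)) \<in> borel_measurable (borel :: ((nat \<Rightarrow> 'b::second_countable_topology) \<times> 'b) measure)"
proof (rule measurable_coordinatewise_then_product)
  fix i
  have "(\<lambda>w :: (nat \<Rightarrow> 'b) \<times> 'b. fst w k) \<in> borel_measurable borel" for k
    by (rule measurable_app_borel) simp
  then show "(\<lambda>w :: (nat \<Rightarrow> 'b) \<times> 'b. emap j (snd w) (fst w) i) \<in> borel_measurable borel"
    by (cases "i < j"; cases "i \<le> Suc j") (simp_all add: emap_def)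
qed

lemma B0_reindex:
  fixes h :: "(nat \<Rightarrow> 'b::second_countable_topology) \<Rightarrow> real"
  assumes h: "B0 M h" and r: "\<And>i. i < M \<Longrightarrow> r i < N" and surj: "\<And>k. k < N \<Longrightarrow> \<exists>i<M. r i = k"
  shows "B0 N (\<lambda>v. h (\<lambda>i. v (r i)))"
proof -
  obtain C K where C: "C \<ge> 0" "compact K" "\<And>t. \<bar>h t\<bar> \<le> C" "\<And>t i. h t \<noteq> 0 \<Longrightarrow> i < M \<Longrightarrow> t i \<in> K"
    using B0D(3)[OF h] by auto
  show ?thesis
  proof (rule B0I[OF _ _ C(2), of _ _ C])
    show "(\<lambda>v. h (\<lambda>i. v (r i))) \<in> borel_measurable borel" by (rule measurable_compose[OF measurable_reindex_borel B0D(1)[OF h]])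
    show "dep N (\<lambda>v. h (\<lambda>i. v (r i)))" unfolding dep_def using r by (auto intro!: depD[OF B0D(2)[OF h]])
    fix t k assume "h (\<lambda>i. t (r i)) \<noteq> 0" "k < N"
    then show "t k \<in> K" using C(4)[of "\<lambda>i. t (r i)"] surj[of k] by auto
  qed (use C in auto)
qed

lemma B0_dmap:
  fixes h :: "(nat \<Rightarrow> 'b::second_countable_topology) \<Rightarrow> real"
  assumes "B0 (Suc N) h" "j < N" shows "B0 N (\<lambda>v. h (dmap j v))"
proof -
  have "dmap j = (\<lambda>v :: nat \<Rightarrow> 'b. \<lambda>i. v (if i \<le> j then i else i - 1))" by (auto simp: dmap_def fun_eq_iff)
  moreover have "\<exists>i<Suc N. (if i \<le> j then i else i - 1) = k" if "k < N" for k
    using that by (intro exI[of _ "if k \<le> j then k else Suc k"]) auto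
  moreover have "(if i \<le> j then i else i - 1) < N" if "i < Suc N" for i using that assms(2) by auto
  ultimately show ?thesis using B0_reindex[OF assms(1), of "\<lambda>i. if i \<le> j then i else i - 1" N] by simp
qed

lemma B0_spr:
  fixes h :: "(nat \<Rightarrow> 'b::second_countable_topology) \<Rightarrow> real"
  assumes h: "B0 (j + deg ls) h" shows "B0 (j + length ls) (\<lambda>v. h (spr j ls v))"
proof -
  let ?r = "\<lambda>i. if i < j then i else j + blk ls (i - j)"
  have "spr j ls = (\<lambda>v :: nat \<Rightarrow> 'b. \<lambda>i. v (?r i))" by (auto simp: spr_def fun_eq_iff)
  moreover have "?r i < j + length ls" if "i < j + deg ls" for i using that blk_less[of "i - j" ls] by auto
  moreover have "\<exists>i<j + deg ls. ?r i = k" if "k < j + length ls" for k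
    using that start_less[of "k - j" ls] by (intro exI[of _ "if k < j then k else j + start ls (k - j)"]) auto
  ultimately show ?thesis using B0_reindex[OF h, of ?r "j + length ls"] by simp
qed

type_synonym 'a tker = "'a two_kernel"

definition tk_meas :: "'a::second_countable_topology tker \<Rightarrow> bool"
  where "tk_meas H \<longleftrightarrow> (\<forall>m. (\<lambda>w. H m (fst w) (snd w)) \<in> borel_measurable borel)"

context jac_process
begin

text \<open>The result of \<open>A\<close> on a coefficient whose first polynomial is p^(0) = 1;
  only \<open>\<sigma>\<close> appears because the fibres have mass one.\<close>

definition int_out :: "nat \<Rightarrow> ((nat \<Rightarrow> 'a) \<Rightarrow> real) \<Rightarrow> (nat \<Rightarrow> 'a) \<Rightarrow> real"
  where "int_out j h v = (\<integral>x. h (emap j x v) \<partial>\<sigma>)"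

lemma emap_section:
  fixes h :: "(nat \<Rightarrow> 'a) \<Rightarrow> real"
  assumes h: "B0 (Suc (Suc N)) h" and j: "j \<le> N"
  shows "(\<lambda>x. h (emap j x v)) \<in> borel_measurable borel"
    "\<exists>C K. compact K \<and> (\<forall>x v. \<bar>h (emap j x v)\<bar> \<le> C) \<and> (\<forall>x v. h (emap j x v) \<noteq> 0 \<longrightarrow> x \<in> K) \<and>
      (\<forall>x v i. h (emap j x v) \<noteq> 0 \<longrightarrow> i < N \<longrightarrow> v i \<in> K) \<and> C \<ge> 0"
proof -
  have "(\<lambda>x :: 'a. (v, x)) \<in> borel_measurable borel"
    by (rule borel_measurable_Pair) simp_all
  from measurable_compose[OF measurable_compose[OF this emap_measurable] B0D(1)[OF h]]
  show "(\<lambda>x. h (emap j x v)) \<in> borel_measurable borel" by simp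
  obtain C K where C: "C \<ge> 0" "compact K" "\<And>t. \<bar>h t\<bar> \<le> C" "\<And>t i. h t \<noteq> 0 \<Longrightarrow> i < Suc (Suc N) \<Longrightarrow> t i \<in> K"
    using B0D(3)[OF h] by auto
  have x: "x \<in> K" if "h (emap j x v) \<noteq> 0" for x v
    using C(4)[OF that, of j] j by (simp add: emap_def)
  have v: "v i \<in> K" if "h (emap j x v) \<noteq> 0" "i < N" for x v i
    using C(4)[OF that(1), of i] C(4)[OF that(1), of "i + 2"] that(2) by (cases "i < j") (auto simp: emap_def)
  show "\<exists>C K. compact K \<and> (\<forall>x v. \<bar>h (emap j x v)\<bar> \<le> C) \<and> (\<forall>x v. h (emap j x v) \<noteq> 0 \<longrightarrow> x \<in> K) \<and>
      (\<forall>x v i. h (emap j x v) \<noteq> 0 \<longrightarrow> i < N \<longrightarrow> v i \<in> K) \<and> C \<ge> 0"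
    using C x v by (intro exI[of _ C] exI[of _ K]) auto
qed

lemma int_out_B0:
  assumes h: "B0 (Suc (Suc N)) h" and j: "j \<le> N" shows "B0 N (int_out j h)"
proof -
  obtain C K where C: "compact K" "\<And>x v. \<bar>h (emap j x v)\<bar> \<le> C" "\<And>x v. h (emap j x v) \<noteq> 0 \<Longrightarrow> x \<in> K"
      "\<And>x v i. h (emap j x v) \<noteq> 0 \<Longrightarrow> i < N \<Longrightarrow> v i \<in> K" "C \<ge> 0"
    using emap_section(2)[OF assms] by blast
  show ?thesis
  proof (rule B0I[OF _ _ C(1), of _ _ "C * measure \<sigma> K"])
    have "(\<lambda>w :: (nat \<Rightarrow> 'a) \<times> 'a. h (emap j (snd w) (fst w))) \<in> borel_measurable borel"
      by (rule measurable_compose[OF emap_measurable B0D(1)[OF h]])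
    then have "(\<lambda>(v, x). h (emap j x v)) \<in> borel_measurable (borel \<Otimes>\<^sub>M \<sigma>)"
      unfolding measurable_cong_sets[OF sets_pair_measure_cong[OF refl sets_sigma] refl] by (simp add: borel_prod case_prod_unfold)
    from S.borel_measurable_lebesgue_integral[OF this]
    show "int_out j h \<in> borel_measurable borel" by (simp add: int_out_def[abs_def])
    show "dep N (int_out j h)" unfolding dep_def int_out_def
    proof (intro allI impI Bochner_Integration.integral_cong refl)
      fix t t' :: "nat \<Rightarrow> 'a" and x assume e: "\<forall>i<N. t i = t' i"
      show "h (emap j x t) = h (emap j x t')"
        by (rule depD[OF B0D(2)[OF h]]) (use e j in \<open>auto simp: emap_def\<close>)
    qed
    show "\<bar>int_out j h v\<bar> \<le> C * measure \<sigma> K" for v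
    proof -
      have fin: "emeasure \<sigma> K < \<infinity>" by (rule emeasure_compact[OF C(1)])
      have i: "integrable \<sigma> (\<lambda>x. C * indicator K x)" using C(1) fin by simp
      have "\<bar>int_out j h v\<bar> \<le> (\<integral>x. \<bar>h (emap j x v)\<bar> \<partial>\<sigma>)" unfolding int_out_def by (rule integral_abs_bound)
      also have "\<dots> \<le> (\<integral>x. C * indicator K x \<partial>\<sigma>)"
      proof (rule integral_mono')
        show "\<bar>h (emap j x v)\<bar> \<le> C * indicator K x" for x
          using C(2)[where x = x and v = v] C(3)[of x v] by (cases "x \<in> K") (auto simp: indicator_def)
      qed (use i C in auto)
      also have "\<dots> = C * measure \<sigma> K" using C(1) fin by simp
      finally show ?thesis .
    qed
    fix v i assume a: "int_out j h v \<noteq> 0" "i < N"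
    have "\<exists>x. h (emap j x v) \<noteq> 0"
    proof (rule ccontr)
      assume "\<not> ?thesis"
      then have "int_out j h v = 0" by (simp add: int_out_def)
      then show False using a by simp
    qed
    then show "v i \<in> K" using C(4) a(2) by blast
  qed
qed

text \<open>The kernel \<open>h(z, t) p\<^sup>(\<^sup>l\<^sup>\<^sub>1\<^sup>)(y\<^sub>1) \<dots> p\<^sup>(\<^sup>l\<^sup>\<^sub>m\<^sup>)(y\<^sub>m)\<close>, where \<open>t\<close> are the first coordinates of \<open>y\<close>. The recursion for
  the polynomials turns \<open>C + A + N\<close> into an operation on the pairs \<open>(h, ls)\<close>, namely \<open>tstep\<close> below.\<close>
definition trm :: "nat \<Rightarrow> ((nat \<Rightarrow> 'a) \<Rightarrow> real) \<Rightarrow> nat list \<Rightarrow> 'a tker"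
  where "trm j h ls m z y = (if m = length ls then h (join j (fst \<circ> z) (fst \<circ> y)) * PP ls y else 0)"

lemma trm_0: "trm 0 h ls m z y = vec h ls m y"
  by (simp add: trm_def vec_def)

type_synonym 'b terms = "(((nat \<Rightarrow> 'b) \<Rightarrow> real) \<times> nat list) list"

definition tsum :: "nat \<Rightarrow> 'a terms \<Rightarrow> 'a tker"
  where "tsum j L m z y = (\<Sum>t\<leftarrow>L. trm j (fst t) (snd t) m z y)"

lemma tsum_append: "tsum j (L @ L') m z y = tsum j L m z y + tsum j L' m z y"
  by (simp add: tsum_def)

lemma tsum_Cons: "tsum j (t # L) m z y = trm j (fst t) (snd t) m z y + tsum j L m z y"
  by (simp add: tsum_def)

lemma tsum_Nil [simp]: "tsum j [] m z y = 0"
  by (simp add: tsum_def)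

definition wf_terms :: "nat \<Rightarrow> 'a terms \<Rightarrow> bool"
  where "wf_terms j L \<longleftrightarrow> (\<forall>t\<in>set L. B0 (j + length (snd t)) (fst t))"

section \<open>One step of \<open>C + A + N\<close> on finite sums of products\<close>

definition gstep :: "nat \<Rightarrow> 'a tker \<Rightarrow> 'a tker"
  where "gstep k H = (\<lambda>m z y. op_C k H m z y + op_A \<sigma> \<mu> k H m z y + op_N k H m z y)"

lemma CAN_power_Suc: "CAN_power \<sigma> \<mu> (Suc k) H = CAN_power \<sigma> \<mu> k (gstep k H)"
  by (simp add: gstep_def)

lemma measurable_upd_fst:
  assumes f: "f \<in> borel_measurable M" and x: "x \<in> borel_measurable M"
  shows "(\<lambda>w. (f w)(k := x w) :: nat \<Rightarrow> 'b::second_countable_topology) \<in> borel_measurable M"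
proof (rule measurable_coordinatewise_then_product)
  fix i show "(\<lambda>w. ((f w)(k := x w)) i) \<in> borel_measurable M"
    using measurable_app_borel[OF f, of i] x by (cases "i = k") auto
qed

lemma gstep_meas: assumes H: "tk_meas H" shows "tk_meas (gstep k H)"
proof -
  have Hm: "(\<lambda>w. H m (a w) (b w)) \<in> borel_measurable N" if "a \<in> borel_measurable N" "b \<in> borel_measurable N" for m a b and N :: "'x measure"
  proof -
    have "(\<lambda>w. (a w, b w)) \<in> borel_measurable N" using that by (rule borel_measurable_Pair)
    from measurable_compose[OF this H[unfolded tk_meas_def, rule_format, of m]] show ?thesis by simp
  qed
  have fs: "fst \<in> borel_measurable (borel :: ((nat \<Rightarrow> 'a \<times> real) \<times> (nat \<Rightarrow> 'a \<times> real)) measure)"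
    "snd \<in> borel_measurable (borel :: ((nat \<Rightarrow> 'a \<times> real) \<times> (nat \<Rightarrow> 'a \<times> real)) measure)"
    by (rule measurable_fst_borel measurable_snd_borel, simp)+
  have s0: "(\<lambda>w :: (nat \<Rightarrow> 'a \<times> real) \<times> (nat \<Rightarrow> 'a \<times> real). snd w 0) \<in> borel_measurable borel"
    by (rule measurable_app_borel[OF fs(2)])
  have C: "(\<lambda>w. op_C k H m (fst w) (snd w)) \<in> borel_measurable borel" for m
  proof (cases m)
    case (Suc n)
    have "(\<lambda>w. H n ((fst w)(k := snd w 0)) (snd w \<circ> Suc)) \<in> borel_measurable borel"
      by (intro Hm measurable_upd_fst measurable_shift_borel fs s0)
    then show ?thesis by (simp add: op_C_def Suc)
  qed (simp add: op_C_def)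
  have N: "(\<lambda>w. op_N k H m (fst w) (snd w)) \<in> borel_measurable borel" for m
  proof (cases "m = 0")
    case False
    have "(\<lambda>w. snd (snd w 0) * H m ((fst w)(k := snd w 0)) (snd w)) \<in> borel_measurable borel"
      by (intro borel_measurable_times Hm measurable_upd_fst fs s0 measurable_snd_borel)
    then show ?thesis using False by (simp add: op_N_def)
  qed (simp add: op_N_def)
  have A: "(\<lambda>w. op_A \<sigma> \<mu> k H m (fst w) (snd w)) \<in> borel_measurable borel" for m
    unfolding op_A_def
  proof (rule ST.borel_measurable_lebesgue_integral)
    let ?N = "borel \<Otimes>\<^sub>M st :: (((nat \<Rightarrow> 'a \<times> real) \<times> (nat \<Rightarrow> 'a \<times> real)) \<times> ('a \<times> real)) measure"
    have x: "snd \<in> borel_measurable ?N"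
      using measurable_snd[of "borel :: ((nat \<Rightarrow> 'a \<times> real) \<times> (nat \<Rightarrow> 'a \<times> real)) measure" st]
      unfolding measurable_cong_sets[OF refl sets_st] .
    have f: "fst \<in> borel_measurable ?N" by (rule measurable_fst)
    have "(\<lambda>v. H (Suc m) ((fst (fst v))(k := snd v)) (case_nat (snd v) (snd (fst v)))) \<in> borel_measurable ?N"
      by (intro Hm measurable_upd_fst measurable_case_nat_borel x measurable_fst_borel measurable_snd_borel f)
    then show "(\<lambda>(w, x). H (Suc m) ((fst w)(k := x)) (case_nat x (snd w))) \<in> borel_measurable ?N"
      by (simp add: case_prod_unfold)
  qed
  show ?thesis unfolding tk_meas_def gstep_def
    using C A N by auto
qed

end

text \<open>Besides the Jacobi coefficients themselves, \<open>\<alpha>\<close> and \<open>\<beta>\<close> will be \<open>\<eta>\<close> and \<open>\<lambda>\<close> of statement (iii), which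
  satisfy the recursion only for almost every \<open>t\<close>.\<close>
locale jac_rec = jac_process \<sigma> \<mu> for \<sigma> :: "'a::{t2_space, second_countable_topology} measure" and \<mu> +
  fixes \<alpha> \<beta> :: "nat \<Rightarrow> 'a \<Rightarrow> real"
  assumes rec_meas: "\<And>l. \<alpha> l \<in> borel_measurable borel" "\<And>l. \<beta> l \<in> borel_measurable borel"
    and rec_bound: "\<And>l K. compact K \<Longrightarrow> \<exists>C. \<forall>t\<in>K. \<bar>\<alpha> l t\<bar> \<le> C" "\<And>l K. compact K \<Longrightarrow> \<exists>C. \<forall>t\<in>K. \<bar>\<beta> l t\<bar> \<le> C"
    and rec_AE: "AE t in \<sigma>. \<forall>l. AE s in \<mu> t. s * p l (t, s) = p (Suc l) (t, s) + \<beta> l t * p l (t, s)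
        + (if l = 0 then 0 else \<alpha> l t * p (l - 1) (t, s))"
begin

text \<open>A condition on single entries, for all levels at once. It is preserved when
  \<open>op_C\<close> and \<open>op_N\<close> copy entries of \<open>y\<close> into
  \<open>z\<close>, whereas an identity for almost every \<open>(z, y)\<close> could be destroyed by
  such a substitution.\<close>

definition good :: "'a \<times> real \<Rightarrow> bool"
  where "good z \<longleftrightarrow> (\<forall>l. snd z * p l z = p (Suc l) z + \<beta> l (fst z) * p l z + (if l = 0 then 0 else \<alpha> l (fst z) * p (l - 1) z))"

lemma good_meas: "Measurable.pred borel good"
proof -
  have fs: "fst \<in> borel_measurable (borel :: ('a \<times> real) measure)" "snd \<in> borel_measurable (borel :: ('a \<times> real) measure)"
    by (rule measurable_fst_borel measurable_snd_borel, simp)+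
  have ab: "(\<lambda>z :: 'a \<times> real. \<alpha> l (fst z)) \<in> borel_measurable borel" "(\<lambda>z :: 'a \<times> real. \<beta> l (fst z)) \<in> borel_measurable borel" for l
    by (rule measurable_compose[OF fs(1) rec_meas(1)], rule measurable_compose[OF fs(1) rec_meas(2)])
  have c: "(\<lambda>z. if l = 0 then 0 else \<alpha> l (fst z) * p (l - 1) z) \<in> borel_measurable borel" for l
    using ab by (cases "l = 0") auto
  have "Measurable.pred borel (\<lambda>z. snd z * p l z = p (Suc l) z + \<beta> l (fst z) * p l z + (if l = 0 then 0 else \<alpha> l (fst z) * p (l - 1) z))" for l
  proof -
    have l: "(\<lambda>z. snd z * p l z) \<in> borel_measurable borel"
      by (intro borel_measurable_times fs p_measurable)
    have r: "(\<lambda>z. p (Suc l) z + \<beta> l (fst z) * p l z + (if l = 0 then 0 else \<alpha> l (fst z) * p (l - 1) z)) \<in> borel_measurable borel"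
      by (intro borel_measurable_times borel_measurable_add ab c p_measurable)
    from borel_measurable_eq[OF l r] show ?thesis unfolding pred_def .
  qed
  then show ?thesis unfolding good_def[abs_def] by (intro pred_intros_countable)
qed

lemma good_AE: "AE z in st. good z"
  unfolding AE_st[OF good_meas]
  using rec_AE
proof eventually_elim
  case (elim t)
  then show ?case unfolding good_def AE_all_countable fst_conv snd_conv by blast
qed

lemma good_fock_AE: "AE y in \<F> m. \<forall>i<m. good (y i)"
  unfolding fock_def
  by (rule AE_PiM_coordinates) (auto intro: ST.sigma_finite_measure_axioms good_AE)

text \<open>The first entry comes from \<open>C\<close>, which contributes the factor p^(0) = 1. By
  the recursion \<open>N\<close> raises, keeps or lowers the first index \<open>l\<close>. The last
  entry has two origins: for \<open>l = 0\<close> nothing can be lowered but \<open>A\<close>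
  contributes; for larger \<open>l\<close> the lowered term of \<open>N\<close> stands there and the
  integral in \<open>A\<close> vanishes by orthogonality to p^(0).\<close>

definition tstep :: "nat \<Rightarrow> ((nat \<Rightarrow> 'a) \<Rightarrow> real) \<times> nat list \<Rightarrow> 'a terms"
  where "tstep j t = (fst t, 0 # snd t) # (case snd t of [] \<Rightarrow> [] | l # r \<Rightarrow>
    [(\<lambda>v. fst t (dmap j v), Suc l # r), (\<lambda>v. \<beta> l (v j) * fst t (dmap j v), l # r),
     (case l of 0 \<Rightarrow> (int_out j (fst t), r) | Suc l' \<Rightarrow> (\<lambda>v. \<alpha> l (v j) * fst t (dmap j v), l' # r))])"

lemma B0_coeff:
  assumes "B0 N h" "j < N" shows "B0 N (\<lambda>v. \<beta> l (v j) * h v)" "B0 N (\<lambda>v. \<alpha> l (v j) * h v)"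
proof -
  have c: "(\<lambda>v :: nat \<Rightarrow> 'a. v j) \<in> borel_measurable borel" by simp
  show "B0 N (\<lambda>v. \<beta> l (v j) * h v)"
  proof (rule B0_mult[OF assms(1)])
    show "(\<lambda>v. \<beta> l (v j)) \<in> borel_measurable borel" by (rule measurable_compose[OF c rec_meas(2)])
    fix K :: "'a set" assume "compact K"
    then obtain C where "\<forall>t\<in>K. \<bar>\<beta> l t\<bar> \<le> C" using rec_bound(2) by blast
    then show "\<exists>C. \<forall>t. (\<forall>i<N. t i \<in> K) \<longrightarrow> \<bar>\<beta> l (t j)\<bar> \<le> C" using assms(2) by blast
  qed (use assms(2) in \<open>auto simp: dep_def\<close>)
  show "B0 N (\<lambda>v. \<alpha> l (v j) * h v)"
  proof (rule B0_mult[OF assms(1)])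
    show "(\<lambda>v. \<alpha> l (v j)) \<in> borel_measurable borel" by (rule measurable_compose[OF c rec_meas(1)])
    fix K :: "'a set" assume "compact K"
    then obtain C where "\<forall>t\<in>K. \<bar>\<alpha> l t\<bar> \<le> C" using rec_bound(1) by blast
    then show "\<exists>C. \<forall>t. (\<forall>i<N. t i \<in> K) \<longrightarrow> \<bar>\<alpha> l (t j)\<bar> \<le> C" using assms(2) by blast
  qed (use assms(2) in \<open>auto simp: dep_def\<close>)
qed

lemma tstep_wf:
  assumes "B0 (Suc j + length (snd t)) (fst t)" shows "wf_terms j (tstep j t)"
proof (cases "snd t")
  case Nil
  then show ?thesis using assms by (simp add: wf_terms_def tstep_def)
next
  case (Cons l r)
  have d: "B0 (j + Suc (length r)) (\<lambda>v. fst t (dmap j v))"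
    using B0_dmap[of "j + Suc (length r)" "fst t" j] assms Cons by simp
  have i: "B0 (j + length r) (int_out j (fst t))"
    using int_out_B0[of "j + length r" "fst t" j] assms Cons by simp
  show ?thesis
    using assms Cons d i B0_coeff[OF d, of j] by (auto simp: wf_terms_def tstep_def split: nat.split)
qed

lemma op_C_trm: "op_C j (trm (Suc j) h ls) m z y = trm j h (0 # ls) m z y"
  by (auto simp: op_C_def trm_def join_C split: nat.split)

lemma op_N_trm:
  assumes "0 < m \<Longrightarrow> good (y 0)"
  shows "op_N j (trm (Suc j) h ls) m z y = (case ls of [] \<Rightarrow> 0 | l # r \<Rightarrow>
    trm j (\<lambda>v. h (dmap j v)) (Suc l # r) m z y + trm j (\<lambda>v. \<beta> l (v j) * h (dmap j v)) (l # r) m z y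
    + (case l of 0 \<Rightarrow> 0 | Suc l' \<Rightarrow> trm j (\<lambda>v. \<alpha> l (v j) * h (dmap j v)) (l' # r) m z y))"
proof (cases ls)
  case Nil
  then show ?thesis by (simp add: op_N_def trm_def)
next
  case (Cons l r)
  show ?thesis
  proof (cases "m = Suc (length r)")
    case True
    let ?w = "join j (fst \<circ> z) (fst \<circ> y)"
    have g: "snd (y 0) * p l (y 0) = p (Suc l) (y 0) + \<beta> l (fst (y 0)) * p l (y 0) + (if l = 0 then 0 else \<alpha> l (fst (y 0)) * p (l - 1) (y 0))"
      using assms True by (simp add: good_def)
    have "op_N j (trm (Suc j) h ls) m z y = (snd (y 0) * p l (y 0)) * (h (dmap j ?w) * PP r (y \<circ> Suc))"
      using True Cons by (simp add: op_N_def trm_def join_N)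
    also have "\<dots> = h (dmap j ?w) * PP (Suc l # r) y + \<beta> l (fst (y 0)) * h (dmap j ?w) * PP (l # r) y
      + (case l of 0 \<Rightarrow> 0 | Suc l' \<Rightarrow> \<alpha> l (fst (y 0)) * h (dmap j ?w) * PP (l' # r) y)"
      unfolding g by (simp add: algebra_simps split: nat.split)
    finally show ?thesis using True Cons by (simp add: trm_def split: nat.split)
  next
    case False
    then show ?thesis using Cons by (simp add: op_N_def trm_def split: nat.split)
  qed
qed

lemma op_A_trm:
  assumes h: "B0 (Suc j + length ls) h"
  shows "integrable st (\<lambda>x. trm (Suc j) h ls (Suc m) (z(j := x)) (case_nat x y))"
    "op_A \<sigma> \<mu> j (trm (Suc j) h ls) m z y = (case ls of [] \<Rightarrow> 0 | l # r \<Rightarrow>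
      (case l of 0 \<Rightarrow> trm j (int_out j h) r m z y | Suc l' \<Rightarrow> 0))"
proof -
  have "integrable st (\<lambda>x. trm (Suc j) h ls (Suc m) (z(j := x)) (case_nat x y)) \<and>
    op_A \<sigma> \<mu> j (trm (Suc j) h ls) m z y = (case ls of [] \<Rightarrow> 0 | l # r \<Rightarrow>
      (case l of 0 \<Rightarrow> trm j (int_out j h) r m z y | Suc l' \<Rightarrow> 0))"
  proof (cases "\<exists>l r. ls = l # r \<and> m = length r")
    case False
    then show ?thesis by (auto simp: trm_def op_A_def split: list.split nat.split)
  next
    case True
    then obtain l r where lr: "ls = l # r" "m = length r" by auto
    let ?w = "join j (fst \<circ> z) (fst \<circ> y)"
    have hh: "B0 (Suc (Suc (j + length r))) h" using h lr by simp
    obtain C K where C: "compact K" "\<And>x v. \<bar>h (emap j x v)\<bar> \<le> C" "\<And>x v. h (emap j x v) \<noteq> 0 \<Longrightarrow> x \<in> K"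
      using emap_section(2)[OF hh le_add1] by blast
    have m: "(\<lambda>x. h (emap j x ?w)) \<in> borel_measurable borel" by (rule emap_section(1)[OF hh]) simp
    \<comment> \<open>The factor \<open>p 0 x = 1\<close> is inserted to reach the form of
      \<open>integral_st_p\<close>, whose orthogonality then kills every \<open>l\<close> other than
      0.\<close>
    have e: "trm (Suc j) h ls (Suc m) (z(j := x)) (case_nat x y) = h (emap j (fst x) ?w) * (p l x * p 0 x) * PP r y" for x
      using lr by (simp add: trm_def join_A)
    have i: "integrable st (\<lambda>x. h (emap j (fst x) ?w) * (p l x * p 0 x))"
      by (rule integrable_st_p[OF m C(1,2,3)])
    have v: "(\<integral>x. h (emap j (fst x) ?w) * (p l x * p 0 x) \<partial>st) = (if l = 0 then int_out j h ?w else 0)"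
      using integral_st_p[OF m C(1,2,3), where l = l and k = 0] by (simp add: int_out_def)
    have "op_A \<sigma> \<mu> j (trm (Suc j) h ls) m z y = (if l = 0 then int_out j h ?w else 0) * PP r y"
      unfolding op_A_def e by (simp only: integral_mult_left_zero v)
    then show ?thesis using i lr unfolding e by (auto simp: trm_def split: nat.split)
  qed
  then show "integrable st (\<lambda>x. trm (Suc j) h ls (Suc m) (z(j := x)) (case_nat x y))"
    "op_A \<sigma> \<mu> j (trm (Suc j) h ls) m z y = (case ls of [] \<Rightarrow> 0 | l # r \<Rightarrow>
      (case l of 0 \<Rightarrow> trm j (int_out j h) r m z y | Suc l' \<Rightarrow> 0))" by auto
qed

lemma tstep_sum:
  assumes "0 < m \<Longrightarrow> good (y 0)" and "B0 (Suc j + length (snd t)) (fst t)"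
  shows "tsum j (tstep j t) m z y = op_C j (trm (Suc j) (fst t) (snd t)) m z y
    + op_A \<sigma> \<mu> j (trm (Suc j) (fst t) (snd t)) m z y + op_N j (trm (Suc j) (fst t) (snd t)) m z y"
proof (cases "snd t")
  case Nil
  then show ?thesis
    using assms(2) op_A_trm(2)[of j "snd t" "fst t" m z y] op_N_trm[of m y j "fst t" "snd t" z] assms(1)
    by (simp add: tstep_def tsum_def op_C_trm)
next
  case (Cons l r)
  then show ?thesis
    using assms(2) op_A_trm(2)[of j "snd t" "fst t" m z y] op_N_trm[of m y j "fst t" "snd t" z] assms(1)
    by (cases l) (simp_all add: tstep_def tsum_def op_C_trm)
qed

text \<open>Equality is demanded at all good points and not merely almost everywhere, so that it may
  be evaluated after substitutions. Measurability of \<open>H\<close> is included because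
  \<open>A\<close> compares integrals of functions that are known to agree at good points
  only.\<close>

definition Rep :: "nat \<Rightarrow> 'a tker \<Rightarrow> 'a terms \<Rightarrow> bool"
  where "Rep j H L \<longleftrightarrow> tk_meas H \<and> wf_terms j L \<and>
    (\<forall>m z y. (\<forall>i<j. good (z i)) \<longrightarrow> (\<forall>i<m. good (y i)) \<longrightarrow> H m z y = tsum j L m z y)"

text \<open>\<open>C\<close> and \<open>N\<close> evaluate the identity at good points again.
  \<open>A\<close> integrates over a variable that is good almost everywhere, and splitting its
  integral over the list uses the integrability of each term.\<close>

lemma gstep_Rep:
  assumes R: "Rep (Suc j) H L" shows "Rep j (gstep j H) (concat (map (tstep j) L))"
  unfolding Rep_def
proof (intro conjI allI impI)
  let ?t = "\<lambda>t. trm (Suc j) (fst t) (snd t)"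
  have wf: "wf_terms (Suc j) L" using R by (simp add: Rep_def)
  show "tk_meas (gstep j H)" using R by (intro gstep_meas) (simp add: Rep_def)
  show "wf_terms j (concat (map (tstep j) L))"
    using wf tstep_wf by (fastforce simp: wf_terms_def)
  fix m :: nat and z y :: "nat \<Rightarrow> 'a \<times> real"
  assume z: "\<forall>i<j. good (z i)" and y: "\<forall>i<m. good (y i)"
  have HR: "H m z y = tsum (Suc j) L m z y" if "\<forall>i<Suc j. good (z i)" "\<forall>i<m. good (y i)" for m z y
    using R that by (simp add: Rep_def)
  have sumC: "op_C j H m z y = (\<Sum>t\<leftarrow>L. op_C j (?t t) m z y)"
  proof (cases m)
    case (Suc n)
    have "H n (z(j := y 0)) (y \<circ> Suc) = tsum (Suc j) L n (z(j := y 0)) (y \<circ> Suc)"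
    proof (rule HR)
      show "\<forall>i<Suc j. good ((z(j := y 0)) i)" using z y Suc by (auto simp: less_Suc_eq)
      show "\<forall>i<n. good ((y \<circ> Suc) i)" using y Suc by auto
    qed
    then show ?thesis by (simp add: op_C_def Suc tsum_def)
  qed (simp add: op_C_def)
  have sumN: "op_N j H m z y = (\<Sum>t\<leftarrow>L. op_N j (?t t) m z y)"
  proof (cases "m = 0")
    case False
    have "H m (z(j := y 0)) y = tsum (Suc j) L m (z(j := y 0)) y"
      by (rule HR) (use z y False in \<open>auto simp: less_Suc_eq\<close>)
    then show ?thesis using False by (simp add: op_N_def tsum_def sum_list_const_mult)
  qed (simp add: op_N_def)
  have sumA: "op_A \<sigma> \<mu> j H m z y = (\<Sum>t\<leftarrow>L. op_A \<sigma> \<mu> j (?t t) m z y)"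
  proof -
    let ?T = "\<lambda>x. tsum (Suc j) L (Suc m) (z(j := x)) (case_nat x y)"
    define F where "F t x = trm (Suc j) (fst t) (snd t) (Suc m) (z(j := x)) (case_nat x y)" for t x
    define G where "G L x = tsum (Suc j) L (Suc m) (z(j := x)) (case_nat x y)" for L x
    have G: "G [] x = 0" "G (t # L) x = F t x + G L x" for t L x
      by (simp_all add: G_def F_def tsum_Cons)
    have F: "(\<integral>x. F t x \<partial>st) = op_A \<sigma> \<mu> j (?t t) m z y" for t
      by (simp only: F_def op_A_def)
    have "integrable st (G L) \<and> (\<integral>x. G L x \<partial>st) = (\<Sum>t\<leftarrow>L. op_A \<sigma> \<mu> j (?t t) m z y)"
      using wf
    proof (induction L)
      case (Cons t L)
      have "integrable st (F t)"
        unfolding F_def by (rule op_A_trm(1)) (use Cons.prems in \<open>simp add: wf_terms_def\<close>)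
      moreover have "G (t # L) = (\<lambda>x. F t x + G L x)" by (simp add: G fun_eq_iff)
      ultimately show ?case using Cons.IH Cons.prems F by (simp add: wf_terms_def)
    next
      case Nil
      have "G [] = (\<lambda>x. 0)" by (simp add: G fun_eq_iff)
      then show ?case by simp
    qed
    then have int: "integrable st ?T \<and>
      (\<integral>x. ?T x \<partial>st)
        = (\<Sum>t\<leftarrow>L. op_A \<sigma> \<mu> j (?t t) m z y)"
      unfolding G_def .
    have "op_A \<sigma> \<mu> j H m z y = (\<integral>x. ?T x \<partial>st)"
      unfolding op_A_def
    proof (rule integral_cong_AE)
      have c: "(\<lambda>x. (z(j := x), case_nat x y)) \<in> borel_measurable (borel :: ('a \<times> real) measure)"
      proof (rule borel_measurable_Pair)
        show "(\<lambda>x. z(j := x)) \<in> borel_measurable (borel :: ('a \<times> real) measure)"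
          by (rule measurable_upd_fst) auto
        show "(\<lambda>x. case_nat x y) \<in> borel_measurable (borel :: ('a \<times> real) measure)"
          by (rule measurable_case_nat_borel) auto
      qed
      have "tk_meas H" using R by (simp add: Rep_def)
      then have "(\<lambda>w. H (Suc m) (fst w) (snd w)) \<in> borel_measurable borel" by (simp add: tk_meas_def)
      from measurable_compose[OF c this]
      show "(\<lambda>x. H (Suc m) (z(j := x)) (case_nat x y)) \<in> borel_measurable st"
        unfolding measurable_cong_sets[OF sets_st refl] by simp
      show "?T \<in> borel_measurable st"
        using int by auto
      show "AE x in st. H (Suc m) (z(j := x)) (case_nat x y) = ?T x"
        using good_AE
      proof eventually_elim
        case (elim x)
        show ?case
        proof (rule HR)
          show "\<forall>i<Suc j. good ((z(j := x)) i)" using z elim by (auto simp: less_Suc_eq)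
          show "\<forall>i<Suc m. good (case_nat x y i)" using y elim by (auto split: nat.split)
        qed
      qed
    qed
    then show ?thesis using int by simp
  qed
  have "tsum j (concat (map (tstep j) L)) m z y = (\<Sum>t\<leftarrow>L. tsum j (tstep j t) m z y)"
    by (induction L) (auto simp: tsum_append)
  also have "\<dots> = (\<Sum>t\<leftarrow>L. op_C j (?t t) m z y
    + op_A \<sigma> \<mu> j (?t t) m z y + op_N j (?t t) m z y)"
    using wf y by (intro arg_cong[where f = sum_list] map_cong refl tstep_sum) (auto simp: wf_terms_def)
  also have "\<dots> = gstep j H m z y"
    by (simp add: gstep_def sumC sumA sumN sum_list_addf)
  finally show "gstep j H m z y = tsum j (concat (map (tstep j) L)) m z y" ..
qed

lemma Rep_cong:
  assumes "Rep j H L" "wf_terms j L'" "\<And>m z y. tsum j L m z y = tsum j L' m z y" shows "Rep j H L'"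
  using assms by (simp add: Rep_def)

end

section \<open>Leading terms of monomials\<close>

definition Sn_list :: "nat \<Rightarrow> nat list list"
  where "Sn_list k = (SOME xs. set xs = Sn k \<and> distinct xs)"

lemma Sn_list: "set (Sn_list k) = Sn k" "distinct (Sn_list k)"
proof -
  have "\<exists>xs. set xs = Sn k \<and> distinct xs" by (rule finite_distinct_list) simp
  from someI_ex[OF this] show "set (Sn_list k) = Sn k" "distinct (Sn_list k)" by (auto simp: Sn_list_def)
qed

lemma sum_list_Sn: "(\<Sum>ls\<leftarrow>Sn_list k. \<phi> ls) = (\<Sum>ls\<in>Sn k. \<phi> ls)"
  using Sn_list[of k] by (metis sum_list_distinct_conv_sum_set)

lemma spr_0_eq: "spr 0 ls v = (\<lambda>i. v (blk ls i))"
  by (simp add: spr_def fun_eq_iff)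

context jac_process
begin

text \<open>All restrictions of one kernel \<open>F\<close> to the strata of order \<open>k\<close>,
  while \<open>j\<close> variables are still to be consumed.\<close>

definition UL :: "nat \<Rightarrow> nat \<Rightarrow> ((nat \<Rightarrow> 'a) \<Rightarrow> real) \<Rightarrow> 'a terms"
  where "UL j k F = map (\<lambda>ls. ((\<lambda>v. F (spr j ls v)), ls)) (Sn_list k)"

text \<open>The image \<open>P(F)\<close> of \<open>F\<close> under \<open>J\<close>.\<close>
definition U :: "nat \<Rightarrow> ((nat \<Rightarrow> 'a) \<Rightarrow> real) \<Rightarrow> 'a fock_vec"
  where "U k F m y = (\<Sum>ls\<in>Sn k. vec (\<lambda>v. F (\<lambda>i. v (blk ls i))) ls m y)"

definition lsum :: "'a terms \<Rightarrow> 'a fock_vec"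
  where "lsum L m y = (\<Sum>t\<leftarrow>L. vec (fst t) (snd t) m y)"

lemma tsum_0: "tsum 0 L m z y = lsum L m y"
  by (simp add: tsum_def lsum_def trm_0)

lemma lsum_append: "lsum (L @ L') m y = lsum L m y + lsum L' m y"
  by (simp add: lsum_def)

lemma lsum_Cons: "lsum (t # L) = (\<lambda>m y. vec (fst t) (snd t) m y + lsum L m y)"
  by (simp add: lsum_def fun_eq_iff)

lemma lsum_Nil: "lsum [] = (\<lambda>m y. 0)"
  by (simp add: lsum_def fun_eq_iff)

lemma tsum_UL: "tsum j (UL j k F) m z y = (\<Sum>ls\<in>Sn k. trm j (\<lambda>v. F (spr j ls v)) ls m z y)"
  by (simp add: tsum_def UL_def o_def sum_list_Sn[symmetric])

lemma lsum_UL: "lsum (UL 0 k F) = U k F"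
proof (intro ext)
  fix m y
  show "lsum (UL 0 k F) m y = U k F m y"
    using tsum_UL[of 0 k F m undefined y] by (simp add: tsum_0 U_def trm_0 spr_0_eq)
qed

lemma UL_wf: "B0 (j + k) F \<Longrightarrow> wf_terms j (UL j k F)"
  using B0_spr[of j _ F] by (auto simp: wf_terms_def UL_def Sn_list Sn_def)

lemma UL_deg: "t \<in> set (UL j k F) \<Longrightarrow> deg (snd t) = k"
  by (auto simp: UL_def Sn_list Sn_def)

lemma lsum_gl2: "wf_terms 0 L \<Longrightarrow> lsum L \<in> gl2 \<F>"
proof (induction L)
  case Nil
  then show ?case by (simp add: lsum_Nil gl2_zero)
next
  case (Cons t L)
  then show ?case unfolding lsum_Cons by (intro gl2_add vec_gl2) (auto simp: wf_terms_def)
qed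

lemma U_wf: "B0 k F \<Longrightarrow> wf_terms 0 (UL 0 k F)"
  by (rule UL_wf) simp

lemma U_gl2: "B0 k F \<Longrightarrow> U k F \<in> gl2 \<F>"
  using lsum_gl2[OF U_wf] by (simp add: lsum_UL)

lemma lsum_inner_zero:
  assumes "wf_terms 0 L" "wf_terms 0 L'" "\<And>t t'. t \<in> set L \<Longrightarrow> t' \<in> set L' \<Longrightarrow> deg (snd t) \<noteq> deg (snd t')"
  shows "gl2_inner \<F> (lsum L) (lsum L') = 0"
  using assms(1,3)
proof (induction L)
  case Nil
  then show ?case by (simp add: lsum_Nil gl2_inner_zero)
next
  case (Cons t L)
  have t: "B0 (length (snd t)) (fst t)" using Cons.prems by (simp add: wf_terms_def)
  have "gl2_inner \<F> (vec (fst t) (snd t)) (lsum L') = 0"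
    using assms(2) Cons.prems(2)
  proof (induction L')
    case Nil
    then show ?case using gl2_inner_zero[of "\<F>" "vec (fst t) (snd t)"] by (simp add: lsum_Nil gl2_inner_sym)
  next
    case (Cons t' L')
    have t': "B0 (length (snd t')) (fst t')" using Cons.prems by (simp add: wf_terms_def)
    have "snd t \<noteq> snd t'" using Cons.prems(2)[of t t'] by auto
    then have "gl2_inner \<F> (vec (fst t) (snd t)) (vec (fst t') (snd t')) = 0"
      using vec_inner[OF t t'] by simp
    then show ?case unfolding lsum_Cons
      using gl2_inner_add2[OF vec_gl2[OF t'] lsum_gl2 vec_gl2[OF t], of L'] Cons by (simp add: wf_terms_def)
  qed
  then show ?case unfolding lsum_Cons
    using gl2_inner_add[OF vec_gl2[OF t] lsum_gl2 lsum_gl2[OF assms(2)], of L] Cons by (simp add: wf_terms_def)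
qed

lemma U_diff: "(\<lambda>m y. U k F m y - U k G m y) = U k (\<lambda>v. F v - G v)"
  by (auto simp: U_def vec_def fun_eq_iff left_diff_distrib simp flip: sum_subtractf intro!: sum.cong)

lemma U_add: "(\<lambda>m y. U k F m y + U k G m y) = U k (\<lambda>v. F v + G v)"
  by (auto simp: U_def vec_def fun_eq_iff distrib_right simp flip: sum.distrib intro!: sum.cong)

lemma U_zero: "U k (\<lambda>v. 0) = (\<lambda>m y. 0)"
  by (auto simp: U_def vec_def fun_eq_iff intro!: sum.neutral)

lemma B0_blk:
  fixes F :: "(nat \<Rightarrow> 'a) \<Rightarrow> real"
  assumes "B0 k F" "ls \<in> Sn k" shows "B0 (length ls) (\<lambda>v. F (\<lambda>i. v (blk ls i)))"
  using B0_spr[of 0 ls F] assms by (simp add: Sn_def spr_0_eq)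

lemma nn_integral_ext_B0:
  assumes F: "B0 k F"
  shows "(\<integral>\<^sup>+u. ennreal ((F u)\<^sup>2) \<partial>ext k) = ennreal (\<Sum>ls\<in>Sn k. \<integral>t. (F (\<lambda>i. t (blk ls i)))\<^sup>2 \<partial>SP ls)"
proof -
  have m: "(\<lambda>u. ennreal ((F u)\<^sup>2)) \<in> borel_measurable (ext k)"
    using measurable_extI[OF B0D(1)[OF F]] by measurable
  have "(\<integral>\<^sup>+u. ennreal ((F u)\<^sup>2) \<partial>ext k) = (\<Sum>ls\<in>Sn k. \<integral>\<^sup>+t. ennreal ((F (spread ls t))\<^sup>2) \<partial>SP ls)"
    by (rule nn_integral_ext[OF m])
  also have "\<dots> = (\<Sum>ls\<in>Sn k. ennreal (\<integral>t. (F (\<lambda>i. t (blk ls i)))\<^sup>2 \<partial>SP ls))"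
  proof (rule sum.cong[OF refl])
    fix ls assume ls: "ls \<in> Sn k"
    have e: "F (spread ls t) = F (\<lambda>i. t (blk ls i))" for t
      by (rule B0_spread[OF B0D(2)[OF F] deg_Sn[OF ls]])
    have i: "integrable (SP ls) (\<lambda>t. (F (\<lambda>i. t (blk ls i)))\<^sup>2)"
      using B0_integrable_SP[OF B0_prod[OF B0_blk[OF F ls] B0_blk[OF F ls]]] by (simp add: power2_eq_square)
    show "(\<integral>\<^sup>+t. ennreal ((F (spread ls t))\<^sup>2) \<partial>SP ls) = ennreal (\<integral>t. (F (\<lambda>i. t (blk ls i)))\<^sup>2 \<partial>SP ls)"
      unfolding e by (rule nn_integral_eq_integral[OF i]) simp
  qed
  also have "\<dots> = ennreal (\<Sum>ls\<in>Sn k. \<integral>t. (F (\<lambda>i. t (blk ls i)))\<^sup>2 \<partial>SP ls)"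
    by (rule sum_ennreal) (auto intro!: integral_nonneg_AE)
  finally show ?thesis .
qed

lemma U_norm_eq: 
  assumes F: "B0 k F"
  shows "gl2_inner \<F> (U k F) (U k F) = (\<Sum>ls\<in>Sn k. \<integral>t. (F (\<lambda>i. t (blk ls i)))\<^sup>2 \<partial>SP ls)"
proof -
  let ?v = "\<lambda>ls. vec (\<lambda>v. F (\<lambda>i. v (blk ls i))) ls"
  have g: "?v ls \<in> gl2 \<F>" if "ls \<in> Sn k" for ls by (rule vec_gl2[OF B0_blk[OF F that]])
  have Ue: "U k F = (\<lambda>m y. \<Sum>ls\<in>Sn k. ?v ls m y)" by (simp add: U_def fun_eq_iff)
  have gU: "(\<lambda>m y. \<Sum>ls\<in>Sn k. ?v ls m y) \<in> gl2 \<F>" using g by (rule gl2_sum)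
  have "gl2_inner \<F> (U k F) (U k F) = (\<Sum>ls\<in>Sn k. gl2_inner \<F> (?v ls) (U k F))"
    unfolding Ue by (rule gl2_inner_sum[OF g gU])
  also have "\<dots> = (\<Sum>ls\<in>Sn k. \<Sum>ls'\<in>Sn k. gl2_inner \<F> (?v ls') (?v ls))"
  proof (rule sum.cong[OF refl])
    fix ls assume ls: "ls \<in> Sn k"
    have "gl2_inner \<F> (?v ls) (U k F) = gl2_inner \<F> (U k F) (?v ls)" by (rule gl2_inner_sym)
    also have "\<dots> = (\<Sum>ls'\<in>Sn k. gl2_inner \<F> (?v ls') (?v ls))"
      unfolding Ue by (rule gl2_inner_sum[OF g g[OF ls]])
    finally show "gl2_inner \<F> (?v ls) (U k F) = (\<Sum>ls'\<in>Sn k. gl2_inner \<F> (?v ls') (?v ls))" .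
  qed
  also have "\<dots> = (\<Sum>ls\<in>Sn k. \<Sum>ls'\<in>Sn k. if ls' = ls then \<integral>t. (F (\<lambda>i. t (blk ls i)))\<^sup>2 \<partial>SP ls else 0)"
    by (intro sum.cong refl) (auto simp: vec_inner[OF B0_blk[OF F] B0_blk[OF F]] power2_eq_square)
  also have "\<dots> = (\<Sum>ls\<in>Sn k. \<integral>t. (F (\<lambda>i. t (blk ls i)))\<^sup>2 \<partial>SP ls)"
    by (simp add: sum.delta')
  finally show ?thesis .
qed

text \<open>Together with the orthogonality of different degrees this is the isometry of
  \<open>J\<close>, here for bounded kernels with compact support.\<close>

lemma U_norm_nn:
  assumes "B0 k F" shows "(\<integral>\<^sup>+u. ennreal ((F u)\<^sup>2) \<partial>ext k) = ennreal (gl2_inner \<F> (U k F) (U k F))"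
  using nn_integral_ext_B0[OF assms] U_norm_eq[OF assms] by simp

text \<open>Coefficients may be prescribed independently on the strata and still come from one
  kernel, because \<open>glue\<close> reproduces each of them almost everywhere for its own
  measure.\<close>

lemma U_glue:
  assumes h: "\<And>ls. ls \<in> Sn k \<Longrightarrow> B0 (length ls) (h ls)"
  shows "gl2_eq \<F> (U k (glue k h)) (\<lambda>m y. \<Sum>ls\<in>Sn k. vec (h ls) ls m y)"
  unfolding U_def[abs_def]
proof (rule gl2_eq_sum)
  fix ls assume ls: "ls \<in> Sn k"
  let ?g = "\<lambda>v. glue k h (\<lambda>i. v (blk ls i))"
  have g: "B0 (length ls) ?g" by (rule B0_blk[OF glue_B0[OF h] ls])
  have d: "B0 (length ls) (\<lambda>v. ?g v - h ls v)" by (rule B0_diff[OF g h[OF ls]])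
  have "gl2_inner \<F> (vec (\<lambda>v. ?g v - h ls v) ls) (vec (\<lambda>v. ?g v - h ls v) ls) = (\<integral>t. (?g t - h ls t) * (?g t - h ls t) \<partial>SP ls)"
    using vec_inner[OF d d] by simp
  also have "\<dots> = (\<integral>t. 0 \<partial>SP ls)"
  proof (rule integral_cong_AE)
    show "(\<lambda>t. (?g t - h ls t) * (?g t - h ls t)) \<in> borel_measurable (SP ls)"
      using measurable_SPI[OF B0D(1)[OF d]] by measurable
    show "AE t in SP ls. (?g t - h ls t) * (?g t - h ls t) = 0"
    proof -
      have "AE t in SP ls. ?g t = h ls t" by (rule glue_AE) (use B0D(2)[OF h] ls in auto)
      then show ?thesis by eventually_elim simp
    qed
  qed simp
  finally have "gl2_eq \<F> (vec (\<lambda>v. ?g v - h ls v) ls) (\<lambda>m y. 0)"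
    using gl2_eq_zero_iff[OF vec_gl2[OF d]] by simp
  then show "gl2_eq \<F> (vec ?g ls) (vec (h ls) ls)"
    unfolding gl2_eq_def by (rule all_forward, elim AE_mp) (auto simp: vec_def left_diff_distrib)
qed

end

context jac_rec
begin

text \<open>For \<open>ls\<close> of degree \<open>k\<close>, the first two entries of
  \<open>tstep\<close>, with first indices 0 and \<open>Suc l\<close>, have degree
  \<open>k + 1\<close> and contribute to \<open>UL j (Suc k) F\<close>; for the empty list there is
  only the former. What remains has degree at most \<open>k\<close>.\<close>

definition rest :: "nat \<Rightarrow> ((nat \<Rightarrow> 'a) \<Rightarrow> real) \<Rightarrow> nat list \<Rightarrow> 'a terms"
  where "rest j F ls = (if ls = [] then [] else drop 2 (tstep j ((\<lambda>v. F (spr (Suc j) ls v)), ls)))"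

lemma tsum_concat: "tsum j (concat (map g xs)) m z y = (\<Sum>x\<leftarrow>xs. tsum j (g x) m z y)"
  by (induction xs) (auto simp: tsum_append)

text \<open>By \<open>spr_0\<close> and \<open>spr_dmap\<close> the leading entries are restrictions
  of the same kernel \<open>F\<close>, and \<open>sum_Sn_Suc\<close> collects them into all strata
  of order \<open>k + 1\<close>.\<close>

lemma tstep_UL:
  "tsum j (concat (map (tstep j) (UL (Suc j) k F))) m z y = tsum j (UL j (Suc k) F) m z y + (\<Sum>ls\<in>Sn k. tsum j (rest j F ls) m z y)"
proof -
  have t: "tsum j (tstep j ((\<lambda>v. F (spr (Suc j) ls v)), ls)) m z y
    = trm j (\<lambda>v. F (spr j (0 # ls) v)) (0 # ls) m z y
    + (case ls of [] \<Rightarrow> 0 | l # r \<Rightarrow> trm j (\<lambda>v. F (spr j (Suc l # r) v)) (Suc l # r) m z y) + tsum j (rest j F ls) m z y" for ls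
    by (cases ls) (auto simp: tstep_def rest_def tsum_def spr_0 spr_dmap)
  have "tsum j (concat (map (tstep j) (UL (Suc j) k F))) m z y = (\<Sum>ls\<in>Sn k. tsum j (tstep j ((\<lambda>v. F (spr (Suc j) ls v)), ls)) m z y)"
    by (simp add: tsum_concat UL_def o_def sum_list_Sn[symmetric])
  then show ?thesis unfolding t tsum_UL sum_Sn_Suc by (simp only: sum.distrib)
qed

lemma terms_rest:
  "\<exists>L'. (\<forall>m z y. tsum j (concat (map (tstep j) (UL (Suc j) k F))) m z y = tsum j (UL j (Suc k) F) m z y + tsum j L' m z y)
    \<and> set L' \<subseteq> set (concat (map (tstep j) (UL (Suc j) k F))) \<and> (\<forall>t\<in>set L'. deg (snd t) < Suc k)"
proof (intro exI conjI allI ballI)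
  let ?L = "concat (map (rest j F) (Sn_list k))"
  show "tsum j (concat (map (tstep j) (UL (Suc j) k F))) m z y = tsum j (UL j (Suc k) F) m z y + tsum j ?L m z y" for m z y
    unfolding tstep_UL by (simp add: tsum_concat sum_list_Sn)
  show "set ?L \<subseteq> set (concat (map (tstep j) (UL (Suc j) k F)))"
    by (fastforce simp: rest_def UL_def split: if_splits dest: in_set_dropD)
  fix t assume "t \<in> set ?L"
  then obtain ls where "ls \<in> Sn k" "t \<in> set (rest j F ls)" by (auto simp: Sn_list)
  then show "deg (snd t) < Suc k" by (cases ls) (auto simp: rest_def tstep_def Sn_def split: nat.splits)
qed

lemma tstep_deg: "t' \<in> set (tstep j t) \<Longrightarrow> deg (snd t') \<le> Suc (deg (snd t))"
  by (cases "snd t") (auto simp: tstep_def split: nat.splits)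

lemma Rep_monomial_step:
  assumes R: "Rep (Suc j) H (UL (Suc j) k F @ L)" and L: "\<forall>t\<in>set L. deg (snd t) < k" and F: "B0 (Suc j + k) F"
  shows "\<exists>L'. Rep j (gstep j H) (UL j (Suc k) F @ L') \<and> (\<forall>t\<in>set L'. deg (snd t) < Suc k)"
proof -
  obtain L1 where L1: "\<And>m z y. tsum j (concat (map (tstep j) (UL (Suc j) k F))) m z y = tsum j (UL j (Suc k) F) m z y + tsum j L1 m z y"
    "set L1 \<subseteq> set (concat (map (tstep j) (UL (Suc j) k F)))" "\<forall>t\<in>set L1. deg (snd t) < Suc k"
    using terms_rest[of j k F] by blast
  define L2 where "L2 = L1 @ concat (map (tstep j) L)"
  note G = gstep_Rep[OF R]
  have "Rep j (gstep j H) (UL j (Suc k) F @ L2)"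
  proof (rule Rep_cong[OF G])
    have "wf_terms j (concat (map (tstep j) (UL (Suc j) k F @ L)))" using G by (simp add: Rep_def)
    then have "wf_terms j L2" using L1(2) unfolding L2_def wf_terms_def by auto
    moreover have "wf_terms j (UL j (Suc k) F)" by (rule UL_wf) (use F in simp)
    ultimately show "wf_terms j (UL j (Suc k) F @ L2)" by (auto simp: wf_terms_def)
    show "tsum j (concat (map (tstep j) (UL (Suc j) k F @ L))) m z y = tsum j (UL j (Suc k) F @ L2) m z y" for m z y
      by (simp add: tsum_append L2_def L1(1))
  qed
  moreover have "\<forall>t\<in>set L2. deg (snd t) < Suc k"
    using L1(3) L tstep_deg by (fastforce simp: L2_def)
  ultimately show ?thesis by blast
qed

text \<open>Kept as an explicit function of the list: its compatibility with append yields the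
  additivity of monomials in the kernel.\<close>

fun itL :: "nat \<Rightarrow> 'a terms \<Rightarrow> 'a terms" where
  "itL 0 L = L"
| "itL (Suc k) L = itL k (concat (map (tstep k) L))"

lemma CAN_Rep: "Rep k H L \<Longrightarrow> Rep 0 (CAN_power \<sigma> \<mu> k H) (itL k L)"
  by (induction k arbitrary: H L) (auto simp: CAN_power_Suc gstep_Rep simp del: CAN_power.simps(2))

lemma itL_append: "itL k (L @ L') = itL k L @ itL k L'"
  by (induction k arbitrary: L L') auto

definition mono_start :: "nat \<Rightarrow> ((nat \<Rightarrow> 'a) \<Rightarrow> real) \<Rightarrow> 'a tker"
  where "mono_start n f = (\<lambda>j z y. f (\<lambda>i\<in>{..<n}. fst (z i)) * vacuum j y)"

lemma mono_start_eq: "mono_start n f m z y = ext_seq n f (fst \<circ> z) * vacuum m y"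
  by (simp add: mono_start_def ext_seq_def restrict_def o_def)

lemma monomial_eq: "monomial \<sigma> \<mu> n f vacuum m y = CAN_power \<sigma> \<mu> n (mono_start n f) m undefined y"
  by (simp add: monomial_def mono_start_def)

text \<open>The vacuum is the empty product, so the initial kernel is a single term of degree
  0.\<close>

lemma mono_start_Rep:
  assumes f: "B0 n (ext_seq n f)" shows "Rep n (mono_start n f) [(ext_seq n f, [])]"
  unfolding Rep_def
proof (intro conjI allI impI)
  show "tk_meas (mono_start n f)"
    unfolding tk_meas_def
  proof
    fix m
    have 1: "(\<lambda>w :: (nat \<Rightarrow> 'a \<times> real) \<times> (nat \<Rightarrow> 'a \<times> real). ext_seq n f (fst \<circ> fst w)) \<in> borel_measurable borel"
      by (rule measurable_compose[OF measurable_fst_comp_borel B0D(1)[OF f]]) simp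
    have "vacuum m = (\<lambda>y :: nat \<Rightarrow> 'a \<times> real. if m = 0 then 1 else 0)" by (auto simp: vacuum_def single_def fun_eq_iff)
    then have 2: "(\<lambda>w :: (nat \<Rightarrow> 'a \<times> real) \<times> (nat \<Rightarrow> 'a \<times> real). vacuum m (snd w)) \<in> borel_measurable borel" by simp
    show "(\<lambda>w. mono_start n f m (fst w) (snd w)) \<in> borel_measurable borel"
      unfolding mono_start_eq using 1 2 by (rule borel_measurable_times)
  qed
  show "wf_terms n [(ext_seq n f, [])]" using f by (simp add: wf_terms_def)
  fix m :: nat and z y :: "nat \<Rightarrow> 'a \<times> real"
  have "ext_seq n f (join n (fst \<circ> z) (fst \<circ> y)) = ext_seq n f (fst \<circ> z)"
    by (rule depD[OF B0D(2)[OF f]]) (simp add: join_def)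
  then show "mono_start n f m z y = tsum n [(ext_seq n f, [])] m z y"
    by (simp add: mono_start_eq tsum_def trm_def vacuum_def single_def)
qed

text \<open>With no \<open>z\<close> left, the required goodness concerns the entries of
  \<open>y\<close> alone and holds almost everywhere in each component.\<close>

lemma Rep_0_gl2_eq:
  assumes "Rep 0 H L"
  shows "gl2_eq \<F> (\<lambda>m y. H m z y) (lsum L)" "(\<lambda>m y. H m z y) \<in> gl2 \<F>"
proof -
  have ae: "AE y in \<F> m. H m z y = lsum L m y" for m
    using good_fock_AE[of m] by eventually_elim (use assms in \<open>auto simp: Rep_def tsum_0\<close>)
  then show e: "gl2_eq \<F> (\<lambda>m y. H m z y) (lsum L)" by (simp add: gl2_eq_def)
  have wf: "wf_terms 0 L" using assms by (simp add: Rep_def)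
  have m: "(\<lambda>y. H m z y) \<in> borel_measurable (\<F> m)" for m
  proof (rule measurable_fockI)
    have 1: "(\<lambda>y :: nat \<Rightarrow> 'a \<times> real. (z, y)) \<in> borel_measurable borel"
      by (rule borel_measurable_Pair) simp_all
    have 2: "(\<lambda>w. H m (fst w) (snd w)) \<in> borel_measurable borel" using assms by (simp add: Rep_def tk_meas_def)
    from measurable_compose[OF 1 2] show "(\<lambda>y. H m z y) \<in> borel_measurable borel" by simp
  qed
  have g: "lsum L \<in> gl2 \<F>" by (rule lsum_gl2[OF wf])
  have c: "(\<integral>y. (H m z y)\<^sup>2 \<partial>\<F> m) = (\<integral>y. (lsum L m y)\<^sup>2 \<partial>\<F> m)" for m
  proof (rule integral_cong_AE)
    show "AE y in \<F> m. (H m z y)\<^sup>2 = (lsum L m y)\<^sup>2" using ae[of m] by eventually_elim simp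
  qed (use m[of m] gl2D(1)[OF g, of m] in auto)
  have "integrable (\<F> m) (\<lambda>y. (H m z y)\<^sup>2)" for m
  proof (subst integrable_cong_AE)
    show "AE y in \<F> m. (H m z y)\<^sup>2 = (lsum L m y)\<^sup>2" using ae[of m] by eventually_elim simp
    show "integrable (\<F> m) (\<lambda>y. (lsum L m y)\<^sup>2)" by (rule gl2D(2)[OF g])
  qed (use m[of m] gl2D(1)[OF g, of m] in auto)
  then show "(\<lambda>m y. H m z y) \<in> gl2 \<F>"
    using m gl2D(3)[OF g] by (simp add: gl2_def c)
qed

text \<open>Induction on the number \<open>k\<close> of variables still to be consumed. The order
  \<open>i\<close> of the leading part grows by one at each step, so \<open>k + i\<close> stays
  fixed.\<close>

lemma CAN_expand:
  assumes "Rep k H (UL k i F @ L)" "\<forall>t\<in>set L. deg (snd t) < i" "B0 (k + i) F"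
  shows "\<exists>L'. Rep 0 (CAN_power \<sigma> \<mu> k H) (UL 0 (k + i) F @ L') \<and> (\<forall>t\<in>set L'. deg (snd t) < k + i)"
  using assms
proof (induction k arbitrary: H i L)
  case 0
  then show ?case by auto
next
  case (Suc k)
  obtain L' where L': "Rep k (gstep k H) (UL k (Suc i) F @ L')" "\<forall>t\<in>set L'. deg (snd t) < Suc i"
    using Rep_monomial_step[OF Suc.prems(1,2)] Suc.prems(3) by auto
  from Suc.IH[OF L'] Suc.prems(3) show ?case by (simp add: CAN_power_Suc del: CAN_power.simps(2))
qed

lemma monomial_expand:
  assumes f: "B0 n (ext_seq n f)"
  shows "\<exists>L. wf_terms 0 L \<and> (\<forall>t\<in>set L. deg (snd t) < n) \<and>
    gl2_eq \<F> (monomial \<sigma> \<mu> n f vacuum) (\<lambda>m y. U n (ext_seq n f) m y + lsum L m y)"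
proof -
  have "Rep n (mono_start n f) (UL n 0 (ext_seq n f) @ [])"
  proof (rule Rep_cong[OF mono_start_Rep[OF f]])
    show "wf_terms n (UL n 0 (ext_seq n f) @ [])" using UL_wf[of n 0 "ext_seq n f"] f by simp
    fix m z y
    have "ext_seq n f (spr n [] v) = ext_seq n f v" for v
      by (rule depD[OF B0D(2)[OF f]]) (simp add: spr_def)
    then show "tsum n [(ext_seq n f, [])] m z y = tsum n (UL n 0 (ext_seq n f) @ []) m z y"
      by (simp add: tsum_UL) (simp add: tsum_def)
  qed
  from CAN_expand[OF this] f obtain L where L: "Rep 0 (CAN_power \<sigma> \<mu> n (mono_start n f)) (UL 0 n (ext_seq n f) @ L)"
    "\<forall>t\<in>set L. deg (snd t) < n" by auto
  have "gl2_eq \<F> (monomial \<sigma> \<mu> n f vacuum) (lsum (UL 0 n (ext_seq n f) @ L))"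
    using Rep_0_gl2_eq(1)[OF L(1), of undefined] by (simp add: monomial_eq[abs_def])
  moreover have "lsum (UL 0 n (ext_seq n f) @ L) = (\<lambda>m y. U n (ext_seq n f) m y + lsum L m y)"
    by (simp add: fun_eq_iff lsum_append lsum_UL)
  moreover have "wf_terms 0 L" using L(1) by (auto simp: Rep_def wf_terms_def)
  ultimately show ?thesis using L(2) by auto
qed

lemma monomial_gl2:
  assumes f: "B0 n (ext_seq n f)" shows "monomial \<sigma> \<mu> n f vacuum \<in> gl2 \<F>"
  using Rep_0_gl2_eq(2)[OF CAN_Rep[OF mono_start_Rep[OF f]], of undefined] by (simp add: monomial_eq[abs_def])

text \<open>Additivity is claimed almost everywhere: the integral in \<open>op_A\<close> need not be
  additive without integrability, so the claim is read off from the expansions, whose terms are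
  integrable.\<close>

lemma monomial_add:
  assumes f: "B0 n (ext_seq n f)" and g: "B0 n (ext_seq n g)"
  shows "gl2_eq \<F> (monomial \<sigma> \<mu> n (\<lambda>t. f t + g t) vacuum)
    (\<lambda>m y. monomial \<sigma> \<mu> n f vacuum m y + monomial \<sigma> \<mu> n g vacuum m y)"
proof -
  have e: "ext_seq n (\<lambda>t. f t + g t) = (\<lambda>t. ext_seq n f t + ext_seq n g t)" by (simp add: ext_seq_def fun_eq_iff)
  have fg: "B0 n (ext_seq n (\<lambda>t. f t + g t))" unfolding e by (rule B0_add[OF f g])
  have "Rep n (mono_start n (\<lambda>t. f t + g t)) ([(ext_seq n f, [])] @ [(ext_seq n g, [])])"
  proof (rule Rep_cong[OF mono_start_Rep[OF fg]])
    show "wf_terms n ([(ext_seq n f, [])] @ [(ext_seq n g, [])])" using f g by (simp add: wf_terms_def)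
  qed (simp add: tsum_def trm_def e)
  from Rep_0_gl2_eq(1)[OF CAN_Rep[OF this], of undefined]
  have s: "gl2_eq \<F> (monomial \<sigma> \<mu> n (\<lambda>t. f t + g t) vacuum)
     (\<lambda>m y. lsum (itL n [(ext_seq n f, [])]) m y + lsum (itL n [(ext_seq n g, [])]) m y)"
    by (simp only: monomial_eq[abs_def] itL_append lsum_append[abs_def])
  have "gl2_eq \<F> (monomial \<sigma> \<mu> n h vacuum) (lsum (itL n [(ext_seq n h, [])]))" if "B0 n (ext_seq n h)" for h
    using Rep_0_gl2_eq(1)[OF CAN_Rep[OF mono_start_Rep[OF that]], of undefined] by (simp only: monomial_eq[abs_def])
  from gl2_eq_trans[OF s gl2_eq_sym[OF gl2_eq_add[OF this[OF f] this[OF g]]]] show ?thesis .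
qed

end

text \<open>In contrast to sums, scaling commutes with the integral without any integrability, so
  this holds at every point.\<close>

lemma CAN_power_cmult:
  "CAN_power \<sigma> \<mu> k (\<lambda>m z y. c * H m z y) = (\<lambda>m z y. c * CAN_power \<sigma> \<mu> k H m z y)"
proof (induction k arbitrary: H)
  case (Suc k)
  have "(\<lambda>m z y. op_C k (\<lambda>m z y. c * H m z y) m z y + op_A \<sigma> \<mu> k (\<lambda>m z y. c * H m z y) m z y + op_N k (\<lambda>m z y. c * H m z y) m z y)
    = (\<lambda>m z y. c * (op_C k H m z y + op_A \<sigma> \<mu> k H m z y + op_N k H m z y))"
    by (auto simp: fun_eq_iff op_C_def op_A_def op_N_def algebra_simps split: nat.split)
  then show ?case using Suc.IH[of "\<lambda>m z y. op_C k H m z y + op_A \<sigma> \<mu> k H m z y + op_N k H m z y"] by simp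
qed simp

lemma monomial_cmult: "monomial \<sigma> \<mu> n (\<lambda>t. c * f t) G = (\<lambda>m y. c * monomial \<sigma> \<mu> n f G m y)"
  using CAN_power_cmult[of \<sigma> \<mu> n c "\<lambda>j z y. f (\<lambda>i\<in>{..<n}. fst (z i)) * G j y"]
  by (simp add: monomial_def mult.assoc)

lemma monomial_zero: "monomial \<sigma> \<mu> n (\<lambda>t. 0) G = (\<lambda>m y. 0)"
  using monomial_cmult[of \<sigma> \<mu> n 0 "\<lambda>_. 0" G] by simp

section \<open>Orthogonal projections of monomials\<close>

lemma ext_seq_dep: "dep n f \<Longrightarrow> ext_seq n f = f"
  unfolding ext_seq_def fun_eq_iff by (auto intro: depD)

lemma monomial_ext_seq: "monomial \<sigma> \<mu> n (ext_seq n f) = monomial \<sigma> \<mu> n f"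
  by (simp add: monomial_def[abs_def] ext_seq_def)

context jac_process
begin

lemma own_rec: "jac_rec \<sigma> \<mu> ja jb"
proof -
  have "AE t in \<sigma>. \<forall>l. AE s in \<mu> t. s * p l (t, s) = p (Suc l) (t, s) + jb l t * p l (t, s)
        + (if l = 0 then 0 else ja l t * p (l - 1) (t, s))"
  proof (rule AE_I2, rule allI)
    fix t l
    show "AE s in \<mu> t. s * p l (t, s) = p (Suc l) (t, s) + jb l t * p l (t, s)
        + (if l = 0 then 0 else ja l t * p (l - 1) (t, s))"
      using p_recursion[where t = t and l = l] by eventually_elim auto
  qed
  then show ?thesis
    by (intro jac_rec.intro jac_rec_axioms.intro jac_process_axioms ja_measurable jb_measurable ja_local_bound jb_local_bound)
qed

section \<open>Continuous polynomials applied to the vacuum, and their closures\<close>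

abbreviation "mono_vac n f \<equiv> monomial \<sigma> \<mu> n f vacuum"

lemma B0_ext_seq_C0: "C0 n (f :: (nat \<Rightarrow> 'a) \<Rightarrow> real) \<Longrightarrow> B0 n (ext_seq n f)"
  using C0_imp_B0[of n f] ext_seq_dep[OF C0D(2), of n f] by simp

lemma mono_gl2: "C0 n f \<Longrightarrow> mono_vac n f \<in> gl2 \<F>"
  using jac_rec.monomial_gl2[OF own_rec B0_ext_seq_C0] .

lemma mono_expand:
  assumes "C0 n f"
  shows "\<exists>L. wf_terms 0 L \<and> (\<forall>t\<in>set L. deg (snd t) < n) \<and> gl2_eq \<F> (mono_vac n f) (\<lambda>m y. U n f m y + lsum L m y)"
  using jac_rec.monomial_expand[OF own_rec B0_ext_seq_C0[OF assms]] ext_seq_dep[OF C0D(2)[OF assms]] by simp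

text \<open>Closed under equality almost everywhere; this makes it a linear space, since the sum of
  two monomials is identified with the monomial of the sum only in that sense.\<close>

definition CPv :: "nat \<Rightarrow> 'a fock_vec set"
  where "CPv n = {v \<in> gl2 \<F>. \<exists>f. (\<forall>k\<le>n. C0 k (f k)) \<and> gl2_eq \<F> v (\<lambda>m y. \<Sum>k\<le>n. mono_vac k (f k) m y)}"

lemma CP_le_iff:
  "Q \<in> CP_le \<sigma> \<mu> n \<longleftrightarrow> (\<exists>f. (\<forall>k\<le>n. C0 k (f k)) \<and> Q = (\<lambda>G m y. \<Sum>k\<le>n. monomial \<sigma> \<mu> k (f k) G m y))"
proof
  assume "Q \<in> CP_le \<sigma> \<mu> n"
  then obtain f where f: "\<forall>k\<le>n. f k \<in> test k" "Q = (\<lambda>G m y. \<Sum>k\<le>n. monomial \<sigma> \<mu> k (f k) G m y)"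
    by (auto simp: CP_le_def)
  then show "\<exists>f. (\<forall>k\<le>n. C0 k (f k)) \<and> Q = (\<lambda>G m y. \<Sum>k\<le>n. monomial \<sigma> \<mu> k (f k) G m y)"
    by (intro exI[of _ "\<lambda>k. ext_seq k (f k)"]) (auto simp: monomial_ext_seq test_imp_C0)
next
  assume "\<exists>f. (\<forall>k\<le>n. C0 k (f k)) \<and> Q = (\<lambda>G m y. \<Sum>k\<le>n. monomial \<sigma> \<mu> k (f k) G m y)"
  then show "Q \<in> CP_le \<sigma> \<mu> n" unfolding CP_le_def using C0_imp_test by blast
qed

lemma CP_vac_gl2: "Q \<in> CP_le \<sigma> \<mu> n \<Longrightarrow> Q vacuum \<in> gl2 \<F>"
  by (auto simp: CP_le_iff intro!: gl2_sum mono_gl2)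

lemma CPv_iff: "v \<in> CPv n \<longleftrightarrow> v \<in> gl2 \<F> \<and> (\<exists>Q\<in>CP_le \<sigma> \<mu> n. gl2_eq \<F> v (Q vacuum))"
  unfolding CPv_def mem_Collect_eq Bex_def CP_le_iff by (rule conj_cong[OF refl]) blast

lemma CPv_gl2: "v \<in> CPv n \<Longrightarrow> v \<in> gl2 \<F>"
  by (simp add: CPv_def)

lemma CPv_cong: "u \<in> CPv n \<Longrightarrow> gl2_eq \<F> v u \<Longrightarrow> v \<in> gl2 \<F> \<Longrightarrow> v \<in> CPv n"
  unfolding CPv_def using gl2_eq_trans by blast

lemma CPv_add:
  assumes "u \<in> CPv n" "v \<in> CPv n" shows "(\<lambda>m y. u m y + v m y) \<in> CPv n"
proof -
  obtain f where f: "\<forall>k\<le>n. C0 k (f k)" "gl2_eq \<F> u (\<lambda>m y. \<Sum>k\<le>n. mono_vac k (f k) m y)" using assms(1) by (auto simp: CPv_def)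
  obtain g where g: "\<forall>k\<le>n. C0 k (g k)" "gl2_eq \<F> v (\<lambda>m y. \<Sum>k\<le>n. mono_vac k (g k) m y)" using assms(2) by (auto simp: CPv_def)
  have "gl2_eq \<F> (\<lambda>m y. u m y + v m y) (\<lambda>m y. \<Sum>k\<le>n. mono_vac k (f k) m y + mono_vac k (g k) m y)"
    using gl2_eq_add[OF f(2) g(2)] by (simp add: sum.distrib)
  moreover have "gl2_eq \<F> (\<lambda>m y. \<Sum>k\<le>n. mono_vac k (\<lambda>t. f k t + g k t) m y) (\<lambda>m y. \<Sum>k\<le>n. mono_vac k (f k) m y + mono_vac k (g k) m y)"
    using f(1) g(1) by (intro gl2_eq_sum jac_rec.monomial_add[OF own_rec] B0_ext_seq_C0) auto
  ultimately have "gl2_eq \<F> (\<lambda>m y. u m y + v m y) (\<lambda>m y. \<Sum>k\<le>n. mono_vac k (\<lambda>t. f k t + g k t) m y)"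
    using gl2_eq_trans gl2_eq_sym by blast
  then show ?thesis
    using f(1) g(1) gl2_add[OF CPv_gl2[OF assms(1)] CPv_gl2[OF assms(2)]]
    unfolding CPv_def by (intro CollectI conjI exI[of _ "\<lambda>k t. f k t + g k t"]) (auto intro!: C0_add)
qed

lemma CPv_cmult:
  assumes "u \<in> CPv n" shows "(\<lambda>m y. c * u m y) \<in> CPv n"
proof -
  obtain f where f: "\<forall>k\<le>n. C0 k (f k)" "gl2_eq \<F> u (\<lambda>m y. \<Sum>k\<le>n. mono_vac k (f k) m y)" using assms(1) by (auto simp: CPv_def)
  have "gl2_eq \<F> (\<lambda>m y. c * u m y) (\<lambda>m y. \<Sum>k\<le>n. mono_vac k (\<lambda>t. c * f k t) m y)"
    using gl2_eq_scale[OF f(2), of c] by (simp add: monomial_cmult sum_distrib_left)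
  then show ?thesis
    using f(1) gl2_scale[OF CPv_gl2[OF assms(1)]]
    unfolding CPv_def by (intro CollectI conjI exI[of _ "\<lambda>k t. c * f k t"]) (auto intro!: C0_cmult)
qed

lemma CPv_zero: "(\<lambda>m y. 0) \<in> CPv n"
  unfolding CPv_def by (intro CollectI conjI gl2_zero exI[of _ "\<lambda>k t. 0"]) (auto simp: monomial_zero C0_zero)

lemma CPv_diff: "u \<in> CPv n \<Longrightarrow> v \<in> CPv n \<Longrightarrow> (\<lambda>m y. u m y - v m y) \<in> CPv n"
  using CPv_add[OF _ CPv_cmult[of v n "-1"]] by simp

lemma CPv_sum: "(\<And>i. i \<in> I \<Longrightarrow> u i \<in> CPv n) \<Longrightarrow> (\<lambda>m y. \<Sum>i\<in>I. u i m y) \<in> CPv n"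
  by (induction I rule: infinite_finite_induct) (auto simp: CPv_zero CPv_add)

lemma CPv_mono:
  assumes "u \<in> CPv k" "k \<le> n" shows "u \<in> CPv n"
proof -
  obtain f where f: "\<forall>i\<le>k. C0 i (f i)" "gl2_eq \<F> u (\<lambda>m y. \<Sum>i\<le>k. mono_vac i (f i) m y)" using assms(1) by (auto simp: CPv_def)
  let ?g = "\<lambda>i. if i \<le> k then f i else (\<lambda>_. 0)"
  have "(\<Sum>i\<le>n. mono_vac i (?g i) m y) = (\<Sum>i\<le>k. mono_vac i (f i) m y)" for m y
    using assms(2) by (intro sum.mono_neutral_cong_right) (auto simp: monomial_zero)
  then show ?thesis
    using f CPv_gl2[OF assms(1)] unfolding CPv_def
    by (intro CollectI conjI exI[of _ ?g]) (auto simp: C0_zero)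
qed

lemma CPv_monomial:
  assumes "C0 k f" "k \<le> n" shows "mono_vac k f \<in> CPv n"
proof (rule CPv_mono[OF _ assms(2)])
  let ?g = "\<lambda>i. if i = k then f else (\<lambda>_. 0)"
  have "(\<Sum>i\<le>k. mono_vac i (?g i) m y) = (\<Sum>i\<le>k. if i = k then mono_vac k f m y else 0)" for m y
    by (rule sum.cong) (auto simp: monomial_zero)
  then have "(\<Sum>i\<le>k. mono_vac i (?g i) m y) = mono_vac k f m y" for m y by (simp add: sum.delta)
  then show "mono_vac k f \<in> CPv k"
    unfolding CPv_def using assms(1) mono_gl2[OF assms(1)]
    by (intro CollectI conjI exI[of _ ?g]) (auto simp: C0_zero)
qed

lemma MP_iff: "v \<in> \<M> n \<longleftrightarrow> v \<in> gl2 \<F> \<and> (\<forall>e>0. \<exists>u\<in>CPv n. gl2_norm \<F> (\<lambda>m y. v m y - u m y) < e)"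
proof -
  have "(\<exists>Q\<in>CP_le \<sigma> \<mu> n. gl2_norm \<F> (\<lambda>m y. v m y - Q vacuum m y) < e) \<longleftrightarrow> (\<exists>u\<in>CPv n. gl2_norm \<F> (\<lambda>m y. v m y - u m y) < e)"
    if v: "v \<in> gl2 \<F>" for e
  proof
    assume "\<exists>Q\<in>CP_le \<sigma> \<mu> n. gl2_norm \<F> (\<lambda>m y. v m y - Q vacuum m y) < e"
    then obtain Q where "Q \<in> CP_le \<sigma> \<mu> n" "gl2_norm \<F> (\<lambda>m y. v m y - Q vacuum m y) < e" by blast
    moreover have "Q vacuum \<in> CPv n" unfolding CPv_iff using \<open>Q \<in> CP_le \<sigma> \<mu> n\<close> CP_vac_gl2 gl2_eq_refl by blast
    ultimately show "\<exists>u\<in>CPv n. gl2_norm \<F> (\<lambda>m y. v m y - u m y) < e" by blast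
  next
    assume "\<exists>u\<in>CPv n. gl2_norm \<F> (\<lambda>m y. v m y - u m y) < e"
    then obtain u Q where u: "u \<in> gl2 \<F>" "gl2_norm \<F> (\<lambda>m y. v m y - u m y) < e" "Q \<in> CP_le \<sigma> \<mu> n" "gl2_eq \<F> u (Q vacuum)"
      by (auto simp: CPv_iff)
    have "gl2_norm \<F> (\<lambda>m y. v m y - u m y) = gl2_norm \<F> (\<lambda>m y. v m y - Q vacuum m y)"
      by (rule gl2_norm_cong[OF gl2_eq_diff[OF gl2_eq_refl u(4)]])
        (use gl2D(1)[OF gl2_diff[OF v u(1)]] gl2D(1)[OF gl2_diff[OF v CP_vac_gl2[OF u(3)]]] in auto)
    then show "\<exists>Q\<in>CP_le \<sigma> \<mu> n. gl2_norm \<F> (\<lambda>m y. v m y - Q vacuum m y) < e" using u by auto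
  qed
  then show ?thesis unfolding MP_def gl2_closure_def by auto
qed

lemma MP_gl2: "v \<in> \<M> n \<Longrightarrow> v \<in> gl2 \<F>"
  by (simp add: MP_iff)

lemma norm_zero: "gl2_norm \<F> (\<lambda>m y. 0) = 0"
  by (simp add: gl2_norm_def gl2_inner_zero)

lemma CPv_MP: "v \<in> CPv n \<Longrightarrow> v \<in> \<M> n"
  unfolding MP_iff using CPv_gl2 norm_zero by (auto intro!: bexI[of _ v])

lemma MP_closed:
  assumes v: "v \<in> gl2 \<F>" and a: "\<And>e. e > 0 \<Longrightarrow> \<exists>u\<in>\<M> n. gl2_norm \<F> (\<lambda>m y. v m y - u m y) < e"
  shows "v \<in> \<M> n"
  unfolding MP_iff
proof (intro conjI v allI impI)
  fix e :: real assume "e > 0"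
  then have e: "e / 2 > 0" by simp
  obtain u where u: "u \<in> \<M> n" "gl2_norm \<F> (\<lambda>m y. v m y - u m y) < e / 2" using a[OF e] by blast
  obtain x where x: "x \<in> CPv n" "gl2_norm \<F> (\<lambda>m y. u m y - x m y) < e / 2" using u(1) e unfolding MP_iff by blast
  have "gl2_norm \<F> (\<lambda>m y. v m y - x m y) < e"
    using gl2_triangle_diff[OF v MP_gl2[OF u(1)] CPv_gl2[OF x(1)]] u x by simp
  then show "\<exists>u\<in>CPv n. gl2_norm \<F> (\<lambda>m y. v m y - u m y) < e" using x by blast
qed

lemma MP_cong:
  assumes "u \<in> \<M> n" "gl2_eq \<F> v u" "v \<in> gl2 \<F>" shows "v \<in> \<M> n"
  using gl2_eq_iff_norm[OF assms(3) MP_gl2[OF assms(1)]] assms by (intro MP_closed) (auto intro!: bexI[of _ u])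

lemma MP_diff:
  assumes "u \<in> \<M> n" "v \<in> \<M> n" shows "(\<lambda>m y. u m y - v m y) \<in> \<M> n"
  unfolding MP_iff
proof (intro conjI allI impI)
  note g = MP_gl2[OF assms(1)] MP_gl2[OF assms(2)]
  show "(\<lambda>m y. u m y - v m y) \<in> gl2 \<F>" by (rule gl2_diff[OF g])
  fix e :: real assume "e > 0"
  then have e: "e / 2 > 0" by simp
  obtain x where x: "x \<in> CPv n" "gl2_norm \<F> (\<lambda>m y. u m y - x m y) < e / 2" using assms(1) e unfolding MP_iff by blast
  obtain z where z: "z \<in> CPv n" "gl2_norm \<F> (\<lambda>m y. v m y - z m y) < e / 2" using assms(2) e unfolding MP_iff by blast
  note d = gl2_diff[OF g(1) CPv_gl2[OF x(1)]] gl2_diff[OF g(2) CPv_gl2[OF z(1)]]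
  have "gl2_norm \<F> (\<lambda>m y. (u m y - x m y) + (-1) * (v m y - z m y)) \<le> gl2_norm \<F> (\<lambda>m y. u m y - x m y) + gl2_norm \<F> (\<lambda>m y. (-1) * (v m y - z m y))"
    by (rule gl2_triangle[OF d(1) gl2_scale[OF d(2)]])
  also have "gl2_norm \<F> (\<lambda>m y. (-1) * (v m y - z m y)) = gl2_norm \<F> (\<lambda>m y. v m y - z m y)"
    using gl2_norm_scale[OF d(2), of "-1"] by simp
  finally have "gl2_norm \<F> (\<lambda>m y. (u m y - v m y) - (x m y - z m y)) < e"
    using x z by (simp add: algebra_simps)
  then show "\<exists>w\<in>CPv n. gl2_norm \<F> (\<lambda>m y. u m y - v m y - w m y) < e"
    using CPv_diff[OF x(1) z(1)] by (intro bexI[of _ "\<lambda>m y. x m y - z m y"])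
qed

lemma MP_add: "u \<in> \<M> n \<Longrightarrow> v \<in> \<M> n \<Longrightarrow> (\<lambda>m y. u m y + v m y) \<in> \<M> n"
  using MP_diff[where u = u and v = "\<lambda>m y. 0 - v m y"] MP_diff[OF CPv_MP[OF CPv_zero], where v = v] by simp

lemma MP_mono: "v \<in> \<M> k \<Longrightarrow> k \<le> n \<Longrightarrow> v \<in> \<M> n"
  unfolding MP_iff using CPv_mono by blast

text \<open>Gluing, with all prescribed coefficients but one equal to zero.\<close>

lemma U_realize:
  assumes h: "B0 (length ls) h"
  shows "\<exists>G. B0 (deg ls) G \<and> gl2_eq \<F> (U (deg ls) G) (vec h ls)"
proof -
  let ?h = "\<lambda>ls'. if ls' = ls then h else (\<lambda>_. 0)"
  have B: "B0 (length ls') (?h ls')" for ls' using h by (auto simp: B0_zero)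
  have "(\<Sum>ls'\<in>Sn (deg ls). vec (?h ls') ls' m y) = (\<Sum>ls'\<in>Sn (deg ls). if ls' = ls then vec h ls m y else 0)" for m y
    by (rule sum.cong) (auto simp: vec_def)
  moreover have "ls \<in> Sn (deg ls)" by (simp add: Sn_def)
  ultimately have "(\<Sum>ls'\<in>Sn (deg ls). vec (?h ls') ls' m y) = vec h ls m y" for m y
    by (simp add: sum.delta')
  then show ?thesis
    using U_glue[of "deg ls" ?h, OF B] glue_B0[of "deg ls" ?h, OF B] by auto
qed

lemma U_approx:
  assumes G: "B0 k G" and e: "e > 0"
  shows "\<exists>\<phi>. C0 k \<phi> \<and> gl2_norm \<F> (\<lambda>m y. U k G m y - U k \<phi> m y) < e"
proof -
  have "approx k G"
    by (rule approx_L2) (use measurable_extI[OF B0D(1)[OF G]] nn_integral_ext_B0[OF G] in auto)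
  moreover have "e\<^sup>2 > 0" using e by simp
  ultimately obtain \<phi> where p: "C0 k \<phi>" "(\<integral>\<^sup>+u. ennreal ((G u - \<phi> u)\<^sup>2) \<partial>ext k) < ennreal (e\<^sup>2)"
    unfolding approx_def by blast
  have d: "B0 k (\<lambda>v. G v - \<phi> v)" by (rule B0_diff[OF G C0_imp_B0[OF p(1)]])
  have "ennreal (gl2_inner \<F> (U k (\<lambda>v. G v - \<phi> v)) (U k (\<lambda>v. G v - \<phi> v))) < ennreal (e\<^sup>2)"
    using p(2) U_norm_nn[OF d] by simp
  then have "gl2_inner \<F> (U k (\<lambda>v. G v - \<phi> v)) (U k (\<lambda>v. G v - \<phi> v)) < e\<^sup>2"
    using gl2_inner_self_nonneg[OF U_gl2[OF d]] by (simp add: ennreal_less_iff)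
  then have "gl2_norm \<F> (U k (\<lambda>v. G v - \<phi> v)) < sqrt (e\<^sup>2)" unfolding gl2_norm_def by (rule real_sqrt_less_mono)
  then show ?thesis using p(1) e by (auto simp: U_diff[symmetric])
qed

text \<open>Strong induction on the degree. For continuous \<open>\<phi>\<close>,
  \<open>U k \<phi>\<close> is a monomial minus products of lower degree. A single product is
  \<open>U k G\<close> with a bounded \<open>G\<close>, and by the isometry the density of
  continuous kernels carries over to the Fock space.\<close>

lemma vec_MP: "B0 (length ls) h \<Longrightarrow> deg ls = k \<Longrightarrow> vec h ls \<in> \<M> k"
proof (induction k arbitrary: ls h rule: less_induct)
  case (less k)
  have low: "lsum L \<in> \<M> k" if "wf_terms 0 L" "\<forall>t\<in>set L. deg (snd t) < k" for L
    using that
  proof (induction L)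
    case Nil
    then show ?case using CPv_MP[OF CPv_zero] by (simp add: lsum_Nil)
  next
    case (Cons t L)
    have "vec (fst t) (snd t) \<in> \<M> (deg (snd t))"
      by (rule less.IH) (use Cons.prems in \<open>auto simp: wf_terms_def\<close>)
    then have "vec (fst t) (snd t) \<in> \<M> k" by (rule MP_mono) (use Cons.prems in auto)
    then show ?case unfolding lsum_Cons using Cons by (intro MP_add) (auto simp: wf_terms_def)
  qed
  have Uphi: "U k \<phi> \<in> \<M> k" if phi: "C0 k \<phi>" for \<phi>
  proof -
    obtain L where L: "wf_terms 0 L" "\<forall>t\<in>set L. deg (snd t) < k" "gl2_eq \<F> (mono_vac k \<phi>) (\<lambda>m y. U k \<phi> m y + lsum L m y)"
      using mono_expand[OF phi] by blast
    have "(\<lambda>m y. mono_vac k \<phi> m y - lsum L m y) \<in> \<M> k"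
      by (intro MP_diff CPv_MP CPv_monomial phi low L) simp
    moreover have "gl2_eq \<F> (U k \<phi>) (\<lambda>m y. mono_vac k \<phi> m y - lsum L m y)"
      using gl2_eq_diff[OF gl2_eq_sym[OF L(3)] gl2_eq_refl[of _ "lsum L"]] by simp
    ultimately show ?thesis using U_gl2[OF C0_imp_B0[OF phi]] by (rule MP_cong)
  qed
  obtain G where G: "B0 k G" "gl2_eq \<F> (U k G) (vec h ls)" using U_realize[OF less.prems(1)] less.prems(2) by auto
  have "U k G \<in> \<M> k"
  proof (rule MP_closed[OF U_gl2[OF G(1)]])
    fix e :: real assume "e > 0"
    then show "\<exists>u\<in>\<M> k. gl2_norm \<F> (\<lambda>m y. U k G m y - u m y) < e"
      using U_approx[OF G(1)] Uphi by blast
  qed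
  then show ?case by (rule MP_cong[OF _ gl2_eq_sym[OF G(2)] vec_gl2[OF less.prems(1)]])
qed

lemma lsum_MP: "wf_terms 0 L \<Longrightarrow> \<forall>t\<in>set L. deg (snd t) \<le> n \<Longrightarrow> lsum L \<in> \<M> n"
proof (induction L)
  case Nil
  then show ?case using CPv_MP[OF CPv_zero] by (simp add: lsum_Nil)
next
  case (Cons t L)
  have "vec (fst t) (snd t) \<in> \<M> n"
    by (rule MP_mono[OF vec_MP]) (use Cons.prems in \<open>auto simp: wf_terms_def\<close>)
  then show ?case unfolding lsum_Cons using Cons by (intro MP_add) (auto simp: wf_terms_def)
qed

lemma sum_lsum:
  assumes "\<And>k. k \<le> n \<Longrightarrow> \<exists>L. wf_terms 0 L \<and> (\<forall>t\<in>set L. deg (snd t) \<le> n) \<and> gl2_eq \<F> (u k) (lsum L)" "j \<le> n"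
  shows "\<exists>L. wf_terms 0 L \<and> (\<forall>t\<in>set L. deg (snd t) \<le> n) \<and> gl2_eq \<F> (\<lambda>m y. \<Sum>k\<le>j. u k m y) (lsum L)"
  using assms(2)
proof (induction j)
  case 0
  then show ?case using assms(1)[of 0] by simp
next
  case (Suc j)
  obtain L1 where "wf_terms 0 L1" "\<forall>t\<in>set L1. deg (snd t) \<le> n" "gl2_eq \<F> (\<lambda>m y. \<Sum>k\<le>j. u k m y) (lsum L1)" using Suc by auto
  moreover obtain L2 where "wf_terms 0 L2" "\<forall>t\<in>set L2. deg (snd t) \<le> n" "gl2_eq \<F> (u (Suc j)) (lsum L2)" using assms(1)[OF Suc.prems] by auto
  ultimately show ?case
    using gl2_eq_add[of \<F> "\<lambda>m y. \<Sum>k\<le>j. u k m y" "lsum L1" "u (Suc j)" "lsum L2"]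
    by (intro exI[of _ "L1 @ L2"]) (auto simp: wf_terms_def lsum_append[abs_def])
qed

lemma mono_lsum:
  assumes "C0 k f" "k \<le> n"
  shows "\<exists>L. wf_terms 0 L \<and> (\<forall>t\<in>set L. deg (snd t) \<le> n) \<and> gl2_eq \<F> (mono_vac k f) (lsum L)"
proof -
  obtain L where L: "wf_terms 0 L" "\<forall>t\<in>set L. deg (snd t) < k" "gl2_eq \<F> (mono_vac k f) (\<lambda>m y. U k f m y + lsum L m y)"
    using mono_expand[OF assms(1)] by blast
  have "lsum (UL 0 k f @ L) = (\<lambda>m y. U k f m y + lsum L m y)" by (simp add: fun_eq_iff lsum_append lsum_UL)
  moreover have "wf_terms 0 (UL 0 k f @ L)" using U_wf[OF C0_imp_B0[OF assms(1)]] L(1) by (auto simp: wf_terms_def)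
  moreover have "\<forall>t\<in>set (UL 0 k f @ L). deg (snd t) \<le> n" using L(2) assms(2) by (auto dest: UL_deg)
  ultimately show ?thesis using L(3) by metis
qed

lemma CPv_lsum:
  assumes "v \<in> CPv n"
  shows "\<exists>L. wf_terms 0 L \<and> (\<forall>t\<in>set L. deg (snd t) \<le> n) \<and> gl2_eq \<F> v (lsum L)"
proof -
  obtain f where f: "\<forall>k\<le>n. C0 k (f k)" "gl2_eq \<F> v (\<lambda>m y. \<Sum>k\<le>n. mono_vac k (f k) m y)" using assms by (auto simp: CPv_def)
  have "\<exists>L. wf_terms 0 L \<and> (\<forall>t\<in>set L. deg (snd t) \<le> n) \<and> gl2_eq \<F> (\<lambda>m y. \<Sum>k\<le>n. mono_vac k (f k) m y) (lsum L)"
    by (rule sum_lsum[where u = "\<lambda>k. mono_vac k (f k)"]) (use mono_lsum f in auto)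
  then show ?thesis using gl2_eq_trans[OF f(2)] by blast
qed

text \<open>Continuous polynomials of order at most \<open>n\<close> expand into products of degree
  at most \<open>n\<close>, which are orthogonal to those in \<open>L\<close>; Cauchy-Schwarz
  extends this to the closure.\<close>

lemma MP_orth:
  assumes v: "v \<in> \<M> n" and L: "wf_terms 0 L" "\<forall>t\<in>set L. n < deg (snd t)"
  shows "gl2_inner \<F> v (lsum L) = 0"
proof -
  have b: "\<bar>gl2_inner \<F> v (lsum L)\<bar> \<le> e * gl2_norm \<F> (lsum L)" if e: "e > 0" for e
  proof -
    obtain u where u: "u \<in> CPv n" "gl2_norm \<F> (\<lambda>m y. v m y - u m y) < e" using v e unfolding MP_iff by blast
    obtain L' where L': "wf_terms 0 L'" "\<forall>t\<in>set L'. deg (snd t) \<le> n" "gl2_eq \<F> u (lsum L')" using CPv_lsum[OF u(1)] by blast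
    note g = MP_gl2[OF v] CPv_gl2[OF u(1)] lsum_gl2[OF L(1)]
    have "gl2_inner \<F> u (lsum L) = gl2_inner \<F> (lsum L') (lsum L)"
      by (rule gl2_inner_cong[OF L'(3) gl2_eq_refl]) (use gl2D(1)[OF g(2)] gl2D(1)[OF g(3)] gl2D(1)[OF lsum_gl2[OF L'(1)]] in auto)
    also have "\<dots> = 0" using L L' by (intro lsum_inner_zero) fastforce+
    finally have "gl2_inner \<F> v (lsum L) = gl2_inner \<F> (\<lambda>m y. v m y - u m y) (lsum L)"
      using gl2_inner_diff[OF g] by simp
    then have "\<bar>gl2_inner \<F> v (lsum L)\<bar> \<le> gl2_norm \<F> (\<lambda>m y. v m y - u m y) * gl2_norm \<F> (lsum L)"
      using gl2_Cauchy_Schwarz[OF gl2_diff[OF g(1,2)] g(3)] by simp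
    also have "\<dots> \<le> e * gl2_norm \<F> (lsum L)" using u(2) gl2_norm_nonneg[OF g(3)] by (intro mult_right_mono) auto
    finally show ?thesis .
  qed
  have n0: "gl2_norm \<F> (lsum L) + 1 > 0" using gl2_norm_nonneg[OF lsum_gl2[OF L(1)]] by simp
  have "\<bar>gl2_inner \<F> v (lsum L)\<bar> \<le> 0 + e" if "e > 0" for e
  proof -
    \<comment> \<open>The added 1 covers the case of norm zero.\<close>
    have "e / (gl2_norm \<F> (lsum L) + 1) > 0" using that n0 by simp
    from b[OF this] have "\<bar>gl2_inner \<F> v (lsum L)\<bar> \<le> e / (gl2_norm \<F> (lsum L) + 1) * gl2_norm \<F> (lsum L)" .
    also have "\<dots> \<le> e" using that n0 by (simp add: field_simps)
    finally show ?thesis by simp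
  qed
  then have "\<bar>gl2_inner \<F> v (lsum L)\<bar> \<le> 0" by (rule field_le_epsilon)
  then show ?thesis by simp
qed

text \<open>\<open>U n f\<close> is a sum of products of degree \<open>n\<close>, hence lies in
  \<open>OP n\<close> by \<open>MP_orth\<close>. Its difference from the monomial has lower degree,
  hence lies in \<open>MP (n - 1)\<close> and is orthogonal to \<open>OP n\<close>.\<close>

lemma P_proj_C0:
  assumes f: "C0 n f" shows "gl2_eq \<F> (P_proj \<sigma> \<mu> n f) (U n f)" "P_proj \<sigma> \<mu> n f \<in> gl2 \<F>"
proof -
  obtain L where L: "wf_terms 0 L" "\<forall>t\<in>set L. deg (snd t) < n" "gl2_eq \<F> (mono_vac n f) (\<lambda>m y. U n f m y + lsum L m y)"
    using mono_expand[OF f] by blast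
  note Ug = U_gl2[OF C0_imp_B0[OF f]] and Uwf = U_wf[OF C0_imp_B0[OF f]]
  have S: "OP \<sigma> \<mu> n \<subseteq> gl2 \<F>" using MP_gl2 by (auto simp: OP_def split: if_splits)
  have diff: "gl2_eq \<F> (\<lambda>m y. mono_vac n f m y - U n f m y) (lsum L)"
    using gl2_eq_diff[OF L(3) gl2_eq_refl[of _ "U n f"]] by simp
  have dg: "(\<lambda>m y. mono_vac n f m y - U n f m y) \<in> gl2 \<F>" by (rule gl2_diff[OF mono_gl2[OF f] Ug])
  have p: "U n f \<in> OP \<sigma> \<mu> n"
  \<comment> \<open>\<open>OP 0\<close> is given by the constants instead of an orthogonal
    complement; in degree 0 the only product is the empty one.\<close>
  proof (cases "n = 0")
    case True
    have "U 0 f m y = f (\<lambda>_. undefined) * vacuum m y" for m y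
      using depD[OF C0D(2)[OF f], of "\<lambda>i. (fst \<circ> y) (blk [] i)" "\<lambda>_. undefined"] True
      by (simp add: U_def vec_def vacuum_def single_def)
    then show ?thesis using Ug True by (auto simp: OP_def gl2_eq_def intro!: exI[of _ "f (\<lambda>_. undefined)"])
  next
    case False
    have "U n f \<in> \<M> n" using lsum_MP[OF Uwf, of n] UL_deg by (auto simp: lsum_UL)
    moreover have "gl2_inner \<F> (U n f) v = 0" if v: "v \<in> \<M> (n - 1)" for v
      using MP_orth[OF v Uwf] UL_deg False by (auto simp: lsum_UL gl2_inner_sym)
    ultimately show ?thesis using False by (simp add: OP_def)
  qed
  have orth: "gl2_inner \<F> (\<lambda>m y. mono_vac n f m y - U n f m y) v = 0" if v: "v \<in> OP \<sigma> \<mu> n" for v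
  proof -
    have vg: "v \<in> gl2 \<F>" using S v by auto
    have e: "gl2_inner \<F> (\<lambda>m y. mono_vac n f m y - U n f m y) v = gl2_inner \<F> (lsum L) v"
      by (rule gl2_inner_cong[OF diff gl2_eq_refl]) (use gl2D(1)[OF dg] gl2D(1)[OF vg] gl2D(1)[OF lsum_gl2[OF L(1)]] in auto)
    show ?thesis
    proof (cases "n = 0")
      case True
      then have "L = []" using L(2) by (cases L) auto
      then show ?thesis using e by (simp add: lsum_Nil gl2_inner_zero)
    next
      case False
      have "lsum L \<in> \<M> (n - 1)" by (rule lsum_MP[OF L(1)]) (use L(2) in auto)
      then have "gl2_inner \<F> v (lsum L) = 0" using v False by (auto simp: OP_def)
      then show ?thesis using e by (simp add: gl2_inner_sym)
    qed
  qed
  note O = orth_proj_eq[OF mono_gl2[OF f] S p orth]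
  show "gl2_eq \<F> (P_proj \<sigma> \<mu> n f) (U n f)" unfolding P_proj_def by (rule O(1))
  show "P_proj \<sigma> \<mu> n f \<in> gl2 \<F>" unfolding P_proj_def using O(2) S by auto
qed

lemma P_proj_ext_seq: "P_proj \<sigma> \<mu> n (ext_seq n f) = P_proj \<sigma> \<mu> n f"
  by (simp add: P_proj_def monomial_ext_seq)

lemma P_proj_test:
  assumes "f \<in> test n" shows "gl2_eq \<F> (P_proj \<sigma> \<mu> n f) (U n (ext_seq n f))" "P_proj \<sigma> \<mu> n f \<in> gl2 \<F>"
  using P_proj_C0[OF test_imp_C0[OF assms]] by (simp_all add: P_proj_ext_seq)

end

section \<open>The unitary \<open>J\<close> and the realization of \<open>X(f)\<close>\<close>

context jac_process
begin

text \<open>Wider than test sequences: \<open>X(f)\<close> in general sends a test sequence to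
  kernels that are merely measurable, and the preimage under \<open>J\<close> has to be found among
  these.\<close>

definition fin_B0 :: "nat \<Rightarrow> (nat \<Rightarrow> (nat \<Rightarrow> 'a) \<Rightarrow> real) \<Rightarrow> bool"
  where "fin_B0 N \<phi> \<longleftrightarrow> (\<forall>n. B0 n (\<phi> n)) \<and> (\<forall>n. N < n \<longrightarrow> \<phi> n = (\<lambda>_. 0))"

definition Usum :: "nat \<Rightarrow> (nat \<Rightarrow> (nat \<Rightarrow> 'a) \<Rightarrow> real) \<Rightarrow> 'a fock_vec"
  where "Usum N \<phi> m y = (\<Sum>n\<le>N. U n (\<phi> n) m y)"

lemma fin_B0_mono: "fin_B0 N \<phi> \<Longrightarrow> N \<le> M \<Longrightarrow> fin_B0 M \<phi>"
  by (auto simp: fin_B0_def)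

lemma Usum_mono:
  assumes "fin_B0 N \<phi>" "N \<le> M" shows "Usum M \<phi> = Usum N \<phi>"
proof (intro ext)
  fix m y
  show "Usum M \<phi> m y = Usum N \<phi> m y"
    unfolding Usum_def
    by (rule sum.mono_neutral_right) (use assms in \<open>auto simp: fin_B0_def U_zero\<close>)
qed

lemma fin_B0_diff: "fin_B0 N \<phi> \<Longrightarrow> fin_B0 N \<psi> \<Longrightarrow> fin_B0 N (\<lambda>n t. \<phi> n t - \<psi> n t)"
  by (auto simp: fin_B0_def fun_eq_iff intro!: B0_diff)

lemma Usum_diff: "(\<lambda>m y. Usum N \<phi> m y - Usum N \<psi> m y) = Usum N (\<lambda>n t. \<phi> n t - \<psi> n t)"
  by (simp add: Usum_def fun_eq_iff U_diff[symmetric] sum_subtractf)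

lemma Usum_gl2: "fin_B0 N \<phi> \<Longrightarrow> Usum N \<phi> \<in> gl2 \<F>"
  unfolding Usum_def[abs_def] fin_B0_def by (intro gl2_sum U_gl2) auto

lemma Usum_inner:
  assumes "fin_B0 N \<phi>"
  shows "gl2_inner \<F> (Usum N \<phi>) (Usum N \<phi>) = (\<Sum>n\<le>N. gl2_inner \<F> (U n (\<phi> n)) (U n (\<phi> n)))"
proof -
  have B: "B0 n (\<phi> n)" for n using assms by (simp add: fin_B0_def)
  note g = U_gl2[OF B]
  have Ne: "Usum N \<phi> = (\<lambda>m y. \<Sum>n\<le>N. U n (\<phi> n) m y)" by (simp add: Usum_def fun_eq_iff)
  have "gl2_inner \<F> (Usum N \<phi>) (Usum N \<phi>) = (\<Sum>n\<le>N. gl2_inner \<F> (U n (\<phi> n)) (Usum N \<phi>))"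
    using gl2_inner_sum[of "{..N}" "\<lambda>n. U n (\<phi> n)" \<F> "Usum N \<phi>"] g Usum_gl2[OF assms] by (simp add: Ne)
  also have "\<dots> = (\<Sum>n\<le>N. \<Sum>k\<le>N. gl2_inner \<F> (U k (\<phi> k)) (U n (\<phi> n)))"
  proof (rule sum.cong[OF refl])
    fix n
    show "gl2_inner \<F> (U n (\<phi> n)) (Usum N \<phi>) = (\<Sum>k\<le>N. gl2_inner \<F> (U k (\<phi> k)) (U n (\<phi> n)))"
      using gl2_inner_sum[of "{..N}" "\<lambda>n. U n (\<phi> n)" \<F> "U n (\<phi> n)"] g
      by (simp add: Ne gl2_inner_sym[of \<F> "U n (\<phi> n)"])
  qed
  also have "\<dots> = (\<Sum>n\<le>N. \<Sum>k\<le>N. if k = n then gl2_inner \<F> (U n (\<phi> n)) (U n (\<phi> n)) else 0)"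
  proof (intro sum.cong refl)
    fix n k
    have "gl2_inner \<F> (U k (\<phi> k)) (U n (\<phi> n)) = 0" if "k \<noteq> n"
      unfolding lsum_UL[symmetric] using that UL_deg by (intro lsum_inner_zero U_wf B) metis
    then show "gl2_inner \<F> (U k (\<phi> k)) (U n (\<phi> n)) = (if k = n then gl2_inner \<F> (U n (\<phi> n)) (U n (\<phi> n)) else 0)" by auto
  qed
  also have "\<dots> = (\<Sum>n\<le>N. gl2_inner \<F> (U n (\<phi> n)) (U n (\<phi> n)))" by simp
  finally show ?thesis .
qed

lemma fin_B0_energy:
  assumes "fin_B0 N \<phi>" shows "gl2_energy ext \<phi> = ennreal (gl2_inner \<F> (Usum N \<phi>) (Usum N \<phi>))"
proof -
  have B: "B0 n (\<phi> n)" for n using assms by (simp add: fin_B0_def)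
  have "gl2_energy ext \<phi> = (\<Sum>n\<le>N. \<integral>\<^sup>+u. ennreal ((\<phi> n u)\<^sup>2) \<partial>ext n)"
    unfolding gl2_energy_def by (rule suminf_finite) (use assms in \<open>auto simp: fin_B0_def\<close>)
  also have "\<dots> = (\<Sum>n\<le>N. ennreal (gl2_inner \<F> (U n (\<phi> n)) (U n (\<phi> n))))"
    by (simp add: U_norm_nn[OF B])
  also have "\<dots> = ennreal (\<Sum>n\<le>N. gl2_inner \<F> (U n (\<phi> n)) (U n (\<phi> n)))"
    by (rule sum_ennreal) (rule gl2_inner_self_nonneg[OF U_gl2[OF B]])
  finally show ?thesis by (simp add: Usum_inner[OF assms])
qed

lemma fin_B0_gl2: assumes "fin_B0 N \<phi>" shows "\<phi> \<in> gl2 ext"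
  by (rule gl2_energy_finiteI)
    (use assms fin_B0_energy[OF assms] in \<open>auto simp: fin_B0_def intro!: measurable_extI B0D(1)\<close>)

lemma Usum_norm: assumes "fin_B0 N \<phi>" shows "gl2_norm \<F> (Usum N \<phi>) = gl2_norm ext \<phi>"
proof -
  have "ennreal ((gl2_norm ext \<phi>)\<^sup>2) = ennreal ((gl2_norm \<F> (Usum N \<phi>))\<^sup>2)"
    using gl2_energy_eq[OF fin_B0_gl2[OF assms]] fin_B0_energy[OF assms] gl2_norm_square[OF Usum_gl2[OF assms]] by simp
  then have "(gl2_norm ext \<phi>)\<^sup>2 = (gl2_norm \<F> (Usum N \<phi>))\<^sup>2" by simp
  then show ?thesis
    using gl2_norm_nonneg[OF Usum_gl2[OF assms]] gl2_norm_nonneg[OF fin_B0_gl2[OF assms]] by (simp add: power2_eq_iff_nonneg)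
qed

definition ext_test :: "(nat \<Rightarrow> (nat \<Rightarrow> 'a) \<Rightarrow> real) \<Rightarrow> nat \<Rightarrow> (nat \<Rightarrow> 'a) \<Rightarrow> real"
  where "ext_test \<phi> n = ext_seq n (\<phi> n)"

lemma finite_test_ext:
  assumes "\<phi> \<in> finite_test" shows "\<exists>N. fin_B0 N (ext_test \<phi>)" "C0 n (ext_test \<phi> n)"
proof -
  from assms have "\<forall>n. \<phi> n \<in> test n" "\<exists>N. \<forall>n>N. \<forall>t\<in>cart n. \<phi> n t = 0"
    unfolding finite_test_def mem_Collect_eq by (rule conjunct1, rule conjunct2)
  then obtain N where N: "\<And>n. \<phi> n \<in> test n" "\<And>n t. n > N \<Longrightarrow> t \<in> cart n \<Longrightarrow> \<phi> n t = 0"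
    by blast
  have C: "C0 n (ext_test \<phi> n)" for n unfolding ext_test_def by (rule test_imp_C0[OF N(1)])
  have "ext_test \<phi> n = (\<lambda>_. 0)" if "n > N" for n
    using N(2)[OF that] by (auto simp: ext_test_def ext_seq_def fun_eq_iff)
  then have "fin_B0 N (ext_test \<phi>)" using C0_imp_B0[OF C] by (simp add: fin_B0_def)
  then show "\<exists>N. fin_B0 N (ext_test \<phi>)" by blast
  show "C0 n (ext_test \<phi> n)" by (rule C)
qed

lemma ext_test_gl2_eq: "gl2_eq ext \<phi> (ext_test \<phi>)"
  unfolding gl2_eq_def by (intro allI AE_I2) (simp add: space_ext ext_test_def ext_seq_cart)

lemma finite_test_gl2:
  assumes "\<phi> \<in> finite_test" shows "\<phi> \<in> gl2 ext"
proof -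
  obtain N where N: "fin_B0 N (ext_test \<phi>)" using finite_test_ext(1)[OF assms] by blast
  note g = gl2D[OF fin_B0_gl2[OF N]]
  have e: "\<phi> n u = ext_test \<phi> n u" if "u \<in> space (ext n)" for n u
    using that by (simp add: space_ext ext_test_def ext_seq_cart)
  have "\<phi> n \<in> borel_measurable (ext n)" for n
    using g(1)[of n] measurable_cong[of "ext n" "\<phi> n" "ext_test \<phi> n" borel] e by simp
  moreover have "gl2_energy ext \<phi> = gl2_energy ext (ext_test \<phi>)"
    unfolding gl2_energy_def by (intro suminf_cong nn_integral_cong) (simp add: e)
  ultimately show ?thesis using fin_B0_energy[OF N] by (intro gl2_energy_finiteI) auto
qed

text \<open>\<open>J_fin\<close> sums over the components that do not vanish on T^n; the omitted
  ones would contribute \<open>U\<close> of the zero kernel.\<close>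

lemma J_fin_eq:
  assumes p: "\<phi> \<in> finite_test" and N: "fin_B0 N (ext_test \<phi>)"
  shows "gl2_eq \<F> (J_fin \<sigma> \<mu> \<phi>) (Usum N (ext_test \<phi>))" "J_fin \<sigma> \<mu> \<phi> \<in> gl2 \<F>"
proof -
  let ?A = "{n. \<exists>t\<in>cart n. \<phi> n t \<noteq> 0}"
  have t: "\<phi> n \<in> test n" for n using p by (simp add: finite_test_def)
  have z: "ext_test \<phi> n = (\<lambda>_. 0)" if "n \<notin> ?A" for n
    using that by (auto simp: ext_test_def ext_seq_def fun_eq_iff)
  have "n \<le> N" if "n \<in> ?A" for n
  proof (rule ccontr)
    assume "\<not> n \<le> N"
    then have "ext_test \<phi> n = (\<lambda>_. 0)" using N by (simp add: fin_B0_def)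
    then have "ext_seq n (\<phi> n) t = 0" for t by (simp add: ext_test_def)
    then have "\<phi> n t = 0" if "t \<in> cart n" for t using ext_seq_cart[OF that, of "\<phi> n"] by simp
    then show False using \<open>n \<in> ?A\<close> by blast
  qed
  then have A: "?A \<subseteq> {..N}" by blast
  have "Usum N (ext_test \<phi>) = (\<lambda>m y. \<Sum>n\<in>?A. U n (ext_test \<phi> n) m y)"
    unfolding Usum_def[abs_def]
  proof (intro ext sum.mono_neutral_right)
    show "\<forall>n\<in>{..N} - ?A. U n (ext_test \<phi> n) m y = 0" for m y
    proof
      fix n assume "n \<in> {..N} - ?A"
      then have "ext_test \<phi> n = (\<lambda>_. 0)" by (intro z) blast
      then show "U n (ext_test \<phi> n) m y = 0" by (simp add: U_zero)
    qed
    show "finite {..N}" by simp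
    show "?A \<subseteq> {..N}" by (rule A)
  qed
  moreover have "gl2_eq \<F> (J_fin \<sigma> \<mu> \<phi>) (\<lambda>m y. \<Sum>n\<in>?A. U n (ext_test \<phi> n) m y)"
    unfolding J_fin_def ext_test_def by (rule gl2_eq_sum) (rule P_proj_test(1)[OF t])
  ultimately show "gl2_eq \<F> (J_fin \<sigma> \<mu> \<phi>) (Usum N (ext_test \<phi>))" by simp
  show "J_fin \<sigma> \<mu> \<phi> \<in> gl2 \<F>" unfolding J_fin_def by (rule gl2_sum) (rule P_proj_test(2)[OF t])
qed

lemma J_fin_iso:
  assumes p: "\<phi> \<in> finite_test" and q: "\<psi> \<in> finite_test"
  shows "gl2_norm \<F> (\<lambda>m y. J_fin \<sigma> \<mu> \<phi> m y - J_fin \<sigma> \<mu> \<psi> m y) = gl2_norm ext (\<lambda>n t. \<phi> n t - \<psi> n t)"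
proof -
  obtain N1 where N1: "fin_B0 N1 (ext_test \<phi>)" using finite_test_ext(1)[OF p] by blast
  obtain N2 where N2: "fin_B0 N2 (ext_test \<psi>)" using finite_test_ext(1)[OF q] by blast
  let ?M = "max N1 N2"
  have M: "fin_B0 ?M (ext_test \<phi>)" "fin_B0 ?M (ext_test \<psi>)" using fin_B0_mono[OF N1] fin_B0_mono[OF N2] by auto
  have d: "fin_B0 ?M (\<lambda>n t. ext_test \<phi> n t - ext_test \<psi> n t)" by (rule fin_B0_diff[OF M])
  have "gl2_norm \<F> (\<lambda>m y. J_fin \<sigma> \<mu> \<phi> m y - J_fin \<sigma> \<mu> \<psi> m y) = gl2_norm \<F> (\<lambda>m y. Usum ?M (ext_test \<phi>) m y - Usum ?M (ext_test \<psi>) m y)"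
    by (rule gl2_norm_cong[OF gl2_eq_diff[OF J_fin_eq(1)[OF p M(1)] J_fin_eq(1)[OF q M(2)]]])
      (use gl2D(1)[OF gl2_diff[OF J_fin_eq(2)[OF p M(1)] J_fin_eq(2)[OF q M(2)]]] gl2D(1)[OF gl2_diff[OF Usum_gl2[OF M(1)] Usum_gl2[OF M(2)]]] in auto)
  also have "\<dots> = gl2_norm ext (\<lambda>n t. ext_test \<phi> n t - ext_test \<psi> n t)"
    unfolding Usum_diff by (rule Usum_norm[OF d])
  also have "\<dots> = gl2_norm ext (\<lambda>n t. \<phi> n t - \<psi> n t)"
    by (rule gl2_norm_cong[OF gl2_eq_sym[OF gl2_eq_diff[OF ext_test_gl2_eq ext_test_gl2_eq]]])
      (use gl2D(1)[OF fin_B0_gl2[OF d]] gl2D(1)[OF gl2_diff[OF finite_test_gl2[OF p] finite_test_gl2[OF q]]] in auto)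
  finally show ?thesis .
qed

text \<open>The tail from index \<open>N\<close> on is dropped, and each of the first
  \<open>N\<close> components is approximated separately.\<close>

lemma finite_test_dense:
  assumes F: "F \<in> gl2 ext" and e: "e > 0"
  shows "\<exists>\<phi>\<in>finite_test. gl2_norm ext (\<lambda>n t. F n t - \<phi> n t) < e"
proof -
  define a where "a n = (\<integral>u. (F n u)\<^sup>2 \<partial>ext n)" for n
  have sa: "summable a" unfolding a_def using gl2D(3)[OF F] .
  have "e\<^sup>2 / 2 > 0" using e by simp
  from suminf_exist_split[OF this sa] obtain N where N: "norm (\<Sum>i. a (i + N)) < e\<^sup>2 / 2" by blast
  \<comment> \<open>\<open>N\<close> errors below \<open>d\<close> add up to at most e^2 / 2; the
    added 1 avoids a division by zero for \<open>N = 0\<close>.\<close>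
  define d where "d = e\<^sup>2 / (2 * (real N + 1))"
  have d: "d > 0" using e by (simp add: d_def)
  have "\<exists>\<phi>. C0 n \<phi> \<and> (\<integral>\<^sup>+u. ennreal ((F n u - \<phi> u)\<^sup>2) \<partial>ext n) < ennreal d" for n
  proof -
    have "approx n (F n)"
    proof (rule approx_L2[OF gl2D(1)[OF F]])
      show "(\<integral>\<^sup>+u. ennreal ((F n u)\<^sup>2) \<partial>ext n) < \<infinity>"
        by (subst nn_integral_eq_integral[OF gl2D(2)[OF F]]) auto
    qed
    then show ?thesis using d unfolding approx_def by blast
  qed
  then obtain \<phi>0 where p0: "\<And>n. C0 n (\<phi>0 n)" "\<And>n. (\<integral>\<^sup>+u. ennreal ((F n u - \<phi>0 n u)\<^sup>2) \<partial>ext n) < ennreal d" by metis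
  define \<phi> where "\<phi> n = (if n < N then \<phi>0 n else (\<lambda>_. 0))" for n
  have C: "C0 n (\<phi> n)" for n using p0(1) by (simp add: \<phi>_def C0_zero)
  have ft: "\<phi> \<in> finite_test"
    unfolding finite_test_def
  proof (intro CollectI conjI allI exI[of _ N] impI ballI)
    show "\<phi> n \<in> test n" for n by (rule C0_imp_test[OF C])
    show "\<phi> n t = 0" if "n > N" for n t using that by (simp add: \<phi>_def)
  qed
  define b where "b n = (\<integral>u. (F n u - \<phi> n u)\<^sup>2 \<partial>ext n)" for n
  have dg: "(\<lambda>n t. F n t - \<phi> n t) \<in> gl2 ext" by (rule gl2_diff[OF F finite_test_gl2[OF ft]])
  have sb: "summable b" unfolding b_def using gl2D(3)[OF dg] .
  have b1: "b n < d" if "n < N" for n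
  proof -
    have "ennreal (b n) = (\<integral>\<^sup>+u. ennreal ((F n u - \<phi> n u)\<^sup>2) \<partial>ext n)"
      unfolding b_def by (rule nn_integral_eq_integral[symmetric, OF gl2D(2)[OF dg]]) simp
    also have "\<dots> < ennreal d" using p0(2)[of n] that by (simp add: \<phi>_def)
    finally show ?thesis using d by (simp add: ennreal_less_iff b_def)
  qed
  have b2: "b (i + N) = a (i + N)" for i by (simp add: a_def b_def \<phi>_def)
  have "gl2_inner ext (\<lambda>n t. F n t - \<phi> n t) (\<lambda>n t. F n t - \<phi> n t) = (\<Sum>n. b n)"
    by (simp add: gl2_inner_def b_def power2_eq_square)
  also have "\<dots> = (\<Sum>i. b (i + N)) + (\<Sum>n<N. b n)" by (rule suminf_split_initial_segment[OF sb])
  also have "\<dots> < e\<^sup>2 / 2 + e\<^sup>2 / 2"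
  proof (rule add_less_le_mono)
    show "(\<Sum>i. b (i + N)) < e\<^sup>2 / 2" using N by (simp add: b2)
    have "(\<Sum>n<N. b n) \<le> (\<Sum>n<N. d)" by (rule sum_mono) (auto intro: less_imp_le[OF b1])
    also have "\<dots> = real N * d" by simp
    also have "\<dots> \<le> e\<^sup>2 / 2" using e by (simp add: d_def field_simps)
    finally show "(\<Sum>n<N. b n) \<le> e\<^sup>2 / 2" .
  qed
  finally have "gl2_inner ext (\<lambda>n t. F n t - \<phi> n t) (\<lambda>n t. F n t - \<phi> n t) < e\<^sup>2" by simp
  then have "gl2_norm ext (\<lambda>n t. F n t - \<phi> n t) < sqrt (e\<^sup>2)" unfolding gl2_norm_def by (rule real_sqrt_less_mono)
  then show ?thesis using ft e by auto
qed

section \<open>The continuous extension \<open>J\<close>\<close>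

abbreviation "J_graph \<equiv> ext_graph ext \<F> finite_test (J_fin \<sigma> \<mu>)"

lemma J_fin_gl2: "\<phi> \<in> finite_test \<Longrightarrow> J_fin \<sigma> \<mu> \<phi> \<in> gl2 \<F>"
  using finite_test_ext(1) J_fin_eq(2) by blast

lemma finite_test_subset: "finite_test \<subseteq> gl2 ext"
  using finite_test_gl2 by blast

abbreviation "\<J> \<equiv> J_ext \<sigma> \<mu>"

lemma J_ext_graph: assumes "F \<in> gl2 ext" shows "J_graph F (\<J> F)"
proof -
  have "\<exists>v. J_graph F v"
    by (rule ext_graph_exists[OF finite_test_subset J_fin_gl2 J_fin_iso assms finite_test_dense[OF assms]])
  then have "J_graph F (SOME v. J_graph F v)" by (rule someI_ex)
  then show ?thesis by (simp add: J_ext_def ext_graph_def)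
qed

lemma J_ext_gl2: "F \<in> gl2 ext \<Longrightarrow> \<J> F \<in> gl2 \<F>"
  using J_ext_graph by (simp add: ext_graph_def)

lemma J_graph_norm:
  assumes "F \<in> gl2 ext" "F' \<in> gl2 ext" "J_graph F v" "J_graph F' v'"
  shows "gl2_norm \<F> (\<lambda>m y. v m y - v' m y) = gl2_norm ext (\<lambda>n t. F n t - F' n t)"
  by (rule ext_graph_isometry[OF finite_test_subset J_fin_gl2 J_fin_iso assms])

lemma J_graph_eq_iff:
  assumes "F \<in> gl2 ext" "F' \<in> gl2 ext" "J_graph F v" "J_graph F' v'"
  shows "gl2_eq \<F> v v' \<longleftrightarrow> gl2_eq ext F F'"
proof -
  have "v \<in> gl2 \<F>" "v' \<in> gl2 \<F>" using assms by (auto simp: ext_graph_def)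
  then show ?thesis using J_graph_norm[OF assms] gl2_eq_iff_norm[of v \<F> v'] gl2_eq_iff_norm[OF assms(1,2)] by simp
qed

text \<open>Identifies \<open>J\<close> beyond test sequences, by comparing \<open>G\<close> with an
  approximating test sequence under the isometry \<open>Usum_norm\<close>.\<close>

lemma J_graph_Usum:
  assumes G: "fin_B0 N G" shows "J_graph G (Usum N G)"
  unfolding ext_graph_def
proof (intro conjI allI impI)
  show "Usum N G \<in> gl2 \<F>" by (rule Usum_gl2[OF G])
  fix e :: real assume "e > 0"
  then obtain \<phi> where p: "\<phi> \<in> finite_test" "gl2_norm ext (\<lambda>n t. G n t - \<phi> n t) < e"
    using finite_test_dense[OF fin_B0_gl2[OF G]] by blast
  obtain N1 where N1: "fin_B0 N1 (ext_test \<phi>)" using finite_test_ext(1)[OF p(1)] by blast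
  let ?M = "max N N1"
  have M: "fin_B0 ?M G" "fin_B0 ?M (ext_test \<phi>)" using fin_B0_mono[OF N1] fin_B0_mono[OF G] by auto
  have d: "fin_B0 ?M (\<lambda>n t. G n t - ext_test \<phi> n t)" by (rule fin_B0_diff[OF M])
  have "gl2_norm \<F> (\<lambda>m y. Usum N G m y - J_fin \<sigma> \<mu> \<phi> m y) = gl2_norm \<F> (\<lambda>m y. Usum ?M G m y - Usum ?M (ext_test \<phi>) m y)"
    unfolding Usum_mono[OF G max.cobounded1]
    by (rule gl2_norm_cong[OF gl2_eq_diff[OF gl2_eq_refl J_fin_eq(1)[OF p(1) M(2)]]])
      (use gl2D(1)[OF gl2_diff[OF Usum_gl2[OF G] J_fin_gl2[OF p(1)]]] gl2D(1)[OF gl2_diff[OF Usum_gl2[OF G] Usum_gl2[OF M(2)]]] in auto)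
  also have "\<dots> = gl2_norm ext (\<lambda>n t. G n t - ext_test \<phi> n t)"
    unfolding Usum_diff by (rule Usum_norm[OF d])
  also have "\<dots> = gl2_norm ext (\<lambda>n t. G n t - \<phi> n t)"
    by (rule gl2_norm_cong[OF gl2_eq_sym[OF gl2_eq_diff[OF gl2_eq_refl ext_test_gl2_eq]]])
      (use gl2D(1)[OF fin_B0_gl2[OF d]] gl2D(1)[OF gl2_diff[OF fin_B0_gl2[OF G] finite_test_gl2[OF p(1)]]] in auto)
  finally show "\<exists>\<phi>\<in>finite_test. gl2_norm ext (\<lambda>n t. G n t - \<phi> n t) < e \<and> gl2_norm \<F> (\<lambda>m y. Usum N G m y - J_fin \<sigma> \<mu> \<phi> m y) < e"
    using p by auto
qed

lemma J_ext_fin_B0: "fin_B0 N G \<Longrightarrow> gl2_eq \<F> (\<J> G) (Usum N G)"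
  using J_graph_eq_iff[OF fin_B0_gl2 fin_B0_gl2 J_ext_graph[OF fin_B0_gl2] J_graph_Usum] by simp

lemma J_ext_eq_iff:
  "F \<in> gl2 ext \<Longrightarrow> F' \<in> gl2 ext \<Longrightarrow> gl2_eq \<F> (\<J> F) (\<J> F') \<longleftrightarrow> gl2_eq ext F F'"
  using J_graph_eq_iff J_ext_graph by blast

lemma J_ext_test:
  assumes "\<phi> \<in> finite_test" "fin_B0 N (ext_test \<phi>)"
  shows "gl2_eq \<F> (\<J> \<phi>) (Usum N (ext_test \<phi>))"
  using J_ext_eq_iff[OF finite_test_gl2[OF assms(1)] fin_B0_gl2[OF assms(2)]] ext_test_gl2_eq J_ext_fin_B0[OF assms(2)]
    gl2_eq_trans by blast

lemma Usum_add_single: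
  assumes G: "fin_B0 N G" and g: "B0 k g"
  defines "G' \<equiv> \<lambda>n v. (if n = k then g else (\<lambda>_. 0)) v + G n v"
  shows "fin_B0 (max N k) G'" "Usum (max N k) G' = (\<lambda>m y. U k g m y + Usum N G m y)"
proof -
  let ?M = "max N k"
  let ?g = "\<lambda>n. if n = k then g else (\<lambda>_. 0)"
  show "fin_B0 ?M G'"
    using G g by (auto simp: G'_def fin_B0_def fun_eq_iff intro!: B0_add B0_zero)
  have s: "(\<Sum>n\<le>?M. U n (?g n) m y) = U k g m y" for m y
  proof -
    have "(\<Sum>n\<le>?M. U n (?g n) m y) = (\<Sum>n\<le>?M. if n = k then U k g m y else 0)"
      by (rule sum.cong) (auto simp: U_zero)
    also have "\<dots> = U k g m y" by (simp add: sum.delta)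
    finally show ?thesis .
  qed
  have "Usum ?M G' m y = (\<Sum>n\<le>?M. U n (?g n) m y) + Usum ?M G m y" for m y
    unfolding Usum_def G'_def by (simp only: U_add[symmetric] sum.distrib)
  then show "Usum ?M G' = (\<lambda>m y. U k g m y + Usum N G m y)"
    by (simp only: s Usum_mono[OF G max.cobounded1] fun_eq_iff) simp
qed

text \<open>Every finite sum of products is attained by \<open>J\<close>, one glued kernel for each
  term; this supplies the preimage that \<open>X_ext\<close> selects.\<close>

lemma Usum_realize:
  assumes "wf_terms 0 L" shows "\<exists>N G. fin_B0 N G \<and> gl2_eq \<F> (Usum N G) (lsum L)"
  using assms
proof (induction L)
  case Nil
  have "fin_B0 0 (\<lambda>_ _. 0)" by (simp add: fin_B0_def B0_zero)
  moreover have "Usum 0 (\<lambda>_ _. 0) = lsum []" by (simp add: Usum_def[abs_def] U_zero lsum_Nil)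
  ultimately show ?case by (metis gl2_eq_refl)
next
  case (Cons t L)
  obtain N G where G: "fin_B0 N G" "gl2_eq \<F> (Usum N G) (lsum L)" using Cons by (auto simp: wf_terms_def)
  obtain g where g: "B0 (deg (snd t)) g" "gl2_eq \<F> (U (deg (snd t)) g) (vec (fst t) (snd t))"
    using U_realize[of "snd t" "fst t"] Cons.prems by (auto simp: wf_terms_def)
  note s = Usum_add_single[OF G(1) g(1)]
  have "gl2_eq \<F> (Usum (max N (deg (snd t))) (\<lambda>n v. (if n = deg (snd t) then g else (\<lambda>_. 0)) v + G n v)) (lsum (t # L))"
    unfolding s(2) lsum_Cons by (rule gl2_eq_add[OF g(2) G(2)])
  with s(1) show ?case by (intro exI conjI)
qed

section \<open>\<open>X(f)\<close> modulo null sets and its realization\<close>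

lemma measurable_shift_fock: "(\<lambda>y. y \<circ> Suc) \<in> \<F> (Suc k) \<rightarrow>\<^sub>M \<F> k"
proof -
  have "(\<lambda>y i. y (Suc i)) \<in> \<F> (Suc k) \<rightarrow>\<^sub>M \<F> k"
    unfolding fock_def
  proof (rule measurable_PiM_single')
    fix i assume "i \<in> {..<k}"
    then show "(\<lambda>y. y (Suc i)) \<in> PiM {..<Suc k} (\<lambda>i. st) \<rightarrow>\<^sub>M st"
      by (intro measurable_component_singleton) auto
  next
    show "(\<lambda>y i. y (Suc i)) \<in> space (PiM {..<Suc k} (\<lambda>i. st)) \<rightarrow> PiE {..<k} (\<lambda>i. space st)"
    proof (rule Pi_I, rule PiE_I)
      fix y :: "nat \<Rightarrow> 'a \<times> real" and i
      assume y: "y \<in> space (PiM {..<Suc k} (\<lambda>i. st))" "i \<notin> {..<k}"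
      then have "y \<in> PiE {..<Suc k} (\<lambda>i. UNIV)" "Suc i \<notin> {..<Suc k}" by (auto simp: space_PiM)
      then show "y (Suc i) = undefined" by (rule PiE_arb)
    qed simp
  qed
  then show ?thesis by (simp add: o_def)
qed

lemma AE_fock_shift:
  assumes "AE y in \<F> k. P y" "Measurable.pred (\<F> k) P" shows "AE y in \<F> (Suc k). P (y \<circ> Suc)"
  unfolding fock_def
proof (rule AE_PiM_Suc_I)
  show "Measurable.pred (PiM {..<Suc k} (\<lambda>i. st)) (\<lambda>y. P (y \<circ> Suc))"
    using measurable_compose[OF measurable_shift_fock assms(2)] by (simp add: fock_def)
  show "AE x in st. AE y in PiM {..<k} (\<lambda>i. st). P (case_nat x y \<circ> Suc)"
    using assms(1)[unfolded fock_def] by (intro AE_I2[where M = st]) (simp add: o_def)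
qed (rule ST.sigma_finite_measure_axioms)

text \<open>Serves the annihilation part, which integrates over the first variable with the others
  fixed.\<close>

lemma AE_fock_swap:
  assumes ae: "AE y in \<F> (Suc m). P y" and P: "Measurable.pred (\<F> (Suc m)) P"
  shows "AE y in \<F> m. AE x in st. P (case_nat x y)"
proof -
  interpret F: sigma_finite_measure "\<F> m" by (rule fock_sigma_finite)
  interpret pair_sigma_finite st "\<F> m" ..
  have "(\<lambda>z. P (case z of (x, y) \<Rightarrow> case_nat x y)) \<in> st \<Otimes>\<^sub>M \<F> m \<rightarrow>\<^sub>M count_space UNIV"
    using measurable_compose[OF measurable_case_nat_PiM[of "\<lambda>i. st" m] P[unfolded fock_def]] by (simp add: fock_def)
  then have "{z \<in> space (st \<Otimes>\<^sub>M \<F> m). P (case_nat (fst z) (snd z))} \<in> sets (st \<Otimes>\<^sub>M \<F> m)"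
    by (simp add: pred_def case_prod_unfold)
  moreover have "AE x in st. AE y in \<F> m. P (case_nat x y)"
    unfolding fock_def
    using AE_PiM_Suc[where M = "\<lambda>i. st" and m = m and P = P] ae[unfolded fock_def] by (simp add: ST.sigma_finite_measure_axioms)
  ultimately show ?thesis using AE_commute[of "\<lambda>x y. P (case_nat x y)"] by simp
qed

text \<open>Each of the three parts respects null sets: creation by a shift of the variables,
  annihilation through sections in the first variable, the neutral part pointwise.\<close>

lemma X_op_cong:
  assumes eq: "gl2_eq \<F> v v'" and m: "\<And>n. v n \<in> borel_measurable (\<F> n)" "\<And>n. v' n \<in> borel_measurable (\<F> n)"
    and f: "f \<in> borel_measurable borel"
  shows "gl2_eq \<F> (\<X> f v) (\<X> f v')"
  unfolding gl2_eq_def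
proof
  fix n
  have P: "Measurable.pred (\<F> k) (\<lambda>y. v k y = v' k y)" for k
    using borel_measurable_eq[OF m(1)[of k] m(2)[of k]] by (simp add: pred_def)
  have e: "AE y in \<F> k. v k y = v' k y" for k using eq by (simp add: gl2_eq_def)
  have c: "AE y in \<F> n. creation h v n y = creation h v' n y" for h
  proof (cases n)
    case (Suc k)
    show ?thesis unfolding Suc using AE_fock_shift[OF e P, of k] by eventually_elim (simp add: creation_def)
  qed (simp add: creation_def)
  have ne: "AE y in \<F> n. neutral h v n y = neutral h v' n y" for h
    using e[of n] by eventually_elim (simp add: neutral_def)
  have a: "AE y in \<F> n. annihilation \<sigma> \<mu> (\<lambda>(t, s). f t) v n y = annihilation \<sigma> \<mu> (\<lambda>(t, s). f t) v' n y"
    using AE_fock_swap[OF e P, of n] AE_space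
  proof eventually_elim
    case (elim y)
    have sec: "(\<lambda>x. case_nat x y) \<in> st \<rightarrow>\<^sub>M \<F> (Suc n)"
      using measurable_compose[OF measurable_Pair2'[OF elim(2), of st] measurable_case_nat_PiM[of "\<lambda>i. st" n, folded fock_def]] by simp
    have fm: "(\<lambda>z :: 'a \<times> real. case z of (t, s) \<Rightarrow> f t) \<in> borel_measurable st"
      unfolding measurable_cong_sets[OF sets_st refl] case_prod_unfold
      by (rule measurable_compose[OF measurable_fst_borel f]) simp
    show ?case unfolding annihilation_def
    proof (rule integral_cong_AE)
      show "AE z in st. (case z of (t, s) \<Rightarrow> f t) * v (Suc n) (case_nat z y) = (case z of (t, s) \<Rightarrow> f t) * v' (Suc n) (case_nat z y)"
        using elim(1) by eventually_elim simp
    qed (intro borel_measurable_times fm measurable_compose[OF sec m(1)] measurable_compose[OF sec m(2)])+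
  qed
  show "AE y in \<F> n. \<X> f v n y = \<X> f v' n y"
    using c[of "\<lambda>(t, s). f t"] a ne[of "\<lambda>(t, s). f t * s"] by eventually_elim (simp add: X_op_def)
qed

text \<open>Exhibits \<open>X(f)\<close> as one step of \<open>C + A + N\<close> on f \<otimes> G,
  so that the calculus of terms applies to it.\<close>

lemma X_op_gstep: "\<X> f G m y = gstep 0 (\<lambda>m z y. f (fst (z 0)) * G m y) m z y"
  by (cases m) (auto simp: X_op_def gstep_def op_C_def op_A_def op_N_def creation_def annihilation_def neutral_def
    case_prod_unfold mult_ac split: nat.split)

lemma test1_bound:
  fixes f :: "'a \<Rightarrow> real"
  assumes "f \<in> test1" obtains C K where "compact K" "\<And>t. \<bar>f t\<bar> \<le> C" "\<And>t. f t \<noteq> 0 \<Longrightarrow> t \<in> K" "C \<ge> 0"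
proof -
  let ?K = "closure {t. f t \<noteq> 0}"
  have K: "compact ?K" and c: "continuous_on UNIV f" using assms by (auto simp: test1_def)
  have "compact (f ` ?K)" by (rule compact_continuous_image[OF continuous_on_subset[OF c] K]) simp
  then obtain C where C: "\<And>t. t \<in> ?K \<Longrightarrow> \<bar>f t\<bar> \<le> C" using compact_imp_bounded by (fastforce simp: bounded_iff)
  have s: "t \<in> ?K" if "f t \<noteq> 0" for t using that closure_subset[of "{t. f t \<noteq> 0}"] by blast
  have "\<bar>f t\<bar> \<le> max 0 C" for t using C[of t] s[of t] by (cases "f t = 0") auto
  then show ?thesis using that[of ?K "max 0 C"] K s by auto
qed

lemma test1_measurable: "(f :: 'a \<Rightarrow> real) \<in> test1 \<Longrightarrow> f \<in> borel_measurable borel"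
  by (auto simp: test1_def intro: borel_measurable_continuous_onI)

lemma B0_shift:
  fixes f :: "'a \<Rightarrow> real"
  assumes f: "f \<in> test1" and h: "B0 N h" shows "B0 (Suc N) (\<lambda>v. f (v 0) * h (v \<circ> Suc))"
proof -
  obtain C K where C: "compact K" "\<And>t. \<bar>f t\<bar> \<le> C" "\<And>t. f t \<noteq> 0 \<Longrightarrow> t \<in> K" "C \<ge> 0"
    by (rule test1_bound[OF f]) blast
  obtain C' K' where C': "C' \<ge> 0" "compact K'" "\<And>t. \<bar>h t\<bar> \<le> C'" "\<And>t i. h t \<noteq> 0 \<Longrightarrow> i < N \<Longrightarrow> t i \<in> K'"
    using B0D(3)[OF h] by auto
  show ?thesis
  proof (rule B0I[OF _ _ compact_Un[OF C(1) C'(2)], of _ _ "C * C'"])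
    have "(\<lambda>v :: nat \<Rightarrow> 'a. f (v 0)) \<in> borel_measurable borel"
      by (rule measurable_compose[OF _ test1_measurable[OF f]]) simp
    moreover have "(\<lambda>v. h (v \<circ> Suc)) \<in> borel_measurable borel"
      by (rule measurable_compose[OF measurable_shift_borel B0D(1)[OF h]]) simp
    ultimately show "(\<lambda>v. f (v 0) * h (v \<circ> Suc)) \<in> borel_measurable borel" by simp
    show "dep (Suc N) (\<lambda>v. f (v 0) * h (v \<circ> Suc))" unfolding dep_def
    proof (intro allI impI)
      fix t t' :: "nat \<Rightarrow> 'a" assume e: "\<forall>i<Suc N. t i = t' i"
      then have "h (t \<circ> Suc) = h (t' \<circ> Suc)" by (intro depD[OF B0D(2)[OF h]]) auto
      then show "f (t 0) * h (t \<circ> Suc) = f (t' 0) * h (t' \<circ> Suc)" using e by simp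
    qed
    show "\<bar>f (t 0) * h (t \<circ> Suc)\<bar> \<le> C * C'" for t
      unfolding abs_mult using C C' by (intro mult_mono) auto
    fix t i assume a: "f (t 0) * h (t \<circ> Suc) \<noteq> 0" "i < Suc N"
    then show "t i \<in> K \<union> K'" using C(3)[of "t 0"] C'(4)[of "t \<circ> Suc" "i - 1"] by (cases i) auto
  qed
qed

lemma join_1: "join (Suc 0) z t 0 = z 0" "join (Suc 0) z t \<circ> Suc = t" "(\<lambda>i. join (Suc 0) z t (Suc i)) = t"
  by (auto simp: join_def fun_eq_iff)

end

context jac_rec
begin

lemma Rep_shift:
  assumes f: "f \<in> test1" and L: "wf_terms 0 L"
  shows "Rep (Suc 0) (\<lambda>m z y. f (fst (z 0)) * lsum L m y) (map (\<lambda>t. (\<lambda>v. f (v 0) * fst t (v \<circ> Suc), snd t)) L)"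
  unfolding Rep_def
proof (intro conjI allI impI)
  show "wf_terms (Suc 0) (map (\<lambda>t. (\<lambda>v. f (v 0) * fst t (v \<circ> Suc), snd t)) L)"
    using L B0_shift[OF f] by (auto simp: wf_terms_def)
  show "tk_meas (\<lambda>m z y. f (fst (z 0)) * lsum L m y)"
    unfolding tk_meas_def
  proof
    fix m
    have l: "lsum L m \<in> borel_measurable borel"
      using L
    proof (induction L)
      case (Cons t L)
      have "vec (fst t) (snd t) m \<in> borel_measurable borel" by (rule vec_measurable) (use Cons.prems in \<open>simp add: wf_terms_def\<close>)
      moreover have "lsum L m \<in> borel_measurable borel" using Cons by (simp add: wf_terms_def)
      ultimately show ?case by (simp add: lsum_Cons)
    qed (simp add: lsum_Nil)
    have w: "(\<lambda>w :: (nat \<Rightarrow> 'a \<times> real) \<times> (nat \<Rightarrow> 'a \<times> real). fst w 0) \<in> borel_measurable borel"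
      by (rule measurable_app_borel) simp
    have "(\<lambda>w :: (nat \<Rightarrow> 'a \<times> real) \<times> (nat \<Rightarrow> 'a \<times> real). f (fst (fst w 0))) \<in> borel_measurable borel"
      by (rule measurable_compose[OF measurable_fst_borel[OF w] test1_measurable[OF f]])
    moreover have "(\<lambda>w :: (nat \<Rightarrow> 'a \<times> real) \<times> (nat \<Rightarrow> 'a \<times> real). lsum L m (snd w)) \<in> borel_measurable borel"
      by (rule measurable_compose[OF measurable_snd_borel l]) simp
    ultimately show "(\<lambda>w :: (nat \<Rightarrow> 'a \<times> real) \<times> (nat \<Rightarrow> 'a \<times> real). f (fst (fst w 0)) * lsum L m (snd w)) \<in> borel_measurable borel"
      by (rule borel_measurable_times)
  qed
  fix m :: nat and z y :: "nat \<Rightarrow> 'a \<times> real"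
  show "f (fst (z 0)) * lsum L m y = tsum (Suc 0) (map (\<lambda>t. (\<lambda>v. f (v 0) * fst t (v \<circ> Suc), snd t)) L) m z y"
    by (induction L) (auto simp: tsum_def lsum_def trm_def vec_def join_1 algebra_simps)
qed

lemma X_op_lsum:
  assumes f: "f \<in> test1" and L: "wf_terms 0 L"
  defines "L' \<equiv> concat (map (tstep 0) (map (\<lambda>t. (\<lambda>v. f (v 0) * fst t (v \<circ> Suc), snd t)) L))"
  shows "wf_terms 0 L'" "gl2_eq \<F> (\<X> f (lsum L)) (lsum L')" "\<X> f (lsum L) \<in> gl2 \<F>"
proof -
  note R = gstep_Rep[OF Rep_shift[OF f L], folded L'_def]
  have e: "\<X> f (lsum L) = (\<lambda>m y. gstep 0 (\<lambda>m z y. f (fst (z 0)) * lsum L m y) m undefined y)"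
    by (intro ext X_op_gstep)
  show "wf_terms 0 L'" using R by (simp add: Rep_def)
  show "gl2_eq \<F> (\<X> f (lsum L)) (lsum L')" unfolding e by (rule Rep_0_gl2_eq(1)[OF R])
  show "\<X> f (lsum L) \<in> gl2 \<F>" unfolding e by (rule Rep_0_gl2_eq(2)[OF R])
qed

end

context jac_process
begin

lemma Usum_lsum: assumes "fin_B0 N \<phi>" shows "\<exists>L. wf_terms 0 L \<and> Usum N \<phi> = lsum L"
proof -
  have "\<exists>L. wf_terms 0 L \<and> Usum M \<phi> = lsum L" for M
  proof (induction M)
    case 0
    have "Usum 0 \<phi> = lsum (UL 0 0 (\<phi> 0))" by (simp add: Usum_def[abs_def] lsum_UL)
    then show ?case using U_wf[of 0 "\<phi> 0"] assms by (auto simp: fin_B0_def)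
  next
    case (Suc M)
    then obtain L where L: "wf_terms 0 L" "Usum M \<phi> = lsum L" by blast
    have "Usum (Suc M) \<phi> = lsum (L @ UL 0 (Suc M) (\<phi> (Suc M)))"
      by (simp add: fun_eq_iff lsum_append lsum_UL Usum_def L(2)[symmetric])
    moreover have "wf_terms 0 (L @ UL 0 (Suc M) (\<phi> (Suc M)))"
      using L(1) U_wf[of "Suc M" "\<phi> (Suc M)"] assms by (auto simp: fin_B0_def wf_terms_def)
    ultimately show ?case by blast
  qed
  then show ?thesis by blast
qed

text \<open>The choice in \<open>X_ext\<close> has a witness because the image is again a finite sum
  of products, which has a preimage by \<open>Usum_realize\<close>.\<close>

lemma X_ext_spec:
  assumes f: "f \<in> test1" and p: "\<phi> \<in> finite_test" and N: "fin_B0 N (ext_test \<phi>)"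
  shows "X_ext \<sigma> \<mu> f \<phi> \<in> gl2 ext" "gl2_eq \<F> (\<J> (X_ext \<sigma> \<mu> f \<phi>)) (\<X> f (Usum N (ext_test \<phi>)))"
proof -
  obtain L where L: "wf_terms 0 L" "Usum N (ext_test \<phi>) = lsum L" using Usum_lsum[OF N] by blast
  obtain L' where L': "wf_terms 0 L'" "gl2_eq \<F> (\<X> f (lsum L)) (lsum L')"
    using jac_rec.X_op_lsum(1,2)[OF own_rec f L(1)] by blast
  obtain M G where G: "fin_B0 M G" "gl2_eq \<F> (Usum M G) (lsum L')" using Usum_realize[OF L'(1)] by blast
  have J: "gl2_eq \<F> (\<X> f (\<J> \<phi>)) (\<X> f (Usum N (ext_test \<phi>)))"
    by (rule X_op_cong[OF J_ext_test[OF p N]])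
      (auto intro: gl2D(1)[OF J_ext_gl2[OF finite_test_gl2[OF p]]] gl2D(1)[OF Usum_gl2[OF N]] test1_measurable[OF f])
  have "gl2_eq \<F> (lsum L') (\<X> f (\<J> \<phi>))"
    using gl2_eq_sym[OF gl2_eq_trans[OF J]] L L'(2) by metis
  then have "gl2_eq \<F> (\<J> G) (\<X> f (\<J> \<phi>))"
    by (rule gl2_eq_trans[OF gl2_eq_trans[OF J_ext_fin_B0[OF G(1)] G(2)]])
  then have "G \<in> gl2 ext \<and> gl2_eq \<F> (\<J> G) (\<X> f (\<J> \<phi>))"
    using fin_B0_gl2[OF G(1)] by simp
  then have s: "X_ext \<sigma> \<mu> f \<phi> \<in> gl2 ext \<and> gl2_eq \<F> (\<J> (X_ext \<sigma> \<mu> f \<phi>)) (\<X> f (\<J> \<phi>))"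
    unfolding X_ext_def
    by (rule someI[of "\<lambda>G. G \<in> gl2 ext \<and> gl2_eq \<F> (\<J> G) (\<X> f (\<J> \<phi>))"])
  then show "X_ext \<sigma> \<mu> f \<phi> \<in> gl2 ext" by simp
  show "gl2_eq \<F> (\<J> (X_ext \<sigma> \<mu> f \<phi>)) (\<X> f (Usum N (ext_test \<phi>)))"
    using s J gl2_eq_trans by blast
qed

text \<open>Reduces statement (ii) to explicit vectors of the full Fock space.\<close>

lemma X_ext_iff:
  assumes f: "f \<in> test1" and p: "\<phi> \<in> finite_test" and N: "fin_B0 N (ext_test \<phi>)"
    and q: "\<psi> \<in> finite_test" and M: "fin_B0 M (ext_test \<psi>)"
  shows "gl2_eq ext (X_ext \<sigma> \<mu> f \<phi>) \<psi> \<longleftrightarrow> gl2_eq \<F> (\<X> f (Usum N (ext_test \<phi>))) (Usum M (ext_test \<psi>))"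
proof -
  note X = X_ext_spec[OF f p N]
  have "gl2_eq ext (X_ext \<sigma> \<mu> f \<phi>) \<psi> \<longleftrightarrow> gl2_eq \<F> (\<J> (X_ext \<sigma> \<mu> f \<phi>)) (\<J> \<psi>)"
    using J_ext_eq_iff[OF X(1) finite_test_gl2[OF q]] by simp
  also have "\<dots> \<longleftrightarrow> gl2_eq \<F> (\<X> f (Usum N (ext_test \<phi>))) (Usum M (ext_test \<psi>))"
    using X(2) J_ext_test[OF q M] gl2_eq_trans gl2_eq_sym by blast
  finally show ?thesis .
qed

end

section \<open>Constant Jacobi coefficients\<close>

text \<open>Makes dominated convergence available for the continuity of parameter integrals.\<close>

lemma continuous_on_UNIV_sequentiallyI:
  fixes f :: "'c::first_countable_topology \<Rightarrow> 'd::topological_space"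
  assumes "\<And>u a. u \<longlonglongrightarrow> a \<Longrightarrow> (\<lambda>n. f (u n)) \<longlonglongrightarrow> f a"
  shows "continuous_on UNIV f"
proof -
  have "eventually (\<lambda>x. f x \<in> S) (nhds a)" if S: "open S" "f a \<in> S" for a S
    unfolding eventually_nhds_iff_sequentially using topological_tendstoD[OF assms S] by blast
  then have "\<forall>\<^sub>F x in nhds a. x \<noteq> a \<longrightarrow> x \<in> UNIV \<longrightarrow> f x \<in> S" if "open S" "f a \<in> S" for a S
    using that by (blast intro: eventually_mono)
  then show ?thesis
    unfolding continuous_on_def tendsto_def eventually_at_filter by blast
qed

lemma continuous_dmap: "continuous_on UNIV (dmap j :: (nat \<Rightarrow> 'b::topological_space) \<Rightarrow> _)"
proof (rule continuous_on_coordinatewise_then_product)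
  fix i show "continuous_on UNIV (\<lambda>v :: nat \<Rightarrow> 'b. dmap j v i)" by (cases "i \<le> j") (auto simp: dmap_def)
qed

lemma continuous_shift: "continuous_on UNIV (\<lambda>v :: nat \<Rightarrow> 'b::topological_space. v \<circ> Suc)"
  unfolding o_def
  by (rule continuous_on_coordinatewise_then_product) (auto intro: continuous_on_product_coordinates)

lemma continuous_coord:
  "continuous_on UNIV g \<Longrightarrow> continuous_on UNIV (\<lambda>v :: nat \<Rightarrow> 'b::topological_space. g (v i))"
  by (rule continuous_on_compose2[OF _ continuous_on_product_coordinates]) auto

lemma C0_dmap:
  fixes h :: "(nat \<Rightarrow> 'b::second_countable_topology) \<Rightarrow> real"
  assumes "C0 (Suc N) h" "j < N" shows "C0 N (\<lambda>v. h (dmap j v))"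
  using assms continuous_on_compose2[OF _ continuous_dmap, of UNIV h j] by (simp add: C0_iff B0_dmap)

lemma C0_coeff:
  assumes "continuous_on UNIV g" "C0 N h" "j < N" shows "C0 N (\<lambda>v. g (v j) * h v)"
  by (rule C0_mult[OF assms(2) continuous_coord[OF assms(1)]]) (use assms(3) in \<open>simp add: dep_def\<close>)

context jac_process
begin

lemma C0_lift:
  fixes f :: "'a \<Rightarrow> real"
  assumes f: "f \<in> test1" and h: "C0 N h" shows "C0 (Suc N) (\<lambda>v. f (v 0) * h (v \<circ> Suc))"
  unfolding C0_iff
proof
  show "continuous_on UNIV (\<lambda>v. f (v 0) * h (v \<circ> Suc))"
    using f by (intro continuous_on_mult continuous_coord continuous_on_compose2[OF C0D(1)[OF h] continuous_shift]) (auto simp: test1_def)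
  show "B0 (Suc N) (\<lambda>v. f (v 0) * h (v \<circ> Suc))" by (rule B0_shift[OF f C0_imp_B0[OF h]])
qed

lemma C0_int_out:
  assumes h: "C0 (Suc (Suc N)) h" and j: "j \<le> N" shows "C0 N (int_out j h)"
proof -
  note b = C0_imp_B0[OF h]
  obtain C K where C: "compact K" "\<And>x v. \<bar>h (emap j x v)\<bar> \<le> C" "\<And>x v. h (emap j x v) \<noteq> 0 \<Longrightarrow> x \<in> K"
      "\<And>x v i. h (emap j x v) \<noteq> 0 \<Longrightarrow> i < N \<Longrightarrow> v i \<in> K" "C \<ge> 0"
    using emap_section(2)[OF b j] by blast
  have "continuous_on UNIV (int_out j h)"
  proof (rule continuous_on_UNIV_sequentiallyI)
    fix u :: "nat \<Rightarrow> nat \<Rightarrow> 'a" and v assume u: "u \<longlonglongrightarrow> v"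
    have c: "continuous_on UNIV (emap j x :: (nat \<Rightarrow> 'a) \<Rightarrow> _)" for x
    proof (rule continuous_on_coordinatewise_then_product)
      fix i show "continuous_on UNIV (\<lambda>v :: nat \<Rightarrow> 'a. emap j x v i)"
        by (cases "i < j"; cases "i \<le> Suc j") (auto simp: emap_def)
    qed
    have "continuous_on UNIV (\<lambda>v. h (emap j x v))" for x
      by (rule continuous_on_compose2[OF C0D(1)[OF h] c]) simp
    then have "(\<lambda>n. h (emap j x (u n))) \<longlonglongrightarrow> h (emap j x v)" for x
      by (rule continuous_on_tendsto_compose[OF _ u]) auto
    then show "(\<lambda>n. int_out j h (u n)) \<longlonglongrightarrow> int_out j h v"
      unfolding int_out_def
    proof (intro integral_dominated_convergence[where w = "\<lambda>x. C * indicator K x"] AE_I2)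
      show "integrable \<sigma> (\<lambda>x. C * indicator K x)" using C(1) emeasure_compact[OF C(1)] by simp
      show "(\<lambda>x. h (emap j x v)) \<in> borel_measurable \<sigma>" "(\<lambda>x. h (emap j x (u n))) \<in> borel_measurable \<sigma>" for n
        using emap_section(1)[OF b j] by (simp_all add: measurable_cong_sets[OF sets_sigma refl])
      show "norm (h (emap j x (u n))) \<le> C * indicator K x" for n x
        using C(2)[where x = x and v = "u n"] C(3)[of x "u n"] by (cases "x \<in> K") (auto simp: indicator_def)
    qed simp
  qed
  then show ?thesis using int_out_B0[OF b j] by (simp add: C0_iff)
qed

text \<open>A pair \<open>(F, k)\<close> stands for a whole kernel of order \<open>k\<close>, all
  strata together. When the coefficients do not depend on the level, the calculus closes on such
  pairs.\<close>

definition TU :: "nat \<Rightarrow> (((nat \<Rightarrow> 'a) \<Rightarrow> real) \<times> nat) list \<Rightarrow> 'a terms"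
  where "TU j Fs = concat (map (\<lambda>t. UL j (snd t) (fst t)) Fs)"

definition C0s :: "nat \<Rightarrow> (((nat \<Rightarrow> 'a) \<Rightarrow> real) \<times> nat) list \<Rightarrow> bool"
  where "C0s j Fs \<longleftrightarrow> (\<forall>t\<in>set Fs. C0 (j + snd t) (fst t))"

lemma TU_append: "TU j (Fs @ Gs) = TU j Fs @ TU j Gs"
  by (simp add: TU_def)

lemma TU_Cons: "TU j (t # Fs) = UL j (snd t) (fst t) @ TU j Fs"
  by (simp add: TU_def)

lemma TU_wf: "C0s j Fs \<Longrightarrow> wf_terms j (TU j Fs)"
  using UL_wf[OF C0_imp_B0] by (fastforce simp: wf_terms_def TU_def C0s_def)

lemma lsum_TU: "lsum (TU 0 Fs) m y = (\<Sum>t\<leftarrow>Fs. U (snd t) (fst t) m y)"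
  by (induction Fs) (auto simp: TU_def lsum_append lsum_UL lsum_Nil)

end

context jac_rec
begin

text \<open>The exact form of the lower terms. The coefficients \<open>\<beta> l\<close> and
  \<open>\<alpha> (Suc l)\<close> depend on the first block of the stratum; without the dependence
  on \<open>l\<close>, each sum consists of the restrictions of one kernel.\<close>

lemma tstep_tsum_UL:
  "tsum j (concat (map (tstep j) (UL (Suc j) k F))) m z y =
   tsum j (UL j (Suc k) F) m z y
   + (\<Sum>ls\<in>Sn k. case ls of [] \<Rightarrow> 0 | l # r \<Rightarrow> trm j (\<lambda>v. \<beta> l (v j) * F (dmap j (spr j ls v))) ls m z y)
   + (case k of 0 \<Rightarrow> 0 | Suc i \<Rightarrow> (\<Sum>ls\<in>Sn i. trm j (\<lambda>v. int_out j F (spr j ls v)) ls m z y)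
     + (\<Sum>ls\<in>Sn i. case ls of [] \<Rightarrow> 0 | l # r \<Rightarrow> trm j (\<lambda>v. \<alpha> (Suc l) (v j) * F (dmap j (dmap j (spr j ls v)))) ls m z y))"
proof -
  define N where "N ls = (case ls of [] \<Rightarrow> 0 | l # r \<Rightarrow> trm j (\<lambda>v. \<beta> l (v j) * F (dmap j (spr j ls v))) ls m z y)" for ls
  define A where "A ls = (case ls of [] \<Rightarrow> 0 | l # r \<Rightarrow> trm j (\<lambda>v. \<alpha> (Suc l) (v j) * F (dmap j (dmap j (spr j ls v)))) ls m z y)" for ls
  \<comment> \<open>What is left after removing the \<open>\<beta>\<close> part: the integral if the
    first index is 0, the \<open>\<alpha>\<close> part if it is positive. \<open>sum_Sn_Suc\<close>
    re-indexes both by the strata of order \<open>k - 1\<close>.\<close>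
  define D where "D ls = tsum j (rest j F ls) m z y - N ls" for ls
  have i: "int_out j (\<lambda>v. F (spr (Suc (Suc j)) r v)) = (\<lambda>v. int_out j F (spr j r v))" for r
    by (simp add: int_out_def[abs_def] emap_spr[unfolded spr_0])
  have D: "D (0 # r) = trm j (\<lambda>v. int_out j F (spr j r v)) r m z y" "D (Suc l # r) = A (l # r)" "D [] = 0" for l r
    by (simp_all add: D_def N_def A_def rest_def tstep_def tsum_def spr_0 i dmap_spr dmap_spr[of j 0, unfolded spr_0] spr_dmap)
  have "(\<Sum>ls\<in>Sn k. D ls) = (case k of 0 \<Rightarrow> 0 | Suc i \<Rightarrow> (\<Sum>ls\<in>Sn i. trm j (\<lambda>v. int_out j F (spr j ls v)) ls m z y) + (\<Sum>ls\<in>Sn i. A ls))"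
  proof (cases k)
    case (Suc i)
    have "(case ls of [] \<Rightarrow> 0 | l # r \<Rightarrow> D (Suc l # r)) = A ls" for ls by (simp add: D A_def split: list.split)
    then show ?thesis unfolding Suc sum_Sn_Suc[of D] by (simp add: D)
  qed (simp add: D)
  moreover have "(\<Sum>ls\<in>Sn k. tsum j (rest j F ls) m z y) = (\<Sum>ls\<in>Sn k. N ls) + (\<Sum>ls\<in>Sn k. D ls)"
    by (simp add: D_def sum.distrib[symmetric])
  ultimately show ?thesis unfolding tstep_UL N_def A_def by simp
qed

text \<open>The variable of \<open>f\<close> stands in front of the blocks and is not repeated, so
  multiplication by \<open>f\<close> commutes with restriction to strata.\<close>

lemma UL_lift: "map (\<lambda>t. (\<lambda>v. f (v 0) * fst t (v \<circ> Suc), snd t)) (UL 0 n g) = UL (Suc 0) n (\<lambda>v. f (v 0) * g (v \<circ> Suc))"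
proof -
  have "spr (Suc 0) ls v 0 = v 0" "spr (Suc 0) ls v \<circ> Suc = spr 0 ls (v \<circ> Suc)" for ls and v :: "nat \<Rightarrow> 'a"
    by (auto simp: spr_def fun_eq_iff)
  then show ?thesis by (simp add: UL_def)
qed

lemma X_op_U:
  assumes f: "f \<in> test1" and g: "B0 n g"
  shows "gl2_eq \<F> (\<X> f (U n g)) (lsum (concat (map (tstep 0) (UL (Suc 0) n (\<lambda>v. f (v 0) * g (v \<circ> Suc))))))"
  using X_op_lsum(2)[OF f U_wf[OF g]] by (simp only: UL_lift lsum_UL)

end

section \<open>The calculus of kernels for coefficients independent of the level\<close>

locale const_rec = jac_rec \<sigma> \<mu> "\<lambda>_. eta" "\<lambda>_. lam"
  for \<sigma> :: "'a::{t2_space, second_countable_topology} measure" and \<mu> eta lam +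
  assumes cont: "continuous_on UNIV lam" "continuous_on UNIV eta"
begin

text \<open>The lower terms as kernels: the neutral part keeps the order, the other two lower it by
  one. A first block that is to be shortened has length at least two, hence no such term for
  \<open>i = 0\<close>.\<close>

definition crest :: "nat \<Rightarrow> ((nat \<Rightarrow> 'a) \<Rightarrow> real) \<times> nat \<Rightarrow> (((nat \<Rightarrow> 'a) \<Rightarrow> real) \<times> nat) list"
  where "crest j t = (case snd t of 0 \<Rightarrow> [] | Suc i \<Rightarrow>
    (\<lambda>v. lam (v j) * fst t (dmap j v), Suc i) # (int_out j (fst t), i) #
    (if i = 0 then [] else [(\<lambda>v. eta (v j) * fst t (dmap j (dmap j v)), i)]))"

definition cstep :: "nat \<Rightarrow> ((nat \<Rightarrow> 'a) \<Rightarrow> real) \<times> nat \<Rightarrow> (((nat \<Rightarrow> 'a) \<Rightarrow> real) \<times> nat) list"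
  where "cstep j t = (fst t, Suc (snd t)) # crest j t"

lemma spr_at: "spr j ls v j = v j"
  by (simp add: spr_def)

lemma Sn_Cons: "ls \<in> Sn (Suc i) \<Longrightarrow> \<exists>l r. ls = l # r"
  by (cases ls) (auto simp: Sn_def)

lemma cstep_tsum:
  "tsum j (concat (map (tstep j) (UL (Suc j) (snd t) (fst t)))) m z y = tsum j (TU j (cstep j t)) m z y"
proof -
  obtain F k where t: "t = (F, k)" by (cases t)
  have n: "(\<Sum>ls\<in>Sn (Suc i). case ls of [] \<Rightarrow> 0 | l # r \<Rightarrow> G ls) = (\<Sum>ls\<in>Sn (Suc i). G ls)" for i and G :: "nat list \<Rightarrow> real"
    by (rule sum.cong[OF refl]) (auto dest: Sn_Cons)
  show ?thesis
  proof (cases k)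
    case 0
    then show ?thesis by (simp add: t tstep_tsum_UL cstep_def crest_def TU_def tsum_UL)
  next
    case (Suc i)
    show ?thesis
    proof (cases i)
      case 0
      then show ?thesis
        by (simp add: t Suc tstep_tsum_UL n cstep_def crest_def TU_def tsum_append tsum_UL spr_at)
    next
      case (Suc i')
      then show ?thesis
        by (simp add: t \<open>k = Suc i\<close> tstep_tsum_UL n cstep_def crest_def TU_def tsum_append tsum_UL spr_at)
    qed
  qed
qed

lemma crest_snd: "t' \<in> set (crest j t) \<Longrightarrow> snd t' \<le> snd t"
  by (auto simp: crest_def split: nat.splits if_splits)

lemma cstep_snd: "t' \<in> set (cstep j t) \<Longrightarrow> snd t' \<le> Suc (snd t)"
  using crest_snd[of t' j t] by (auto simp: cstep_def)

lemma cstep_C0: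
  assumes "C0 (Suc j + snd t) (fst t)" shows "C0s j (cstep j t)"
proof -
  obtain F k where t: "t = (F, k)" by (cases t)
  have F: "C0 (Suc j + k) F" using assms t by simp
  show ?thesis
  proof (cases k)
    case 0
    then show ?thesis using F by (simp add: t cstep_def crest_def C0s_def)
  next
    case (Suc i)
    have F': "C0 (Suc (j + Suc i)) F" "C0 (Suc (Suc (j + i))) F" using F Suc by auto
    have d: "C0 (j + Suc i) (\<lambda>v. F (dmap j v))" by (rule C0_dmap[OF F'(1)]) simp
    have "C0 (j + Suc i) (\<lambda>v. lam (v j) * F (dmap j v))" by (rule C0_coeff[OF cont(1) d]) simp
    moreover have "C0 (j + i) (int_out j F)" by (rule C0_int_out[OF F'(2)]) simp
    moreover have "C0 (j + i) (\<lambda>v. eta (v j) * F (dmap j (dmap j v)))" if "i \<noteq> 0"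
    proof (rule C0_coeff[OF cont(2)])
      show "C0 (j + i) (\<lambda>v. F (dmap j (dmap j v)))" by (rule C0_dmap) (use d that in auto)
    qed (use that in simp)
    ultimately show ?thesis using F'(1) by (auto simp: t Suc cstep_def crest_def C0s_def)
  qed
qed

lemma Rep_cstep:
  assumes R: "Rep (Suc j) H (TU (Suc j) Fs)" and C: "C0s (Suc j) Fs"
  shows "Rep j (gstep j H) (TU j (concat (map (cstep j) Fs)))" "C0s j (concat (map (cstep j) Fs))"
proof -
  show C': "C0s j (concat (map (cstep j) Fs))" using C cstep_C0 by (fastforce simp: C0s_def)
  show "Rep j (gstep j H) (TU j (concat (map (cstep j) Fs)))"
  proof (rule Rep_cong[OF gstep_Rep[OF R] TU_wf[OF C']])
    fix m z y
    show "tsum j (concat (map (tstep j) (TU (Suc j) Fs))) m z y = tsum j (TU j (concat (map (cstep j) Fs))) m z y"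
    proof (induction Fs)
      case (Cons t Fs)
      then show ?case by (simp add: TU_Cons TU_append tsum_append cstep_tsum)
    qed (simp add: TU_def)
  qed
qed

text \<open>The induction of \<open>CAN_expand\<close> with whole kernels instead of single
  products, which keeps all lower terms continuous.\<close>

lemma CAN_const:
  assumes "Rep k H (TU k ((F, i) # Fs))" "C0s k ((F, i) # Fs)" "\<forall>t\<in>set Fs. snd t < i"
  shows "\<exists>Fs'. Rep 0 (CAN_power \<sigma> \<mu> k H) (TU 0 ((F, i + k) # Fs')) \<and> C0s 0 ((F, i + k) # Fs') \<and> (\<forall>t\<in>set Fs'. snd t < i + k)"
  using assms
proof (induction k arbitrary: H i Fs)
  case 0
  then show ?case by auto
next
  case (Suc k)
  let ?Gs = "crest k (F, i) @ concat (map (cstep k) Fs)"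
  have e: "concat (map (cstep k) ((F, i) # Fs)) = (F, Suc i) # ?Gs" by (simp add: cstep_def)
  have "\<forall>t\<in>set ?Gs. snd t < Suc i"
  proof
    fix t assume "t \<in> set ?Gs"
    then consider "t \<in> set (crest k (F, i))" | s where "s \<in> set Fs" "t \<in> set (cstep k s)" by auto
    then show "snd t < Suc i"
    proof cases
      case 1
      then show ?thesis using crest_snd[OF 1] by simp
    next
      case (2 s)
      then show ?thesis using cstep_snd[OF 2(2)] Suc.prems(3) by fastforce
    qed
  qed
  from Suc.IH[OF Rep_cstep[OF Suc.prems(1,2), unfolded e] this] show ?case by (simp add: CAN_power_Suc del: CAN_power.simps)
qed

lemma mono_const:
  assumes f: "C0 n f"
  shows "\<exists>Fs. C0s 0 Fs \<and> (\<forall>t\<in>set Fs. snd t < n) \<and> gl2_eq \<F> (mono_vac n f) (\<lambda>m y. U n f m y + lsum (TU 0 Fs) m y)"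
proof -
  have x: "ext_seq n f = f" by (rule ext_seq_dep[OF C0D(2)[OF f]])
  have "Rep n (mono_start n f) (TU n [(f, 0)])"
  proof (rule Rep_cong[OF mono_start_Rep[of n f]])
    show "B0 n (ext_seq n f)" using C0_imp_B0[OF f] by (simp add: x)
    show "wf_terms n (TU n [(f, 0)])" by (rule TU_wf) (use f in \<open>simp add: C0s_def\<close>)
    have s: "f (spr n [] v) = f v" for v by (rule depD[OF C0D(2)[OF f]]) (simp add: spr_def)
    show "tsum n [(ext_seq n f, [])] m z y = tsum n (TU n [(f, 0)]) m z y" for m z y
      by (simp add: x TU_def tsum_UL s) (simp add: tsum_def)
  qed
  then obtain Fs where Fs: "Rep 0 (CAN_power \<sigma> \<mu> n (mono_start n f)) (TU 0 ((f, n) # Fs))" "C0s 0 ((f, n) # Fs)" "\<forall>t\<in>set Fs. snd t < n"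
    using CAN_const[of n "mono_start n f" f 0 "[]"] f by (auto simp: C0s_def)
  have "gl2_eq \<F> (mono_vac n f) (lsum (TU 0 ((f, n) # Fs)))"
    using Rep_0_gl2_eq(1)[OF Fs(1), of undefined] by (simp add: monomial_eq[abs_def])
  moreover have "lsum (TU 0 ((f, n) # Fs)) = (\<lambda>m y. U n f m y + lsum (TU 0 Fs) m y)"
    by (simp add: TU_Cons lsum_append lsum_UL fun_eq_iff)
  ultimately show ?thesis using Fs(2,3) by (auto simp: C0s_def)
qed

text \<open>Induction on the order: a monomial equals \<open>U n f\<close> plus \<open>U\<close> of
  continuous kernels of smaller order, which already come from continuous polynomials.\<close>

lemma U_CPv: "C0 n f \<Longrightarrow> U n f \<in> CPv n"
proof (induction n arbitrary: f rule: less_induct)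
  case (less n)
  obtain Fs where Fs: "C0s 0 Fs" "\<forall>t\<in>set Fs. snd t < n" "gl2_eq \<F> (mono_vac n f) (\<lambda>m y. U n f m y + lsum (TU 0 Fs) m y)"
    using mono_const[OF less.prems] by blast
  have "lsum (TU 0 Fs) \<in> CPv n" using Fs(1,2)
  proof (induction Fs)
    case Nil
    then show ?case using CPv_zero by (simp add: TU_def lsum_Nil)
  next
    case (Cons t Fs)
    have "U (snd t) (fst t) \<in> CPv (snd t)" using Cons.prems by (intro less.IH) (auto simp: C0s_def)
    then have "U (snd t) (fst t) \<in> CPv n" by (rule CPv_mono) (use Cons.prems in auto)
    moreover have "lsum (TU 0 Fs) \<in> CPv n" using Cons by (simp add: C0s_def)
    ultimately have "(\<lambda>m y. U (snd t) (fst t) m y + lsum (TU 0 Fs) m y) \<in> CPv n" by (rule CPv_add)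
    moreover have "lsum (TU 0 (t # Fs)) = (\<lambda>m y. U (snd t) (fst t) m y + lsum (TU 0 Fs) m y)"
      by (simp add: TU_Cons lsum_append lsum_UL fun_eq_iff)
    ultimately show ?case by simp
  qed
  from CPv_diff[OF CPv_monomial[OF less.prems le_refl] this]
  show ?case
  proof (rule CPv_cong)
    show "gl2_eq \<F> (U n f) (\<lambda>m y. mono_vac n f m y - lsum (TU 0 Fs) m y)"
      using gl2_eq_sym[OF gl2_eq_diff[OF Fs(3) gl2_eq_refl[of _ "lsum (TU 0 Fs)"]]] by simp
    show "U n f \<in> gl2 \<F>" by (rule U_gl2[OF C0_imp_B0[OF less.prems]])
  qed
qed

lemma X_op_const:
  assumes f: "f \<in> test1" and g: "C0 n g"
  shows "gl2_eq \<F> (\<X> f (U n g)) (lsum (TU 0 (cstep 0 (\<lambda>v. f (v 0) * g (v \<circ> Suc), n))))"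
proof -
  have "lsum (concat (map (tstep 0) (UL (Suc 0) n (\<lambda>v. f (v 0) * g (v \<circ> Suc)))))
      = lsum (TU 0 (cstep 0 (\<lambda>v. f (v 0) * g (v \<circ> Suc), n)))"
    using cstep_tsum[of 0 "(\<lambda>v. f (v 0) * g (v \<circ> Suc), n)"] by (simp add: tsum_0 fun_eq_iff)
  then show ?thesis using X_op_U[OF f C0_imp_B0[OF g]] by simp
qed

end

section \<open>Invariance of the finite test sequences\<close>

lemma deg_replicate [simp]: "deg (replicate n 0) = n"
  by (induction n) auto

lemma blk_replicate: "i < n \<Longrightarrow> blk (replicate n 0) i = i"
  by (induction n arbitrary: i) (auto simp: less_Suc_eq_0_disj)

text \<open>Puts one more variable in front of the \<open>z\<close>. It is consumed last, so
  applying \<open>X(f)\<close> to a monomial with kernel g yields the monomial with kernel f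
  \<otimes> g.\<close>

definition lift_ker :: "('a \<Rightarrow> real) \<Rightarrow> 'a two_kernel \<Rightarrow> 'a two_kernel"
  where "lift_ker f H = (\<lambda>m z y. f (fst (z 0)) * H m (z \<circ> Suc) y)"

lemma upd_shift: "(z(Suc k := x)) \<circ> Suc = (z \<circ> Suc)(k := x)"
  by (auto simp: fun_eq_iff)

context jac_process
begin

section \<open>Continuous functions vanishing almost everywhere\<close>

lemma continuous_AE_zero:
  fixes h :: "'a \<Rightarrow> real"
  assumes h: "continuous_on UNIV h" and ae: "AE t in \<sigma>. h t = 0" shows "h t = 0"
proof (rule ccontr)
  assume t: "h t \<noteq> 0"
  let ?A = "{t. h t \<noteq> 0}"
  have "open ?A" using open_vimage[OF _ h, of "- {0}"] by (simp add: vimage_def open_Compl)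
  moreover have "emeasure \<sigma> ?A = 0"
    using ae AE_iff_measurable[of ?A \<sigma> "\<lambda>t. h t = 0"] borel_open[OF \<open>open ?A\<close>] by simp
  ultimately show False using full_support[of ?A] t by auto
qed

lemma SP_replicate: "SP (replicate n 0) = PiM {..<n} (\<lambda>_. \<sigma>)"
  unfolding SP_def by (rule PiM_cong) (auto simp: sigma_l_0)

lemma continuous_case_nat: "continuous_on UNIV (\<lambda>x :: 'a. case_nat x y)" "continuous_on UNIV (case_nat (x :: 'a))"
proof -
  have "continuous_on UNIV (\<lambda>x :: 'a. case i of 0 \<Rightarrow> x | Suc j \<Rightarrow> y j)" for i by (cases i) auto
  then show "continuous_on UNIV (\<lambda>x :: 'a. case_nat x y)" by (rule continuous_on_coordinatewise_then_product)
  have "continuous_on UNIV (\<lambda>y. case i of 0 \<Rightarrow> x | Suc j \<Rightarrow> y j)" for i by (cases i) auto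
  then show "continuous_on UNIV (case_nat x)" by (rule continuous_on_coordinatewise_then_product)
qed

text \<open>For almost every first coordinate the induction gives vanishing in all the others;
  continuity in the first coordinate then removes the exceptional set.\<close>

lemma continuous_AE_zero_PiM:
  assumes "continuous_on UNIV h" "dep n h" "AE t in PiM {..<n} (\<lambda>_. \<sigma>). h t = 0"
  shows "h (t :: nat \<Rightarrow> 'a) = (0 :: real)"
  using assms
proof (induction n arbitrary: h t)
  case 0
  have "h t = h (\<lambda>_. undefined)" for t by (rule depD[OF 0(2)]) simp
  moreover have "h (\<lambda>_. undefined) = 0" using 0(3)[unfolded lessThan_0 PiM_empty] by (simp add: AE_count_space)
  ultimately show ?case by simp
next
  case (Suc n)
  have "AE x in \<sigma>. AE y in PiM {..<n} (\<lambda>_. \<sigma>). h (case_nat x y) = 0"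
    by (rule AE_PiM_Suc[OF S.sigma_finite_measure_axioms Suc.prems(3)])
  then have ae: "AE x in \<sigma>. h (case_nat x y) = 0" for y
  proof eventually_elim
    case (elim x)
    have c: "continuous_on UNIV (\<lambda>y. h (case_nat x y))"
      by (rule continuous_on_compose2[OF Suc.prems(1) continuous_case_nat(2)]) simp
    have "dep n (\<lambda>y. h (case_nat x y))" unfolding dep_def
    proof (intro allI impI)
      fix t t' :: "nat \<Rightarrow> 'a" assume "\<forall>i<n. t i = t' i"
      then show "h (case_nat x t) = h (case_nat x t')" by (intro depD[OF Suc.prems(2)]) (auto split: nat.split)
    qed
    then show ?case by (rule Suc.IH[OF c _ elim])
  qed
  have c: "continuous_on UNIV (\<lambda>x. h (case_nat x y))" for y
    by (rule continuous_on_compose2[OF Suc.prems(1) continuous_case_nat(1)]) simp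
  have "h (case_nat (t 0) (t \<circ> Suc)) = 0" by (rule continuous_AE_zero[OF c ae])
  moreover have "case_nat (t 0) (t \<circ> Suc) = t" by (auto simp: fun_eq_iff split: nat.split)
  ultimately show ?case by simp
qed

text \<open>On the stratum without repetitions, \<open>replicate n 0\<close>, the measure is the
  power of \<open>\<sigma>\<close> and the restriction of \<open>G\<close> is \<open>G\<close>
  itself.\<close>

lemma U_eq_0:
  assumes G: "C0 n G" and z: "gl2_inner \<F> (U n G) (U n G) = 0" shows "G = (\<lambda>_. 0)"
proof
  fix v
  let ?r = "replicate n 0"
  have r: "?r \<in> Sn n" by (simp add: Sn_def)
  let ?g = "\<lambda>t. G (\<lambda>i. t (blk ?r i))"
  have "(\<Sum>ls\<in>Sn n. \<integral>t. (G (\<lambda>i. t (blk ls i)))\<^sup>2 \<partial>SP ls) = 0"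
    using U_norm_eq[OF C0_imp_B0[OF G]] z by simp
  then have "(\<integral>t. (?g t)\<^sup>2 \<partial>SP ?r) = 0"
    using r by (subst (asm) sum_nonneg_eq_0_iff) (auto intro!: integral_nonneg_AE)
  moreover have "integrable (SP ?r) (\<lambda>t. (?g t)\<^sup>2)"
    using B0_integrable_SP[OF B0_prod[OF B0_blk[OF C0_imp_B0[OF G] r] B0_blk[OF C0_imp_B0[OF G] r]]]
    by (simp add: power2_eq_square)
  ultimately have "AE t in SP ?r. (?g t)\<^sup>2 = 0"
    using integral_nonneg_eq_0_iff_AE[of "SP ?r" "\<lambda>t. (?g t)\<^sup>2"] by simp
  moreover have "?g t = G t" for t by (rule depD[OF C0D(2)[OF G]]) (simp add: blk_replicate)
  ultimately have "AE t in PiM {..<n} (\<lambda>_. \<sigma>). G t = 0" unfolding SP_replicate by simp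
  then show "G v = 0" by (rule continuous_AE_zero_PiM[OF C0D(1,2)[OF G]])
qed

section \<open>Leading kernels of continuous polynomials\<close>

lemma mono_sum_lsum:
  assumes "\<forall>k\<le>n. C0 k (f k)"
  shows "\<exists>L. wf_terms 0 L \<and> (\<forall>t\<in>set L. deg (snd t) \<le> n) \<and> gl2_eq \<F> (\<lambda>m y. \<Sum>k\<le>n. mono_vac k (f k) m y) (lsum L)"
  by (rule sum_lsum[OF mono_lsum le_refl]) (use assms in auto)

lemma CPv_top:
  assumes "\<forall>k\<le>Suc N. C0 k (f k)" "gl2_eq \<F> v (\<lambda>m y. \<Sum>k\<le>Suc N. mono_vac k (f k) m y)"
  shows "\<exists>L. wf_terms 0 L \<and> (\<forall>t\<in>set L. deg (snd t) \<le> N) \<and> gl2_eq \<F> v (\<lambda>m y. U (Suc N) (f (Suc N)) m y + lsum L m y)"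
proof -
  let ?U = "U (Suc N) (f (Suc N))"
  obtain L1 where L1: "wf_terms 0 L1" "\<forall>t\<in>set L1. deg (snd t) \<le> N" "gl2_eq \<F> (\<lambda>m y. \<Sum>k\<le>N. mono_vac k (f k) m y) (lsum L1)"
    using mono_sum_lsum[of N f] assms(1) by auto
  obtain L2 where L2: "wf_terms 0 L2" "\<forall>t\<in>set L2. deg (snd t) < Suc N" "gl2_eq \<F> (mono_vac (Suc N) (f (Suc N))) (\<lambda>m y. ?U m y + lsum L2 m y)"
    using mono_expand[of "Suc N" "f (Suc N)"] assms(1) by auto
  have "gl2_eq \<F> (\<lambda>m y. (\<Sum>k\<le>N. mono_vac k (f k) m y) + mono_vac (Suc N) (f (Suc N)) m y) (\<lambda>m y. lsum L1 m y + (?U m y + lsum L2 m y))"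
    by (rule gl2_eq_add[OF L1(3) L2(3)])
  then have "gl2_eq \<F> v (\<lambda>m y. ?U m y + lsum (L1 @ L2) m y)"
    using gl2_eq_trans[OF assms(2)] by (simp add: lsum_append add_ac)
  then show ?thesis using L1 L2 by (intro exI[of _ "L1 @ L2"]) (auto simp: wf_terms_def)
qed

text \<open>A polynomial may be written with an order larger than the degree of its vector. Its
  leading part is then orthogonal both to the vector and to the remainder, so it has norm zero and
  the leading kernel vanishes; this lowers the order by one.\<close>

lemma CPv_lower:
  assumes "u \<in> CPv M" and L: "gl2_eq \<F> u (lsum L)" "wf_terms 0 L" "\<forall>t\<in>set L. deg (snd t) \<le> N"
  shows "u \<in> CPv N"
  using assms(1)
proof (induction M)
  case 0
  then show ?case by (rule CPv_mono) simp
next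
  case (Suc M)
  show ?case
  proof (cases "Suc M \<le> N")
    case True
    then show ?thesis by (rule CPv_mono[OF Suc.prems])
  next
    case False
    obtain f where f: "\<forall>k\<le>Suc M. C0 k (f k)" "gl2_eq \<F> u (\<lambda>m y. \<Sum>k\<le>Suc M. mono_vac k (f k) m y)"
      using Suc.prems unfolding CPv_def by blast
    have fM: "C0 (Suc M) (f (Suc M))" using f by simp
    let ?U = "U (Suc M) (f (Suc M))"
    note gU = U_gl2[OF C0_imp_B0[OF fM]]
    obtain L1 where L1: "wf_terms 0 L1" "\<forall>t\<in>set L1. deg (snd t) \<le> M" "gl2_eq \<F> u (\<lambda>m y. ?U m y + lsum L1 m y)"
      using CPv_top[OF f] by blast
    have g1: "lsum L1 \<in> gl2 \<F>" and gL: "lsum L \<in> gl2 \<F>" using L1(1) L(2) by (auto intro: lsum_gl2)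
    have e: "gl2_eq \<F> (lsum L) (\<lambda>m y. ?U m y + lsum L1 m y)"
      by (rule gl2_eq_trans[OF gl2_eq_sym[OF L(1)] L1(3)])
    have o: "gl2_inner \<F> (lsum L') ?U = 0" if "wf_terms 0 L'" "\<forall>t\<in>set L'. deg (snd t) < Suc M" for L'
      unfolding lsum_UL[symmetric]
      by (rule lsum_inner_zero[OF that(1) U_wf[OF C0_imp_B0[OF fM]]]) (use that(2) UL_deg in fastforce)
    have "gl2_inner \<F> (lsum L) ?U = gl2_inner \<F> (\<lambda>m y. ?U m y + lsum L1 m y) ?U"
      by (rule gl2_inner_cong[OF e gl2_eq_refl]) (use gl2D(1)[OF gL] gl2D(1)[OF gl2_add[OF gU g1]] gl2D(1)[OF gU] in auto)
    also have "\<dots> = gl2_inner \<F> ?U ?U + gl2_inner \<F> (lsum L1) ?U" by (rule gl2_inner_add[OF gU g1 gU])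
    also have "gl2_inner \<F> (lsum L1) ?U = 0"
      by (rule o) (use L1 in auto)
    finally have "gl2_inner \<F> ?U ?U = 0" using o[OF L(2)] L(3) False by fastforce
    then have z: "f (Suc M) = (\<lambda>_. 0)" by (rule U_eq_0[OF fM])
    have "u \<in> CPv M"
      unfolding CPv_def using f CPv_gl2[OF Suc.prems]
      by (intro CollectI conjI exI[of _ f]) (auto simp: z monomial_zero)
    then show ?thesis by (rule Suc.IH)
  qed
qed

text \<open>The leading part is split off as \<open>U\<close> of a continuous kernel. By the first
  hypothesis the remainder is a continuous polynomial of some order; its degree is at most
  \<open>N\<close>, so \<open>CPv_lower\<close> brings the order down to \<open>N\<close> and the
  induction applies.\<close>

lemma CPv_TU:
  assumes i: "\<And>n f. C0 n f \<Longrightarrow> \<exists>M. U n f \<in> CPv M" and v: "v \<in> CPv N"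
  shows "\<exists>Fs. C0s 0 Fs \<and> gl2_eq \<F> v (lsum (TU 0 Fs))"
  using v
proof (induction N arbitrary: v)
  case 0
  then obtain f where f: "C0 0 f" "gl2_eq \<F> v (mono_vac 0 f)" by (auto simp: CPv_def)
  obtain L where L: "\<forall>t\<in>set L. deg (snd t) < 0" "gl2_eq \<F> (mono_vac 0 f) (\<lambda>m y. U 0 f m y + lsum L m y)"
    using mono_expand[OF f(1)] by blast
  then have "L = []" by (cases L) auto
  then have "gl2_eq \<F> v (lsum (TU 0 [(f, 0)]))"
    using gl2_eq_trans[OF f(2) L(2)] by (simp add: lsum_Nil TU_def lsum_UL)
  moreover have "C0s 0 [(f, 0)]" using f by (simp add: C0s_def)
  ultimately show ?case by blast
next
  case (Suc N)
  obtain f where f: "\<forall>k\<le>Suc N. C0 k (f k)" "gl2_eq \<F> v (\<lambda>m y. \<Sum>k\<le>Suc N. mono_vac k (f k) m y)"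
    using Suc.prems unfolding CPv_def by blast
  have fN: "C0 (Suc N) (f (Suc N))" using f by simp
  let ?U = "U (Suc N) (f (Suc N))"
  obtain L1 where L1: "wf_terms 0 L1" "\<forall>t\<in>set L1. deg (snd t) \<le> N" "gl2_eq \<F> v (\<lambda>m y. ?U m y + lsum L1 m y)"
    using CPv_top[OF f] by blast
  from gl2_eq_diff[OF L1(3) gl2_eq_refl[of _ ?U]]
  have e: "gl2_eq \<F> (\<lambda>m y. v m y - ?U m y) (lsum L1)" by simp
  obtain M where M: "?U \<in> CPv M" using i[OF fN] by blast
  have "(\<lambda>m y. v m y - ?U m y) \<in> CPv (max (Suc N) M)"
    by (rule CPv_diff[OF CPv_mono[OF Suc.prems] CPv_mono[OF M]]) auto
  then have "(\<lambda>m y. v m y - ?U m y) \<in> CPv N"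
    by (rule CPv_lower[OF _ e L1(1,2)])
  then obtain Fs where Fs: "C0s 0 Fs" "gl2_eq \<F> (\<lambda>m y. v m y - ?U m y) (lsum (TU 0 Fs))" using Suc.IH by blast
  from gl2_eq_add[OF gl2_eq_refl[of _ ?U] Fs(2)]
  have "gl2_eq \<F> v (lsum (TU 0 ((f (Suc N), Suc N) # Fs)))"
    by (simp add: TU_Cons lsum_append[abs_def] lsum_UL)
  moreover have "C0s 0 ((f (Suc N), Suc N) # Fs)" using Fs fN by (simp add: C0s_def)
  ultimately show ?case by blast
qed

lemma finite_testI:
  assumes "\<And>n. C0 n (\<psi> n)" "\<And>n. N < n \<Longrightarrow> \<psi> n = (\<lambda>_. 0)"
  shows "\<psi> \<in> finite_test" "fin_B0 N \<psi>" "ext_test \<psi> = \<psi>"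
proof -
  show "\<psi> \<in> finite_test" unfolding finite_test_def
  proof (intro CollectI conjI allI exI[of _ N] impI ballI)
    show "\<psi> n \<in> test n" for n by (rule C0_imp_test[OF assms(1)])
    show "\<psi> n t = 0" if "n > N" for n t using assms(2)[OF that] by simp
  qed
  show "fin_B0 N \<psi>" using assms C0_imp_B0 by (auto simp: fin_B0_def)
  show "ext_test \<psi> = \<psi>" by (simp add: ext_test_def fun_eq_iff ext_seq_dep[OF C0D(2)[OF assms(1)]])
qed

lemma TU_Usum:
  assumes "C0s 0 Fs"
  shows "\<exists>\<psi> N. (\<forall>n. C0 n (\<psi> n)) \<and> fin_B0 N \<psi> \<and> lsum (TU 0 Fs) = Usum N \<psi>"
  using assms
proof (induction Fs)
  case Nil
  have "fin_B0 0 (\<lambda>_ _. 0)" by (simp add: fin_B0_def B0_zero)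
  moreover have "lsum (TU 0 []) = Usum 0 (\<lambda>_ _. 0)" by (simp add: Usum_def[abs_def] U_zero lsum_Nil TU_def)
  ultimately show ?case using C0_zero by (intro exI[of _ "\<lambda>_ _. 0"] exI[of _ 0]) auto
next
  case (Cons t Fs)
  then obtain \<psi> N where p: "\<forall>n. C0 n (\<psi> n)" "fin_B0 N \<psi>" "lsum (TU 0 Fs) = Usum N \<psi>" by (auto simp: C0s_def)
  have t: "C0 (snd t) (fst t)" using Cons.prems by (simp add: C0s_def)
  note s = Usum_add_single[OF p(2) C0_imp_B0[OF t]]
  have "C0 n (\<lambda>v. (if n = snd t then fst t else (\<lambda>_. 0)) v + \<psi> n v)" for n
    using p(1) t by (intro C0_add) (auto simp: C0_zero)
  moreover have "lsum (TU 0 (t # Fs)) = Usum (max N (snd t)) (\<lambda>n v. (if n = snd t then fst t else (\<lambda>_. 0)) v + \<psi> n v)"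
    unfolding s(2) by (simp add: TU_Cons lsum_append lsum_UL p(3) fun_eq_iff)
  ultimately show ?case using s(1) by (intro exI conjI allI)
qed

section \<open>\<open>X(f)\<close> on continuous polynomials\<close>

lemma gstep_lift: "gstep (Suc k) (lift_ker f H) = lift_ker f (gstep k H)"
  by (auto simp: gstep_def lift_ker_def op_C_def op_A_def op_N_def upd_shift fun_eq_iff algebra_simps split: nat.split)

lemma CAN_power_lift: "CAN_power \<sigma> \<mu> (Suc k) (lift_ker f H) = gstep 0 (lift_ker f (CAN_power \<sigma> \<mu> k H))"
proof (induction k arbitrary: H)
  case (Suc k)
  show ?case by (simp only: CAN_power_Suc[of "Suc k"] gstep_lift Suc.IH) (simp only: CAN_power_Suc)
qed (simp add: gstep_def)

text \<open>Every slot of \<open>z\<close> on which \<open>H\<close> depends is overwritten in the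
  course of the \<open>k\<close> steps.\<close>

lemma CAN_power_indep:
  assumes "\<And>m z z' y. (\<And>i. i < k \<Longrightarrow> z i = z' i) \<Longrightarrow> H m z y = H m z' y"
  shows "CAN_power \<sigma> \<mu> k H m z y = CAN_power \<sigma> \<mu> k H m z' y"
  using assms
proof (induction k arbitrary: H)
  case (Suc k)
  have H: "H m (z(k := x)) y = H m (z'(k := x)) y" if "\<And>i. i < k \<Longrightarrow> z i = z' i" for m z z' x y
    by (rule Suc.prems) (use that in auto)
  show ?case unfolding CAN_power_Suc
  proof (rule Suc.IH)
    fix m z z' y assume e: "\<And>i. i < k \<Longrightarrow> z i = (z' i :: 'a \<times> real)"
    show "gstep k H m z y = gstep k H m z' y"
      by (simp add: gstep_def op_C_def op_A_def op_N_def H[OF e] split: nat.split)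
  qed
qed simp

lemma X_op_monomial: "\<X> f (mono_vac k g) = mono_vac (Suc k) (\<lambda>t. f (t 0) * g (t \<circ> Suc))"
proof (intro ext)
  fix m y
  let ?H = "\<lambda>j z y. g (\<lambda>i\<in>{..<k}. fst (z i)) * vacuum j (y :: nat \<Rightarrow> 'a \<times> real)"
  have H: "(\<lambda>j z y. f ((\<lambda>i\<in>{..<Suc k}. fst (z i)) 0) * g ((\<lambda>i\<in>{..<Suc k}. fst (z i)) \<circ> Suc) * vacuum j y) = lift_ker f ?H"
  proof -
    have "(\<lambda>i\<in>{..<Suc k}. fst (z i)) \<circ> Suc = (\<lambda>i\<in>{..<k}. fst ((z \<circ> Suc) i))" for z :: "nat \<Rightarrow> 'a \<times> real"
      by (auto simp: fun_eq_iff)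
    then show ?thesis by (simp add: lift_ker_def mult.assoc)
  qed
  have i: "CAN_power \<sigma> \<mu> k ?H m z y = CAN_power \<sigma> \<mu> k ?H m undefined y" for m y and z :: "nat \<Rightarrow> 'a \<times> real"
  proof (rule CAN_power_indep)
    fix m y and z z' :: "nat \<Rightarrow> 'a \<times> real" assume "\<And>i. i < k \<Longrightarrow> z i = z' i"
    then have "(\<lambda>i\<in>{..<k}. fst (z i)) = (\<lambda>i\<in>{..<k}. fst (z' i))" by (auto simp: fun_eq_iff)
    then show "?H m z y = ?H m z' y" by simp
  qed
  have "lift_ker f (CAN_power \<sigma> \<mu> k ?H) = (\<lambda>m z y. f (fst (z 0)) * mono_vac k g m y)"
  proof (intro ext)
    fix m z y
    show "lift_ker f (CAN_power \<sigma> \<mu> k ?H) m z y = f (fst (z 0)) * mono_vac k g m y"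
      unfolding lift_ker_def monomial_def by (simp only: i[of m "z \<circ> Suc" y])
  qed
  then have "\<X> f (mono_vac k g) m y = gstep 0 (lift_ker f (CAN_power \<sigma> \<mu> k ?H)) m undefined y"
    using X_op_gstep by simp
  also have "\<dots> = mono_vac (Suc k) (\<lambda>t. f (t 0) * g (t \<circ> Suc)) m y"
    unfolding CAN_power_lift[symmetric] H[symmetric] monomial_def ..
  finally show "\<X> f (mono_vac k g) m y = mono_vac (Suc k) (\<lambda>t. f (t 0) * g (t \<circ> Suc)) m y" .
qed

text \<open>Vectors on which \<open>X_op\<close> is additive almost everywhere: their expansion
  provides the integrability that additivity of the annihilation integral needs.\<close>

definition flat :: "'a fock_vec \<Rightarrow> bool"
  where "flat v \<longleftrightarrow> v \<in> gl2 \<F> \<and> (\<exists>L. wf_terms 0 L \<and> gl2_eq \<F> v (lsum L))"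

lemma X_op_add:
  assumes f: "f \<in> test1" and u: "flat u" and v: "flat v"
  shows "flat (\<lambda>m y. u m y + v m y)"
    "gl2_eq \<F> (\<X> f (\<lambda>m y. u m y + v m y)) (\<lambda>m y. \<X> f u m y + \<X> f v m y)"
proof -
  obtain L where L: "wf_terms 0 L" "gl2_eq \<F> u (lsum L)" using u by (auto simp: flat_def)
  obtain K where K: "wf_terms 0 K" "gl2_eq \<F> v (lsum K)" using v by (auto simp: flat_def)
  have g: "u \<in> gl2 \<F>" "v \<in> gl2 \<F>" using u v by (auto simp: flat_def)
  have LK: "wf_terms 0 (L @ K)" using L(1) K(1) by (auto simp: wf_terms_def)
  have e: "gl2_eq \<F> (\<lambda>m y. u m y + v m y) (lsum (L @ K))"
    using gl2_eq_add[OF L(2) K(2)] by (simp add: lsum_append[abs_def])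
  then show "flat (\<lambda>m y. u m y + v m y)" using LK gl2_add[OF g] unfolding flat_def by blast
  note X = jac_rec.X_op_lsum(2)[OF own_rec f]
  have c: "gl2_eq \<F> (\<X> f u') (\<X> f (lsum L'))" if "u' \<in> gl2 \<F>" "wf_terms 0 L'" "gl2_eq \<F> u' (lsum L')" for u' L'
    by (rule X_op_cong[OF that(3)]) (use gl2D(1)[OF that(1)] gl2D(1)[OF lsum_gl2[OF that(2)]] test1_measurable[OF f] in auto)
  have a: "gl2_eq \<F> (\<lambda>m y. \<X> f (lsum L) m y + \<X> f (lsum K) m y) (\<X> f (lsum (L @ K)))"
    using gl2_eq_trans[OF gl2_eq_add[OF X[OF L(1)] X[OF K(1)]]] gl2_eq_sym[OF X[OF LK]]
    by (simp add: lsum_append[abs_def])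
  show "gl2_eq \<F> (\<X> f (\<lambda>m y. u m y + v m y)) (\<lambda>m y. \<X> f u m y + \<X> f v m y)"
    by (rule gl2_eq_trans[OF gl2_eq_trans[OF c[OF gl2_add[OF g] LK e] gl2_eq_sym[OF a]]
          gl2_eq_sym[OF gl2_eq_add[OF c[OF g(1) L] c[OF g(2) K]]]])
qed

lemma X_op_sum:
  fixes n :: nat
  assumes f: "f \<in> test1" and u: "\<And>k. k \<le> n \<Longrightarrow> flat (u k)"
  shows "flat (\<lambda>m y. \<Sum>k\<le>n. u k m y) \<and>
    gl2_eq \<F> (\<X> f (\<lambda>m y. \<Sum>k\<le>n. u k m y)) (\<lambda>m y. \<Sum>k\<le>n. \<X> f (u k) m y)"
  using u
proof (induction n)
  case 0
  then show ?case using gl2_eq_refl by simp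
next
  case (Suc n)
  have IH: "flat (\<lambda>m y. \<Sum>k\<le>n. u k m y)"
    "gl2_eq \<F> (\<X> f (\<lambda>m y. \<Sum>k\<le>n. u k m y)) (\<lambda>m y. \<Sum>k\<le>n. \<X> f (u k) m y)"
    using Suc.IH[OF Suc.prems] by auto
  note a = X_op_add[OF f IH(1) Suc.prems[OF le_refl]]
  have "gl2_eq \<F> (\<X> f (\<lambda>m y. (\<Sum>k\<le>n. u k m y) + u (Suc n) m y))
      (\<lambda>m y. (\<Sum>k\<le>n. \<X> f (u k) m y) + \<X> f (u (Suc n)) m y)"
    by (rule gl2_eq_trans[OF a(2) gl2_eq_add[OF IH(2) gl2_eq_refl]])
  with a(1) show ?case by simp
qed

lemma X_op_CPv:
  assumes f: "f \<in> test1" and v: "v \<in> CPv N"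
  shows "\<exists>u\<in>CPv (Suc N). gl2_eq \<F> (\<X> f v) u"
proof -
  obtain g where g: "\<forall>k\<le>N. C0 k (g k)" "gl2_eq \<F> v (\<lambda>m y. \<Sum>k\<le>N. mono_vac k (g k) m y)" using v by (auto simp: CPv_def)
  have fl: "flat (mono_vac k (g k))" if "k \<le> N" for k
    using mono_lsum[of k "g k" k] mono_gl2[of k "g k"] g(1) that unfolding flat_def by blast
  note s = X_op_sum[of f N "\<lambda>k. mono_vac k (g k)", OF f fl]
  have "gl2_eq \<F> (\<X> f v) (\<X> f (\<lambda>m y. \<Sum>k\<le>N. mono_vac k (g k) m y))"
    by (rule X_op_cong[OF g(2)]) (use s gl2D(1)[OF CPv_gl2[OF v]] test1_measurable[OF f] gl2D(1) in \<open>auto simp: flat_def\<close>)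
  then have "gl2_eq \<F> (\<X> f v) (\<lambda>m y. \<Sum>k\<le>N. mono_vac (Suc k) (\<lambda>t. f (t 0) * g k (t \<circ> Suc)) m y)"
    by (rule gl2_eq_trans) (use s in \<open>simp add: X_op_monomial\<close>)
  moreover have "(\<lambda>m y. \<Sum>k\<le>N. mono_vac (Suc k) (\<lambda>t. f (t 0) * g k (t \<circ> Suc)) m y) \<in> CPv (Suc N)"
    by (rule CPv_sum, rule CPv_monomial) (use C0_lift[OF f] g(1) in auto)
  ultimately show ?thesis by blast
qed

lemma X_ext_finite_test:
  assumes i: "\<And>n f. C0 n f \<Longrightarrow> \<exists>M. U n f \<in> CPv M" and f: "f \<in> test1" and p: "\<phi> \<in> finite_test"
  shows "\<exists>\<psi>\<in>finite_test. gl2_eq ext (X_ext \<sigma> \<mu> f \<phi>) \<psi>"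
proof -
  obtain N where N: "fin_B0 N (ext_test \<phi>)" using finite_test_ext(1)[OF p] by blast
  obtain M where M: "\<And>n. U n (ext_test \<phi> n) \<in> CPv (M n)" using i[OF finite_test_ext(2)[OF p]] by metis
  let ?M = "Max (M ` {..N})"
  have "U n (ext_test \<phi> n) \<in> CPv ?M" if "n \<le> N" for n
    by (rule CPv_mono[OF M]) (use that in auto)
  then have "Usum N (ext_test \<phi>) \<in> CPv ?M"
    unfolding Usum_def[abs_def] by (intro CPv_sum) auto
  then obtain u where u: "u \<in> CPv (Suc ?M)" "gl2_eq \<F> (\<X> f (Usum N (ext_test \<phi>))) u"
    using X_op_CPv[OF f] by blast
  obtain Fs where Fs: "C0s 0 Fs" "gl2_eq \<F> u (lsum (TU 0 Fs))" using CPv_TU[OF i u(1)] by blast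
  obtain \<psi> K where q: "\<forall>n. C0 n (\<psi> n)" "fin_B0 K \<psi>" "lsum (TU 0 Fs) = Usum K \<psi>" using TU_Usum[OF Fs(1)] by blast
  have t: "\<psi> \<in> finite_test" "ext_test \<psi> = \<psi>"
    using finite_testI[of \<psi> K] q(1,2) by (auto simp: fin_B0_def)
  have "gl2_eq \<F> (\<X> f (Usum N (ext_test \<phi>))) (Usum K (ext_test \<psi>))"
    using gl2_eq_trans[OF u(2) Fs(2)] by (simp add: q(3) t(2))
  then have "gl2_eq ext (X_ext \<sigma> \<mu> f \<phi>) \<psi>"
    using X_ext_iff[OF f p N t(1)] q(2) t(2) by simp
  with t(1) show ?thesis by blast
qed

end

section \<open>The Jacobi coefficients of an invariant process\<close>

context jac_process
begin

lemma sum_vec_inner: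
  assumes A: "finite A" and h: "\<And>ls. ls \<in> A \<Longrightarrow> B0 (length ls) (h ls)" and g: "B0 (length r) g"
  shows "gl2_inner \<F> (\<lambda>m y. \<Sum>ls\<in>A. vec (h ls) ls m y) (vec g r) = (if r \<in> A then \<integral>t. h r t * g t \<partial>SP r else 0)"
proof -
  have "gl2_inner \<F> (\<lambda>m y. \<Sum>ls\<in>A. vec (h ls) ls m y) (vec g r) = (\<Sum>ls\<in>A. gl2_inner \<F> (vec (h ls) ls) (vec g r))"
    by (rule gl2_inner_sum) (auto intro: vec_gl2 h g)
  also have "\<dots> = (\<Sum>ls\<in>A. if ls = r then \<integral>t. h r t * g t \<partial>SP r else 0)"
    by (rule sum.cong) (auto simp: vec_inner[OF h g])
  also have "\<dots> = (if r \<in> A then \<integral>t. h r t * g t \<partial>SP r else 0)" using A by simp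
  finally show ?thesis .
qed

lemma U_vec_inner:
  assumes F: "B0 k F" and g: "B0 (length r) g"
  shows "gl2_inner \<F> (U k F) (vec g r) = (if deg r = k then \<integral>t. F (\<lambda>i. t (blk r i)) * g t \<partial>SP r else 0)"
proof -
  have "r \<in> Sn k \<longleftrightarrow> deg r = k" by (simp add: Sn_def)
  then show ?thesis unfolding U_def[abs_def] using sum_vec_inner[OF finite_Sn B0_blk[OF F] g] by simp
qed

lemma Usum_vec_inner:
  assumes F: "fin_B0 N \<psi>" and g: "B0 (length r) g"
  shows "gl2_inner \<F> (Usum N \<psi>) (vec g r) = (\<integral>t. \<psi> (deg r) (\<lambda>i. t (blk r i)) * g t \<partial>SP r)"
proof -
  have B: "B0 k (\<psi> k)" for k using F by (simp add: fin_B0_def)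
  have "gl2_inner \<F> (Usum N \<psi>) (vec g r) = (\<Sum>k\<le>N. gl2_inner \<F> (U k (\<psi> k)) (vec g r))"
    unfolding Usum_def[abs_def] by (rule gl2_inner_sum) (auto intro: vec_gl2 g U_gl2 B)
  also have "\<dots> = (\<Sum>k\<le>N. if deg r = k then \<integral>t. \<psi> (deg r) (\<lambda>i. t (blk r i)) * g t \<partial>SP r else 0)"
    by (rule sum.cong) (auto simp: U_vec_inner[OF B g])
  also have "\<dots> = (\<integral>t. \<psi> (deg r) (\<lambda>i. t (blk r i)) * g t \<partial>SP r)"
    using F by (cases "deg r \<le> N") (auto simp: fin_B0_def)
  finally show ?thesis .
qed

text \<open>The difference \<open>h - h'\<close> is itself an admissible test function.\<close>

lemma AE_eq_of_integrals:
  assumes h: "B0 (length r) h" and h': "B0 (length r) h'"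
    and e: "\<And>g. B0 (length r) g \<Longrightarrow> (\<integral>t. h t * g t \<partial>SP r) = (\<integral>t. h' t * g t \<partial>SP r)"
  shows "AE t in SP r. h t = h' t"
proof -
  let ?d = "\<lambda>t. h t - h' t"
  have d: "B0 (length r) ?d" by (rule B0_diff[OF h h'])
  note i = B0_integrable_SP[OF B0_prod[OF d h]] B0_integrable_SP[OF B0_prod[OF d h']]
  have "(\<integral>t. (?d t)\<^sup>2 \<partial>SP r) = (\<integral>t. h t * ?d t - h' t * ?d t \<partial>SP r)"
    by (simp add: power2_eq_square left_diff_distrib)
  also have "\<dots> = 0" using i e[OF d] by simp
  finally have "(\<integral>t. (?d t)\<^sup>2 \<partial>SP r) = 0" .
  moreover have "integrable (SP r) (\<lambda>t. (?d t)\<^sup>2)"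
    using B0_integrable_SP[OF B0_prod[OF d d]] by (simp add: power2_eq_square)
  ultimately have "AE t in SP r. (?d t)\<^sup>2 = 0"
    using integral_nonneg_eq_0_iff_AE[of "SP r" "\<lambda>t. (?d t)\<^sup>2"] by simp
  then show ?thesis by eventually_elim simp
qed

text \<open>Products with different indices \<open>ls\<close> are orthogonal, so the coefficients of the two expansions of
  \<open>X(f) g\<close> agree on each stratum separately.\<close>
lemma X_op_coefficients:
  assumes f: "f \<in> test1" and g: "B0 n g" and p: "fin_B0 N \<psi>"
    and eq: "gl2_eq \<F> (\<X> f (U n g)) (Usum N \<psi>)"
  shows "deg (l # r) = n \<Longrightarrow> AE v in SP (l # r).
      jb l (v 0) * (f (v 0) * g (\<lambda>i. v (blk (l # r) i))) = \<psi> n (\<lambda>i. v (blk (l # r) i))"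
    and "Suc (deg (l # r)) = n \<Longrightarrow> AE v in SP (l # r).
      int_out 0 (\<lambda>v. f (v 0) * g (v \<circ> Suc)) (\<lambda>i. v (blk (l # r) i))
      + ja (Suc l) (v 0) * (f (v 0) * g (dmap 0 (\<lambda>i. v (blk (l # r) i)))) = \<psi> (deg (l # r)) (\<lambda>i. v (blk (l # r) i))"
proof -
  let ?F = "\<lambda>v. f (v 0) * g (v \<circ> Suc)"
  have F: "B0 (Suc n) ?F" by (rule B0_shift[OF f g])
  have d1: "?F (dmap 0 v) = f (v 0) * g v" for v :: "nat \<Rightarrow> 'a" by (simp add: dmap_def o_def)
  have d2: "?F (dmap 0 (dmap 0 v)) = f (v 0) * g (dmap 0 v)" for v :: "nat \<Rightarrow> 'a"
    using d1[of "dmap 0 v"] by (simp add: dmap_def)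
  define hb where "hb ls = (\<lambda>v. jb (hd ls) (v 0) * ?F (dmap 0 (\<lambda>i. v (blk ls i))))" for ls
  define ha where "ha ls = (\<lambda>v. ja (Suc (hd ls)) (v 0) * ?F (dmap 0 (dmap 0 (\<lambda>i. v (blk ls i)))))" for ls
  \<comment> \<open>The neutral part in degree \<open>n\<close>, then the integral and the
    \<open>ja\<close> part in degree \<open>n - 1\<close>; together with the leading part in degree
    \<open>n + 1\<close> they make up \<open>X(f)\<close> on \<open>U n g\<close>.\<close>
  define S1 where "S1 = (\<lambda>m y. \<Sum>ls\<in>Sn n - {[]}. vec (hb ls) ls m y)"
  define S2 where "S2 = (if n = 0 then (\<lambda>m y. 0) else U (n - 1) (int_out 0 ?F))"
  define S3 where "S3 = (if n = 0 then (\<lambda>m y. 0) else (\<lambda>m y. \<Sum>ls\<in>Sn (n - 1) - {[]}. vec (ha ls) ls m y))"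
  have hb: "B0 (length ls) (hb ls)" if "ls \<in> Sn n - {[]}" for ls
  proof -
    from that have l: "length ls > 0" "n > 0" by (cases ls; auto simp: Sn_def)+
    have "B0 n (\<lambda>v. ?F (dmap 0 v))" by (rule B0_dmap[OF F]) (use l in simp)
    from B0_blk[OF this, of ls] that have "B0 (length ls) (\<lambda>v. ?F (dmap 0 (\<lambda>i. v (blk ls i))))" by simp
    then show ?thesis unfolding hb_def by (rule jac_rec.B0_coeff(1)[OF own_rec _ l(1)])
  qed
  have io: "B0 (n - 1) (int_out 0 ?F)" if "n \<noteq> 0"
    by (rule int_out_B0) (use F that in auto)
  have ha: "B0 (length ls) (ha ls)" if "ls \<in> Sn (n - 1) - {[]}" for ls
  proof -
    from that have l: "length ls > 0" "n - 1 > 0" by (cases ls; auto simp: Sn_def)+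
    have "B0 n (\<lambda>v. ?F (dmap 0 v))" by (rule B0_dmap[OF F]) (use l in simp)
    then have "B0 (Suc (n - 1)) (\<lambda>v. ?F (dmap 0 v))" using l by simp
    then have "B0 (n - 1) (\<lambda>v. ?F (dmap 0 (dmap 0 v)))" by (rule B0_dmap) (use l in simp)
    from B0_blk[OF this, of ls] that have "B0 (length ls) (\<lambda>v. ?F (dmap 0 (dmap 0 (\<lambda>i. v (blk ls i)))))" by simp
    then show ?thesis unfolding ha_def by (rule jac_rec.B0_coeff(2)[OF own_rec _ l(1)])
  qed
  \<comment> \<open>Rewrites the case distinction as a sum over nonempty lists, with
    \<open>hd\<close> as first index, to match the sums of \<open>vec\<close> above.\<close>
  have sum_hd: "(\<Sum>ls\<in>Sn k. case ls of [] \<Rightarrow> 0 | l # r \<Rightarrow> \<phi> l ls) = (\<Sum>ls\<in>Sn k - {[]}. \<phi> (hd ls) ls)"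
    for k and \<phi> :: "nat \<Rightarrow> nat list \<Rightarrow> real"
    by (rule sum.mono_neutral_cong_right) (auto split: list.split)
  let ?R = "\<lambda>m y. U (Suc n) ?F m y + (S1 m y + (S2 m y + S3 m y))"
  have "lsum (concat (map (jac_rec.tstep \<sigma> ja jb 0) (UL (Suc 0) n ?F))) m y = ?R m y" for m y
    unfolding tsum_0[symmetric, of _ m y undefined] jac_rec.tstep_tsum_UL[OF own_rec] sum_hd
    by (cases n) (simp_all add: tsum_UL trm_0 spr_0_eq U_def S1_def S2_def S3_def hb_def ha_def)
  then have Re: "lsum (concat (map (jac_rec.tstep \<sigma> ja jb 0) (UL (Suc 0) n ?F))) = ?R" by (intro ext)
  have X: "gl2_eq \<F> (\<X> f (U n g)) ?R"
    using jac_rec.X_op_U[OF own_rec f g] unfolding Re .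
  have gS: "S1 \<in> gl2 \<F>" "S2 \<in> gl2 \<F>" "S3 \<in> gl2 \<F>" "U (Suc n) ?F \<in> gl2 \<F>"
    unfolding S1_def S2_def S3_def by (auto intro!: gl2_sum vec_gl2 hb ha U_gl2 io[unfolded One_nat_def neq0_conv] gl2_zero F)
  have gR: "?R \<in> gl2 \<F>" by (intro gl2_add gS)
  note gp = Usum_gl2[OF p]
  have RU: "gl2_eq \<F> ?R (Usum N \<psi>)" by (rule gl2_eq_trans[OF gl2_eq_sym[OF X] eq])
  have inner: "gl2_inner \<F> (U (Suc n) ?F) (vec k r) + (gl2_inner \<F> S1 (vec k r) + (gl2_inner \<F> S2 (vec k r) + gl2_inner \<F> S3 (vec k r)))
      = (\<integral>t. \<psi> (deg r) (\<lambda>i. t (blk r i)) * k t \<partial>SP r)" if k: "B0 (length r) k" for k r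
  proof -
    note v = vec_gl2[OF k]
    have "gl2_inner \<F> ?R (vec k r) = gl2_inner \<F> (Usum N \<psi>) (vec k r)"
      by (rule gl2_inner_cong[OF RU gl2_eq_refl]) (use gl2D(1)[OF gR] gl2D(1)[OF gp] gl2D(1)[OF v] in auto)
    then show ?thesis
      using gl2_inner_add[OF gS(4) gl2_add[OF gS(1) gl2_add[OF gS(2,3)]] v] gl2_inner_add[OF gS(1) gl2_add[OF gS(2,3)] v]
        gl2_inner_add[OF gS(2,3) v] Usum_vec_inner[OF p k] by simp
  qed
  have i1: "gl2_inner \<F> S1 (vec k r) = (if r \<in> Sn n - {[]} then \<integral>t. hb r t * k t \<partial>SP r else 0)" if "B0 (length r) k" for k r
    unfolding S1_def by (rule sum_vec_inner) (use that hb in auto)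
  have i2: "gl2_inner \<F> S2 (vec k r) = (if n \<noteq> 0 \<and> deg r = n - 1 then \<integral>t. int_out 0 ?F (\<lambda>i. t (blk r i)) * k t \<partial>SP r else 0)" if "B0 (length r) k" for k r
    using U_vec_inner[OF io that] by (auto simp: S2_def gl2_inner_zero)
  have i3: "gl2_inner \<F> S3 (vec k r) = (if n \<noteq> 0 \<and> r \<in> Sn (n - 1) - {[]} then \<integral>t. ha r t * k t \<partial>SP r else 0)" if "B0 (length r) k" for k r
    using sum_vec_inner[of "Sn (n - 1) - {[]}" ha r k] ha that by (auto simp: S3_def gl2_inner_zero)
  let ?p = "\<lambda>r v. \<psi> (deg r) (\<lambda>i. v (blk r i))" and ?J = "\<lambda>r v. int_out 0 ?F (\<lambda>i. v (blk r i))"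
  have Bp: "B0 (length r) (?p r)" for r
    by (rule B0_blk[of "deg r"]) (use p in \<open>auto simp: fin_B0_def Sn_def\<close>)
  {
    assume n: "deg (l # r) = n"
    then have S: "l # r \<in> Sn n - {[]}" by (simp add: Sn_def)
    have "AE v in SP (l # r). hb (l # r) v = ?p (l # r) v"
    proof (rule AE_eq_of_integrals[OF hb[OF S] Bp])
      fix k :: "(nat \<Rightarrow> 'a) \<Rightarrow> real" assume k: "B0 (length (l # r)) k"
      show "(\<integral>t. hb (l # r) t * k t \<partial>SP (l # r)) = (\<integral>t. ?p (l # r) t * k t \<partial>SP (l # r))"
        using inner[OF k] U_vec_inner[OF F k] i1[OF k] i2[OF k] i3[OF k] n S by (simp add: Sn_def split: if_splits)
    qed
    then show "AE v in SP (l # r). jb l (v 0) * (f (v 0) * g (\<lambda>i. v (blk (l # r) i))) = \<psi> n (\<lambda>i. v (blk (l # r) i))"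
      unfolding n by eventually_elim (simp add: hb_def d1)
  next
    assume n: "Suc (deg (l # r)) = n"
    then have S: "l # r \<in> Sn (n - 1) - {[]}" "n \<noteq> 0" by (auto simp: Sn_def)
    have I: "B0 (length (l # r)) (?J (l # r))" by (rule B0_blk[OF io]) (use S in auto)
    note h = ha[OF S(1)]
    have "AE v in SP (l # r). ?J (l # r) v + ha (l # r) v = ?p (l # r) v"
    proof (rule AE_eq_of_integrals[OF B0_add[OF I h] Bp])
      fix k :: "(nat \<Rightarrow> 'a) \<Rightarrow> real" assume k: "B0 (length (l # r)) k"
      have "(\<integral>t. (?J (l # r) t + ha (l # r) t) * k t \<partial>SP (l # r))
          = (\<integral>t. ?J (l # r) t * k t \<partial>SP (l # r)) + (\<integral>t. ha (l # r) t * k t \<partial>SP (l # r))"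
        unfolding distrib_right
        by (rule Bochner_Integration.integral_add[OF B0_integrable_SP[OF B0_prod[OF k I]] B0_integrable_SP[OF B0_prod[OF k h]]])
      also have "\<dots> = (\<integral>t. ?p (l # r) t * k t \<partial>SP (l # r))"
      proof -
        have "gl2_inner \<F> (U (Suc n) ?F) (vec k (l # r)) = 0" using U_vec_inner[OF F k] n by simp
        moreover have "gl2_inner \<F> S1 (vec k (l # r)) = 0" using i1[OF k] n by (simp add: Sn_def)
        moreover have "gl2_inner \<F> S2 (vec k (l # r)) = (\<integral>t. ?J (l # r) t * k t \<partial>SP (l # r))"
          unfolding i2[OF k] by (rule if_P) (use n in auto)
        moreover have "gl2_inner \<F> S3 (vec k (l # r)) = (\<integral>t. ha (l # r) t * k t \<partial>SP (l # r))"
          unfolding i3[OF k] by (rule if_P) (use S in auto)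
        ultimately show ?thesis using inner[OF k] by linarith
      qed
      finally show "(\<integral>t. (?J (l # r) t + ha (l # r) t) * k t \<partial>SP (l # r)) = (\<integral>t. ?p (l # r) t * k t \<partial>SP (l # r))" .
    qed
    then show "AE v in SP (l # r). ?J (l # r) v
      + ja (Suc l) (v 0) * (f (v 0) * g (dmap 0 (\<lambda>i. v (blk (l # r) i)))) = ?p (l # r) v"
      by eventually_elim (simp only: ha_def d2 list.sel blk_0)
  }
qed

end

section \<open>From invariance to constant Jacobi coefficients\<close>

lemma finite_test_single:
  fixes g :: "(nat \<Rightarrow> 'b::t2_space) \<Rightarrow> real"
  assumes "g \<in> test n" shows "single n g \<in> finite_test"
proof -
  have "(\<lambda>_. 0 :: real) \<in> (test m :: ((nat \<Rightarrow> 'b) \<Rightarrow> real) set)" for m by (rule C0_imp_test[OF C0_zero])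
  then show ?thesis
    unfolding finite_test_def single_def using assms
    by (intro CollectI conjI allI exI[of _ n]) auto
qed

lemma C0_prod_coords:
  fixes f :: "'b::t2_space \<Rightarrow> real"
  assumes f: "f \<in> test1" shows "C0 n (\<lambda>v. \<Prod>i<n. f (v i))"
proof (rule C0I[where K = "closure {t. f t \<noteq> 0}"])
  show "continuous_on UNIV (\<lambda>v :: nat \<Rightarrow> 'b. \<Prod>i<n. f (v i))"
    using f by (intro continuous_on_prod continuous_coord) (simp add: test1_def)
  show "compact (closure {t. f t \<noteq> 0})" using f by (simp add: test1_def)
  fix v :: "nat \<Rightarrow> 'b" and i assume "(\<Prod>i<n. f (v i)) \<noteq> 0" "i < n"
  then have "f (v i) \<noteq> 0" by (auto simp: prod_zero_iff)
  then show "v i \<in> closure {t. f t \<noteq> 0}" using closure_subset[of "{t. f t \<noteq> 0}"] by blast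
qed (simp add: dep_def)

context jac_process
begin

lemma continuous_AE_zero_on:
  fixes h :: "'a \<Rightarrow> real"
  assumes B: "open B" and h: "continuous_on UNIV h" and ae: "AE t in \<sigma>. t \<in> B \<longrightarrow> h t = 0" and t: "t \<in> B"
  shows "h t = 0"
proof (rule ccontr)
  assume n: "h t \<noteq> 0"
  let ?A = "B \<inter> {t. h t \<noteq> 0}"
  have o: "open ?A" using open_vimage[OF _ h, of "- {0}"] B by (auto simp: vimage_def open_Compl)
  have "emeasure \<sigma> ?A = 0"
    using ae AE_iff_measurable[of ?A \<sigma> "\<lambda>t. t \<in> B \<longrightarrow> h t = 0"] borel_open[OF o] by (simp add: Int_def)
  then show False using full_support[OF o] n t by auto
qed

text \<open>Finitely many open sets with compact closure cover \<open>closure B\<close>, so a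
  Urysohn function for this neighbourhood has compact support.\<close>

lemma cutoff:
  assumes B: "open B" "compact (closure B)"
  obtains f :: "'a \<Rightarrow> real" where "f \<in> test1" "\<And>t. t \<in> B \<Longrightarrow> f t = 1"
proof -
  obtain W :: "nat \<Rightarrow> 'a set" where W: "\<And>k. open (W k)" "\<And>k. compact (closure (W k))" "incseq W" "(\<Union>k. W k) = UNIV"
    by (rule compact_exhaustion) blast
  obtain I where I: "finite I" "closure B \<subseteq> (\<Union>k\<in>I. W k)"
    using compactE_image[OF B(2), of UNIV W] W by auto
  let ?W = "\<Union>k\<in>I. W k"
  have "closure ?W \<subseteq> (\<Union>k\<in>I. closure (W k))"
    using I(1) closure_subset by (intro closure_minimal closed_UN UN_mono) auto
  moreover have "compact (\<Union>k\<in>I. closure (W k))" using I(1) W(2) by (intro compact_UN) auto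
  ultimately have cW: "compact (closure ?W)"
    using compact_Int_closed[of "\<Union>k\<in>I. closure (W k)" "closure ?W"] by (simp add: Int_absorb1)
  have cr: "completely_regular_space (euclidean :: 'a topology)"
    by (intro locally_compact_regular_imp_completely_regular_space loc_compact disjI1 Hausdorff_space_euclidean_t2)
  obtain f where f: "continuous_map euclidean (top_of_set {0..1}) f" "f ` (- ?W) \<subseteq> {0::real}" "f ` closure B \<subseteq> {1}"
    by (rule Urysohn_completely_regular_compact_closed[OF zero_le_one cr, of "closure B" "- ?W"])
      (use B W(1) I in \<open>auto simp: disjnt_def closed_Compl intro!: closed_INT\<close>)
  have c: "continuous_on UNIV f" using f(1) by (auto simp: continuous_map_in_subtopology)
  have "closure {t. f t \<noteq> 0} \<subseteq> closure ?W" by (rule closure_mono) (use f(2) in auto)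
  then have "compact (closure {t. f t \<noteq> 0})"
    using compact_Int_closed[OF cW closed_closure, of "{t. f t \<noteq> 0}"] by (simp add: Int_absorb1)
  then have "f \<in> test1" using c by (simp add: test1_def)
  moreover have "f t = 1" if "t \<in> B" for t using f(3) closure_subset[of B] that by auto
  ultimately show ?thesis using that by blast
qed

lemma AE_SP_single:
  assumes "AE v in SP [l]. Q (v 0)" shows "AE t in \<S> l. Q t"
proof -
  have "length [l] = Suc 0" by simp
  then have "AE v in PiM {..<Suc 0} (\<lambda>j. \<S> ([l] ! j)). Q (v 0)"
    using assms unfolding SP_def by metis
  from AE_PiM_Suc[OF sigma_finite_sigma_l this]
  show ?thesis unfolding lessThan_0 PiM_empty nth_Cons_0 by (simp add: AE_count_space)
qed

lemma C0_diagonal: "C0 n h \<Longrightarrow> continuous_on UNIV (\<lambda>t :: 'a. h (\<lambda>_. t))"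
  by (rule continuous_on_compose2[OF C0D(1)]) (auto intro: continuous_on_coordinatewise_then_product)

text \<open>On \<open>\<sigma>\<^sup>n\<close> the coefficients are those of level \<open>0\<close>, on the full diagonal those of level
  \<open>n - 1\<close>; a continuous function relates the two.\<close>
lemma continuous_coefficient:
  fixes c :: "nat \<Rightarrow> 'a \<Rightarrow> real"
  assumes H: "\<And>n B. n \<ge> 1 \<Longrightarrow> open B \<Longrightarrow> compact (closure B) \<Longrightarrow> \<exists>k \<psi>. C0 n k \<and> C0 n \<psi> \<and>
      (\<forall>v. (\<forall>i<n. v i \<in> B) \<longrightarrow> k v = 1) \<and>
      (\<forall>l r. deg (l # r) = n \<longrightarrow> (AE v in SP (l # r). c l (v 0) * k (\<lambda>i. v (blk (l # r) i)) = \<psi> (\<lambda>i. v (blk (l # r) i))))"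
  shows "\<exists>lam. continuous_on UNIV lam \<and> (\<forall>l. AE t in \<sigma>. w l t \<noteq> 0 \<longrightarrow> c l t = lam t)"
proof -
  obtain B :: "nat \<Rightarrow> 'a set" where B: "\<And>k. open (B k)" "\<And>k. compact (closure (B k))" "incseq B" "(\<Union>k. B k) = UNIV"
    by (rule compact_exhaustion) blast
  have diag: "AE t in \<S> l. c l t * k (\<lambda>_. t) = \<psi> (\<lambda>_. t)"
    if k: "C0 (Suc l) k" and q: "C0 (Suc l) \<psi>"
      and ae: "AE v in SP [l]. c l (v 0) * k (\<lambda>i. v (blk [l] i)) = \<psi> (\<lambda>i. v (blk [l] i))" for k \<psi> l
  proof (rule AE_SP_single)
    have "k (\<lambda>i. v (blk [l] i)) = k (\<lambda>_. v 0)" "\<psi> (\<lambda>i. v (blk [l] i)) = \<psi> (\<lambda>_. v 0)" for v :: "nat \<Rightarrow> 'a"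
      by (rule depD[OF C0D(2)[OF k]] depD[OF C0D(2)[OF q]]; simp)+
    with ae show "AE v in SP [l]. c l (v 0) * k (\<lambda>_. v 0) = \<psi> (\<lambda>_. v 0)" by simp
  qed
  \<comment> \<open>For \<open>n = 1\<close> the only stratum has level 0, so on each
    \<open>B m\<close> the coefficient \<open>c 0\<close> agrees almost everywhere with a continuous
    function.\<close>
  have "\<exists>q. continuous_on UNIV q \<and> (AE t in \<sigma>. t \<in> B m \<longrightarrow> c 0 t = q t)" for m
  proof -
    obtain k \<psi> where k: "C0 (Suc 0) k" "C0 (Suc 0) \<psi>" "\<And>v. (\<forall>i<Suc 0. v i \<in> B m) \<Longrightarrow> k v = 1"
        "AE v in SP [0]. c 0 (v 0) * k (\<lambda>i. v (blk [0] i)) = \<psi> (\<lambda>i. v (blk [0] i))"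
      using H[OF _ B(1,2)[of m], of "Suc 0"] by auto
    have "AE t in \<sigma>. c 0 t * k (\<lambda>_. t) = \<psi> (\<lambda>_. t)" using diag[OF k(1,2,4)] unfolding sigma_l_0 .
    then have "AE t in \<sigma>. t \<in> B m \<longrightarrow> c 0 t = \<psi> (\<lambda>_. t)"
    proof eventually_elim
      case (elim t)
      then show ?case using k(3)[of "\<lambda>_. t"] by auto
    qed
    then show ?thesis using C0_diagonal[OF k(2)] by blast
  qed
  then obtain q where q: "\<And>m. continuous_on UNIV (q m)" "\<And>m. AE t in \<sigma>. t \<in> B m \<longrightarrow> c 0 t = q m t" by metis
  \<comment> \<open>Full support of \<open>\<sigma>\<close> makes the local versions coincide
    everywhere on overlaps, so they can be patched.\<close>
  have agree: "q m t = q m' t" if t: "t \<in> B m \<inter> B m'" for m m' t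
  proof -
    have "AE t in \<sigma>. t \<in> B m \<inter> B m' \<longrightarrow> q m t - q m' t = 0" using q(2)[of m] q(2)[of m'] by eventually_elim auto
    then have "q m t - q m' t = 0"
      by (rule continuous_AE_zero_on[OF open_Int[OF B(1,1)] continuous_on_diff[OF q(1,1)] _ t])
    then show ?thesis by simp
  qed
  define lam where "lam t = q (LEAST m. t \<in> B m) t" for t
  have lam: "lam t = q m t" if "t \<in> B m" for m t
  proof -
    have "t \<in> B (LEAST m. t \<in> B m)" by (rule LeastI[of "\<lambda>m. t \<in> B m", OF that])
    then show ?thesis unfolding lam_def by (intro agree IntI that)
  qed
  have "continuous_on (\<Union>m\<in>UNIV. B m) lam"
  proof (rule continuous_on_open_UN)
    show "continuous_on (B m) lam" for m
      using continuous_on_cong[of "B m" "B m" lam "q m"] lam continuous_on_subset[OF q(1)] by auto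
  qed (use B in auto)
  then have cl: "continuous_on UNIV lam" using B(4) by simp
  have l0: "AE t in \<sigma>. c 0 t = lam t"
  proof -
    have "AE t in \<sigma>. \<forall>m. t \<in> B m \<longrightarrow> c 0 t = q m t" using q(2) by (simp add: AE_all_countable)
    then show ?thesis
    proof eventually_elim
      case (elim t)
      obtain m where "t \<in> B m" using B(4) by blast
      then show ?case using elim lam by auto
    qed
  qed
  have "AE t in \<sigma>. w l t \<noteq> 0 \<longrightarrow> c l t = lam t" for l
  proof -
    have "AE t in \<S> l. t \<in> B m \<longrightarrow> c l t = lam t" for m
    proof -
      let ?n = "Suc l"
      obtain k \<psi> where k: "C0 ?n k" "C0 ?n \<psi>" "\<And>v. (\<forall>i<?n. v i \<in> B m) \<Longrightarrow> k v = 1"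
          and ae: "\<And>l' r. deg (l' # r) = ?n \<Longrightarrow> AE v in SP (l' # r). c l' (v 0) * k (\<lambda>i. v (blk (l' # r) i)) = \<psi> (\<lambda>i. v (blk (l' # r) i))"
        using H[OF _ B(1,2)[of m], of ?n] by auto
      \<comment> \<open>The stratum without repetitions, where the coefficient is that of level 0
        and hence already known to be \<open>lam\<close>.\<close>
      let ?r = "replicate ?n 0"
      have "AE v in SP ?r. c 0 (v 0) * k (\<lambda>i. v (blk ?r i)) = \<psi> (\<lambda>i. v (blk ?r i))"
        using ae[of 0 "replicate l 0"] by (simp only: replicate_Suc deg_simps deg_replicate)
      moreover have "k (\<lambda>i. v (blk ?r i)) = k v" "\<psi> (\<lambda>i. v (blk ?r i)) = \<psi> v" for v :: "nat \<Rightarrow> 'a"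
        by (rule depD[OF C0D(2)[OF k(1)]] depD[OF C0D(2)[OF k(2)]]; simp only: blk_replicate)+
      ultimately have e: "AE v in PiM {..<?n} (\<lambda>_. \<sigma>). c 0 (v 0) * k v = \<psi> v" unfolding SP_replicate by simp
      have "AE v in PiM {..<?n} (\<lambda>_. \<sigma>). \<forall>i<?n. c 0 (v i) = lam (v i)"
        by (rule AE_PiM_coordinates[OF S.sigma_finite_measure_axioms l0])
      with e have ae0: "AE v in PiM {..<?n} (\<lambda>_. \<sigma>). lam (v 0) * k v - \<psi> v = 0" by eventually_elim auto
      have D: "C0 ?n (\<lambda>v. lam (v 0) * k v - \<psi> v)" by (intro C0_diff C0_coeff cl k) simp
      \<comment> \<open>By continuity the identity passes from almost every point of the power of
        \<open>\<sigma>\<close> to every point, in particular to the full diagonal, where the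
        coefficient is that of level \<open>l\<close>.\<close>
      have all: "lam t * k (\<lambda>_. t) = \<psi> (\<lambda>_. t)" for t
        using continuous_AE_zero_PiM[OF C0D(1,2)[OF D] ae0, of "\<lambda>_. t"] by simp
      have "AE t in \<S> l. c l t * k (\<lambda>_. t) = \<psi> (\<lambda>_. t)"
        by (rule diag[OF k(1,2)]) (use ae[of l "[]"] in simp)
      then show ?thesis
      proof eventually_elim
        case (elim t)
        then show ?case using k(3)[of "\<lambda>_. t"] all[of t] by auto
      qed
    qed
    then have "AE t in \<S> l. \<forall>m. t \<in> B m \<longrightarrow> c l t = lam t" unfolding AE_all_countable by blast
    then have "AE t in \<S> l. c l t = lam t"
    proof eventually_elim
      case (elim t)
      then show ?case using B(4) by blast
    qed
    then show ?thesis by (simp add: AE_sigma_l)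
  qed
  with cl show ?thesis by blast
qed

lemma ext_test_single: "ext_test (single n g) = single n (ext_seq n g)"
  by (auto simp: ext_test_def single_def ext_seq_def fun_eq_iff)

lemma fin_B0_single: "B0 n g \<Longrightarrow> fin_B0 n (single n g)"
  by (auto simp: fin_B0_def single_def B0_zero)

lemma Usum_single: "Usum n (single n g) = U n g"
proof (intro ext)
  fix m y
  have "Usum n (single n g) m y = (\<Sum>k\<le>n. if k = n then U n g m y else 0)"
    unfolding Usum_def by (rule sum.cong) (auto simp: single_def U_zero)
  then show "Usum n (single n g) m y = U n g m y" by simp
qed

lemma invariant_U:
  assumes ii: "\<forall>f\<in>test1. \<forall>\<phi>\<in>finite_test. \<exists>\<psi>\<in>finite_test. gl2_eq ext (X_ext \<sigma> \<mu> f \<phi>) \<psi>"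
    and f: "f \<in> test1" and g: "C0 n g"
  shows "\<exists>\<psi> N. (\<forall>k. C0 k (\<psi> k)) \<and> fin_B0 N \<psi> \<and> gl2_eq \<F> (\<X> f (U n g)) (Usum N \<psi>)"
proof -
  have p: "single n g \<in> finite_test" by (rule finite_test_single[OF C0_imp_test[OF g]])
  have e: "ext_test (single n g) = single n g" by (simp add: ext_test_single ext_seq_dep[OF C0D(2)[OF g]])
  have N: "fin_B0 n (ext_test (single n g))" unfolding e by (rule fin_B0_single[OF C0_imp_B0[OF g]])
  obtain \<psi> where q: "\<psi> \<in> finite_test" "gl2_eq ext (X_ext \<sigma> \<mu> f (single n g)) \<psi>" using ii f p by blast
  obtain M where M: "fin_B0 M (ext_test \<psi>)" using finite_test_ext(1)[OF q(1)] by blast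
  have "gl2_eq \<F> (\<X> f (U n g)) (Usum M (ext_test \<psi>))"
    using X_ext_iff[OF f p N q(1) M] q(2) by (simp add: e Usum_single)
  then show ?thesis using M finite_test_ext(2)[OF q(1)] by blast
qed

lemma AE_nonneg_continuous:
  fixes h :: "'a \<Rightarrow> real"
  assumes h: "continuous_on UNIV h" and ae: "AE t in \<sigma>. 0 \<le> h t" shows "0 \<le> h t"
proof -
  have c: "continuous_on UNIV (\<lambda>t. min (h t) 0)" by (intro continuous_on_min h continuous_on_const)
  have "AE t in \<sigma>. min (h t) 0 = 0" using ae by eventually_elim auto
  then have "min (h t) 0 = 0" by (rule continuous_AE_zero[OF c])
  then show ?thesis by simp
qed

lemma constant_jacobi_of_invariant:
  assumes ii: "\<forall>f\<in>test1. \<forall>\<phi>\<in>finite_test. \<exists>\<psi>\<in>finite_test. gl2_eq ext (X_ext \<sigma> \<mu> f \<phi>) \<psi>"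
  shows "\<exists>lam eta. constant_jacobi \<sigma> \<mu> lam eta"
proof -
  have "\<exists>lam. continuous_on UNIV lam \<and> (\<forall>l. AE t in \<sigma>. w l t \<noteq> 0 \<longrightarrow> jb l t = lam t)"
  proof (rule continuous_coefficient)
    fix n :: nat and B :: "'a set" assume n: "n \<ge> 1" and B: "open B" "compact (closure B)"
    obtain f where f: "f \<in> test1" "\<And>t. t \<in> B \<Longrightarrow> f t = (1 :: real)" using cutoff[OF B] by blast
    \<comment> \<open>Chosen so that \<open>f (v 0) * ?g v\<close> equals 1 when all coordinates lie
      in \<open>B\<close>, which leaves the bare coefficient there.\<close>
    let ?g = "\<lambda>v :: nat \<Rightarrow> 'a. \<Prod>i<n. f (v i)"
    have g: "C0 n ?g" by (rule C0_prod_coords[OF f(1)])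
    obtain \<psi> N where q: "\<forall>k. C0 k (\<psi> k)" "fin_B0 N \<psi>" "gl2_eq \<F> (\<X> f (U n ?g)) (Usum N \<psi>)"
      using invariant_U[OF ii f(1) g] by blast
    note X = X_op_coefficients(1)[OF f(1) C0_imp_B0[OF g] q(2,3)]
    have "C0 n (\<lambda>v. f (v 0) * ?g v)" by (rule C0_coeff) (use f(1) g n in \<open>auto simp: test1_def\<close>)
    moreover have "C0 n (\<psi> n)" using q(1) by simp
    moreover have "f (v 0) * ?g v = 1" if "\<forall>i<n. v i \<in> B" for v
      using that n f(2) by (simp add: prod.neutral)
    moreover have "AE v in SP (l # r). jb l (v 0) * (f (v (blk (l # r) 0)) * ?g (\<lambda>i. v (blk (l # r) i))) = \<psi> n (\<lambda>i. v (blk (l # r) i))"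
      if "deg (l # r) = n" for l r using X[OF that] unfolding blk_0 .
    ultimately show "\<exists>k \<psi>. C0 n k \<and> C0 n \<psi> \<and> (\<forall>v. (\<forall>i<n. v i \<in> B) \<longrightarrow> k v = 1) \<and>
        (\<forall>l r. deg (l # r) = n \<longrightarrow> (AE v in SP (l # r). jb l (v 0) * k (\<lambda>i. v (blk (l # r) i)) = \<psi> (\<lambda>i. v (blk (l # r) i))))"
      by (intro exI[of _ "\<lambda>v. f (v 0) * ?g v"] exI[of _ "\<psi> n"] conjI allI impI)
  qed
  then obtain lam where lam: "continuous_on UNIV lam" "\<And>l. AE t in \<sigma>. w l t \<noteq> 0 \<longrightarrow> jb l t = lam t" by blast
  have "\<exists>eta. continuous_on UNIV eta \<and> (\<forall>l. AE t in \<sigma>. w l t \<noteq> 0 \<longrightarrow> ja (Suc l) t = eta t)"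
  proof (rule continuous_coefficient)
    fix n :: nat and B :: "'a set" assume n: "n \<ge> 1" and B: "open B" "compact (closure B)"
    obtain f where f: "f \<in> test1" "\<And>t. t \<in> B \<Longrightarrow> f t = (1 :: real)" using cutoff[OF B] by blast
    \<comment> \<open>One variable more than before, since the annihilation part lowers the order by
      one.\<close>
    let ?g = "\<lambda>v :: nat \<Rightarrow> 'a. \<Prod>i<Suc n. f (v i)"
    \<comment> \<open>The integral part is continuous as well, so it can be moved to the side of the
      test function.\<close>
    let ?I = "int_out 0 (\<lambda>v. f (v 0) * ?g (v \<circ> Suc))"
    have g: "C0 (Suc n) ?g" by (rule C0_prod_coords[OF f(1)])
    obtain \<psi> N where q: "\<forall>k. C0 k (\<psi> k)" "fin_B0 N \<psi>" "gl2_eq \<F> (\<X> f (U (Suc n) ?g)) (Usum N \<psi>)"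
      using invariant_U[OF ii f(1) g] by blast
    note X = X_op_coefficients(2)[OF f(1) C0_imp_B0[OF g] q(2,3)]
    have "C0 n (\<lambda>v. ?g (dmap 0 v))" by (rule C0_dmap[OF g]) (use n in simp)
    then have "C0 n (\<lambda>v. f (v 0) * ?g (dmap 0 v))" by (rule C0_coeff[rotated]) (use f(1) n in \<open>auto simp: test1_def\<close>)
    moreover have "C0 n (\<lambda>v. \<psi> n v - ?I v)"
      using C0_int_out[OF C0_lift[OF f(1) g]] q(1) by (intro C0_diff) auto
    moreover have "f (v 0) * ?g (dmap 0 v) = 1" if v: "\<forall>i<n. v i \<in> B" for v
    proof -
      have "f (dmap 0 v i) = 1" if "i < Suc n" for i
        using v n f(2) that by (auto simp: dmap_def)
      then show ?thesis using v n f(2) by (simp add: prod.neutral)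
    qed
    moreover have "AE v in SP (l # r). ja (Suc l) (v 0) * (f (v (blk (l # r) 0)) * ?g (dmap 0 (\<lambda>i. v (blk (l # r) i))))
        = \<psi> n (\<lambda>i. v (blk (l # r) i)) - ?I (\<lambda>i. v (blk (l # r) i))"
      if "deg (l # r) = n" for l r
      using X[of l r] unfolding that blk_0 by simp (erule eventually_mono, simp)
    ultimately show "\<exists>k \<psi>. C0 n k \<and> C0 n \<psi> \<and> (\<forall>v. (\<forall>i<n. v i \<in> B) \<longrightarrow> k v = 1) \<and>
        (\<forall>l r. deg (l # r) = n \<longrightarrow> (AE v in SP (l # r). ja (Suc l) (v 0) * k (\<lambda>i. v (blk (l # r) i)) = \<psi> (\<lambda>i. v (blk (l # r) i))))"
      by (intro exI[of _ "\<lambda>v. f (v 0) * ?g (dmap 0 v)"] exI[of _ "\<lambda>v. \<psi> n v - ?I v"] conjI allI impI)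
  qed
  then obtain eta where eta: "continuous_on UNIV eta" "\<And>l. AE t in \<sigma>. w l t \<noteq> 0 \<longrightarrow> ja (Suc l) t = eta t" by blast
  have "0 \<le> eta t" for t
  proof (rule AE_nonneg_continuous[OF eta(1)])
    show "AE t in \<sigma>. 0 \<le> eta t" using eta(2)[of 0]
    proof eventually_elim
      case (elim t)
      then show ?case using w_nonneg[of "Suc 0" t] by (simp add: ja_eq)
    qed
  qed
  \<comment> \<open>Where the polynomial of level \<open>l\<close> vanishes, its coefficient in the
    recursion is free and is set to \<open>lam\<close>.\<close>
  moreover define b where "b l t = (if w l t = 0 then lam t else jb l t)" for l t
  have "jacobi_coefficients \<mu> ja b" unfolding jacobi_coefficients_def
  proof (intro conjI allI impI)
    fix t n
    have z: "p n (t, s) = 0" if "w n t = 0" for s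
      using that by (simp add: p_def monic_op_def w_eq_0_iff)
    show "AE s in \<mu> t. s * poly (monic_op (\<mu> t) n) s = poly (monic_op (\<mu> t) (Suc n)) s
        + b n t * poly (monic_op (\<mu> t) n) s + ja n t * (if n = 0 then 0 else poly (monic_op (\<mu> t) (n - 1)) s)"
      using p_recursion[of n t]
    proof eventually_elim
      case (elim s)
      then show ?case using z[of s] by (cases "w n t = 0") (auto simp: b_def p_def)
    qed
    show "ja n t = 0" if "0 < n" "supp_card_le (\<mu> t) n"
      using that by (simp add: ja_eq w_eq_0_iff[symmetric])
  qed
  moreover have "AE t in \<sigma>. (\<forall>l. b l t = lam t) \<and> (\<forall>l\<ge>1. ja l t = eta t)"
  proof -
    have "AE t in \<sigma>. \<forall>l. w l t \<noteq> 0 \<longrightarrow> jb l t = lam t" "AE t in \<sigma>. \<forall>l. w l t \<noteq> 0 \<longrightarrow> ja (Suc l) t = eta t"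
      using lam(2) eta(2) by (simp_all add: AE_all_countable)
    then show ?thesis
    proof eventually_elim
      case (elim t)
      have "ja (Suc l) t = eta t" for l
      proof (cases "w l t = 0")
        case True
        \<comment> \<open>At the first vanishing weight \<open>ja k t\<close> is 0, while the level
          below is still visible; hence \<open>eta t = 0\<close>. The coefficient at
          \<open>Suc l\<close> is 0 by division by \<open>w l t = 0\<close>.\<close>
        define k where "k = (LEAST k. w k t = 0)"
        have k: "w k t = 0" "\<And>i. i < k \<Longrightarrow> w i t \<noteq> 0"
          unfolding k_def using LeastI[of "\<lambda>k. w k t = 0", OF True] not_less_Least by auto
        then obtain k' where k': "k = Suc k'" by (cases k) auto
        then have "eta t = ja (Suc k') t" using elim(2) k(2)[of k'] by simp
        also have "\<dots> = 0" using k(1) by (simp add: ja_eq k')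
        finally show ?thesis using True by (simp add: ja_eq)
      qed (use elim in blast)
      moreover have "l \<ge> 1 \<Longrightarrow> \<exists>k. l = Suc k" for l :: nat by (cases l) auto
      ultimately show ?case using elim(1) by (auto simp: b_def)
    qed
  qed
  ultimately show ?thesis unfolding constant_jacobi_def using lam(1) eta(1) by blast
qed

text \<open>Outside a null set of \<open>t\<close> the admissible coefficients are replaced by
  \<open>lam\<close> and \<open>eta\<close>. At level 0 the factor p^(-1) = 0 removes
  \<open>a 0\<close>, about which (iii) says nothing.\<close>

lemma const_rec_of_constant_jacobi:
  assumes "constant_jacobi \<sigma> \<mu> lam eta" shows "const_rec \<sigma> \<mu> eta lam"
proof -
  have c: "continuous_on UNIV lam" "continuous_on UNIV eta" using assms by (auto simp: constant_jacobi_def)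
  obtain a b where ab: "jacobi_coefficients \<mu> a b" "AE t in \<sigma>. (\<forall>l. b l t = lam t) \<and> (\<forall>l\<ge>1. a l t = eta t)"
    using assms by (auto simp: constant_jacobi_def)
  have bd: "\<exists>C. \<forall>t\<in>K. \<bar>h t\<bar> \<le> C" if "continuous_on UNIV h" "compact K" for h :: "'a \<Rightarrow> real" and K
  proof -
    have "bounded (h ` K)" by (rule compact_imp_bounded[OF compact_continuous_image[OF continuous_on_subset[OF that(1)] that(2)]]) simp
    then show ?thesis by (auto simp: bounded_iff)
  qed
  have "AE t in \<sigma>. \<forall>l. AE s in \<mu> t. s * p l (t, s) = p (Suc l) (t, s) + lam t * p l (t, s)
        + (if l = 0 then 0 else eta t * p (l - 1) (t, s))"
    using ab(2)
  proof eventually_elim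
    case (elim t)
    show ?case
    proof
      fix l
      have "AE s in \<mu> t. s * poly (monic_op (\<mu> t) l) s = poly (monic_op (\<mu> t) (Suc l)) s
        + b l t * poly (monic_op (\<mu> t) l) s + a l t * (if l = 0 then 0 else poly (monic_op (\<mu> t) (l - 1)) s)"
        using ab(1) by (simp add: jacobi_coefficients_def)
      then show "AE s in \<mu> t. s * p l (t, s) = p (Suc l) (t, s) + lam t * p l (t, s)
        + (if l = 0 then 0 else eta t * p (l - 1) (t, s))"
        by eventually_elim (use elim in \<open>auto simp: p_def\<close>)
    qed
  qed
  then show ?thesis
    by (intro const_rec.intro jac_rec.intro jac_rec_axioms.intro const_rec_axioms.intro jac_process_axioms
        borel_measurable_continuous_onI c bd)
qed

end

section \<open>The three components of \<open>X(f)\<close>\<close>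

lemma test_cong:
  assumes g: "g \<in> test n" and e: "\<And>t. t \<in> cart n \<Longrightarrow> h t = g t" shows "h \<in> test n"
proof -
  have s: "{t \<in> cart n. h t \<noteq> 0} = {t \<in> cart n. g t \<noteq> 0}" by (rule Collect_cong) (use e in metis)
  have "continuous_map (cart_top n) euclideanreal h"
    by (rule continuous_map_eq[of _ _ g]) (use g e in \<open>auto simp: test_def\<close>)
  then show ?thesis using g by (simp add: test_def s)
qed

lemma cart_shift: "t \<in> cart (Suc n) \<Longrightarrow> t \<circ> Suc \<in> cart n"
  by (auto simp: PiE_def extensional_def)

lemma cart_case_nat: "t \<in> cart n \<Longrightarrow> case_nat x t \<in> cart (Suc n)"
  by (auto simp: PiE_def extensional_def split: nat.split)

context jac_process
begin

lemma Usum_add: "Usum N (\<lambda>n v. \<phi> n v + \<psi> n v) = (\<lambda>m y. Usum N \<phi> m y + Usum N \<psi> m y)"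
  by (simp add: Usum_def fun_eq_iff U_add[symmetric] sum.distrib)

lemma Usum_single_le: "B0 k g \<Longrightarrow> k \<le> N \<Longrightarrow> Usum N (single k g) = U k g"
  using Usum_mono[OF fin_B0_single] Usum_single by simp

lemma U_0_CPv: assumes f: "C0 0 f" shows "U 0 f \<in> CPv 0"
proof (rule CPv_cong[OF CPv_monomial[OF f le_refl] _ U_gl2[OF C0_imp_B0[OF f]]])
  obtain L where L: "\<forall>t\<in>set L. deg (snd t) < 0" "gl2_eq \<F> (mono_vac 0 f) (\<lambda>m y. U 0 f m y + lsum L m y)"
    using mono_expand[OF f] by blast
  then have "L = []" by (cases L) auto
  then show "gl2_eq \<F> (U 0 f) (mono_vac 0 f)" using gl2_eq_sym[OF L(2)] by (simp add: lsum_Nil)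
qed

lemma P_proj_CP_iff:
  assumes "f \<in> test n"
  shows "(\<exists>Q\<in>CP \<sigma> \<mu>. gl2_eq \<F> (P_proj \<sigma> \<mu> n f) (Q vacuum)) \<longleftrightarrow> (\<exists>M. U n (ext_seq n f) \<in> CPv M)"
proof -
  note P = P_proj_test[OF assms]
  have "gl2_eq \<F> (P_proj \<sigma> \<mu> n f) v \<longleftrightarrow> gl2_eq \<F> (U n (ext_seq n f)) v" for v
    using P(1) gl2_eq_trans gl2_eq_sym by blast
  then show ?thesis
    using U_gl2[OF C0_imp_B0[OF test_imp_C0[OF assms]]] by (auto simp: CP_def CPv_iff)
qed

text \<open>The right-hand side includes order 0, which is automatic because \<open>U 0 f\<close> is
  a constant monomial.\<close>

lemma P_proj_CP_all_iff:
  "(\<forall>n\<ge>1. \<forall>f\<in>test n. \<exists>Q\<in>CP \<sigma> \<mu>. gl2_eq \<F> (P_proj \<sigma> \<mu> n f) (Q vacuum)) \<longleftrightarrow> (\<forall>n f. C0 n f \<longrightarrow> (\<exists>M. U n f \<in> CPv M))"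
  (is "?P \<longleftrightarrow> ?U")
proof
  assume P: ?P
  show ?U
  proof (intro allI impI)
    fix n and f :: "(nat \<Rightarrow> 'a) \<Rightarrow> real" assume f: "C0 n f"
    show "\<exists>M. U n f \<in> CPv M"
    proof (cases "n \<ge> 1")
      case True
      then have "\<exists>M. U n (ext_seq n f) \<in> CPv M"
        using P P_proj_CP_iff[OF C0_imp_test[OF f]] C0_imp_test[OF f] by blast
      then show ?thesis by (simp add: ext_seq_dep[OF C0D(2)[OF f]])
    next
      case False
      then have "n = 0" by simp
      then show ?thesis using U_0_CPv f by blast
    qed
  qed
next
  assume U: ?U
  show ?P
  proof (intro allI impI ballI)
    fix n and f :: "(nat \<Rightarrow> 'a) \<Rightarrow> real" assume f: "f \<in> test n"
    show "\<exists>Q\<in>CP \<sigma> \<mu>. gl2_eq \<F> (P_proj \<sigma> \<mu> n f) (Q vacuum)"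
      unfolding P_proj_CP_iff[OF f] using U test_imp_C0[OF f] by blast
  qed
qed

end

context const_rec
begin

text \<open>The value selected by \<open>X_ext\<close> is determined almost everywhere, so it is
  compared with the explicit sequence \<open>\<psi>\<close>, whose three entries are continuous
  kernels.\<close>

lemma X_ext_single:
  assumes f: "f \<in> test1" and n: "n \<ge> 1" and g: "g \<in> test n"
  shows "gl2_eq ext (X_ext \<sigma> \<mu> f (single n g))
            (\<lambda>m t. single (n + 1) (X_plus \<sigma> \<mu> f n g) m t
                 + single n (X_zero \<sigma> \<mu> f n g) m t
                 + single (n - 1) (X_minus \<sigma> \<mu> f n g) m t)" (is ?sum)
    and "is_test_fun \<sigma> \<mu> (n + 1) (X_plus \<sigma> \<mu> f n g) (\<lambda>t. f (t 0) * g (t \<circ> Suc))" (is ?plus)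
    and "is_test_fun \<sigma> \<mu> n (X_zero \<sigma> \<mu> f n g) (\<lambda>t. lam (t 0) * f (t 0) * g t)" (is ?zero)
    and "is_test_fun \<sigma> \<mu> (n - 1) (X_minus \<sigma> \<mu> f n g)
            (\<lambda>t. (\<integral>u. f u * g (case_nat u t) \<partial>\<sigma>)
                + (if n = 1 then 0 else eta (t 0) * f (t 0) * g (case_nat (t 0) t)))" (is ?minus)
proof -
  obtain i where i: "n = Suc i" using n by (cases n) auto
  define G where "G = ext_seq n g"
  define F where "F = (\<lambda>v. f (v 0) * G (v \<circ> Suc))"
  define Z where "Z = (\<lambda>v. lam (v 0) * F (dmap 0 v))"
  \<comment> \<open>Shortening a first block needs order at least two, so this part is absent for
    \<open>n = 1\<close>.\<close>
  define E where "E = (\<lambda>v. if i = 0 then 0 else eta (v 0) * F (dmap 0 (dmap 0 v)))"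
  define M where "M = (\<lambda>v. int_out 0 F v + E v)"
  define \<psi> where "\<psi> = (\<lambda>m v. single (n + 1) F m v + single n Z m v + single (n - 1) M m v)"
  have G: "C0 n G" unfolding G_def by (rule test_imp_C0[OF g])
  have F: "C0 (Suc n) F" unfolding F_def by (rule C0_lift[OF f G])
  have cs: "cstep 0 (F, n) = (F, Suc n) # (Z, n) # (int_out 0 F, i) # (if i = 0 then [] else [(E, i)])"
    by (simp add: cstep_def crest_def i Z_def E_def)
  have C: "C0s 0 (cstep 0 (F, n))" by (rule cstep_C0) (use F in simp)
  then have CZ: "C0 n Z" "C0 i (int_out 0 F)" "i \<noteq> 0 \<Longrightarrow> C0 i E" by (auto simp: cs C0s_def)
  have CE: "C0 i E" using CZ(3) by (cases "i = 0") (simp_all add: E_def C0_zero)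
  have CM: "C0 i M" unfolding M_def by (intro C0_add CZ CE)
  have L: "lsum (TU 0 (cstep 0 (F, n))) = Usum (n + 1) \<psi>"
  proof (intro ext)
    fix m y
    have E0: "U i E m y = 0" if "i = 0" using that U_zero[of 0] by (simp add: E_def fun_eq_iff)
    have "Usum (n + 1) \<psi> m y = U (n + 1) F m y + U n Z m y + U (n - 1) M m y"
      unfolding \<psi>_def Usum_add using F CZ(1) CM by (simp add: Usum_single_le C0_imp_B0 i)
    also have "U (n - 1) M m y = U i (int_out 0 F) m y + U i E m y"
      unfolding M_def U_add[symmetric] by (simp add: i)
    finally show "lsum (TU 0 (cstep 0 (F, n))) m y = Usum (n + 1) \<psi> m y"
      using E0 by (simp add: lsum_TU cs)
  qed
  have C\<psi>: "C0 m (\<psi> m)" for m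
    unfolding \<psi>_def by (intro C0_add) (use F CZ(1) CM i in \<open>auto simp: single_def C0_zero\<close>)
  have z\<psi>: "\<psi> m = (\<lambda>_. 0)" if "n + 1 < m" for m using that i by (simp add: \<psi>_def single_def)
  note q = finite_testI[of \<psi> "n + 1", OF C\<psi> z\<psi>]
  have N: "fin_B0 n (ext_test (single n g))"
    unfolding ext_test_single by (rule fin_B0_single[OF C0_imp_B0[OF test_imp_C0[OF g]]])
  have "gl2_eq \<F> (\<X> f (U n G)) (Usum (n + 1) \<psi>)"
    using X_op_const[OF f G] unfolding F_def[symmetric] L .
  then have "gl2_eq ext (X_ext \<sigma> \<mu> f (single n g)) \<psi>"
    using X_ext_iff[OF f finite_test_single[OF g] N q(1), of "n + 1"] q(2,3)
    by (simp add: ext_test_single G_def Usum_single)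
  then have X: "AE t in ext m. X_ext \<sigma> \<mu> f (single n g) m t = \<psi> m t" for m by (simp add: gl2_eq_def)
  show ?sum
    unfolding gl2_eq_def
  proof
    fix m
    show "AE t in ext m. X_ext \<sigma> \<mu> f (single n g) m t = single (n + 1) (X_plus \<sigma> \<mu> f n g) m t
                 + single n (X_zero \<sigma> \<mu> f n g) m t + single (n - 1) (X_minus \<sigma> \<mu> f n g) m t"
      using X[of m]
    proof eventually_elim
      case (elim t)
      show ?case
      \<comment> \<open>The three levels are distinct because \<open>n \<ge> 1\<close>, so each
        \<open>single\<close> acts on its own level.\<close>
      proof (cases "m = n + 1 \<or> m = n \<or> m = n - 1")
        case True
        then show ?thesis using i by (auto simp: single_def X_plus_def X_zero_def X_minus_def)
      next
        case False
        then show ?thesis using elim by (simp add: \<psi>_def single_def)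
      qed
    qed
  qed
  have tst: "is_test_fun \<sigma> \<mu> m (X_ext \<sigma> \<mu> f (single n g) m) h" if h: "\<And>t. t \<in> cart m \<Longrightarrow> h t = \<psi> m t" for m h
    unfolding is_test_fun_def
  proof
    show "h \<in> test m" by (rule test_cong[OF C0_imp_test[OF C\<psi>] h])
    show "AE t in ext m. X_ext \<sigma> \<mu> f (single n g) m t = h t"
      using X[of m] AE_space
    proof eventually_elim
      case (elim t)
      then show ?case using h[of t] by (simp add: space_ext)
    qed
  qed
  have Fd: "F (dmap 0 v) = f (v 0) * G v" for v by (simp add: F_def dmap_def o_def)
  have d0: "dmap 0 v = case_nat (v 0) v" for v :: "nat \<Rightarrow> 'a"
    by (auto simp: fun_eq_iff dmap_def split: nat.split)
  have e0: "F (emap 0 x v) = f x * G (case_nat x v)" for x v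
  proof -
    have "emap 0 x v \<circ> Suc = case_nat x v" by (auto simp: fun_eq_iff emap_def split: nat.split)
    then show ?thesis by (simp add: F_def emap_def)
  qed
  show ?plus unfolding X_plus_def
  proof (rule tst)
    fix t :: "nat \<Rightarrow> 'a" assume "t \<in> cart (n + 1)"
    then have "t \<circ> Suc \<in> cart n" using cart_shift by simp
    then show "f (t 0) * g (t \<circ> Suc) = \<psi> (n + 1) t"
      by (simp add: \<psi>_def single_def F_def G_def ext_seq_cart)
  qed
  show ?zero unfolding X_zero_def
  proof (rule tst)
    fix t :: "nat \<Rightarrow> 'a" assume "t \<in> cart n"
    then show "lam (t 0) * f (t 0) * g t = \<psi> n t"
      using i by (simp add: \<psi>_def single_def Z_def Fd G_def ext_seq_cart)
  qed
  show ?minus unfolding X_minus_def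
  proof (rule tst)
    fix t :: "nat \<Rightarrow> 'a" assume t: "t \<in> cart (n - 1)"
    have c: "case_nat x t \<in> cart n" for x using cart_case_nat[of t "n - 1" x] t i by simp
    have "int_out 0 F t = (\<integral>u. f u * g (case_nat u t) \<partial>\<sigma>)"
      unfolding int_out_def e0 by (simp add: G_def ext_seq_cart[OF c])
    moreover have "E t = (if n = 1 then 0 else eta (t 0) * f (t 0) * g (case_nat (t 0) t))"
      by (simp add: E_def i Fd) (simp add: dmap_def d0 G_def ext_seq_cart[OF c])
    ultimately show "(\<integral>u. f u * g (case_nat u t) \<partial>\<sigma>) + (if n = 1 then 0 else eta (t 0) * f (t 0) * g (case_nat (t 0) t)) = \<psi> (n - 1) t"
      using i by (simp add: \<psi>_def single_def M_def)
  qed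
qed

end

theorem theorem4p1:
  fixes \<sigma> :: "'a::{t2_space, second_countable_topology, perfect_space} measure"
    and \<mu> :: "'a \<Rightarrow> real measure"
  assumes "locally_compact_space (euclidean :: 'a topology)"
    and "radon_measure \<sigma>"
    and "non_atomic \<sigma>"
    and "\<And>U. open U \<Longrightarrow> U \<noteq> {} \<Longrightarrow> emeasure \<sigma> U > 0"
    and "\<mu> \<in> borel \<rightarrow>\<^sub>M prob_algebra borel"
    and "\<And>t. compact (measure_support (\<mu> t))"
    and "\<And>\<Delta>. \<Delta> \<in> sets borel \<Longrightarrow> compact (closure \<Delta>) \<Longrightarrow>
           \<exists>R>0. \<forall>t\<in>\<Delta>. measure_support (\<mu> t) \<subseteq> {-R..R}"
  shows
    "((\<forall>n\<ge>1. \<forall>f\<in>test n. \<exists>Q\<in>CP \<sigma> \<mu>. gl2_eq (fock \<sigma> \<mu>) (P_proj \<sigma> \<mu> n f) (Q vacuum)) \<longleftrightarrow>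
      (\<forall>f\<in>test1. \<forall>\<phi>\<in>finite_test. \<exists>\<psi>\<in>finite_test.
         gl2_eq (ext_fock \<sigma> \<mu>) (X_ext \<sigma> \<mu> f \<phi>) \<psi>)) \<and>
     ((\<forall>f\<in>test1. \<forall>\<phi>\<in>finite_test. \<exists>\<psi>\<in>finite_test.
         gl2_eq (ext_fock \<sigma> \<mu>) (X_ext \<sigma> \<mu> f \<phi>) \<psi>) \<longleftrightarrow>
      (\<exists>lam eta. constant_jacobi \<sigma> \<mu> lam eta)) \<and>
     (\<forall>lam eta. constant_jacobi \<sigma> \<mu> lam eta \<longrightarrow>
       (\<forall>f\<in>test1. \<forall>n\<ge>1. \<forall>g\<in>test n.
          gl2_eq (ext_fock \<sigma> \<mu>) (X_ext \<sigma> \<mu> f (single n g))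
            (\<lambda>m t. single (n + 1) (X_plus \<sigma> \<mu> f n g) m t
                 + single n (X_zero \<sigma> \<mu> f n g) m t
                 + single (n - 1) (X_minus \<sigma> \<mu> f n g) m t) \<and>
          is_test_fun \<sigma> \<mu> (n + 1) (X_plus \<sigma> \<mu> f n g)
            (\<lambda>t. f (t 0) * g (t \<circ> Suc)) \<and>
          is_test_fun \<sigma> \<mu> n (X_zero \<sigma> \<mu> f n g)
            (\<lambda>t. lam (t 0) * f (t 0) * g t) \<and>
          is_test_fun \<sigma> \<mu> (n - 1) (X_minus \<sigma> \<mu> f n g)
            (\<lambda>t. (\<integral>u. f u * g (case_nat u t) \<partial>\<sigma>)
                + (if n = 1 then 0 else eta (t 0) * f (t 0) * g (case_nat (t 0) t)))))"
    (is "(?i \<longleftrightarrow> ?ii) \<and> (?ii \<longleftrightarrow> ?iii) \<and> ?action")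
proof -
  interpret jac_process \<sigma> \<mu> by (rule jac_process.intro) (fact assms)+
  have "?i \<Longrightarrow> ?ii" using P_proj_CP_all_iff X_ext_finite_test by blast
  moreover have "?ii \<Longrightarrow> ?iii" by (rule constant_jacobi_of_invariant)
  moreover have "?iii \<Longrightarrow> ?i"
    unfolding P_proj_CP_all_iff using const_rec.U_CPv[OF const_rec_of_constant_jacobi] by blast
  moreover have ?action
    by (intro allI impI ballI conjI const_rec.X_ext_single[OF const_rec_of_constant_jacobi])
  ultimately show ?thesis by blast
qed

end
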